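(* Consider the problem $\min_{x\in\mathcal X}f(x)=\sum_{j=1}^mf_j(x)$, $f_j(x)=\mathbb E[F_j(x;\xi_j)]$, with $\mathcal X=\{x\in\mathbb R^d:Bx-b\le0,\ Cx-c\le0\}$, where $B\in\mathbb R^{d_1\times d}$, $b\in\mathbb R^{d_1}$, $C\in\mathbb R^{d_2\times d}$, $c\in\mathbb R^{d_2}$, and the distributed dual averaging algorithm with regularizer $\psi(x)=\frac12\|x\|^2$ described in the context. Let $x^*\in\mathcal X^*$ be the limit of $\{\bar x_k\}$, with $Bx^*=b$ and $Cx^*<c$. Suppose: 1. (Objective) For every $j$ and every $\xi_j$, $F_j(\cdot;\xi_j)$ is differentiable and convex on $\mathcal X$, and $|F_j(x;\xi_j)-F_j(y;\xi_j)|\le L_{0,j}(\xi_j)\|x-y\|$ for all $x,y\in\mathcal X$, with $L_{0,j}$ measurable and $\mathbb E[L_{0,j}^p(\xi_j)]<\infty$ for some $p>2$. There is $L>0$ with $\|\nabla f_j(x)-\nabla f_j(y)\|\le L\|x-y\|$ for all $x,y\in\mathcal X$ and all $j$. There are $c_0,\epsilon\in(0,\infty)$ with $\|\nabla f(x)-\nabla f(x^* )-\nabla^2f(x^* )(x-x^* )\|\le c_0\|x-x^*\|^2$ for all $x\in\mathcal X$ with $\|x-x^*\|\le\epsilon$. There is $\mu>0$ with $x^T\nabla^2f(x^* )x\ge\mu\|x\|^2$ for all $x$ in the critical tangent cone $\mathcal T_{\mathcal X}(x^* )=\{x:Bx=0\}$. 2. (Constraint qualification) $-\nabla f(x^* )\in\operatorname{ri}\mathcal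 N_{\mathcal X}(x^* )$, where $\mathcal N_{\mathcal X}(x^* )=\{B^T\lambda:\lambda\in\mathbb R^{d_1}_+\}$ is the normal cone and $\operatorname{ri}$ the relative interior. 3. (Weight matrices) $A_k$, $k\ge1$, are i.i.d. random doubly stochastic matrices with nonnegative entries; the spectral norm $\rho$ of $\mathbb E\big[A_k^T(I_m-\frac{\mathbf 1\mathbf 1^T}m)A_k\big]$ satisfies $\rho<1$; and $A_k$ is independent of $\mathcal F_k$ for every $k$. 4. (Step-size) $\alpha_k=a/k^\alpha$ with $\alpha\in(\frac23,1)$, $a>0$. 5. (Sampling) For all $i,j$: $\xi_{j,1},\xi_{j,2},\dots$ is an i.i.d. sample of $\xi_j$; for $i\ne j$, $\xi_{i,k}$ and $\xi_{j,k}$ are conditionally independent given $\mathcal F_k'=\sigma(\mathcal F_k\cup\sigma(A_k))$; and $\xi_{j,k}$ is conditionally independent of $A_k$ given $\mathcal F_k$. 6. The covariance matrix mapping $x\mapsto\sum_{j=1}^m\operatorname{Cov}(\nabla F_j(x;\xi_j))$ is continuous at $x^*$. Then for any $1\le j\le m$, $$\frac{x_{j,k}-x^*}{\sqrt{\alpha_k}}\xrightarrow{d}N(0,\Sigma),\qquad \Sigma=U\begin{pmatrix}\Sigma_1&\mathbf 0\\ \mathbf 0&\mathbf 0\end{pmatrix}U^T,$$ where $$\Sigma_1=\int_0^\infty e^{-Gt}(U^T)^{(r)}P_B\bar\Sigma P_B\big((U^T)^{(r)}\big)^Te^{-G^Tt}\,dt,\qquad \bar\Sigma=\frac1{m^2}\sum_{j=1}^m\operatorname{Cov}(\nabla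 F_j(x^*;\xi_j)),$$ and $U$, $r$, $(U^T)^{(r)}$, $P_B$, $H$, $G$ are defined as follows: $P_B=I_d-B^T(BB^T)^\dagger B$; $H=\frac1mP_B\nabla^2f(x^* )P_B$; $\mathcal Y=\{x:Bx=0\}$ has dimension $r$; $U=(u_1,\dots,u_d)\in\mathbb R^{d\times d}$, where $u_1,\dots,u_r$ is an orthonormal basis of $\mathcal Y$ and $u_{r+1},\dots,u_d$ an orthonormal basis of its orthogonal complement; $(U^T)^{(r)}\in\mathbb R^{r\times d}$ consists of the first $r$ rows of $U^T$; and $G$ is the leading principal $r\times r$ submatrix of $U^THU$.
   Context: Setting. $m$ agents; for each $1\le j\le m$, $\xi_j$ is a random vector on a probability space $(\Omega,\mathcal F,\mathbb P)$, $F_j(x;\xi_j)$ is real-valued, $f_j(x)=\mathbb E[F_j(x;\xi_j)]$, $f=\sum_jf_j$, and $\mathcal X^*$ is the set of minimizers of $f$ over $\mathcal X$. $\nabla F_j$ is the gradient in $x$. $\mathbf 1\in\mathbb R^m$ is the all-ones vector; $\|\cdot\|$ is the Euclidean norm of vectors and the spectral norm of matrices; vector inequalities are componentwise; $M^\dagger$ is the Moore–Penrose inverse; $\xrightarrow{d}$ is convergence in distribution as $k\to\infty$. Algorithm (with $\psi(x)=\frac12\|x\|^2$). Let $\mathrm Q(z)=\arg\max_{x\in\mathcal X}\{\langle z,x\rangle-\frac12\|x\|^2\}$. Each agent $j$ starts from $z_{j,0}\in\mathbb R^d$ (possibly random). For $k=1,2,\dots$, $$x_{j,k}=\mathrm Q(z_{j,k-1}),\qquad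 z_{j,k}=\sum_{i=1}^m[A_k]_{ji}z_{i,k-1}-\alpha_k\nabla F_j(x_{j,k};\xi_{j,k}),$$ where $\xi_{j,k}$ is a sample of $\xi_j$ drawn at step $k$, $A_k\in\mathbb R^{m\times m}$ is the random weight matrix and $\alpha_k$ the step-size. Averages: $\bar z_k=\frac1m\sum_jz_{j,k}$, $\bar x_{k+1}=\mathrm Q(\bar z_k)$, $k\ge0$. Filtration. $\mathcal F_1=\sigma\{z_{j,0}:1\le j\le m\}$, $\mathcal F_k=\sigma\{z_{j,0},\xi_{j,t},A_t:1\le j\le m,\,1\le t\le k-1\}$. The point $x^*$. Under the listed hypotheses $\bar x_k$ converges almost surely to a point of $\mathcal X^*$, denoted $x^*$; the second-order condition makes $x^*$ the unique minimizer of $f$ over $\mathcal X$. $Bx\le b$ collects the constraints active at $x^*$ and $Cx\le c$ the inactive ones. Conventions. The sample $\xi_{j,k}$ is drawn afresh, i.e. it is distributed as $\xi_j$ and independent of $\mathcal F_k$, so that $\mathbb E[\nabla F_j(x_{j,k};\xi_{j,k})-\nabla f_j(x_{j,k})\mid\mathcal F_k]=0$. The Lipschitz hypothesis is understood to include $\|\nabla F_j(x;\xi_j)\|\le L_{0,j}(\xi_j)$ and $\nabla f_j(x)=\mathbb E[\nabla F_j(x;\xi_j)]$ for $x\in\mathcal X$. *)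

theory Defs
  imports "HOL-Probability.Probability" "Jordan_Normal_Form.Matrix"
begin

text \<open>
  Vectors and matrices of fixed size are those of HOL-Analysis.  The dimension \<open>r\<close> of a null space
  is not a type, so \<open>r \<times> r\<close> and \<open>r \<times> d\<close> matrices are of the carrier-based type \<^typ>\<open>real mat\<close>;
  the infix symbols shared by the two libraries keep their HOL-Analysis meaning.
\<close>

no_notation Matrix.vec_index (infixl \<open>$\<close> 100)
no_notation Matrix.scalar_prod (infix \<open>\<bullet>\<close> 70)

subsection \<open>Deterministic ingredients\<close>

definition feasible :: "real^'d^'p \<Rightarrow> real^'p \<Rightarrow> real^'d^'q \<Rightarrow> real^'q \<Rightarrow> (real^'d) set" where
  "feasible B b C c = {x. (\<forall>i. (B *v x) $ i - b $ i \<le> 0) \<and> (\<forall>i. (C *v x) $ i - c $ i \<le> 0)}"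

definition minimizers :: "('a \<Rightarrow> real) \<Rightarrow> 'a set \<Rightarrow> 'a set" where
  "minimizers f X = {x \<in> X. \<forall>y\<in>X. f x \<le> f y}"

text \<open>Meaningful only where \<open>f\<close> is (Frechet) differentiable.\<close>

definition grad :: "('a::real_inner \<Rightarrow> real) \<Rightarrow> 'a \<Rightarrow> 'a" where
  "grad f x = (THE D. GDERIV f x :> D)"

text \<open>
  \<open>Hf\<close> is the derivative of \<open>grad f\<close> at \<open>x\<close> relative to \<open>S\<close>: \<open>f\<close> need be differentiable only at the
  points of \<open>S\<close>, and \<open>x\<close> may lie on the boundary.  The Hessian satisfies this whenever \<open>f\<close> is twice
  differentiable at \<open>x\<close>.
\<close>

definition is_hessian_within ::
  "(real^'d \<Rightarrow> real) \<Rightarrow> (real^'d) set \<Rightarrow> real^'d \<Rightarrow> real^'d^'d \<Rightarrow> bool" where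
  "is_hessian_within f S x Hf \<longleftrightarrow> (grad f has_derivative (\<lambda>h. Hf *v h)) (at x within S)"

definition mirror_map :: "'a::real_inner set \<Rightarrow> 'a \<Rightarrow> 'a" where
  "mirror_map X z = arg_max_on (\<lambda>x. z \<bullet> x - (norm x)\<^sup>2 / 2) X"

definition doubly_stochastic :: "real^'m^'m \<Rightarrow> bool" where
  "doubly_stochastic W \<longleftrightarrow>
     (\<forall>i j. 0 \<le> W $ i $ j) \<and> (\<forall>i. (\<Sum>j\<in>UNIV. W $ i $ j) = 1) \<and> (\<forall>j. (\<Sum>i\<in>UNIV. W $ i $ j) = 1)"

text \<open>The Moore--Penrose inverse, by the four Penrose equations.\<close>

definition pinv :: "real^'n^'m \<Rightarrow> real^'m^'n" where
  "pinv A = (THE Y. A ** Y ** A = A \<and> Y ** A ** Y = Y \<and>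
                    transpose (A ** Y) = A ** Y \<and> transpose (Y ** A) = Y ** A)"

definition null_proj :: "real^'d^'p \<Rightarrow> real^'d^'d" where
  "null_proj B = Finite_Cartesian_Product.mat 1 - transpose B ** pinv (B ** transpose B) ** B"

definition is_orthonormal_basis :: "('i \<Rightarrow> 'a::euclidean_space) \<Rightarrow> 'i set \<Rightarrow> 'a set \<Rightarrow> bool" where
  "is_orthonormal_basis u I V \<longleftrightarrow>
     (\<forall>i\<in>I. \<forall>j\<in>I. u i \<bullet> u j = (if i = j then 1 else 0)) \<and> span (u ` I) = V"

subsection \<open>Passing between the two kinds of matrices\<close>

text \<open>
  The map \<open>e\<close> enumerates the index type: \<open>bij_betw e {..<CARD('d)} UNIV\<close>.  Rows and columns of a
  \<^typ>\<open>real mat\<close> are counted from \<open>0\<close>.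
\<close>

definition to_mat :: "(nat \<Rightarrow> 'd) \<Rightarrow> real^'d^'d \<Rightarrow> real mat" where
  "to_mat e A = Matrix.mat CARD('d) CARD('d) (\<lambda>(i, j). A $ e i $ e j)"

definition of_mat :: "(nat \<Rightarrow> 'd) \<Rightarrow> real mat \<Rightarrow> real^'d^'d" where
  "of_mat e A = (\<chi> i j. A $$ (inv_into {..<CARD('d)} e i, inv_into {..<CARD('d)} e j))"

definition first_rows :: "nat \<Rightarrow> real mat \<Rightarrow> real mat" where
  "first_rows r A = Matrix.mat r (dim_col A) (\<lambda>ij. A $$ ij)"

definition leading_principal :: "nat \<Rightarrow> real mat \<Rightarrow> real mat" where
  "leading_principal r A = Matrix.mat r r (\<lambda>ij. A $$ ij)"

definition mat_exp :: "real mat \<Rightarrow> real mat" where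
  "mat_exp A = Matrix.mat (dim_row A) (dim_row A) (\<lambda>ij. \<Sum>n. (A ^\<^sub>m n) $$ ij / fact n)"

text \<open>The integral of \<open>exp (-G t) R S R\<^sup>T exp (-G\<^sup>T t)\<close> over \<open>t \<ge> 0\<close>, taken entrywise.\<close>

definition lyapunov_integral :: "real mat \<Rightarrow> real mat \<Rightarrow> real mat \<Rightarrow> real mat" where
  "lyapunov_integral G R S = Matrix.mat (dim_row G) (dim_row G) (\<lambda>ij.
     LBINT t:{0..}. (mat_exp ((- t) \<cdot>\<^sub>m G) * R * S * transpose_mat R *
                     mat_exp ((- t) \<cdot>\<^sub>m transpose_mat G)) $$ ij)"

definition asymptotic_cov ::
  "(nat \<Rightarrow> 'd) \<Rightarrow> nat \<Rightarrow> real^'d^'d \<Rightarrow> real^'d^'d \<Rightarrow> real^'d^'d \<Rightarrow> real^'d^'d \<Rightarrow> real^'d^'d" where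
  "asymptotic_cov e r U P H Sbar =
     (let G = leading_principal r (to_mat e (transpose U ** H ** U));
          R = first_rows r (to_mat e (transpose U));
          S1 = lyapunov_integral G R (to_mat e (P ** Sbar ** P));
          s = CARD('d) - r
      in U ** of_mat e (four_block_mat S1 (0\<^sub>m r s) (0\<^sub>m s r) (0\<^sub>m s s)) ** transpose U)"

subsection \<open>The algorithm\<close>

primrec dual_iter ::
  "(real^'d) set \<Rightarrow> ('m::finite \<Rightarrow> real^'d \<Rightarrow> 's \<Rightarrow> real) \<Rightarrow> ('m \<Rightarrow> 'w \<Rightarrow> real^'d) \<Rightarrow>
   ('m \<Rightarrow> nat \<Rightarrow> 'w \<Rightarrow> 's) \<Rightarrow> (nat \<Rightarrow> 'w \<Rightarrow> real^'m^'m) \<Rightarrow> (nat \<Rightarrow> real) \<Rightarrow>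
   nat \<Rightarrow> 'm \<Rightarrow> 'w \<Rightarrow> real^'d" where
  "dual_iter X F z0 \<xi>s A \<alpha> 0 = z0"
| "dual_iter X F z0 \<xi>s A \<alpha> (Suc k) = (\<lambda>j \<omega>.
     (\<Sum>i\<in>UNIV. (A (Suc k) \<omega> $ j $ i) *\<^sub>R dual_iter X F z0 \<xi>s A \<alpha> k i \<omega>)
     - \<alpha> (Suc k) *\<^sub>R grad (\<lambda>x. F j x (\<xi>s j (Suc k) \<omega>)) (mirror_map X (dual_iter X F z0 \<xi>s A \<alpha> k j \<omega>)))"

subsection \<open>Probabilistic ingredients\<close>

definition rv_events :: "'w measure \<Rightarrow> ('w \<Rightarrow> 'b::topological_space) \<Rightarrow> 'w set set" where
  "rv_events M Y = {Y -` S \<inter> space M | S. S \<in> sets borel}"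

definition history ::
  "'w measure \<Rightarrow> ('m \<Rightarrow> 'w \<Rightarrow> 'a::topological_space) \<Rightarrow> ('m \<Rightarrow> nat \<Rightarrow> 'w \<Rightarrow> 'b::topological_space) \<Rightarrow>
   (nat \<Rightarrow> 'w \<Rightarrow> 'c::topological_space) \<Rightarrow> nat \<Rightarrow> 'w measure" where
  "history M z0 \<xi>s A k = sigma (space M)
     ((\<Union>j. rv_events M (z0 j)) \<union> (\<Union>j. \<Union>t\<in>{1..<k}. rv_events M (\<xi>s j t))
      \<union> (\<Union>t\<in>{1..<k}. rv_events M (A t)))"

definition history_with_weights ::
  "'w measure \<Rightarrow> ('m \<Rightarrow> 'w \<Rightarrow> 'a::topological_space) \<Rightarrow> ('m \<Rightarrow> nat \<Rightarrow> 'w \<Rightarrow> 'b::topological_space) \<Rightarrow>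
   (nat \<Rightarrow> 'w \<Rightarrow> 'c::topological_space) \<Rightarrow> nat \<Rightarrow> 'w measure" where
  "history_with_weights M z0 \<xi>s A k =
     sigma (space M) (sets (history M z0 \<xi>s A k) \<union> rv_events M (A k))"

text \<open>Conditional independence of \<open>Y\<close> and \<open>Z\<close> given the sub-sigma-algebra \<open>N\<close>.\<close>

definition cond_indep ::
  "'w measure \<Rightarrow> 'w measure \<Rightarrow> ('w \<Rightarrow> 'a::topological_space) \<Rightarrow> ('w \<Rightarrow> 'b::topological_space) \<Rightarrow> bool" where
  "cond_indep M N Y Z \<longleftrightarrow> (\<forall>S\<in>sets borel. \<forall>T\<in>sets borel. AE \<omega> in M.
     real_cond_exp M N (\<lambda>\<omega>. indicator S (Y \<omega>) * indicator T (Z \<omega>)) \<omega> =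
     real_cond_exp M N (\<lambda>\<omega>. indicator S (Y \<omega>)) \<omega> * real_cond_exp M N (\<lambda>\<omega>. indicator T (Z \<omega>)) \<omega>)"

definition cov_matrix :: "'w measure \<Rightarrow> ('w \<Rightarrow> real^'d) \<Rightarrow> real^'d^'d" where
  "cov_matrix M V = (\<chi> i j. LINT \<omega>|M.
     (V \<omega> $ i - (LINT \<omega>'|M. V \<omega>' $ i)) * (V \<omega> $ j - (LINT \<omega>'|M. V \<omega>' $ j)))"

text \<open>The law \<open>N(\<mu>, \<Sigma>)\<close> by its characteristic function, which also covers singular \<open>\<Sigma>\<close>.\<close>

definition is_multivariate_normal :: "(real^'d) measure \<Rightarrow> real^'d \<Rightarrow> real^'d^'d \<Rightarrow> bool" where
  "is_multivariate_normal N \<mu> \<Sigma> \<longleftrightarrow> prob_space N \<and> sets N = sets borel \<and> transpose \<Sigma> = \<Sigma> \<and>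
     (\<forall>t. (CLINT x|N. iexp (t \<bullet> x)) =
           exp (\<i> * complex_of_real (t \<bullet> \<mu>) - complex_of_real (t \<bullet> (\<Sigma> *v t)) / 2))"

definition converges_in_distribution ::
  "'w measure \<Rightarrow> (nat \<Rightarrow> 'w \<Rightarrow> 'a::topological_space) \<Rightarrow> 'a measure \<Rightarrow> bool" where
  "converges_in_distribution M Y N \<longleftrightarrow>
     (\<forall>g :: 'a \<Rightarrow> real. continuous_on UNIV g \<longrightarrow> bounded (range g) \<longrightarrow>
        (\<lambda>k. LINT \<omega>|M. g (Y k \<omega>)) \<longlonglongrightarrow> (LINT y|N. g y))"

end

theory Submission
  imports Defs "HOL-Real_Asymp.Real_Asymp"
begin

text \<open>
  The mirror map of \<open>\<psi>(x) = |x|\<^sup>2/2\<close> is the Euclidean projection onto \<open>X\<close>.  The weights contract the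
  deviations of the \<open>z\<^sub>j\<close> from their average \<open>z\<close>, whose mean square is \<open>o(\<alpha>\<^sub>k)\<close>.  Divided by the sum of
  the step sizes, \<open>z\<close> converges to the direction \<open>-\<nabla>f(x\<^sup>*)/m\<close>, which lies in the relative interior of the
  normal cone; hence the projection \<open>x\<close> of \<open>z\<close> satisfies \<open>B(x - x\<^sup>*) = 0\<close> from some time on, and then
  \<open>x - x\<^sup>* = P\<^sub>B(z - x\<^sup>*)\<close>.  So \<open>x - x\<^sup>*\<close> obeys the linear recursion
  \<open>\<Delta> \<mapsto> \<Delta> - \<alpha>\<^sub>k(H\<Delta> + P\<^sub>B\<epsilon>\<^sub>k)\<close> up to an error negligible at the scale \<open>sqrt \<alpha>\<^sub>k\<close>.

  For the linear recursion, let \<open>\<phi>\<^sub>k\<close> be the characteristic function of \<open>\<Delta>\<^sub>k / sqrt \<alpha>\<^sub>k\<close>.  Conditioning gives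
  \<open>\<phi>\<^sub>k\<^sub>+\<^sub>1(t) = \<phi>\<^sub>k(t - \<alpha>\<^sub>k H\<^sup>Tt)(1 - \<alpha>\<^sub>k t\<^sup>TTt/2) + o(\<alpha>\<^sub>k)\<close>, where \<open>T\<close> is the covariance of
  the noise, and by the Lyapunov equation \<open>H\<Sigma> + \<Sigma>H\<^sup>T = T\<close> the function \<open>exp(-t\<^sup>T\<Sigma>t/2)\<close> satisfies the same relation.  As the argument is
  contracted in every step, the two functions approach each other.
\<close>

section \<open>Polyhedra and projections\<close>

text \<open>The integrands are convex on \<open>X\<close> only, so their gradients need not be
  continuous at \<open>xs\<close>; their components along the null space of \<open>B\<close> are,
  since there both d and -d are feasible. This suffices because the noise enters the linear
  recursion through \<open>P\<close>: it can be replaced by the noise of the same samples at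
  \<open>xs\<close>, whose conditional covariance is constant.

  Identification happens at a random time that cannot be conditioned on. So \<open>Del\<close> is
  run from time 0 with the true noise, which keeps it adapted, and is compared with the iterates on
  events of probability near 1. There the expected error is at most a multiple of \<delta> at the
  scale \<open>sqrt (g n)\<close>, where \<delta> bounds the distance to \<open>xs\<close>; \<delta>
  tends to 0 after n tends to infinity.

  In the comparison of characteristic functions every error carries a factor \<open>norm t\<close>,
  which turns contraction of the argument into contraction of the error. The exponent p is lowered
  to at most 3 so that \<open>\<bar>u\<bar> powr p\<close> bounds the second-order Taylor remainder
  of the exponential.\<close>

lemma mirror_map_eq_closest_point:
  fixes X :: "'a::euclidean_space set"
  assumes X: "closed X" "convex X" "X \<noteq> {}"
  shows "mirror_map X z = closest_point X z"
proof -
  let ?h = "\<lambda>x. z \<bullet> x - (norm x)\<^sup>2 / 2"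
  \<comment> \<open>Completing the square: maximizing is minimizing the distance to
    \<open>z\<close>. The maximizer over a closed convex set is unique, so the choice operator
    behind \<open>arg_max_on\<close> has only one candidate.\<close>
  have h: "?h x = (norm z)\<^sup>2 / 2 - (dist z x)\<^sup>2 / 2" for x
    by (simp add: dist_norm power2_norm_eq_inner inner_diff_left inner_diff_right inner_commute field_simps)
  have less: "?h x < ?h y \<longleftrightarrow> dist z y < dist z x" for x y
    unfolding h by (auto intro: power_strict_mono power2_less_imp_less)
  have max: "is_arg_max ?h (\<lambda>x. x \<in> X) x \<longleftrightarrow> x \<in> X \<and> (\<forall>y\<in>X. dist z x \<le> dist z y)" for x
    unfolding is_arg_max_def less by (auto simp: not_less)
  have "is_arg_max ?h (\<lambda>x. x \<in> X) = (\<lambda>x. x = closest_point X z)"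
  proof (intro ext iffI)
    fix x assume "is_arg_max ?h (\<lambda>x. x \<in> X) x"
    then show "x = closest_point X z"
      unfolding max by (intro closest_point_unique[OF X(2,1)]) auto
  next
    fix x assume "x = closest_point X z"
    then show "is_arg_max ?h (\<lambda>x. x \<in> X) x"
      unfolding max
      using closest_point_in_set[OF X(1,3)] closest_point_le[OF X(1)] by simp
  qed
  then show ?thesis
    by (simp add: mirror_map_def arg_max_on_def arg_max_def)
qed

lemma feasible_convex: "convex (feasible B b C c)"
  and feasible_closed: "closed (feasible B b C c)"
proof -
  have eq: "feasible B b C c = (\<Inter>i. {x. B $ i \<bullet> x \<le> b $ i}) \<inter> (\<Inter>i. {x. C $ i \<bullet> x \<le> c $ i})"
    by (auto simp: feasible_def inner_vec_def matrix_vector_mult_def)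
  show "convex (feasible B b C c)" unfolding eq
    by (intro convex_Int convex_INT convex_halfspace_le)
  show "closed (feasible B b C c)" unfolding eq
    by (intro closed_Int closed_INT ballI closed_halfspace_le)
qed

lemma orthogonal_projection_exists:
  fixes V :: "'a::euclidean_space set"
  assumes "subspace V"
  obtains f where "linear f" "\<And>x. f x \<in> V" "\<And>x y. y \<in> V \<Longrightarrow> (x - f x) \<bullet> y = 0"
proof -
  obtain T where T: "T \<subseteq> V" "pairwise Linear_Algebra.orthogonal T" "\<And>x. x \<in> T \<Longrightarrow> norm x = 1" "independent T" "span T = V"
    using orthonormal_basis_subspace[OF assms] by metis
  have fT: "finite T" using T(4) by (rule independent_imp_finite)
  define f where "f = (\<lambda>x. \<Sum>t\<in>T. (t \<bullet> x) *\<^sub>R t)"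
  show ?thesis
  proof
    show "linear f"
      unfolding f_def by (intro linearI) (simp_all add: inner_add_right algebra_simps sum.distrib scaleR_sum_right)
    show "f x \<in> V" for x
      unfolding f_def using T(1) assms by (intro subspace_sum subspace_scale) auto
    show "(x - f x) \<bullet> y = 0" if "y \<in> V" for x y
    proof -
      have "Linear_Algebra.orthogonal (x - f x) t" if t: "t \<in> T" for t
      proof -
        have "(\<Sum>s\<in>T. (s \<bullet> x) * (s \<bullet> t)) = (\<Sum>s\<in>T. if s = t then t \<bullet> x else 0)"
          using T(2,3) t by (intro sum.cong) (auto simp: pairwise_def Linear_Algebra.orthogonal_def norm_eq_1)
        also have "\<dots> = t \<bullet> x" using fT t by simp
        finally show ?thesis
          by (simp add: Linear_Algebra.orthogonal_def f_def inner_diff_left inner_sum_left inner_commute[of x])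
      qed
      then have "Linear_Algebra.orthogonal (x - f x) y"
        using that T(5) orthogonal_to_span[of y T "x - f x"] by simp
      then show ?thesis by (simp add: Linear_Algebra.orthogonal_def)
    qed
  qed
qed

section \<open>The pseudoinverse and the projection onto the null space\<close>

lemma transpose_inner: "(transpose A *v x) \<bullet> y = x \<bullet> (A *v y)" for A :: "real^'n^'m"
  by (metis dot_lmul_matrix transpose_matrix_vector)

text \<open>The predicate inside the definite description of \<open>pinv\<close>, named so that
  existence and uniqueness can be proved separately.\<close>

definition is_pinv :: "real^'n^'m \<Rightarrow> real^'m^'n \<Rightarrow> bool" where
  "is_pinv A Y \<longleftrightarrow> A ** Y ** A = A \<and> Y ** A ** Y = Y \<and>
    transpose (A ** Y) = A ** Y \<and> transpose (Y ** A) = Y ** A"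

text \<open>Two solutions give the same projections: by symmetry of the products,
  \<open>A ** Y = A ** Z\<close> and \<open>Y ** A = Z ** A\<close>, and then Y = YAY = YAZ = ZAZ =
  Z.\<close>

lemma is_pinv_unique:
  assumes "is_pinv A Y" "is_pinv A Z"
  shows "Y = Z"
proof -
  note y = assms(1)[unfolded is_pinv_def] and z = assms(2)[unfolded is_pinv_def]
  have "A ** Y = (A ** Z ** A) ** Y" using z by simp
  also have "\<dots> = (A ** Z) ** (A ** Y)" by (simp add: matrix_mul_assoc)
  also have "\<dots> = transpose ((A ** Y) ** (A ** Z))"
    using y z by (simp add: matrix_transpose_mul)
  also have "\<dots> = transpose (A ** Y ** A ** Z)" by (simp add: matrix_mul_assoc)
  also have "\<dots> = A ** Z" using y z by simp
  finally have 1: "A ** Y = A ** Z" .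
  have "Y ** A = Y ** (A ** Z ** A)" using z by simp
  also have "\<dots> = (Y ** A) ** (Z ** A)" by (simp add: matrix_mul_assoc)
  also have "\<dots> = transpose ((Z ** A) ** (Y ** A))"
    using y z by (simp add: matrix_transpose_mul)
  also have "\<dots> = transpose (Z ** (A ** Y ** A))" by (simp add: matrix_mul_assoc)
  also have "\<dots> = Z ** A" using y z by simp
  finally have 2: "Y ** A = Z ** A" .
  have "Y = Y ** (A ** Y)" using y by (simp add: matrix_mul_assoc)
  also have "\<dots> = (Y ** A) ** Z" by (simp add: 1 matrix_mul_assoc)
  also have "\<dots> = Z" using z by (simp add: 2)
  finally show ?thesis .
qed

text \<open>A symmetric matrix is injective on its range \<open>V\<close>, which is the orthogonal
  complement of its kernel. Inverting it there and composing with the orthogonal projection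
  \<open>f\<close> onto \<open>V\<close> on both sides yields Y = f g f, and both products of A and
  Y are then equal to \<open>f\<close>. The symmetric case is the one that matters, as the
  pseudoinverse is taken of \<open>B ** transpose B\<close>.\<close>

lemma is_pinv_symmetric_exists:
  fixes A :: "real^'n^'n"
  assumes sym: "transpose A = A"
  shows "\<exists>Y. is_pinv A Y"
proof -
  have adj: "(A *v x) \<bullet> y = x \<bullet> (A *v y)" for x y
    by (metis dot_lmul_matrix sym transpose_matrix_vector)
  define V where "V = range ((*v) A)"
  have V: "subspace V" unfolding V_def
    using linear_subspace_image[OF matrix_vector_mul_linear subspace_UNIV] .
  obtain f where f: "linear f" "\<And>x. f x \<in> V" "\<And>x y. y \<in> V \<Longrightarrow> (x - f x) \<bullet> y = 0"
    using orthogonal_projection_exists[OF V] by blast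
  have fV: "f x = x" if "x \<in> V" for x
    using f(3)[OF subspace_diff[OF V that f(2)], of x x] by simp
  have fsym: "f x \<bullet> y = x \<bullet> f y" for x y
  proof -
    have "f x \<bullet> y = f x \<bullet> f y"
      using f(3)[OF f(2), of y x] by (simp add: inner_diff_left inner_commute[of "f x"])
    also have "\<dots> = x \<bullet> f y"
      using f(3)[OF f(2), of y x] f(3)[OF f(2), of x y] by (simp add: inner_diff_left inner_diff_right inner_commute)
    finally show ?thesis .
  qed
  have Af: "A *v f x = A *v x" for x
  proof -
    have "(A *v (x - f x)) \<bullet> (A *v (x - f x)) = 0"
      using f(3)[of "A *v (A *v (x - f x))" x] unfolding adj by (simp add: V_def)
    then show ?thesis by (simp add: matrix_vector_mult_diff_distrib)
  qed
  have "inj_on ((*v) A) V"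
  proof (rule inj_onI)
    fix x y assume *: "x \<in> V" "y \<in> V" "A *v x = A *v y"
    then obtain w where w: "x - y = A *v w" using subspace_diff[OF V] unfolding V_def by blast
    have "(x - y) \<bullet> (x - y) = (A *v (x - y)) \<bullet> w" unfolding adj w ..
    also have "\<dots> = 0" using * by (simp add: matrix_vector_mult_diff_distrib)
    finally show "x = y" by simp
  qed
  then obtain g where g: "linear g" "\<And>x. x \<in> V \<Longrightarrow> g (A *v x) = x"
    using linear_inj_on_left_inverse[OF matrix_vector_mul_linear, of A V] V
    by (auto simp: span_eq_iff[THEN iffD2])
  define Y where "Y = matrix (\<lambda>x. f (g (f x)))"
  have "linear (\<lambda>x. f (g (f x)))"
    using linear_compose[OF linear_compose[OF f(1) g(1)] f(1)] by (simp add: o_def)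
  then have Y: "Y *v x = f (g (f x))" for x
    unfolding Y_def using matrix_vector_mul(2) by metis
  have YA: "Y *v (A *v x) = f x" for x
  proof -
    have "f (A *v x) = A *v f x" using fV[of "A *v x"] Af by (simp add: V_def)
    then have "g (f (A *v x)) = f x" using g(2)[OF f(2)] by simp
    then show ?thesis using fV[OF f(2)] by (simp add: Y)
  qed
  have AY: "A *v (Y *v x) = f x" for x
  proof -
    obtain w where w: "f x = A *v w" using f(2)[of x] unfolding V_def by blast
    have "f x = A *v f w" using w Af by simp
    then have "g (f x) = f w" using g(2)[OF f(2)] by simp
    then show ?thesis using Af w fV[OF f(2)] by (simp add: Y)
  qed
  have sym': "transpose D = D" if "\<And>x. D *v x = f x" for D :: "real^'n^'n"
  proof -
    have "(transpose D *v y) \<bullet> x = (D *v y) \<bullet> x" for x y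
      unfolding transpose_inner that by (rule fsym[symmetric])
    then have "transpose D *v y = D *v y" for y using vector_eq_rdot by blast
    then show ?thesis by (simp add: matrix_eq)
  qed
  have "is_pinv A Y"
    unfolding is_pinv_def
  proof (intro conjI sym')
    show "A ** Y ** A = A" "Y ** A ** Y = Y"
      unfolding matrix_eq matrix_vector_mul_assoc[symmetric] AY YA by (simp_all add: Af Y fV f(2))
    show "(A ** Y) *v x = f x" "(Y ** A) *v x = f x" for x
      by (simp_all add: matrix_vector_mul_assoc[symmetric] AY YA)
  qed
  then show ?thesis ..
qed

lemma is_pinv_pinv:
  fixes A :: "real^'n^'n"
  assumes "transpose A = A"
  shows "is_pinv A (pinv A)"
proof -
  obtain Y where Y: "is_pinv A Y" using is_pinv_symmetric_exists[OF assms] ..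
  have "pinv A = (THE Y. is_pinv A Y)" unfolding pinv_def is_pinv_def ..
  also have "is_pinv A \<dots>" using Y is_pinv_unique[OF _ Y] by (rule theI)
  finally show ?thesis .
qed

text \<open>Everything rests on the fact that M = \<open>B ** transpose B\<close> and
  \<open>transpose B\<close> have the same kernel, because x . M x is the squared norm of
  \<open>transpose B *v x\<close>. So the rank of \<open>B\<close> may be deficient.\<close>

lemma null_proj_kernel:
  fixes B :: "real^'d^'p"
  shows "B *v (null_proj B *v x) = 0"
    and "B *v x = 0 \<Longrightarrow> null_proj B *v x = x"
    and "null_proj B *v (transpose B *v l) = 0"
proof -
  define T where "T = transpose B"
  define M where "M = B ** T"
  define Y where "Y = pinv M"
  have Ms: "transpose M = M" by (simp add: M_def T_def matrix_transpose_mul)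
  have Y: "is_pinv M Y" unfolding Y_def by (rule is_pinv_pinv[OF Ms])
  have MYM: "M ** Y ** M = M" "transpose (M ** Y) = M ** Y" using Y by (auto simp: is_pinv_def)
  have M: "M *v v = B *v (T *v v)" for v by (simp add: M_def matrix_vector_mul_assoc)
  have P: "null_proj B *v x = x - T *v (Y *v (B *v x))" for x
    unfolding null_proj_def Y_def M_def T_def
    by (simp add: matrix_vector_mult_diff_rdistrib matrix_vector_mul_assoc matrix_mul_assoc)
  have inj: "T *v x = 0" if "M *v x = 0" for x
  proof -
    have "(T *v x) \<bullet> (T *v x) = x \<bullet> (M *v x)"
      unfolding M by (subst (1) T_def) (rule transpose_inner)
    then show ?thesis using that by simp
  qed
  show "null_proj B *v (transpose B *v l) = 0"
  proof -
    have "M *v (Y *v (M *v l)) = M *v l"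
      using MYM(1) by (simp add: matrix_vector_mul_assoc matrix_mul_assoc)
    then have "M *v (l - Y *v (M *v l)) = 0"
      by (simp only: matrix_vector_mult_diff_distrib diff_self)
    from inj[OF this] have "T *v l = T *v (Y *v (M *v l))"
      by (simp only: matrix_vector_mult_diff_distrib right_minus_eq)
    then show ?thesis
      by (simp only: P M T_def[symmetric] diff_self)
  qed
  show "B *v x = 0 \<Longrightarrow> null_proj B *v x = x"
    by (simp add: P)
  show "B *v (null_proj B *v x) = 0"
  proof -
    \<comment> \<open>This vector is \<open>B\<close> applied to the projection, written in a form
      that \<open>M\<close> visibly annihilates. Then \<open>transpose B\<close> annihilates it as
      well, which makes it orthogonal to itself.\<close>
    define w where "w = B *v x - M *v (Y *v (B *v x))"
    have MMY: "M ** (M ** Y) = M"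
      by (metis MYM Ms matrix_transpose_mul)
    have "M *v (M *v (Y *v (B *v x))) = M *v (B *v x)"
      unfolding matrix_vector_mul_assoc by (subst (2) MMY[symmetric]) (simp only: matrix_mul_assoc)
    then have "M *v w = 0"
      by (simp only: w_def matrix_vector_mult_diff_distrib diff_self)
    from inj[OF this] have 1: "T *v w = 0" .
    have w: "w = B *v (null_proj B *v x)"
      by (simp only: w_def P M matrix_vector_mult_diff_distrib)
    then have "w \<bullet> w = (T *v w) \<bullet> (null_proj B *v x)"
      unfolding T_def transpose_inner by simp
    then show ?thesis using 1 w by simp
  qed
qed

lemma null_proj_orthogonal:
  fixes B :: "real^'d^'p"
  assumes "B *v y = 0"
  shows "(x - null_proj B *v x) \<bullet> y = 0"
proof -
  have "x - null_proj B *v x = transpose B *v (pinv (B ** transpose B) *v (B *v x))"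
    unfolding null_proj_def
    by (simp add: matrix_vector_mult_diff_rdistrib matrix_vector_mul_assoc matrix_mul_assoc)
  then show ?thesis using assms transpose_inner by (metis inner_zero_right)
qed

lemma null_proj_self_adjoint:
  fixes B :: "real^'d^'p"
  shows "(null_proj B *v x) \<bullet> y = x \<bullet> (null_proj B *v y)"
proof -
  let ?P = "null_proj B"
  have "(?P *v x) \<bullet> y = (?P *v x) \<bullet> (?P *v y)"
    using null_proj_orthogonal[OF null_proj_kernel(1)[of B x], of y]
    by (simp add: inner_diff_left inner_commute[of "?P *v x"])
  also have "\<dots> = x \<bullet> (?P *v y)"
    using null_proj_orthogonal[OF null_proj_kernel(1)[of B y], of x] by (simp add: inner_diff_left)
  finally show ?thesis .
qed

lemma null_proj_orthogonal_complement:
  fixes B :: "real^'d^'p"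
  assumes "\<And>y. B *v y = 0 \<Longrightarrow> w \<bullet> y = 0"
  shows "null_proj B *v w = 0"
  using assms[OF null_proj_kernel(1)] null_proj_self_adjoint[of B w "null_proj B *v w"]
  by (metis inner_eq_zero_iff null_proj_kernel(1,2))

lemma norm_null_proj_le:
  fixes B :: "real^'d^'p"
  shows "norm (null_proj B *v x) \<le> norm x"
proof -
  let ?p = "null_proj B *v x"
  have "?p \<bullet> ?p = x \<bullet> ?p"
    using null_proj_self_adjoint[of B x ?p] null_proj_kernel by metis
  also have "\<dots> \<le> norm x * norm ?p" by (rule norm_cauchy_schwarz)
  finally have "norm ?p * norm ?p \<le> norm x * norm ?p"
    by (simp add: dot_square_norm power2_eq_square)
  then show ?thesis
    by (cases "?p = 0") auto
qed

text \<open>A Hoffman bound: the distance to the null space of \<open>B\<close> is controlled by the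
  residual, as the complementary projection factors through \<open>B\<close>.\<close>

lemma kernel_complement_bound:
  fixes B :: "real^'d^'p"
  obtains \<kappa> where "0 < \<kappa>" "\<And>d. norm (d - null_proj B *v d) \<le> \<kappa> * norm (B *v d)"
proof -
  let ?K = "transpose B ** pinv (B ** transpose B)"
  obtain \<kappa> where \<kappa>: "0 < \<kappa>" "\<And>v. norm (?K *v v) \<le> norm v * \<kappa>"
    using bounded_linear.pos_bounded[OF matrix_vector_mul_bounded_linear[of ?K]] by blast
  show ?thesis
  proof
    show "norm (d - null_proj B *v d) \<le> \<kappa> * norm (B *v d)" for d
      using \<kappa>(2)[of "B *v d"] unfolding null_proj_def
      by (simp add: matrix_vector_mult_diff_rdistrib matrix_vector_mul_assoc matrix_mul_assoc mult.commute)
  qed (rule \<kappa>)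
qed

section \<open>Strict complementarity and identification of the active constraints\<close>

lemma rel_interior_cone_strict:
  fixes B :: "real^'d^'p"
  assumes v: "v \<in> rel_interior {transpose B *v l | l. \<forall>i. 0 \<le> l $ i}" (is "v \<in> rel_interior ?N")
  obtains \<gamma> where "0 < \<gamma>" "\<And>d. (\<And>i. (B *v d) $ i \<le> 0) \<Longrightarrow> v \<bullet> d \<le> - \<gamma> * norm (B *v d)"
proof -
  let ?n = "real CARD('p)"
  have polar: "w \<bullet> d \<le> 0" if w: "w \<in> ?N" and d: "\<And>i. (B *v d) $ i \<le> 0" for w d
  proof -
    obtain l where l: "w = transpose B *v l" "\<And>i. 0 \<le> l $ i" using w by blast
    have "w \<bullet> d = l \<bullet> (B *v d)" unfolding l(1) by (rule transpose_inner)
    also have "\<dots> \<le> 0" unfolding inner_vec_def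
      using l(2) d by (intro sum_nonpos) (auto simp: mult_nonneg_nonpos)
    finally show ?thesis .
  qed
  \<comment> \<open>A point of the cone that involves every row of \<open>B\<close>: its product
    with a feasible direction is minus the l1 norm of \<open>B *v d\<close>, so it measures how far
    \<open>d\<close> leaves the null space.\<close>
  define s where "s = transpose B *v (1 :: real^'p)"
  have s: "s \<in> ?N" unfolding s_def by (intro CollectI exI[of _ 1]) simp
  have "convex ?N"
  proof (rule convexI)
    fix x y u w :: real and x' y' assume "x' \<in> ?N" "y' \<in> ?N" "0 \<le> u" "0 \<le> w" "u + w = 1"
    then obtain l k where "x' = transpose B *v l" "y' = transpose B *v k" "\<And>i. 0 \<le> l $ i" "\<And>i. 0 \<le> k $ i"
      by blast
    then show "u *\<^sub>R x' + w *\<^sub>R y' \<in> ?N"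
      using \<open>0 \<le> u\<close> \<open>0 \<le> w\<close>
      by (intro CollectI exI[of _ "u *\<^sub>R l + w *\<^sub>R k"])
         (auto simp: matrix_vector_right_distrib matrix_vector_mult_scaleR)
  qed
  moreover have "?N \<noteq> {}" using s by blast
  \<comment> \<open>Relative interior: the segment from \<open>s\<close> to \<open>v\<close> can be
    prolonged beyond \<open>v\<close> inside the cone. Polarity at its end point, divided by
    \<open>e\<close>, produces the constant \<open>\<gamma>\<close>.\<close>
  ultimately obtain e where e: "1 < e" "(1 - e) *\<^sub>R s + e *\<^sub>R v \<in> ?N"
    using convex_rel_interior_iff[of ?N v] v s by blast
  define \<gamma> where "\<gamma> = (e - 1) / e"
  have \<gamma>: "0 < \<gamma>" using e(1) by (simp add: \<gamma>_def)
  show ?thesis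
  proof (rule that[OF \<gamma>])
    fix d assume d: "\<And>i. (B *v d) $ i \<le> 0"
    have "(1 - e) * (s \<bullet> d) + e * (v \<bullet> d) \<le> 0"
      using polar[OF e(2) d] by (simp add: inner_add_left)
    then have "v \<bullet> d \<le> \<gamma> * (s \<bullet> d)"
      using e(1) by (simp add: \<gamma>_def field_simps)
    also have "s \<bullet> d = - (\<Sum>i\<in>UNIV. \<bar>(B *v d) $ i\<bar>)"
      unfolding s_def transpose_inner using d
      by (simp add: inner_vec_def sum_negf[symmetric] abs_of_nonpos)
    also have "\<gamma> * \<dots> \<le> \<gamma> * (- norm (B *v d))"
      using \<gamma> norm_le_l1_cart[of "B *v d"] by (intro mult_left_mono) auto
    finally show "v \<bullet> d \<le> - \<gamma> * norm (B *v d)" by simp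
  qed
qed

text \<open>
  No multipliers are needed: \<open>z - x\<close> vanishes on the lineality space of the tangent cone at \<open>xs\<close> and on
  \<open>x - xs\<close>, so strict complementarity forces \<open>B *v (x - xs) = 0\<close> once the direction of \<open>z - x\<close> is
  close to that of \<open>v\<close>.
\<close>

lemma closest_point_near_vertex:
  fixes B :: "real^'d^'p" and C :: "real^'d^'q"
  assumes X: "X = feasible B b C c" and act: "B *v xs = b" and inact: "\<And>i. (C *v xs) $ i < c $ i"
  obtains \<delta> where "0 < \<delta>"
    "\<And>z x. x = closest_point X z \<Longrightarrow> norm (x - xs) < \<delta> \<Longrightarrow> null_proj B *v (z - x) = 0"
    "\<And>z x. x = closest_point X z \<Longrightarrow> norm (x - xs) < \<delta> \<Longrightarrow> (z - x) \<bullet> (x - xs) = 0"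
proof -
  have "\<forall>i. \<exists>e>0. \<forall>x. norm (x - xs) < e \<longrightarrow> (C *v x) $ i < c $ i"
  proof
    fix i
    have "isCont (\<lambda>x. (C *v x) $ i) xs"
      by (intro continuous_intros linear_continuous_at matrix_vector_mul_bounded_linear)
    then have "\<exists>e>0. \<forall>x. dist x xs < e \<longrightarrow> dist ((C *v x) $ i) ((C *v xs) $ i) < c $ i - (C *v xs) $ i"
      using inact[of i] unfolding continuous_at_eps_delta by simp
    then show "\<exists>e>0. \<forall>x. norm (x - xs) < e \<longrightarrow> (C *v x) $ i < c $ i"
      unfolding dist_norm by (elim exE conjE) (rule exI, rule conjI, assumption, force)
  qed
  then obtain e where e: "\<And>i. 0 < e i" "\<And>i x. norm (x - xs) < e i \<Longrightarrow> (C *v x) $ i < c $ i" by metis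
  define \<delta> where "\<delta> = Min (range e)"
  have \<delta>: "0 < \<delta>" using e(1) by (simp add: \<delta>_def)
  have "\<delta> \<le> e i" for i by (simp add: \<delta>_def)
  then have inC: "(C *v x) $ i < c $ i" if "norm (x - xs) < \<delta>" for x i
    using e(2) that by (meson order_less_le_trans)
  have clX: "closed X" "convex X" unfolding X by (rule feasible_closed feasible_convex)+
  have xsX: "xs \<in> X" using act inact by (auto simp: X feasible_def less_imp_le)
  \<comment> \<open>The variational inequality of the projection along any direction that keeps the
    constraints of \<open>B\<close> for some step \<open>s\<close>. A shorter step \<open>t\<close>
    keeps them by convexity and stays in the ball where the constraints of \<open>C\<close> are
    slack.\<close>
  have main: "(z - x) \<bullet> d \<le> 0"
    if x: "x = closest_point X z" "norm (x - xs) < \<delta>" and d: "\<And>i. (B *v (x - xs)) $ i + s * (B *v d) $ i \<le> 0"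
      and s: "0 < s" for z x d s
  proof -
    have xX: "x \<in> X" using closest_point_in_set[OF clX(1)] xsX x(1) by blast
    define t where "t = min 1 (min s ((\<delta> - norm (x - xs)) / (2 * (1 + norm d))))"
    have t: "0 < t" "t \<le> s" "t * norm d < \<delta> - norm (x - xs)"
    proof -
      show "0 < t" "t \<le> s" using s x(2) by (auto simp: t_def add_pos_nonneg)
      have "t * norm d \<le> (\<delta> - norm (x - xs)) / (2 * (1 + norm d)) * norm d"
        by (intro mult_right_mono) (auto simp: t_def)
      also have "\<dots> = (\<delta> - norm (x - xs)) * (norm d / (2 * (1 + norm d)))"
        by simp
      also have "\<dots> < (\<delta> - norm (x - xs)) * 1"
      proof (rule mult_strict_left_mono)
        have "0 < 2 * (1 + norm d)"
          by (simp add: add_pos_nonneg)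
        then show "norm d / (2 * (1 + norm d)) < 1" by simp
      qed (use x(2) in simp)
      finally show "t * norm d < \<delta> - norm (x - xs)" by simp
    qed
    have "norm (x + t *\<^sub>R d - xs) < \<delta>"
      using norm_triangle_ineq[of "x - xs" "t *\<^sub>R d"] t by (simp add: algebra_simps)
    then have "(C *v (x + t *\<^sub>R d)) $ i - c $ i \<le> 0" for i
      using inC by (simp add: less_imp_le)
    moreover have "(B *v (x + t *\<^sub>R d)) $ i - b $ i \<le> 0" for i
    proof -
      have "(B *v (x - xs)) $ i \<le> 0"
        using xX act by (simp add: X feasible_def matrix_vector_mult_diff_distrib)
      then have "(1 - t / s) * (B *v (x - xs)) $ i + (t / s) * ((B *v (x - xs)) $ i + s * (B *v d) $ i) \<le> 0"
        by (intro add_nonpos_nonpos mult_nonneg_nonpos d) (use t s in auto)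
      also have "(1 - t / s) * (B *v (x - xs)) $ i + (t / s) * ((B *v (x - xs)) $ i + s * (B *v d) $ i)
          = (B *v (x + t *\<^sub>R d)) $ i - b $ i"
        using s act by (simp add: matrix_vector_mult_diff_distrib matrix_vector_right_distrib
            matrix_vector_mult_scaleR algebra_simps)
      finally show ?thesis .
    qed
    ultimately have "x + t *\<^sub>R d \<in> X" by (simp add: X feasible_def)
    from closest_point_dot[OF clX(2,1) this, of z] show ?thesis
      using t(1) by (simp add: x(1)[symmetric] mult_le_0_iff)
  qed
  have tan: "(B *v (x - xs)) $ i \<le> 0" if "x = closest_point X z" for x z i
    using closest_point_in_set[OF clX(1)] xsX that act
    by (force simp: X feasible_def matrix_vector_mult_diff_distrib)
  show ?thesis
  proof (rule that[OF \<delta>])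
    fix z x assume x: "x = closest_point X z" "norm (x - xs) < \<delta>"
    \<comment> \<open>Both directions are admissible: moving away from \<open>xs\<close> preserves
      the sign of \<open>B *v (x - xs)\<close>, and the opposite full step ends at
      \<open>xs\<close>.\<close>
    have "(z - x) \<bullet> (x - xs) \<le> 0"
      by (rule main[OF x, of 1]) (use tan[OF x(1)] in \<open>auto simp: add_nonpos_nonpos\<close>)
    moreover have "(z - x) \<bullet> - (x - xs) \<le> 0"
      by (rule main[OF x, of 1]) (auto simp: matrix_vector_mult_diff_distrib)
    ultimately show "(z - x) \<bullet> (x - xs) = 0" unfolding inner_minus_right by linarith
    show "null_proj B *v (z - x) = 0"
    proof (rule null_proj_orthogonal_complement)
      fix y assume y: "B *v y = 0"
      have "(z - x) \<bullet> y \<le> 0" "(z - x) \<bullet> - y \<le> 0"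
        by (rule main[OF x, of 1]; use tan[OF x(1)] y in \<open>auto simp: vec.neg\<close>)+
      then show "(z - x) \<bullet> y = 0" by simp
    qed
  qed
qed

text \<open>The error u = z - x - S v is annihilated by \<open>null_proj B\<close>, so its product
  with d = x - xs only sees the complementary part of \<open>d\<close>, whose norm is at most
  \<kappa> times \<open>norm (B *v d)\<close>. But z - x is orthogonal to \<open>d\<close>, so this
  product equals -S (v . d), which is at least S \<gamma> \<open>norm (B *v d)\<close>. The choice
  \<eta> \<kappa> = \<gamma> / 2 makes the two bounds compatible only if \<open>B *v d\<close>
  vanishes.\<close>

lemma active_constraints_identified:
  fixes B :: "real^'d^'p" and C :: "real^'d^'q"
  assumes X: "X = feasible B b C c" and act: "B *v xs = b" and inact: "\<And>i. (C *v xs) $ i < c $ i"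
    and v: "v \<in> rel_interior {transpose B *v l | l. \<forall>i. 0 \<le> l $ i}"
  obtains \<delta> \<eta> where "0 < \<delta>" "0 < \<eta>"
    "\<And>z x S. x = closest_point X z \<Longrightarrow> norm (x - xs) < \<delta> \<Longrightarrow> 0 < S \<Longrightarrow>
      norm (z - x - S *\<^sub>R v) \<le> \<eta> * S \<Longrightarrow> B *v (x - xs) = 0"
proof -
  obtain \<gamma> where \<gamma>: "0 < \<gamma>" "\<And>d. (\<And>i. (B *v d) $ i \<le> 0) \<Longrightarrow> v \<bullet> d \<le> - \<gamma> * norm (B *v d)"
    using rel_interior_cone_strict[OF v] by blast
  obtain \<kappa> where \<kappa>: "0 < \<kappa>" "\<And>d. norm (d - null_proj B *v d) \<le> \<kappa> * norm (B *v d)"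
    using kernel_complement_bound[of B] by blast
  obtain \<delta> where \<delta>: "0 < \<delta>"
    "\<And>z x. x = closest_point X z \<Longrightarrow> norm (x - xs) < \<delta> \<Longrightarrow> null_proj B *v (z - x) = 0"
    "\<And>z x. x = closest_point X z \<Longrightarrow> norm (x - xs) < \<delta> \<Longrightarrow> (z - x) \<bullet> (x - xs) = 0"
    using closest_point_near_vertex[OF X act inact] by blast
  obtain l where l: "v = transpose B *v l"
    using v rel_interior_subset by blast
  define \<eta> where "\<eta> = \<gamma> / (2 * \<kappa>)"
  have \<eta>: "0 < \<eta>" "\<eta> * \<kappa> = \<gamma> / 2" using \<gamma>(1) \<kappa>(1) by (auto simp: \<eta>_def)
  have clX: "closed X" unfolding X by (rule feasible_closed)
  have xsX: "xs \<in> X" using act inact by (auto simp: X feasible_def less_imp_le)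
  show ?thesis
  proof (rule that[OF \<delta>(1) \<eta>(1)])
    fix z x S assume x: "x = closest_point X z" "norm (x - xs) < \<delta>" and S: "0 < S"
      and close: "norm (z - x - S *\<^sub>R v) \<le> \<eta> * S"
    define d where "d = x - xs"
    define u where "u = z - x - S *\<^sub>R v"
    have xX: "x \<in> X" using closest_point_in_set[OF clX] xsX x(1) by blast
    have d: "(B *v d) $ i \<le> 0" for i
      using xX act by (simp add: d_def X feasible_def matrix_vector_mult_diff_distrib)
    have "null_proj B *v u = 0"
      by (simp add: u_def \<delta>(2)[OF x] l null_proj_kernel(3) matrix_vector_mult_diff_distrib[of _ "z - x"]
          matrix_vector_mult_scaleR del: transpose_matrix_vector)
    then have "u \<bullet> (null_proj B *v d) = 0"
      by (simp flip: null_proj_self_adjoint)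
    then have "u \<bullet> d = u \<bullet> (d - null_proj B *v d)" by (simp add: inner_diff_right)
    also have "\<dots> \<le> norm u * norm (d - null_proj B *v d)" by (rule norm_cauchy_schwarz)
    also have "\<dots> \<le> (\<eta> * S) * (\<kappa> * norm (B *v d))"
      using close \<kappa> \<eta> S by (intro mult_mono) (auto simp: u_def)
    also have "\<dots> = S * (\<gamma> / 2 * norm (B *v d))"
      using \<eta>(2) by (metis mult.assoc mult.commute)
    finally have "u \<bullet> d \<le> S * (\<gamma> / 2 * norm (B *v d))" .
    moreover have "u \<bullet> d = - S * (v \<bullet> d)"
      using \<delta>(3)[OF x] by (simp add: u_def d_def inner_diff_left[of "z - x"])
    moreover have "S * (\<gamma> * norm (B *v d)) \<le> S * - (v \<bullet> d)"
      using \<gamma>(2)[OF d] S by (intro mult_left_mono) auto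
    ultimately have "S * (\<gamma> * norm (B *v d)) \<le> S * (\<gamma> / 2 * norm (B *v d))" by linarith
    then have "\<gamma> * norm (B *v d) \<le> 0" using S by simp
    then show "B *v (x - xs) = 0"
      using \<gamma>(1) by (simp add: d_def mult_le_0_iff)
  qed
qed

declare transpose_matrix_vector [simp del]

section \<open>The Lyapunov integral\<close>

text \<open>This is x . exp(-tH) v. As a scalar power series in \<open>t\<close> it can be
  differentiated termwise, and its values at columns of \<open>U\<close> are the entries of the
  matrix exponentials in \<open>asymptotic_cov\<close>.\<close>

definition exp_form :: "real^'d^'d \<Rightarrow> real^'d \<Rightarrow> real^'d \<Rightarrow> real \<Rightarrow> real" where
  "exp_form H x v t = (\<Sum>k. x \<bullet> (((*v) H ^^ k) v) * (- t) ^ k / fact k)"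

lemma exp_form_summable:
  fixes H :: "real^'d^'d"
  shows "summable (\<lambda>k. (- 1) ^ k * (x \<bullet> (((*v) H ^^ k) v)) / fact k * t ^ k)"
proof -
  obtain K where K: "0 < K" "\<And>w. norm (H *v w) \<le> norm w * K"
    using bounded_linear.pos_bounded[OF matrix_vector_mul_bounded_linear[of H]] by blast
  have pow: "norm (((*v) H ^^ k) v) \<le> K ^ k * norm v" for k
  proof (induction k)
    case (Suc k)
    have "norm (((*v) H ^^ Suc k) v) \<le> norm (((*v) H ^^ k) v) * K" using K(2) by simp
    also have "\<dots> \<le> (K ^ k * norm v) * K" using Suc K(1) by (intro mult_right_mono) auto
    finally show ?case by (simp add: mult_ac)
  qed simp
  show ?thesis
  proof (rule summable_comparison_test'[of "\<lambda>k. norm x * norm v * (inverse (fact k) * (K * \<bar>t\<bar>) ^ k)" 0])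
    show "summable (\<lambda>k. norm x * norm v * (inverse (fact k) * (K * \<bar>t\<bar>) ^ k))"
      by (intro summable_mult summable_exp)
    fix k :: nat
    have "\<bar>x \<bullet> (((*v) H ^^ k) v)\<bar> \<le> norm x * (K ^ k * norm v)"
      by (rule order_trans[OF Cauchy_Schwarz_ineq2 mult_left_mono[OF pow]]) simp
    then have "\<bar>x \<bullet> (((*v) H ^^ k) v)\<bar> * (\<bar>t\<bar> ^ k / fact k) \<le> norm x * (K ^ k * norm v) * (\<bar>t\<bar> ^ k / fact k)"
      by (rule mult_right_mono) simp
    then show "norm ((- 1) ^ k * (x \<bullet> (((*v) H ^^ k) v)) / fact k * t ^ k) \<le> norm x * norm v * (inverse (fact k) * (K * \<bar>t\<bar>) ^ k)"
      by (simp add: abs_mult power_abs power_mult_distrib divide_inverse mult_ac)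
  qed
qed

lemma exp_form_power_series:
  "exp_form H x v t = (\<Sum>k. (- 1) ^ k * (x \<bullet> (((*v) H ^^ k) v)) / fact k * t ^ k)"
  unfolding exp_form_def by (simp add: power_minus[of t] mult_ac)

lemma exp_form_sums:
  "(\<lambda>k. (- 1) ^ k * (x \<bullet> (((*v) H ^^ k) v)) / fact k * t ^ k) sums exp_form H x v t"
  unfolding exp_form_power_series by (rule summable_sums[OF exp_form_summable])

lemma exp_form_has_derivative:
  "((\<lambda>t. exp_form H x v t) has_real_derivative - exp_form H x (H *v v) t) (at t)"
proof -
  define c where "c = (\<lambda>k. (- 1) ^ k * (x \<bullet> (((*v) H ^^ k) v)) / fact k)"
  have "((\<lambda>t. \<Sum>k. c k * t ^ k) has_field_derivative (\<Sum>k. diffs c k * t ^ k)) (at t)"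
    by (rule termdiffs_strong_converges_everywhere) (unfold c_def, rule exp_form_summable)
  moreover have "diffs c k * t ^ k = - ((- 1) ^ k * (x \<bullet> (((*v) H ^^ k) (H *v v))) / fact k * t ^ k)" for k
    by (simp add: diffs_def c_def funpow_swap1 field_simps del: of_nat_Suc)
  then have "(\<lambda>k. diffs c k * t ^ k) sums - exp_form H x (H *v v) t"
    by (simp only: sums_minus[OF exp_form_sums])
  ultimately show ?thesis
    by (simp only: exp_form_power_series[of H x v] c_def sums_iff)
qed

lemma exp_form_add:
  "exp_form H x (v + w) t = exp_form H x v t + exp_form H x w t"
  "exp_form H (x + y) v t = exp_form H x v t + exp_form H y v t"
proof -
  have *: "((*v) H ^^ k) (v + w) = ((*v) H ^^ k) v + ((*v) H ^^ k) w" for k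
    by (induction k) (simp_all add: matrix_vector_right_distrib)
  show "exp_form H x (v + w) t = exp_form H x v t + exp_form H x w t"
    by (rule sums_unique2[OF exp_form_sums])
       (use sums_add[OF exp_form_sums[of x H v t] exp_form_sums[of x H w t]] in
         \<open>simp add: * inner_add_right distrib_left distrib_right add_divide_distrib\<close>)
  show "exp_form H (x + y) v t = exp_form H x v t + exp_form H y v t"
    by (rule sums_unique2[OF exp_form_sums])
       (use sums_add[OF exp_form_sums[of x H v t] exp_form_sums[of y H v t]] in
         \<open>simp add: inner_add_left distrib_left distrib_right add_divide_distrib\<close>)
qed

lemma exp_form_scaleR:
  "exp_form H x (a *\<^sub>R v) t = a * exp_form H x v t"
  "exp_form H (a *\<^sub>R x) v t = a * exp_form H x v t"
proof -
  have *: "((*v) H ^^ k) (a *\<^sub>R v) = a *\<^sub>R ((*v) H ^^ k) v" for k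
    by (induction k) (simp_all add: matrix_vector_mult_scaleR)
  show "exp_form H x (a *\<^sub>R v) t = a * exp_form H x v t" "exp_form H (a *\<^sub>R x) v t = a * exp_form H x v t"
    by (rule sums_unique2[OF exp_form_sums],
        use sums_mult[OF exp_form_sums[of x H v t], of a] in \<open>simp add: * mult_ac\<close>)+
qed

lemma exp_form_linear: "linear (\<lambda>v. exp_form H x v t)" "linear (\<lambda>x. exp_form H x v t)"
  by (auto intro!: linearI simp: exp_form_add exp_form_scaleR)

lemma exp_form_0: "exp_form H x v 0 = x \<bullet> v"
proof -
  have "exp_form H x v 0 = (\<Sum>k\<in>{0}. x \<bullet> (((*v) H ^^ k) v) * (- 0) ^ k / fact k)"
    unfolding exp_form_def by (rule suminf_finite) auto
  then show ?thesis by simp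
qed

lemma exp_form_transpose: "exp_form H (transpose H *v x) v t = exp_form H x (H *v v) t"
proof -
  have "(transpose H *v x) \<bullet> (((*v) H ^^ k) v) = x \<bullet> (((*v) H ^^ k) (H *v v))" for k
    unfolding transpose_inner by (simp add: funpow_swap1)
  then show ?thesis unfolding exp_form_def by simp
qed

text \<open>The primitive carries a negative sign because in the application it decays to zero, so
  that its value at 0 is all that remains.\<close>

lemma integral_atLeast_FTC:
  fixes F f :: "real \<Rightarrow> real"
  assumes F: "\<And>t. (F has_real_derivative - f t) (at t)" and f: "set_integrable lborel {0..} f"
    and cont: "continuous_on UNIV f" and lim: "(F \<longlongrightarrow> 0) at_top"
  shows "(LBINT t:{0..}. f t) = F 0"
proof -
  have "((\<lambda>y. \<integral>t. indicator {..y} t *\<^sub>R (indicator {0..} t *\<^sub>R f t) \<partial>lborel) \<longlongrightarrow> (LBINT t:{0..}. f t)) at_top"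
    using tendsto_integral_at_top[OF sets_lborel f[unfolded set_integrable_def]]
    by (simp add: set_lebesgue_integral_def)
  moreover have "\<forall>\<^sub>F y in at_top. (\<integral>t. indicator {..y} t *\<^sub>R (indicator {0..} t *\<^sub>R f t) \<partial>lborel) = F 0 - F y"
    using eventually_ge_at_top[of 0]
  proof eventually_elim
    case (elim y)
    have "(\<integral>t. f t * indicator {0..y} t \<partial>lborel) = - F y - - F 0"
    proof (rule integral_FTC_Icc_real[OF elim])
      show "((\<lambda>t. - F t) has_real_derivative f t) (at t)" for t
        using DERIV_minus[OF F[of t]] by simp
      show "isCont f t" for t using cont by (simp add: continuous_on_eq_continuous_at)
    qed
    moreover have "(\<integral>t. indicator {..y} t *\<^sub>R (indicator {0..} t *\<^sub>R f t) \<partial>lborel) = (\<integral>t. f t * indicator {0..y} t \<partial>lborel)"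
      by (intro Bochner_Integration.integral_cong) (auto simp: indicator_def)
    ultimately show ?case by simp
  qed
  ultimately have "((\<lambda>y. F 0 - F y) \<longlongrightarrow> (LBINT t:{0..}. f t)) at_top"
    by (rule Lim_transform_eventually)
  moreover have "((\<lambda>y. F 0 - F y) \<longlongrightarrow> F 0 - 0) at_top"
    by (intro tendsto_intros lim)
  ultimately show ?thesis using tendsto_unique by (metis diff_zero trivial_limit_at_top_linorder)
qed

lemma exp_decay_integrable:
  assumes "0 < (c::real)"
  shows "set_integrable lborel {0..} (\<lambda>t. exp (- c * t))"
proof -
  have "set_integrable lborel {0<..} (\<lambda>t. exp (- c * t))"
    using integrable_I0i_exp_mscale[OF assms] by (simp add: mult.commute)
  then show ?thesis
    unfolding set_integrable_def
    by (rule integrable_cong_AE_imp) (auto intro!: AE_I[of _ _ "{0}"] simp: indicator_def split: if_splits)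
qed

text \<open>\<open>P\<close> is an orthogonal projection and \<open>H\<close> acts inside its range,
  where alone it is coercive. On the kernel of \<open>P\<close> the matrix \<open>H\<close> vanishes
  and exp(-tH) does not decay, so the flow below carries a factor \<open>P\<close>.\<close>

locale lyapunov_flow =
  fixes H P T :: "real^'d^'d" and \<kappa> :: real
  assumes PP: "P ** P = P" and Psym: "transpose P = P"
    and PH: "P ** H = H" and HP: "H ** P = H" and Tsym: "transpose T = T"
    and \<kappa>: "0 < \<kappa>" and coercive: "\<And>v. P *v v = v \<Longrightarrow> \<kappa> * (norm v)\<^sup>2 \<le> v \<bullet> (H *v v)"
begin

text \<open>P exp(-t H^T) x, given by its coordinates through \<open>exp_form\<close>.\<close>

definition flow :: "real^'d \<Rightarrow> real \<Rightarrow> real^'d" where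
  "flow x t = (\<Sum>b\<in>Basis. exp_form H x (P *v b) t *\<^sub>R b)"

lemma flow_inner: "flow x t \<bullet> v = exp_form H x (P *v v) t"
proof -
  have "exp_form H x (P *v v) t = (\<Sum>b\<in>Basis. (v \<bullet> b) * exp_form H x (P *v b) t)"
  proof -
    interpret f: linear "\<lambda>v. exp_form H x (P *v v) t"
      using linear_compose[OF matrix_vector_mul_linear[of P] exp_form_linear(1)[of H x t]] by (simp add: o_def)
    show ?thesis
      using f.sum[of "\<lambda>b. (v \<bullet> b) *\<^sub>R b" Basis] by (simp add: euclidean_representation f.scaleR)
  qed
  then show ?thesis
    by (simp add: flow_def inner_sum_left inner_commute[of v] mult.commute)
qed

lemma Pinner: "(P *v x) \<bullet> y = x \<bullet> (P *v y)"
  by (metis Psym transpose_inner)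

lemma flow_0: "flow x 0 = P *v x"
  using vector_eq_rdot[of "flow x 0" "P *v x"] by (simp add: flow_inner exp_form_0 Pinner)

lemma P_flow: "P *v flow x t = flow x t"
proof -
  have "(P *v flow x t) \<bullet> v = flow x t \<bullet> v" for v
    unfolding Pinner flow_inner by (simp add: matrix_vector_mul_assoc PP)
  then show ?thesis using vector_eq_rdot by blast
qed

lemma flow_linear: "flow (x + y) t = flow x t + flow y t" "flow (a *\<^sub>R x) t = a *\<^sub>R flow x t"
  by (simp_all add: flow_def exp_form_add exp_form_scaleR sum.distrib scaleR_sum_right algebra_simps)

lemma flow_transpose: "flow (transpose H *v x) t = transpose H *v flow x t"
proof -
  have "flow (transpose H *v x) t \<bullet> v = (transpose H *v flow x t) \<bullet> v" for v
    unfolding transpose_inner flow_inner exp_form_transpose by (simp add: matrix_vector_mul_assoc PH HP)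
  then show ?thesis using vector_eq_rdot by blast
qed

lemma flow_P: "flow (P *v x) t = flow x t"
proof -
  have "(P *v x) \<bullet> (((*v) H ^^ k) (P *v v)) = x \<bullet> (((*v) H ^^ k) (P *v v))" for v k
    unfolding Pinner by (cases k) (simp_all add: matrix_vector_mul_assoc PP PH)
  then have "flow (P *v x) t \<bullet> v = flow x t \<bullet> v" for v
    by (simp add: flow_inner exp_form_def)
  then show ?thesis using vector_eq_rdot by blast
qed

lemma flow_derivative: "((\<lambda>t. flow x t) has_vector_derivative - (transpose H *v flow x t)) (at t)"
proof -
  have "((\<lambda>t. \<Sum>b\<in>Basis. exp_form H x (P *v b) t *\<^sub>R b) has_vector_derivative
      (\<Sum>b\<in>Basis. (- exp_form H x (H *v (P *v b)) t) *\<^sub>R b)) (at t)"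
    by (intro has_vector_derivative_sum)
       (auto intro!: derivative_eq_intros has_vector_derivative_scaleR[THEN has_vector_derivative_eq_rhs] exp_form_has_derivative)
  moreover have "(\<Sum>b\<in>Basis. (- exp_form H x (H *v (P *v b)) t) *\<^sub>R b) = - (transpose H *v flow x t)"
  proof -
    have "(\<Sum>b\<in>Basis. exp_form H x (H *v (P *v b)) t *\<^sub>R b) \<bullet> v = (transpose H *v flow x t) \<bullet> v" if "v \<in> Basis" for v
      using that unfolding transpose_inner flow_inner
      by (simp add: inner_sum_left inner_Basis if_distrib matrix_vector_mul_assoc PH HP cong: if_cong)
    then have "(\<Sum>b\<in>Basis. exp_form H x (H *v (P *v b)) t *\<^sub>R b) = transpose H *v flow x t"
      by (rule euclidean_eqI)
    then show ?thesis by (simp only: scaleR_minus_left sum_negf)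
  qed
  ultimately show ?thesis by (simp add: flow_def)
qed

lemma flow_continuous: "continuous_on S (flow x)"
  by (intro continuous_at_imp_continuous_on ballI has_vector_derivative_continuous[OF flow_derivative])

text \<open>Gronwall: the flow stays in the range of \<open>P\<close>, so coercivity makes exp(2
  \<kappa> t) times its squared norm nonincreasing.\<close>

lemma flow_decay:
  assumes "0 \<le> t"
  shows "norm (flow x t) \<le> exp (- \<kappa> * t) * norm x"
proof -
  define g where "g t = exp (2 * \<kappa> * t) * (flow x t \<bullet> flow x t)" for t
  have g: "(g has_real_derivative 2 * exp (2 * \<kappa> * t) * (\<kappa> * (norm (flow x t))\<^sup>2 - flow x t \<bullet> (H *v flow x t))) (at t)" for t
  proof -
    have "((\<lambda>t. flow x t \<bullet> flow x t) has_real_derivative - 2 * (flow x t \<bullet> (H *v flow x t))) (at t)"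
    proof -
      have "((\<lambda>t. flow x t \<bullet> flow x t) has_vector_derivative
          flow x t \<bullet> - (transpose H *v flow x t) + - (transpose H *v flow x t) \<bullet> flow x t) (at t)"
        by (rule bounded_bilinear.has_vector_derivative[OF bounded_bilinear_inner flow_derivative flow_derivative])
      moreover have "flow x t \<bullet> - (transpose H *v flow x t) + - (transpose H *v flow x t) \<bullet> flow x t
          = - 2 * (flow x t \<bullet> (H *v flow x t))"
        using transpose_inner[of H "flow x t" "flow x t"] by (simp add: inner_commute[of "flow x t" "transpose H *v flow x t"])
      ultimately show ?thesis
        by (simp only: has_real_derivative_iff_has_vector_derivative)
    qed
    then show ?thesis
      unfolding g_def by (auto intro!: derivative_eq_intros simp: power2_norm_eq_inner algebra_simps)
  qed
  have "g t \<le> g 0"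
  proof (rule DERIV_nonpos_imp_nonincreasing[OF assms])
    fix s
    show "\<exists>y. (g has_real_derivative y) (at s) \<and> y \<le> 0"
      using g[of s] coercive[OF P_flow, of x s]
      by (intro exI conjI) (auto simp: mult_le_0_iff)
  qed
  also have "g 0 \<le> (norm x)\<^sup>2"
  proof -
    have "(P *v x) \<bullet> (P *v x) = x \<bullet> (P *v x)" by (simp add: Pinner matrix_vector_mul_assoc PP)
    then have "norm (P *v x) * norm (P *v x) \<le> norm x * norm (P *v x)"
      using norm_cauchy_schwarz[of x "P *v x"] by (simp add: dot_square_norm power2_eq_square)
    then have "norm (P *v x) \<le> norm x" by (cases "P *v x = 0") auto
    then show ?thesis by (simp add: g_def flow_0 dot_square_norm power_mono)
  qed
  finally have "(exp (\<kappa> * t) * norm (flow x t))\<^sup>2 \<le> (norm x)\<^sup>2"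
    by (simp add: g_def dot_square_norm power_mult_distrib exp_double[symmetric] mult.assoc)
  then have "exp (\<kappa> * t) * norm (flow x t) \<le> norm x"
    by (rule power2_le_imp_le) simp
  then show ?thesis by (simp add: exp_minus field_simps)
qed

lemma flow_form_integrable: "set_integrable lborel {0..} (\<lambda>t. flow x t \<bullet> (T *v flow w t))"
proof -
  obtain K where K: "0 < K" "\<And>v. norm (T *v v) \<le> norm v * K"
    using bounded_linear.pos_bounded[OF matrix_vector_mul_bounded_linear[of T]] by blast
  have "set_integrable lborel {0..} (\<lambda>t. norm x * norm w * K * exp (- (2 * \<kappa>) * t))"
    using exp_decay_integrable[of "2 * \<kappa>"] \<kappa> by simp
  then show ?thesis
    unfolding set_integrable_def
  proof (rule Bochner_Integration.integrable_bound)
    have "continuous_on UNIV (\<lambda>t. flow x t \<bullet> (T *v flow w t))"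
      by (intro continuous_intros flow_continuous bounded_linear.continuous_on[OF matrix_vector_mul_bounded_linear])
    then have [measurable]: "(\<lambda>t. flow x t \<bullet> (T *v flow w t)) \<in> borel_measurable borel"
      by (rule borel_measurable_continuous_onI)
    show "(\<lambda>t. indicator {0..} t *\<^sub>R (flow x t \<bullet> (T *v flow w t))) \<in> borel_measurable lborel"
      by measurable
    show "AE t in lborel. norm (indicator {0..} t *\<^sub>R (flow x t \<bullet> (T *v flow w t)))
        \<le> norm (indicator {0..} t *\<^sub>R (norm x * norm w * K * exp (- (2 * \<kappa>) * t)))"
    proof (intro AE_I2)
      fix t :: real
      have "\<bar>flow x t \<bullet> (T *v flow w t)\<bar> \<le> norm x * norm w * K * exp (- (2 * \<kappa>) * t)" if "0 \<le> t"
      proof -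
        have "\<bar>flow x t \<bullet> (T *v flow w t)\<bar> \<le> norm (flow x t) * (norm (flow w t) * K)"
          by (rule order_trans[OF Cauchy_Schwarz_ineq2 mult_left_mono[OF K(2)]]) simp
        also have "\<dots> \<le> (exp (- \<kappa> * t) * norm x) * ((exp (- \<kappa> * t) * norm w) * K)"
          using flow_decay[OF that] K(1) by (intro mult_mono) auto
        also have "\<dots> = norm x * norm w * K * exp (- (2 * \<kappa>) * t)"
          by (simp add: mult_ac flip: exp_add)
        finally show ?thesis .
      qed
      then show "norm (indicator {0..} t *\<^sub>R (flow x t \<bullet> (T *v flow w t)))
        \<le> norm (indicator {0..} t *\<^sub>R (norm x * norm w * K * exp (- (2 * \<kappa>) * t)))"
        using K(1) by (auto simp: indicator_def)
    qed
  qed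
qed

text \<open>The bilinear form of \<Sigma>, the integral of exp(-tH) P T P exp(-t H^T) over t >= 0.
  Working with the form keeps matrix-valued integrals out of the proofs.\<close>

definition lyap :: "real^'d \<Rightarrow> real^'d \<Rightarrow> real" where
  "lyap x w = (LBINT t:{0..}. flow x t \<bullet> (T *v flow w t))"

lemma T_inner: "x \<bullet> (T *v y) = y \<bullet> (T *v x)"
  by (metis Tsym transpose_inner inner_commute)

text \<open>The integrand is minus the derivative of
  \<open>flow x t \<bullet> (T *v flow x t)\<close>, which decays to zero, so only the value at t =
  0 survives. On the diagonal this is H \<Sigma> + \<Sigma> H^T = P T P.\<close>

lemma lyapunov_equation: "2 * lyap (transpose H *v x) x = (P *v x) \<bullet> (T *v (P *v x))"
proof -
  have "(LBINT t:{0..}. 2 * (flow (transpose H *v x) t \<bullet> (T *v flow x t))) = flow x 0 \<bullet> (T *v flow x 0)"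
  proof (rule integral_atLeast_FTC[where F = "\<lambda>t. flow x t \<bullet> (T *v flow x t)"])
    show "((\<lambda>t. flow x t \<bullet> (T *v flow x t)) has_real_derivative
        - (2 * (flow (transpose H *v x) t \<bullet> (T *v flow x t)))) (at t)" for t
    proof -
      have "((\<lambda>t. T *v flow x t) has_vector_derivative T *v - (transpose H *v flow x t)) (at t)"
        by (rule bounded_linear.has_vector_derivative[OF matrix_vector_mul_bounded_linear flow_derivative])
      from bounded_bilinear.has_vector_derivative[OF bounded_bilinear_inner flow_derivative this]
      have "((\<lambda>t. flow x t \<bullet> (T *v flow x t)) has_real_derivative
          flow x t \<bullet> (T *v - (transpose H *v flow x t)) + (- (transpose H *v flow x t)) \<bullet> (T *v flow x t)) (at t)"
        unfolding has_real_derivative_iff_has_vector_derivative .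
      then show ?thesis
        unfolding T_inner[of "flow x t" "- (transpose H *v flow x t)"] flow_transpose[symmetric]
        by (simp add: inner_minus_left vec.neg T_inner[of "flow x t" "flow (transpose H *v x) t"])
    qed
    show "set_integrable lborel {0..} (\<lambda>t. 2 * (flow (transpose H *v x) t \<bullet> (T *v flow x t)))"
      using flow_form_integrable by simp
    show "continuous_on UNIV (\<lambda>t. 2 * (flow (transpose H *v x) t \<bullet> (T *v flow x t)))"
      by (intro continuous_intros flow_continuous bounded_linear.continuous_on[OF matrix_vector_mul_bounded_linear])
    have "((\<lambda>t. exp (- \<kappa> * t) * norm x) \<longlongrightarrow> 0) at_top"
    proof -
      have "filterlim (\<lambda>t. \<kappa> * t) at_top at_top"
        by (rule filterlim_tendsto_pos_mult_at_top[OF tendsto_const \<kappa> filterlim_ident])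
      then have "filterlim (\<lambda>t. - (\<kappa> * t)) at_bot at_top"
        by (rule filterlim_compose[OF filterlim_uminus_at_bot_at_top])
      then have "((\<lambda>t. exp (- (\<kappa> * t))) \<longlongrightarrow> 0) at_top"
        by (rule filterlim_compose[OF exp_at_bot])
      then show ?thesis by (intro tendsto_mult_left_zero) simp
    qed
    then have "((\<lambda>t. flow x t) \<longlongrightarrow> 0) at_top"
      by (rule Lim_null_comparison[rotated]) (use flow_decay in \<open>auto intro!: eventually_mono[OF eventually_ge_at_top[of 0]]\<close>)
    then have "((\<lambda>t. flow x t \<bullet> (T *v flow x t)) \<longlongrightarrow> 0 \<bullet> (T *v 0)) at_top"
      by (intro tendsto_inner bounded_linear.tendsto[OF matrix_vector_mul_bounded_linear])
    then show "((\<lambda>t. flow x t \<bullet> (T *v flow x t)) \<longlongrightarrow> 0) at_top" by simp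
  qed
  then show ?thesis by (simp add: lyap_def flow_0)
qed

end

section \<open>Identification of the form with the explicit covariance matrix\<close>

lemma orthonormal_expansion:
  assumes "is_orthonormal_basis u I V" "finite I" "v \<in> V"
  shows "(\<Sum>i\<in>I. (u i \<bullet> v) *\<^sub>R u i) = v"
proof -
  have ort: "u i \<bullet> u j = (if i = j then 1 else 0)" if "i \<in> I" "j \<in> I" for i j
    using assms(1) that by (auto simp: is_orthonormal_basis_def)
  have V: "span (u ` I) = V"
    using assms(1) by (auto simp: is_orthonormal_basis_def)
  define w where "w = v - (\<Sum>i\<in>I. (u i \<bullet> v) *\<^sub>R u i)"
  have orth: "w \<bullet> u j = 0" if "j \<in> I" for j
  proof -
    have "(\<Sum>i\<in>I. (u i \<bullet> v) * (u i \<bullet> u j)) = (\<Sum>i\<in>I. if i = j then u j \<bullet> v else 0)"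
      using ort that by (intro sum.cong) auto
    also have "\<dots> = u j \<bullet> v" using assms(2) that by simp
    finally show ?thesis by (simp add: w_def inner_diff_left inner_sum_left inner_commute[of v])
  qed
  have "w \<in> span (u ` I)"
    unfolding w_def using V assms(3) by (intro span_diff span_sum span_scale) (auto intro: span_base)
  then have "Linear_Algebra.orthogonal w w"
    by (rule orthogonal_to_span) (use orth in \<open>auto simp: Linear_Algebra.orthogonal_def\<close>)
  then show ?thesis by (simp add: w_def Linear_Algebra.orthogonal_def)
qed

lemma mult_mat_entry:
  assumes "A \<in> carrier_mat p q" "B \<in> carrier_mat q s" "i < p" "j < s"
  shows "(A * B) $$ (i, j) = (\<Sum>l<q. A $$ (i, l) * B $$ (l, j))"
  using assms by (auto simp: times_mat_def scalar_prod_def lessThan_atLeast0 intro!: sum.cong)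

lemma smult_pow_mat_entry:
  fixes A :: "real mat"
  assumes A: "A \<in> carrier_mat n n" and "i < n" "j < n"
  shows "((s \<cdot>\<^sub>m A) ^\<^sub>m k) $$ (i, j) = s ^ k * (A ^\<^sub>m k) $$ (i, j)"
  using assms(2,3)
proof (induction k arbitrary: i j)
  case (Suc k)
  have "(s \<cdot>\<^sub>m A) ^\<^sub>m k \<in> carrier_mat n n" "A ^\<^sub>m k \<in> carrier_mat n n" "s \<cdot>\<^sub>m A \<in> carrier_mat n n"
    using A by (auto intro: pow_carrier_mat)
  note c = this
  have "((s \<cdot>\<^sub>m A) ^\<^sub>m Suc k) $$ (i, j) = (\<Sum>l<n. ((s \<cdot>\<^sub>m A) ^\<^sub>m k) $$ (i, l) * (s \<cdot>\<^sub>m A) $$ (l, j))"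
    unfolding pow_mat.simps by (rule mult_mat_entry[OF c(1,3) Suc.prems])
  also have "\<dots> = (\<Sum>l<n. s ^ Suc k * ((A ^\<^sub>m k) $$ (i, l) * A $$ (l, j)))"
    using Suc A by (intro sum.cong) auto
  also have "\<dots> = s ^ Suc k * (A ^\<^sub>m Suc k) $$ (i, j)"
    unfolding pow_mat.simps mult_mat_entry[OF c(2) A Suc.prems] by (rule sum_distrib_left[symmetric])
  finally show ?case .
qed (use A in auto)

lemma conjugate_entry: "(transpose U ** A ** U) $ a $ b = column a U \<bullet> (A *v column b U)"
proof -
  have "(transpose U ** A ** U) $ a $ b = (\<Sum>k\<in>UNIV. \<Sum>l\<in>UNIV. U $ l $ a * A $ l $ k * U $ k $ b)"
    by (simp add: matrix_matrix_mult_def Finite_Cartesian_Product.transpose_def sum_distrib_right)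
  also have "\<dots> = (\<Sum>l\<in>UNIV. \<Sum>k\<in>UNIV. U $ l $ a * A $ l $ k * U $ k $ b)"
    by (rule sum.swap)
  finally show ?thesis
    by (simp add: column_def inner_vec_def matrix_vector_mult_def sum_distrib_left mult_ac)
qed

lemma exp_form_swap: "exp_form (transpose H) x v t = exp_form H v x t"
proof -
  have "x \<bullet> (((*v) (transpose H) ^^ k) v) = v \<bullet> (((*v) H ^^ k) x)" for k
  proof (induction k arbitrary: x v)
    case (Suc k)
    have "x \<bullet> (((*v) (transpose H) ^^ Suc k) v) = (transpose H *v (((*v) (transpose H) ^^ k) v)) \<bullet> x"
      unfolding funpow.simps o_apply by (rule inner_commute)
    also have "\<dots> = (H *v x) \<bullet> (((*v) (transpose H) ^^ k) v)"
      unfolding transpose_inner by (rule inner_commute)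
    also have "\<dots> = v \<bullet> (((*v) H ^^ Suc k) x)"
      unfolding Suc by (simp add: funpow_swap1)
    finally show ?case .
  qed (simp add: inner_commute)
  then show ?thesis by (simp add: exp_form_def)
qed

context
  fixes e :: "nat \<Rightarrow> 'd::finite" and r :: nat and U :: "real^'d^'d" and Y :: "(real^'d) set"
  assumes enum: "bij_betw e {..<CARD('d)} UNIV" and rn: "r \<le> CARD('d)"
    and U: "is_orthonormal_basis (\<lambda>i. column (e i) U) {..<r} Y"
begin

lemma leading_conjugate_entry:
  assumes "i < r" "j < r"
  shows "leading_principal r (to_mat e (transpose U ** K ** U)) $$ (i, j) = column (e i) U \<bullet> (K *v column (e j) U)"
  using assms rn by (simp add: leading_principal_def to_mat_def conjugate_entry)

text \<open>Cutting to the leading block commutes with powers because \<open>K\<close> leaves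
  \<open>Y\<close> invariant: the expansion of \<open>K\<close> applied to a column involves only
  the first \<open>r\<close> columns.\<close>

lemma leading_conjugate_pow:
  assumes K: "\<And>v. v \<in> Y \<Longrightarrow> K *v v \<in> Y" and "i < r" "j < r"
  shows "(leading_principal r (to_mat e (transpose U ** K ** U)) ^\<^sub>m k) $$ (i, j)
    = column (e i) U \<bullet> (((*v) K ^^ k) (column (e j) U))"
  using assms(2,3)
proof (induction k arbitrary: j)
  case 0
  then show ?case using U by (auto simp: leading_principal_def is_orthonormal_basis_def)
next
  case (Suc k)
  let ?u = "\<lambda>i. column (e i) U" and ?G = "leading_principal r (to_mat e (transpose U ** K ** U))"
  have G: "?G \<in> carrier_mat r r" by (simp add: leading_principal_def)
  have lin: "linear ((*v) K ^^ k)"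
    by (induction k) (auto simp: id_def[symmetric] o_def linear_id intro: linear_compose[unfolded o_def])
  have "?u j \<in> Y" using U Suc.prems by (auto simp: is_orthonormal_basis_def intro: span_base)
  then have Ku: "(\<Sum>l<r. (?u l \<bullet> (K *v ?u j)) *\<^sub>R ?u l) = K *v ?u j"
    by (intro orthonormal_expansion[OF U] K) auto
  have "(?G ^\<^sub>m Suc k) $$ (i, j) = (\<Sum>l<r. (?G ^\<^sub>m k) $$ (i, l) * ?G $$ (l, j))"
    unfolding pow_mat.simps by (rule mult_mat_entry[OF pow_carrier_mat[OF G] G Suc.prems])
  also have "\<dots> = (\<Sum>l<r. (?u i \<bullet> (((*v) K ^^ k) (?u l))) * (?u l \<bullet> (K *v ?u j)))"
    using Suc by (intro sum.cong) (auto simp: leading_conjugate_entry)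
  also have "\<dots> = ?u i \<bullet> (((*v) K ^^ k) (\<Sum>l<r. (?u l \<bullet> (K *v ?u j)) *\<^sub>R ?u l))"
    by (simp add: linear_sum[OF lin] linear_scale[OF lin] inner_sum_right mult.commute)
  finally show ?case by (simp add: Ku funpow_swap1)
qed

lemma mat_exp_leading_conjugate:
  assumes K: "\<And>v. v \<in> Y \<Longrightarrow> K *v v \<in> Y" and "i < r" "j < r"
  shows "mat_exp ((- t) \<cdot>\<^sub>m leading_principal r (to_mat e (transpose U ** K ** U))) $$ (i, j)
    = exp_form K (column (e i) U) (column (e j) U) t"
proof -
  let ?G = "leading_principal r (to_mat e (transpose U ** K ** U))"
  have G: "?G \<in> carrier_mat r r" by (simp add: leading_principal_def)
  have "dim_row ((- t) \<cdot>\<^sub>m ?G) = r" using G by simp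
  then show ?thesis
    using assms(2,3)
    by (simp add: mat_exp_def exp_form_def smult_pow_mat_entry[OF G] leading_conjugate_pow[OF K] mult_ac)
qed

lemma first_rows_conjugate:
  assumes "k < r" "l < r"
  shows "(first_rows r (to_mat e (transpose U)) * to_mat e A * transpose_mat (first_rows r (to_mat e (transpose U)))) $$ (k, l)
    = column (e k) U \<bullet> (A *v column (e l) U)"
proof -
  let ?n = "CARD('d)" and ?R = "first_rows r (to_mat e (transpose U))"
  have R: "?R \<in> carrier_mat r ?n" and A: "to_mat e A \<in> carrier_mat ?n ?n"
    by (simp_all add: first_rows_def to_mat_def)
  have Re: "?R $$ (i, a) = U $ e a $ e i" if "i < r" "a < ?n" for i a
    using that rn by (simp add: first_rows_def to_mat_def Finite_Cartesian_Product.transpose_def)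
  have re: "(\<Sum>a<?n. g (e a)) = (\<Sum>a\<in>UNIV. g a)" for g :: "'d \<Rightarrow> real"
    by (rule sum.reindex_bij_betw[OF enum])
  have RA: "?R * to_mat e A \<in> carrier_mat r ?n" and Rt: "transpose_mat ?R \<in> carrier_mat ?n r"
    using R A by auto
  have "(?R * to_mat e A * transpose_mat ?R) $$ (k, l) = (\<Sum>b<?n. (?R * to_mat e A) $$ (k, b) * transpose_mat ?R $$ (b, l))"
    by (rule mult_mat_entry[OF RA Rt assms])
  also have "\<dots> = (\<Sum>b<?n. (\<Sum>a<?n. U $ e a $ e k * A $ e a $ e b) * U $ e b $ e l)"
  proof (intro sum.cong refl arg_cong2[where f = "(*)"])
    fix b assume b: "b \<in> {..<?n}"
    then show "transpose_mat ?R $$ (b, l) = U $ e b $ e l"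
      using assms R Re by auto
    have "(?R * to_mat e A) $$ (k, b) = (\<Sum>a<?n. ?R $$ (k, a) * to_mat e A $$ (a, b))"
      by (rule mult_mat_entry[OF R A assms(1)]) (use b in simp)
    also have "\<dots> = (\<Sum>a<?n. U $ e a $ e k * A $ e a $ e b)"
      using assms b Re by (intro sum.cong) (auto simp: to_mat_def)
    finally show "(?R * to_mat e A) $$ (k, b) = (\<Sum>a<?n. U $ e a $ e k * A $ e a $ e b)" .
  qed
  also have "\<dots> = (\<Sum>b<?n. (\<Sum>a\<in>UNIV. U $ a $ e k * A $ a $ e b) * U $ e b $ e l)"
    by (intro sum.cong refl arg_cong2[where f = "(*)"]) (rule re)
  also have "\<dots> = (\<Sum>b\<in>UNIV. (\<Sum>a\<in>UNIV. U $ a $ e k * A $ a $ b) * U $ b $ e l)"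
    by (rule re)
  also have "\<dots> = (\<Sum>b\<in>UNIV. \<Sum>a\<in>UNIV. U $ a $ e k * A $ a $ b * U $ b $ e l)"
    by (simp add: sum_distrib_right)
  also have "\<dots> = (\<Sum>a\<in>UNIV. \<Sum>b\<in>UNIV. U $ a $ e k * A $ a $ b * U $ b $ e l)"
    by (rule sum.swap)
  finally show ?thesis
    by (simp add: column_def inner_vec_def matrix_vector_mult_def sum_distrib_left mult_ac)
qed

lemma conjugate_of_mat_form:
  assumes "A \<in> carrier_mat CARD('d) CARD('d)"
  shows "x \<bullet> ((U ** of_mat e A ** transpose U) *v w)
    = (\<Sum>i<CARD('d). \<Sum>j<CARD('d). (column (e i) U \<bullet> x) * A $$ (i, j) * (column (e j) U \<bullet> w))"
proof -
  have inv: "inv_into {..<CARD('d)} e (e i) = i" if "i < CARD('d)" for i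
    using enum that by (intro inv_into_f_f) (auto simp: bij_betw_def)
  have tr: "(transpose U *v v) $ a = column a U \<bullet> v" for v a
    by (simp add: column_def inner_vec_def matrix_vector_mult_def Finite_Cartesian_Product.transpose_def)
  have "x \<bullet> ((U ** of_mat e A ** transpose U) *v w) = (transpose U *v x) \<bullet> (of_mat e A *v (transpose U *v w))"
    unfolding transpose_inner by (simp add: matrix_vector_mul_assoc matrix_mul_assoc)
  also have "\<dots> = (\<Sum>a\<in>UNIV. \<Sum>b\<in>UNIV. (column a U \<bullet> x) * of_mat e A $ a $ b * (column b U \<bullet> w))"
    by (subst inner_vec_def) (simp add: tr matrix_vector_mult_def[of "of_mat e A"] sum_distrib_left mult_ac)
  also have "\<dots> = (\<Sum>i<CARD('d). \<Sum>j<CARD('d). (column (e i) U \<bullet> x) * of_mat e A $ e i $ e j * (column (e j) U \<bullet> w))"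
  proof -
    have re: "(\<Sum>a<CARD('d). g (e a)) = (\<Sum>a\<in>UNIV. g a)" for g :: "'d \<Rightarrow> real"
      by (rule sum.reindex_bij_betw[OF enum])
    show ?thesis
      by (subst re[symmetric]) (intro sum.cong refl re[symmetric])
  qed
  also have "\<dots> = (\<Sum>i<CARD('d). \<Sum>j<CARD('d). (column (e i) U \<bullet> x) * A $$ (i, j) * (column (e j) U \<bullet> w))"
    by (intro sum.cong refl) (simp add: of_mat_def inv)
  finally show ?thesis .
qed

end

context lyapunov_flow
begin

lemma lyap_add: "lyap (x + y) w = lyap x w + lyap y w" "lyap w (x + y) = lyap w x + lyap w y"
  by (simp_all add: lyap_def flow_linear inner_add_left inner_add_right matrix_vector_right_distrib
      set_integral_add flow_form_integrable)

lemma lyap_scaleR: "lyap (a *\<^sub>R x) w = a * lyap x w" "lyap w (a *\<^sub>R x) = a * lyap w x"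
  by (simp_all add: lyap_def flow_linear matrix_vector_mult_scaleR)

lemma lyap_linear: "linear (\<lambda>x. lyap x w)" "linear (\<lambda>x. lyap w x)"
  by (auto intro!: linearI simp: lyap_add lyap_scaleR)

lemma lyap_P: "lyap (P *v x) (P *v w) = lyap x w"
  by (simp add: lyap_def flow_P)

lemma lyap_commute: "lyap x w = lyap w x"
  by (simp add: lyap_def T_inner[of "flow x _"])

lemma lyap_nonneg:
  assumes "\<And>v. 0 \<le> v \<bullet> (T *v v)"
  shows "0 \<le> lyap x x"
  unfolding lyap_def set_lebesgue_integral_def using assms by (intro Bochner_Integration.integral_nonneg) auto

text \<open>In the basis formed by the columns of \<open>U\<close> the leading block of the
  covariance has the entries \<open>lyap (u i) (u j)\<close>; the zero blocks are correct because
  \<open>lyap\<close> depends on its arguments through \<open>P\<close> only.\<close>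

theorem asymptotic_cov_form:
  fixes e :: "nat \<Rightarrow> 'd" and U S :: "real^'d^'d"
  assumes enum: "bij_betw e {..<CARD('d)} UNIV" and rn: "r \<le> CARD('d)"
    and U: "is_orthonormal_basis (\<lambda>i. column (e i) U) {..<r} {v. P *v v = v}"
    and T: "T = P ** S ** P"
  shows "x \<bullet> (asymptotic_cov e r U P H S *v w) = lyap x w"
proof -
  let ?Y = "{v. P *v v = v}" and ?n = "CARD('d)"
  define u where "u i = column (e i) U" for i
  note U' = U[folded u_def]
  define G where "G = leading_principal r (to_mat e (transpose U ** H ** U))"
  define R where "R = first_rows r (to_mat e (transpose U))"
  have Gt: "transpose_mat G = leading_principal r (to_mat e (transpose U ** transpose H ** U))"
  proof (rule eq_matI)
    fix i j assume "i < dim_row (leading_principal r (to_mat e (transpose U ** transpose H ** U)))"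
      "j < dim_col (leading_principal r (to_mat e (transpose U ** transpose H ** U)))"
    then have ij: "i < r" "j < r" by (simp_all add: leading_principal_def)
    then have "transpose_mat G $$ (i, j) = G $$ (j, i)" by (simp add: G_def leading_principal_def)
    then show "transpose_mat G $$ (i, j) = leading_principal r (to_mat e (transpose U ** transpose H ** U)) $$ (i, j)"
      unfolding G_def using ij leading_conjugate_entry[OF enum rn U]
      by (simp add: inner_commute[of "column (e i) U"] transpose_inner)
  qed (simp_all add: G_def leading_principal_def)
  have PHt: "P ** transpose H = transpose H"
    using HP Psym by (metis matrix_transpose_mul)
  have KY: "H *v v \<in> ?Y" "transpose H *v v \<in> ?Y" for v
    by (simp_all add: matrix_vector_mul_assoc PH PHt)
  have uY: "P *v u i = u i" if "i < r" for i
  proof -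
    have "u i \<in> span (u ` {..<r})" using that by (intro span_base) auto
    then show ?thesis using U' by (simp add: is_orthonormal_basis_def)
  qed
  have dims: "mat_exp ((- t) \<cdot>\<^sub>m G) \<in> carrier_mat r r" "mat_exp ((- t) \<cdot>\<^sub>m transpose_mat G) \<in> carrier_mat r r"
    "R \<in> carrier_mat r ?n" "to_mat e T \<in> carrier_mat ?n ?n" for t
    by (simp_all add: mat_exp_def G_def leading_principal_def R_def first_rows_def to_mat_def)
  \<comment> \<open>The flow remains in the span of the first \<open>r\<close> columns. This makes
    the entries of the r by r integrand equal to the full quadratic form.\<close>
  have flow_exp: "flow (u i) t = (\<Sum>k<r. exp_form H (u i) (u k) t *\<^sub>R u k)" for i t
  proof -
    have "flow (u i) t = (\<Sum>k<r. (u k \<bullet> flow (u i) t) *\<^sub>R u k)"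
      using orthonormal_expansion[OF U', of "flow (u i) t"] P_flow by simp
    also have "\<dots> = (\<Sum>k<r. exp_form H (u i) (u k) t *\<^sub>R u k)"
      by (intro sum.cong refl) (simp add: inner_commute[of _ "flow _ _"] flow_inner uY)
    finally show ?thesis .
  qed
  have prod: "(mat_exp ((- t) \<cdot>\<^sub>m G) * R * to_mat e T * transpose_mat R * mat_exp ((- t) \<cdot>\<^sub>m transpose_mat G)) $$ (i, j)
      = flow (u i) t \<bullet> (T *v flow (u j) t)" if ij: "i < r" "j < r" for i j t
  proof -
    let ?E = "mat_exp ((- t) \<cdot>\<^sub>m G)" and ?E' = "mat_exp ((- t) \<cdot>\<^sub>m transpose_mat G)" and ?M = "R * to_mat e T * transpose_mat R"
    have M: "?M \<in> carrier_mat r r" using dims by auto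
    have "?E * R * to_mat e T * transpose_mat R * ?E' = ?E * ?M * ?E'"
    proof -
      have Rt: "transpose_mat R \<in> carrier_mat ?n r" and RT: "R * to_mat e T \<in> carrier_mat r ?n" using dims(3,4) by auto
      show ?thesis
        unfolding assoc_mult_mat[OF dims(1) dims(3,4)] assoc_mult_mat[OF dims(1) RT Rt] ..
    qed
    then have "(?E * R * to_mat e T * transpose_mat R * ?E') $$ (i, j) = (\<Sum>l<r. (\<Sum>k<r. ?E $$ (i, k) * ?M $$ (k, l)) * ?E' $$ (l, j))"
      by (simp only: mult_mat_entry[OF mult_carrier_mat[OF dims(1) M] dims(2) ij])
         (intro sum.cong refl arg_cong2[where f = "(*)"] mult_mat_entry[OF dims(1) M ij(1)], simp)
    also have "\<dots> = (\<Sum>l<r. (\<Sum>k<r. exp_form H (u i) (u k) t * (u k \<bullet> (T *v u l))) * exp_form H (u j) (u l) t)"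
    proof (intro sum.cong refl arg_cong2[where f = "(*)"])
      fix l assume l: "l \<in> {..<r}"
      \<comment> \<open>The transposed generator produces the entry with exchanged indices, hence
        \<open>exp_form_swap\<close>.\<close>
      show "?E' $$ (l, j) = exp_form H (u j) (u l) t"
        unfolding Gt using l ij mat_exp_leading_conjugate[OF enum rn U, of "transpose H" l j t] KY
        by (simp add: u_def exp_form_swap)
      fix k assume k: "k \<in> {..<r}"
      show "?E $$ (i, k) = exp_form H (u i) (u k) t"
        unfolding G_def using k ij mat_exp_leading_conjugate[OF enum rn U, of H i k t] KY
        by (simp add: u_def)
      show "?M $$ (k, l) = u k \<bullet> (T *v u l)"
        unfolding R_def u_def using k l by (intro first_rows_conjugate[OF enum rn U]) auto
    qed
    also have "\<dots> = flow (u i) t \<bullet> (T *v flow (u j) t)"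
    proof -
      have "T *v flow (u j) t = (\<Sum>l<r. exp_form H (u j) (u l) t *\<^sub>R (T *v u l))"
        by (simp add: flow_exp[of j] vec.sum matrix_vector_mult_scaleR)
      then show ?thesis
        by (simp add: flow_exp[of i] inner_sum_left inner_sum_right sum_distrib_right sum_distrib_left mult_ac)
    qed
    finally show ?thesis .
  qed
  define S1 where "S1 = lyapunov_integral G R (to_mat e T)"
  have S1: "S1 \<in> carrier_mat r r" "S1 $$ (i, j) = lyap (u i) (u j)" if "i < r" "j < r" for i j
    using that prod by (simp_all add: S1_def lyapunov_integral_def lyap_def G_def[unfolded leading_principal_def])
  let ?B = "four_block_mat S1 (0\<^sub>m r (?n - r)) (0\<^sub>m (?n - r) r) (0\<^sub>m (?n - r) (?n - r))"
  have dS1: "dim_row S1 = r" "dim_col S1 = r"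
    by (simp_all add: S1_def lyapunov_integral_def G_def leading_principal_def)
  have B: "?B \<in> carrier_mat ?n ?n"
  proof -
    have "S1 \<in> carrier_mat r r" using dS1 by (rule carrier_matI)
    then have "?B \<in> carrier_mat (r + (?n - r)) (r + (?n - r))"
      by (rule four_block_carrier_mat) (rule zero_carrier_mat)
    then show ?thesis by (simp only: le_add_diff_inverse[OF rn])
  qed
  have Be: "?B $$ (i, j) = (if i < r \<and> j < r then lyap (u i) (u j) else 0)" if "i < ?n" "j < ?n" for i j
  proof -
    have "?B $$ (i, j) = (if i < r then if j < r then S1 $$ (i, j) else 0\<^sub>m r (?n - r) $$ (i, j - r)
        else if j < r then 0\<^sub>m (?n - r) r $$ (i - r, j) else 0\<^sub>m (?n - r) (?n - r) $$ (i - r, j - r))"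
      using index_mat_four_block(1)[of i S1 "0\<^sub>m (?n - r) (?n - r)" j "0\<^sub>m r (?n - r)" "0\<^sub>m (?n - r) r"] that rn
      by (simp only: dS1 index_zero_mat le_add_diff_inverse)
    moreover have "i < r \<or> i - r < ?n - r" "j < r \<or> j - r < ?n - r"
      using that by linarith+
    ultimately show ?thesis
      using S1(2)[of i j] by (cases "i < r"; cases "j < r") (simp_all only: index_zero_mat if_True if_False simp_thms)
  qed
  have "x \<bullet> (asymptotic_cov e r U P H S *v w)
      = (\<Sum>i<?n. \<Sum>j<?n. (u i \<bullet> x) * ?B $$ (i, j) * (u j \<bullet> w))"
    unfolding u_def conjugate_of_mat_form[OF enum rn U B, symmetric]
    by (simp add: asymptotic_cov_def Let_def S1_def G_def R_def T)
  also have "\<dots> = (\<Sum>i<?n. \<Sum>j<?n. if i < r \<and> j < r then (u i \<bullet> x) * lyap (u i) (u j) * (u j \<bullet> w) else 0)"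
    by (intro sum.cong refl) (simp add: Be)
  also have "\<dots> = (\<Sum>i<r. \<Sum>j<r. (u i \<bullet> x) * lyap (u i) (u j) * (u j \<bullet> w))"
  proof -
    have "(\<Sum>i<?n. \<Sum>j<?n. if i < r \<and> j < r then f i j else 0) = (\<Sum>i<r. \<Sum>j<r. f i j)" for f :: "nat \<Rightarrow> nat \<Rightarrow> real"
    proof -
      have "(\<Sum>j<?n. if i < r \<and> j < r then f i j else 0) = (if i < r then (\<Sum>j<r. f i j) else 0)" for i
        using rn by (auto intro!: sum.mono_neutral_cong_right split: if_splits)
      then show ?thesis using rn by (auto intro!: sum.mono_neutral_cong_right split: if_splits)
    qed
    then show ?thesis .
  qed
  also have "\<dots> = lyap (\<Sum>i<r. (u i \<bullet> x) *\<^sub>R u i) (\<Sum>j<r. (u j \<bullet> w) *\<^sub>R u j)"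
    unfolding linear_sum[OF lyap_linear(1)] lyap_scaleR linear_sum[OF lyap_linear(2)] sum_distrib_left
    by (subst sum.swap) (simp add: mult_ac)
  also have "\<dots> = lyap (P *v x) (P *v w)"
  proof -
    have "(\<Sum>i<r. (u i \<bullet> v) *\<^sub>R u i) = P *v v" for v
    proof -
      have "(\<Sum>i<r. (u i \<bullet> v) *\<^sub>R u i) = (\<Sum>i<r. (u i \<bullet> (P *v v)) *\<^sub>R u i)"
        by (intro sum.cong refl) (simp add: uY flip: Pinner)
      also have "\<dots> = P *v v"
        by (rule orthonormal_expansion[OF U']) (auto simp: matrix_vector_mul_assoc PP)
      finally show ?thesis .
    qed
    then show ?thesis by simp
  qed
  finally show ?thesis by (simp add: lyap_P)
qed

end

section \<open>Existence of a possibly degenerate normal law\<close>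

lemma psd_sum_of_squares:
  fixes f :: "'a::euclidean_space \<Rightarrow> 'a"
  assumes "finite S" "S \<subseteq> Basis" "linear f" "\<And>x y. x \<bullet> f y = f x \<bullet> y" "\<And>x. 0 \<le> x \<bullet> f x"
    and "\<And>b. b \<in> Basis - S \<Longrightarrow> f b = 0"
  shows "\<exists>v. \<forall>x. x \<bullet> f x = (\<Sum>b\<in>S. (v b \<bullet> x)\<^sup>2)"
  using assms
proof (induction S arbitrary: f rule: finite_induct)
  case empty
  then have "f = (\<lambda>x. 0)"
    by (intro linear_eq_stdbasis) (auto simp: linear_zero)
  then show ?case by simp
next
  case (insert s S)
  interpret f: linear f by fact
  define c where "c = f s"
  define d where "d = s \<bullet> f s"
  \<comment> \<open>Cholesky elimination of the basis vector \<open>s\<close>: after a shift of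
    \<open>x\<close> along \<open>s\<close> the form is a quadratic polynomial in the shift
    \<open>l\<close>. Its minimum is used when d > 0, and its linear term must vanish when d =
    0.\<close>
  have expand: "(x - l *\<^sub>R s) \<bullet> f (x - l *\<^sub>R s) = x \<bullet> f x - 2 * l * (c \<bullet> x) + l\<^sup>2 * d" for x l
    using insert.prems(3)[of s x]
    by (simp add: f.diff f.scaleR inner_diff_left inner_diff_right c_def d_def inner_commute power2_eq_square algebra_simps)
  have d0: "0 \<le> d" using insert.prems by (simp add: d_def)
  show ?case
  proof (cases "d = 0")
    case True
    have "c \<bullet> x = 0" for x
    proof (rule ccontr)
      assume n: "c \<bullet> x \<noteq> 0"
      \<comment> \<open>If \<open>c \<bullet> x\<close> were not zero, this shift would give the
        form the value -1.\<close>
      have "0 \<le> x \<bullet> f x - 2 * ((x \<bullet> f x + 1) / (2 * (c \<bullet> x))) * (c \<bullet> x)"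
        using insert.prems(4)[of "x - ((x \<bullet> f x + 1) / (2 * (c \<bullet> x))) *\<^sub>R s"] unfolding expand True by simp
      then show False using n by simp
    qed
    then have "c = 0" using inner_eq_zero_iff by blast
    then have "f b = 0" if "b \<in> Basis - S" for b
      using that insert.prems(5) by (cases "b = s") (auto simp: c_def)
    then obtain v where v: "\<And>x. x \<bullet> f x = (\<Sum>b\<in>S. (v b \<bullet> x)\<^sup>2)"
      using insert.IH[of f] insert.prems by auto
    have "(\<Sum>b\<in>insert s S. ((v(s := 0)) b \<bullet> x)\<^sup>2) = (\<Sum>b\<in>S. (v b \<bullet> x)\<^sup>2)" for x
      using insert.hyps by (auto intro!: sum.cong)
    then show ?thesis using v by metis
  next
    case False
    then have d: "0 < d" using d0 by simp
    \<comment> \<open>Subtracting the square of c . x / sqrt d removes \<open>s\<close> from the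
      form. Nonnegativity of the rest is positivity of the form at the minimizing shift l = c . x /
      d.\<close>
    define g where "g = (\<lambda>x. f x - ((c \<bullet> x) / d) *\<^sub>R c)"
    have cs: "c \<bullet> b = s \<bullet> f b" for b
      using insert.prems(3)[of s b] by (simp add: c_def)
    have "linear g"
      unfolding g_def
      by (intro linearI) (simp_all add: f.add f.scaleR inner_add_right algebra_simps add_divide_distrib)
    moreover have "x \<bullet> g y = g x \<bullet> y" for x y
      using insert.prems(3)[of x y] by (simp add: g_def inner_diff_left inner_diff_right inner_commute)
    moreover have "0 \<le> x \<bullet> g x" for x
      using insert.prems(4)[of "x - ((c \<bullet> x) / d) *\<^sub>R s"] d unfolding expand
      by (simp add: g_def inner_diff_right inner_commute power2_eq_square)
    moreover have "g b = 0" if "b \<in> Basis - S" for b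
    proof (cases "b = s")
      case True
      moreover have "c \<bullet> s = d" by (simp add: d_def c_def inner_commute)
      ultimately show ?thesis using d by (simp add: g_def c_def[symmetric])
    next
      case False
      then show ?thesis using that insert.prems(5)[of b] by (simp add: g_def cs)
    qed
    ultimately obtain v where v: "\<And>x. x \<bullet> g x = (\<Sum>b\<in>S. (v b \<bullet> x)\<^sup>2)"
      using insert.IH[of g] insert.prems(1) by auto
    have "(\<Sum>b\<in>insert s S. ((v(s := (1 / sqrt d) *\<^sub>R c)) b \<bullet> x)\<^sup>2) = (c \<bullet> x)\<^sup>2 / d + (\<Sum>b\<in>S. (v b \<bullet> x)\<^sup>2)" for x
    proof -
      have "(\<Sum>b\<in>S. ((v(s := (1 / sqrt d) *\<^sub>R c)) b \<bullet> x)\<^sup>2) = (\<Sum>b\<in>S. (v b \<bullet> x)\<^sup>2)"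
        using insert.hyps by (auto intro!: sum.cong)
      then show ?thesis using insert.hyps d by (simp add: power_divide)
    qed
    moreover have "x \<bullet> f x = (c \<bullet> x)\<^sup>2 / d + x \<bullet> g x" for x
      by (simp add: g_def inner_diff_right inner_commute power2_eq_square)
    ultimately show ?thesis using v by metis
  qed
qed

lemma std_normal_iexp:
  "(CLINT x|std_normal_distribution. iexp (t * x)) = exp (- (complex_of_real t)\<^sup>2 / 2)"
  using fun_cong[OF char_std_normal_distribution, of t] by (simp add: char_def exp_of_real[symmetric])

text \<open>The law is that of a combination of vectors \<open>v b\<close> with independent standard
  normal coefficients, where the \<open>v b\<close> write the form of \<open>Q\<close> as a sum of
  squares. Singular \<open>Q\<close> is covered, as some \<open>v b\<close> may vanish.\<close>

lemma multivariate_normal_exists: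
  fixes Q :: "real^'d^'d"
  assumes sym: "transpose Q = Q" and psd: "\<And>x. 0 \<le> x \<bullet> (Q *v x)"
  shows "\<exists>N. is_multivariate_normal N 0 Q"
proof -
  have "x \<bullet> (Q *v y) = (Q *v x) \<bullet> y" for x y
    by (metis dot_lmul_matrix sym transpose_matrix_vector)
  then obtain v where v: "\<And>x. x \<bullet> (Q *v x) = (\<Sum>b\<in>(Basis :: (real^'d) set). (v b \<bullet> x)\<^sup>2)"
    using psd_sum_of_squares[of Basis "(*v) Q"] psd by (metis Diff_cancel empty_iff finite_Basis matrix_vector_mul_linear subset_refl)
  let ?S = "\<lambda>_::real^'d. std_normal_distribution"
  interpret S: prob_space std_normal_distribution
    using prob_space_normal_density by simp
  interpret P: product_prob_space ?S Basis
    by unfold_locales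
  define V where "V = (\<lambda>g. \<Sum>b\<in>(Basis :: (real^'d) set). g b *\<^sub>R v b)"
  have V[measurable]: "V \<in> borel_measurable (PiM Basis ?S)"
    unfolding V_def by measurable
  define N where "N = distr (PiM Basis ?S) borel V"
  have pN: "prob_space N"
    unfolding N_def by (rule P.prob_space_distr) measurable
  have "(CLINT x|N. iexp (t \<bullet> x)) = exp (- complex_of_real (t \<bullet> (Q *v t)) / 2)" for t
  proof -
    have "(CLINT x|N. iexp (t \<bullet> x)) = (CLINT g|PiM Basis ?S. iexp (t \<bullet> V g))"
      unfolding N_def by (subst integral_distr) auto
    also have "\<dots> = (CLINT g|PiM Basis ?S. (\<Prod>b\<in>Basis. iexp ((v b \<bullet> t) * g b)))"
      by (intro Bochner_Integration.integral_cong refl)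
         (simp add: V_def inner_sum_right inner_commute[of t] mult.commute sum_distrib_left flip: exp_sum)
    also have "\<dots> = (\<Prod>b\<in>Basis. CLINT x|std_normal_distribution. iexp ((v b \<bullet> t) * x))"
      by (rule P.product_integral_prod) (auto intro!: S.integrable_const_bound[where B = 1])
    also have "\<dots> = (\<Prod>b\<in>Basis. exp (- (complex_of_real (v b \<bullet> t))\<^sup>2 / 2))"
      by (simp only: std_normal_iexp)
    also have "\<dots> = exp (\<Sum>b\<in>Basis. - (complex_of_real (v b \<bullet> t))\<^sup>2 / 2)"
      by (rule exp_sum[symmetric]) simp
    also have "\<dots> = exp (- complex_of_real (t \<bullet> (Q *v t)) / 2)"
      by (simp add: v sum_negf sum_divide_distrib)
    finally show ?thesis .
  qed
  then have "is_multivariate_normal N 0 Q"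
    using pN sym unfolding is_multivariate_normal_def by (simp add: N_def)
  then show ?thesis by blast
qed

section \<open>Convergence in distribution by characteristic functions\<close>

text \<open>With the phase the class contains sines, with t = 0 the constants. It is an algebra by
  the product formula for cosines and meets the requirements of the Stone-Weierstrass
  theorem.\<close>

inductive trig_polynomial :: "('a::real_inner \<Rightarrow> real) \<Rightarrow> bool" where
  cos: "trig_polynomial (\<lambda>x. c * cos (t \<bullet> x + \<theta>))"
| add: "trig_polynomial f \<Longrightarrow> trig_polynomial g \<Longrightarrow> trig_polynomial (\<lambda>x. f x + g x)"

lemma trig_polynomial_const: "trig_polynomial (\<lambda>x. c)"
  using trig_polynomial.cos[of c 0 0] by simp

lemma trig_polynomial_continuous: "trig_polynomial f \<Longrightarrow> continuous_on S f"
  by (induction rule: trig_polynomial.induct) (auto intro!: continuous_intros)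

lemma trig_polynomial_bounded: "trig_polynomial f \<Longrightarrow> \<exists>K. \<forall>x. \<bar>f x\<bar> \<le> K"
proof (induction rule: trig_polynomial.induct)
  case (cos c t \<theta>)
  have "\<bar>c * cos (t \<bullet> x + \<theta>)\<bar> \<le> \<bar>c\<bar>" for x
    by (simp add: abs_mult mult_left_le)
  then show ?case by blast
next
  case (add f g)
  then obtain K L where "\<forall>x. \<bar>f x\<bar> \<le> K" "\<forall>x. \<bar>g x\<bar> \<le> L" by blast
  then have "\<forall>x. \<bar>f x + g x\<bar> \<le> K + L"
    by (meson abs_triangle_ineq add_mono order_trans)
  then show ?case by blast
qed

lemma trig_polynomial_mult:
  assumes "trig_polynomial f" "trig_polynomial g"
  shows "trig_polynomial (\<lambda>x. f x * g x)"
  using assms(1)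
proof (induction rule: trig_polynomial.induct)
  case (cos c t \<theta>)
  show ?case using assms(2)
  proof (induction rule: trig_polynomial.induct)
    case (cos c' t' \<theta>')
    have "c * cos (t \<bullet> x + \<theta>) * (c' * cos (t' \<bullet> x + \<theta>')) =
        c * c' / 2 * cos ((t - t') \<bullet> x + (\<theta> - \<theta>')) + c * c' / 2 * cos ((t + t') \<bullet> x + (\<theta> + \<theta>'))" for x
      using cos_times_cos[of "t \<bullet> x + \<theta>" "t' \<bullet> x + \<theta>'"]
      by (simp add: inner_add_left inner_diff_left algebra_simps add_divide_distrib)
    then show ?case
      using trig_polynomial.add[OF trig_polynomial.cos trig_polynomial.cos] by (simp only:)
  next
    case (add f g)
    then show ?case using trig_polynomial.add by (simp add: distrib_left)
  qed
next
  case (add f h)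
  then show ?case using trig_polynomial.add by (simp add: distrib_right)
qed

lemma trig_polynomial_compose_polynomial:
  fixes p :: "real \<Rightarrow> real"
  assumes "real_polynomial_function p" "trig_polynomial f"
  shows "trig_polynomial (\<lambda>x. p (f x))"
  using assms(1)
proof (induction rule: real_polynomial_function.induct)
  case (linear p)
  have "p y = p 1 * y" for y
    using linear_scale[OF bounded_linear.linear[OF linear], of y 1] by simp
  then have "(\<lambda>x. p (f x)) = (\<lambda>x. p 1 * f x)"
    by blast
  then show ?case
    using trig_polynomial_mult[OF trig_polynomial_const[of "p 1"] assms(2)] by (simp only:)
qed (auto intro: trig_polynomial_const trig_polynomial.add trig_polynomial_mult)

lemma trig_polynomial_separates:
  fixes x y :: "'a::real_inner"
  assumes "x \<noteq> y"
  shows "\<exists>f. trig_polynomial f \<and> f x \<noteq> f y"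
proof -
  \<comment> \<open>Scaled so that t . (x - y) = 1; the cosine then takes the distinct values cos 1
    and cos 0.\<close>
  define t where "t = (1 / (norm (x - y))\<^sup>2) *\<^sub>R (x - y)"
  define f where "f = (\<lambda>v. 1 * cos (t \<bullet> v + - (t \<bullet> y)))"
  have "t \<bullet> x - t \<bullet> y = 1"
    using assms by (simp add: t_def inner_diff_right[symmetric] dot_square_norm flip: diff_divide_distrib)
  then have "f x = cos 1" "f y = 1"
    by (auto simp: f_def)
  moreover have "cos (1::real) < cos 0"
    by (rule cos_monotone_0_pi) (use pi_gt3 in auto)
  ultimately show ?thesis
    using trig_polynomial.cos[of 1 t "- (t \<bullet> y)"] f_def by (intro exI[of _ f]) auto
qed

text \<open>
  A trigonometric polynomial close to \<open>g\<close> on \<open>K\<close> is globally bounded, but its bound depends on \<open>K\<close>;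
  composing it with a polynomial approximation of the truncation at level \<open>M\<close> removes this dependence.
\<close>

lemma trig_polynomial_approximation:
  fixes g :: "'a::real_inner \<Rightarrow> real"
  assumes K: "compact K" and g: "continuous_on K g" and M: "\<And>x. x \<in> K \<Longrightarrow> \<bar>g x\<bar> \<le> M"
    and M0: "0 \<le> M" and e: "0 < e"
  obtains q where "trig_polynomial q" "\<And>x. x \<in> K \<Longrightarrow> \<bar>g x - q x\<bar> \<le> e" "\<And>x. \<bar>q x\<bar> \<le> M + e"
proof -
  have "\<exists>h. trig_polynomial h \<and> (\<forall>x\<in>K. \<bar>g x - h x\<bar> < e / 2)"
    by (rule Stone_Weierstrass_HOL[where P = trig_polynomial])
       (use assms in \<open>auto intro: trig_polynomial_const trig_polynomial_continuous trig_polynomial.add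
         trig_polynomial_mult trig_polynomial_separates\<close>)
  then obtain h where h: "trig_polynomial h" "\<And>x. x \<in> K \<Longrightarrow> \<bar>g x - h x\<bar> < e / 2" by blast
  obtain L where L: "\<And>x. \<bar>h x\<bar> \<le> L"
    using trig_polynomial_bounded[OF h(1)] by blast
  define clip where "clip = (\<lambda>y. max (- M) (min M y))"
  have cont: "continuous_on {- L..L} clip"
    unfolding clip_def by (intro continuous_intros)
  obtain p where p: "real_polynomial_function p" "\<And>y. y \<in> {- L..L} \<Longrightarrow> \<bar>clip y - p y\<bar> < e / 2"
    using Stone_Weierstrass_real_polynomial_function[OF compact_Icc cont, of "e / 2"] e by auto
  have hL: "h x \<in> {- L..L}" for x
    using L[of x] by auto
  show ?thesis
  proof
    show "trig_polynomial (\<lambda>x. p (h x))"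
      by (rule trig_polynomial_compose_polynomial[OF p(1) h(1)])
    show "\<bar>g x - p (h x)\<bar> \<le> e" if "x \<in> K" for x
      using p(2)[OF hL, of x] h(2)[OF that] M[OF that] unfolding clip_def by linarith
    show "\<bar>p (h x)\<bar> \<le> M + e" for x
      using p(2)[OF hL, of x] M0 e unfolding clip_def by linarith
  qed
qed

lemma (in prob_space) trig_polynomial_expectation_tendsto:
  fixes Y :: "nat \<Rightarrow> 'a \<Rightarrow> 'b::euclidean_space"
  assumes Y[measurable]: "\<And>k. Y k \<in> borel_measurable M"
    and N: "prob_space N" "sets N = sets borel"
    and char: "\<And>t. (\<lambda>k. CLINT \<omega>|M. iexp (t \<bullet> Y k \<omega>)) \<longlonglongrightarrow> (CLINT x|N. iexp (t \<bullet> x))"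
    and q: "trig_polynomial q"
  shows "(\<lambda>k. LINT \<omega>|M. q (Y k \<omega>)) \<longlonglongrightarrow> (LINT x|N. q x)"
  using q
proof (induction rule: trig_polynomial.induct)
  case (cos c t \<theta>)
  interpret N: prob_space N by fact
  note [measurable_cong] = N(2)
  have *: "c * cos (t \<bullet> x + \<theta>) = Re (complex_of_real c * iexp \<theta> * iexp (t \<bullet> x))" for x
    by (simp add: Re_exp Im_exp cos_add algebra_simps)
  have iM: "integrable M (\<lambda>\<omega>. iexp (t \<bullet> Y k \<omega>))" for k
    by (intro integrable_const_bound[of _ 1]) auto
  have iN: "integrable N (\<lambda>x. iexp (t \<bullet> x))"
    by (intro N.integrable_const_bound[of _ 1]) auto
  have 1: "(LINT \<omega>|M. c * cos (t \<bullet> Y k \<omega> + \<theta>))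
      = Re (complex_of_real c * iexp \<theta> * (CLINT \<omega>|M. iexp (t \<bullet> Y k \<omega>)))" for k
    unfolding * using iM[of k] by (subst integral_Re) auto
  have 2: "(LINT x|N. c * cos (t \<bullet> x + \<theta>))
      = Re (complex_of_real c * iexp \<theta> * (CLINT x|N. iexp (t \<bullet> x)))"
    unfolding * using iN by (subst integral_Re) auto
  show ?case unfolding 1 2
    by (intro tendsto_intros char)
next
  case (add f g)
  interpret N: prob_space N by fact
  note [measurable_cong] = N(2)
  have int: "integrable M (\<lambda>\<omega>. f (Y k \<omega>)) \<and> integrable N f" if tp: "trig_polynomial f" for f k
  proof -
    obtain K where K: "\<forall>x. \<bar>f x\<bar> \<le> K" using trig_polynomial_bounded[OF tp] by blast
    have [measurable]: "f \<in> borel_measurable borel"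
      using trig_polynomial_continuous[OF tp] by (rule borel_measurable_continuous_onI)
    show ?thesis
    proof
      show "integrable M (\<lambda>\<omega>. f (Y k \<omega>))"
        by (rule integrable_const_bound[where B = K]) (use K in auto)
      show "integrable N f"
        by (rule N.integrable_const_bound[where B = K]) (use K in auto)
    qed
  qed
  show ?case
    using tendsto_add[OF add.IH] int[OF add.hyps(1)] int[OF add.hyps(2)] by simp
qed

text \<open>Levy's continuity theorem with given limit law and tightness. On a ball carrying most of
  the mass \<open>g\<close> is replaced by a trigonometric polynomial. Off the ball the global bound
  C + e controls the error, so it must not depend on the radius.\<close>

lemma (in prob_space) converges_in_distribution_char:
  fixes Y :: "nat \<Rightarrow> 'a \<Rightarrow> 'b::euclidean_space"
  assumes Y[measurable]: "\<And>k. Y k \<in> borel_measurable M"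
    and N: "prob_space N" "sets N = sets borel"
    and char: "\<And>t. (\<lambda>k. CLINT \<omega>|M. iexp (t \<bullet> Y k \<omega>)) \<longlonglongrightarrow> (CLINT x|N. iexp (t \<bullet> x))"
    and tight: "\<And>\<epsilon>. 0 < \<epsilon> \<Longrightarrow> \<exists>R. \<forall>\<^sub>F k in sequentially. prob {\<omega>\<in>space M. R < norm (Y k \<omega>)} \<le> \<epsilon>"
  shows "converges_in_distribution M Y N"
  unfolding converges_in_distribution_def
proof (intro allI impI)
  fix g :: "'b \<Rightarrow> real"
  assume g: "continuous_on UNIV g" "bounded (range g)"
  interpret N: prob_space N by fact
  note [measurable_cong] = N(2)
  have spN: "space N = UNIV" using sets_eq_imp_space_eq[OF N(2)] by simp
  have [measurable]: "g \<in> borel_measurable borel"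
    using g(1) by (rule borel_measurable_continuous_onI)
  obtain C where C: "0 < C" "\<And>x. \<bar>g x\<bar> \<le> C"
    using g(2) unfolding bounded_pos by auto
  \<comment> \<open>Stated over an arbitrary probability space, since it is applied both to
    \<open>Y k\<close> on \<open>M\<close> and to the identity on \<open>N\<close>.\<close>
  have tail: "\<bar>(LINT \<omega>|L. g (V \<omega>)) - (LINT \<omega>|L. q (V \<omega>))\<bar> \<le> e + (2 * C + e) * measure L {\<omega>\<in>space L. R < norm (V \<omega>)}"
    if L: "prob_space L" and V[measurable]: "V \<in> borel_measurable L" and q: "trig_polynomial q" and e: "0 < e"
      "\<And>x. x \<in> cball 0 R \<Longrightarrow> \<bar>g x - q x\<bar> \<le> e" "\<And>x. \<bar>q x\<bar> \<le> C + e"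
    for L :: "'c measure" and V :: "'c \<Rightarrow> 'b" and q e R
  proof -
    interpret L: prob_space L by fact
    have [measurable]: "q \<in> borel_measurable borel"
      using trig_polynomial_continuous[OF q] by (rule borel_measurable_continuous_onI)
    have ig: "integrable L (\<lambda>\<omega>. g (V \<omega>))" "integrable L (\<lambda>\<omega>. q (V \<omega>))"
      subgoal by (rule L.integrable_const_bound[where B = C]) (use C in auto)
      subgoal by (rule L.integrable_const_bound[where B = "C + e"]) (use e in auto)
      done
    have "\<bar>(LINT \<omega>|L. g (V \<omega>)) - (LINT \<omega>|L. q (V \<omega>))\<bar> \<le> (LINT \<omega>|L. \<bar>g (V \<omega>) - q (V \<omega>)\<bar>)"
      using integral_norm_bound[of L "\<lambda>\<omega>. g (V \<omega>) - q (V \<omega>)"] ig by simp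
    also have "\<dots> \<le> (LINT \<omega>|L. e + (2 * C + e) * indicator {\<omega>\<in>space L. R < norm (V \<omega>)} \<omega>)"
    proof (rule integral_mono)
      show "integrable L (\<lambda>\<omega>. \<bar>g (V \<omega>) - q (V \<omega>)\<bar>)" using ig by auto
      show "integrable L (\<lambda>\<omega>. e + (2 * C + e) * indicator {\<omega>\<in>space L. R < norm (V \<omega>)} \<omega>)"
        by (intro Bochner_Integration.integrable_add integrable_mult_right integrable_real_indicator)
           (auto simp: L.emeasure_finite less_top[symmetric])
      fix \<omega> assume "\<omega> \<in> space L"
      then show "\<bar>g (V \<omega>) - q (V \<omega>)\<bar> \<le> e + (2 * C + e) * indicator {\<omega>\<in>space L. R < norm (V \<omega>)} \<omega>"
        using e(2)[of "V \<omega>"] e(3)[of "V \<omega>"] C(2)[of "V \<omega>"] e(1) by (cases "R < norm (V \<omega>)") auto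
    qed
    also have "\<dots> = e + (2 * C + e) * measure L {\<omega>\<in>space L. R < norm (V \<omega>)}"
    proof (subst Bochner_Integration.integral_add)
      show "integrable L (\<lambda>\<omega>. (2 * C + e) * indicator {\<omega>\<in>space L. R < norm (V \<omega>)} \<omega>)"
        by (intro integrable_mult_right integrable_real_indicator)
           (auto simp: L.emeasure_finite less_top[symmetric])
    qed (simp_all add: L.prob_space)
    finally show ?thesis .
  qed
  show "(\<lambda>k. LINT \<omega>|M. g (Y k \<omega>)) \<longlonglongrightarrow> (LINT y|N. g y)"
  proof (rule tendstoI)
    fix \<epsilon> :: real assume \<epsilon>: "0 < \<epsilon>"
    \<comment> \<open>Each of the two tail errors is then at most \<epsilon> / 5, and the
      expectations of the trigonometric polynomial eventually differ by less than \<epsilon> /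
      10.\<close>
    define e where "e = min 1 (\<epsilon> / 10)"
    define d where "d = \<epsilon> / (10 * (2 * C + 1))"
    have e: "0 < e" "e \<le> 1" "e \<le> \<epsilon> / 10" and d: "0 < d" "(2 * C + 1) * d = \<epsilon> / 10"
      using \<epsilon> C by (auto simp: e_def d_def divide_simps algebra_simps)
    obtain R1 where R1: "\<forall>\<^sub>F k in sequentially. prob {\<omega>\<in>space M. R1 < norm (Y k \<omega>)} \<le> d"
      using tight[OF d(1)] by blast
    have "(\<lambda>n. measure N {x\<in>space N. real n < norm x}) \<longlonglongrightarrow> measure N (\<Inter>n. {x\<in>space N. real n < norm x})"
      by (intro N.finite_Lim_measure_decseq) (auto simp: decseq_def)
    moreover have "(\<Inter>n. {x\<in>space N. real n < norm x}) = {}"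
    proof -
      have "\<exists>n. norm x \<le> real n" for x :: 'b
        by (rule real_arch_simple)
      then show ?thesis unfolding not_less[symmetric] by blast
    qed
    ultimately have "(\<lambda>n. measure N {x\<in>space N. real n < norm x}) \<longlonglongrightarrow> 0"
      by simp
    then have "\<forall>\<^sub>F n in sequentially. measure N {x\<in>space N. real n < norm x} < d"
      using d(1) by (rule order_tendstoD)
    then obtain n where n: "measure N {x\<in>space N. real n < norm x} < d"
      using eventually_sequentially by auto
    define R where "R = max R1 (real n)"
    have RN: "measure N {x\<in>space N. R < norm x} \<le> d"
      by (rule order_trans[OF N.finite_measure_mono less_imp_le[OF n]]) (auto simp: R_def)
    have RY: "\<forall>\<^sub>F k in sequentially. prob {\<omega>\<in>space M. R < norm (Y k \<omega>)} \<le> d"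
      using R1
    proof eventually_elim
      case (elim k)
      show ?case
        by (rule order_trans[OF finite_measure_mono elim]) (auto simp: R_def)
    qed
    obtain q where q: "trig_polynomial q" "\<And>x. x \<in> cball 0 R \<Longrightarrow> \<bar>g x - q x\<bar> \<le> e" "\<And>x. \<bar>q x\<bar> \<le> C + e"
      by (rule trig_polynomial_approximation[of "cball 0 R" g C e])
         (use continuous_on_subset[OF g(1) subset_UNIV] C e in auto)
    have "\<forall>\<^sub>F k in sequentially. dist (LINT \<omega>|M. q (Y k \<omega>)) (LINT x|N. q x) < \<epsilon> / 10"
      by (rule tendstoD[OF trig_polynomial_expectation_tendsto[OF Y N char q(1)]]) (use \<epsilon> in auto)
    then show "\<forall>\<^sub>F k in sequentially. dist (LINT \<omega>|M. g (Y k \<omega>)) (LINT y|N. g y) < \<epsilon>"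
      using RY
    proof eventually_elim
      case (elim k)
      have le: "e + (2 * C + e) * m \<le> \<epsilon> / 5" if "0 \<le> m" "m \<le> d" for m
      proof -
        have "(2 * C + e) * m \<le> (2 * C + 1) * d"
          using that C e by (intro mult_mono) auto
        then show ?thesis using e d by linarith
      qed
      have 1: "\<bar>(LINT \<omega>|M. g (Y k \<omega>)) - (LINT \<omega>|M. q (Y k \<omega>))\<bar> \<le> \<epsilon> / 5"
        by (rule order_trans[OF tail[OF prob_space_axioms Y q(1) e(1) q(2,3)] le])
           (use elim in auto)
      have 2: "\<bar>(LINT x|N. g x) - (LINT x|N. q x)\<bar> \<le> \<epsilon> / 5"
        by (rule order_trans[OF tail[OF N(1) _ q(1) e(1) q(2,3), of "\<lambda>x. x"] le])
           (use RN in auto)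
      show ?case
        using 1 2 elim(1) \<epsilon> unfolding dist_real_def by linarith
    qed
  qed
qed

section \<open>Contracting recursions with divergent step sums\<close>

lemma contraction_tendsto_0:
  fixes u g :: "nat \<Rightarrow> real"
  assumes u: "\<And>n. n \<ge> n0 \<Longrightarrow> u (Suc n) \<le> (1 - c * g n) * u n" and u0: "\<And>n. n \<ge> n0 \<Longrightarrow> 0 \<le> u n"
    and g: "\<And>n. 0 \<le> g n" and div: "filterlim (\<lambda>n. \<Sum>i<n. g i) at_top sequentially" and c: "0 < c"
  shows "u \<longlonglongrightarrow> 0"
proof -
  define S where "S n = (\<Sum>i<n. g i)" for n
  \<comment> \<open>1 - c g is at most exp(-c g), so the product of the factors is bounded by the
    exponential of minus the divergent sum.\<close>
  have bd: "u (n0 + k) \<le> exp (- c * (S (n0 + k) - S n0)) * u n0" for k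
  proof (induction k)
    case (Suc k)
    have "u (n0 + Suc k) \<le> (1 - c * g (n0 + k)) * u (n0 + k)" using u by simp
    also have "\<dots> \<le> exp (- c * g (n0 + k)) * u (n0 + k)"
      using exp_ge_add_one_self[of "- c * g (n0 + k)"] u0[of "n0 + k"] by (intro mult_right_mono) auto
    also have "\<dots> \<le> exp (- c * g (n0 + k)) * (exp (- c * (S (n0 + k) - S n0)) * u n0)"
      using Suc by (intro mult_left_mono) auto
    also have "\<dots> = exp (- c * (S (n0 + Suc k) - S n0)) * u n0"
      by (simp add: S_def exp_add[symmetric] algebra_simps)
    finally show ?case .
  qed simp
  have "filterlim (\<lambda>k. S (k + n0)) at_top sequentially"
    using div unfolding S_def by (rule filterlim_compose) (rule filterlim_add_const_nat_at_top)
  then have "filterlim (\<lambda>k. c * (- S n0 + S (n0 + k))) at_top sequentially"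
    by (intro filterlim_tendsto_pos_mult_at_top[OF tendsto_const c] filterlim_tendsto_add_at_top[OF tendsto_const])
       (simp add: add.commute)
  then have "filterlim (\<lambda>k. - (c * (- S n0 + S (n0 + k)))) at_bot sequentially"
    by (rule filterlim_compose[OF filterlim_uminus_at_bot_at_top])
  then have "(\<lambda>k. exp (- (c * (- S n0 + S (n0 + k))))) \<longlonglongrightarrow> 0"
    by (rule filterlim_compose[OF exp_at_bot])
  then have lim: "(\<lambda>k. exp (- c * (S (n0 + k) - S n0)) * u n0) \<longlonglongrightarrow> 0"
    using tendsto_mult_left_zero[of "\<lambda>k. exp (- (c * (- S n0 + S (n0 + k))))" sequentially "u n0"]
    by (simp add: algebra_simps)
  have ge: "\<forall>\<^sub>F k in sequentially. 0 \<le> u (n0 + k)"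
    using u0 by simp
  have le: "\<forall>\<^sub>F k in sequentially. u (n0 + k) \<le> exp (- c * (S (n0 + k) - S n0)) * u n0"
    using bd by (intro always_eventually) blast
  have "(\<lambda>k. u (n0 + k)) \<longlonglongrightarrow> 0"
    by (rule tendsto_sandwich[OF ge le tendsto_const lim])
  then show ?thesis
    by (subst (asm) add.commute) (rule LIMSEQ_offset[where k = n0])
qed

text \<open>b / c is the fixed point of the recursion, and the positive part of u - b / c satisfies
  the homogeneous inequality. The positive part is taken because \<open>u\<close> may lie below the
  fixed point.\<close>

lemma contraction_eventually_le:
  fixes u g :: "nat \<Rightarrow> real"
  assumes u: "\<forall>\<^sub>F n in sequentially. u (Suc n) \<le> (1 - c * g n) * u n + g n * b"
    and g: "\<And>n. 0 \<le> g n" and g1: "\<forall>\<^sub>F n in sequentially. c * g n \<le> 1" and div: "filterlim (\<lambda>n. \<Sum>i<n. g i) at_top sequentially"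
    and c: "0 < c" and e: "0 < e"
  shows "\<forall>\<^sub>F n in sequentially. u n \<le> b / c + e"
proof -
  obtain n0 where n0: "\<And>n. n \<ge> n0 \<Longrightarrow> u (Suc n) \<le> (1 - c * g n) * u n + g n * b"
    "\<And>n. n \<ge> n0 \<Longrightarrow> c * g n \<le> 1"
    using eventually_conj[OF u g1] unfolding eventually_sequentially by blast
  define w where "w n = max 0 (u n - b / c)" for n
  have "w (Suc n) \<le> (1 - c * g n) * w n" if "n \<ge> n0" for n
  proof -
    have "u (Suc n) - b / c \<le> (1 - c * g n) * (u n - b / c)"
    proof -
      have "(1 - c * g n) * (u n - b / c) = (1 - c * g n) * u n + g n * b - b / c"
        using c by (simp add: field_simps)
      then show ?thesis using n0(1)[OF that] by linarith
    qed
    also have "\<dots> \<le> (1 - c * g n) * w n"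
      using n0(2)[OF that] by (intro mult_left_mono) (auto simp: w_def)
    finally show ?thesis using n0(2)[OF that] by (simp add: w_def)
  qed
  then have "w \<longlonglongrightarrow> 0"
    by (rule contraction_tendsto_0[where u = w and g = g]) (use g div c in \<open>auto simp: w_def\<close>)
  then have "\<forall>\<^sub>F n in sequentially. w n < e"
    using e by (rule order_tendstoD)
  then show ?thesis
    by eventually_elim (auto simp: w_def)
qed

lemma contraction_tendsto_0':
  fixes u g b :: "nat \<Rightarrow> real"
  assumes u: "\<forall>\<^sub>F n in sequentially. u (Suc n) \<le> (1 - c * g n) * u n + g n * b n"
    and u0: "\<And>n. 0 \<le> u n"
    and g: "\<And>n. 0 \<le> g n" and g1: "\<forall>\<^sub>F n in sequentially. c * g n \<le> 1" and div: "filterlim (\<lambda>n. \<Sum>i<n. g i) at_top sequentially"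
    and c: "0 < c" and b: "b \<longlonglongrightarrow> 0"
  shows "u \<longlonglongrightarrow> 0"
proof (rule tendstoI)
  fix e :: real assume e: "0 < e"
  have "\<forall>\<^sub>F n in sequentially. b n < c * e / 4"
    using b e c by (intro order_tendstoD(2)) auto
  with u have "\<forall>\<^sub>F n in sequentially. u (Suc n) \<le> (1 - c * g n) * u n + g n * (c * e / 4)"
  proof eventually_elim
    case (elim n)
    then have "g n * b n \<le> g n * (c * e / 4)"
      using g by (intro mult_left_mono) auto
    then show ?case using elim by linarith
  qed
  from contraction_eventually_le[OF this g g1 div c, of "e / 4"]
  have "\<forall>\<^sub>F n in sequentially. u n \<le> c * e / 4 / c + e / 4" using e by simp
  then show "\<forall>\<^sub>F n in sequentially. dist (u n) 0 < e"
  proof eventually_elim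
    case (elim n)
    moreover have "c * e / 4 / c = e / 4" using c by simp
    ultimately show ?case using e u0[of n] unfolding dist_real_def by linarith
  qed
qed

section \<open>Freezing of independent variables and conditional independence\<close>

lemma rv_events_sets:
  assumes "Y \<in> borel_measurable M"
  shows "rv_events M Y \<subseteq> sets M" "rv_events M Y \<subseteq> Pow (space M)"
  using assms by (auto simp: rv_events_def)

lemma sigma_sets_rv_events:
  assumes "Y \<in> borel_measurable M"
  shows "sigma_sets (space M) (rv_events M Y) = rv_events M Y"
proof -
  have "rv_events M Y = sets (vimage_algebra (space M) Y borel)"
    unfolding rv_events_def by (subst sets_vimage_algebra2) auto
  then show ?thesis
    using sets.sigma_sets_eq[of "vimage_algebra (space M) Y borel"] by simp
qed

lemma rv_events_Int_stable: "Int_stable (rv_events M Y)"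
proof (rule Int_stableI)
  fix a b assume "a \<in> rv_events M Y" "b \<in> rv_events M Y"
  then obtain S T where "a = Y -` S \<inter> space M" "b = Y -` T \<inter> space M" "S \<in> sets borel" "T \<in> sets borel"
    by (auto simp: rv_events_def)
  then show "a \<inter> b \<in> rv_events M Y"
    unfolding rv_events_def by (intro CollectI exI[of _ "S \<inter> T"]) auto
qed

text \<open>Independence says that the identity, seen as a map into \<open>N\<close>, and
  \<open>Y\<close> have a product as joint law; Fubini then integrates \<open>Y\<close> out. This
  takes the place of conditional expectations: an \<open>N\<close>-measurable quantity is treated as
  a constant while \<open>Y\<close> is averaged.\<close>

lemma (in prob_space) freezing:
  fixes h :: "'a \<times> 'b::topological_space \<Rightarrow> 'c::{banach, second_countable_topology}"
  assumes N: "subalgebra M N" and Y[measurable]: "Y \<in> borel_measurable M"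
    and ind: "indep_set (rv_events M Y) (sets N)"
    and h: "h \<in> borel_measurable (N \<Otimes>\<^sub>M borel)" and int: "integrable M (\<lambda>\<omega>. h (\<omega>, Y \<omega>))"
  shows "(LINT \<omega>|M. h (\<omega>, Y \<omega>)) = (LINT \<omega>|M. (LINT y|distr M borel Y. h (\<omega>, y)))"
    and "integrable M (\<lambda>\<omega>. LINT y|distr M borel Y. h (\<omega>, y))"
proof -
  have id: "(\<lambda>\<omega>. \<omega>) \<in> measurable M N"
    using N by (intro measurableI) (auto simp: subalgebra_def dest: sets.sets_into_space)
  have spN: "space N = space M" using N by (simp add: subalgebra_def)
  have pair: "(\<lambda>\<omega>. (\<omega>, Y \<omega>)) \<in> measurable M (N \<Otimes>\<^sub>M borel)"
    using id by measurable
  interpret N: prob_space "distr M N (\<lambda>\<omega>. \<omega>)" by (rule prob_space_distr[OF id])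
  interpret Y: prob_space "distr M borel Y" by (rule prob_space_distr[OF Y])
  interpret NY: pair_prob_space "distr M N (\<lambda>\<omega>. \<omega>)" "distr M borel Y" ..
  have eq: "distr M N (\<lambda>\<omega>. \<omega>) \<Otimes>\<^sub>M distr M borel Y = distr M (N \<Otimes>\<^sub>M borel) (\<lambda>\<omega>. (\<omega>, Y \<omega>))"
  proof (rule pair_measure_eqI)
    fix A S assume A: "A \<in> sets (distr M N (\<lambda>\<omega>. \<omega>))" and S: "S \<in> sets (distr M borel Y)"
    have AM: "A \<in> sets M" "(\<lambda>\<omega>. \<omega>) -` A \<inter> space M = A"
      using A N sets.sets_into_space[of A N] by (auto simp: subalgebra_def)
    have "prob ((Y -` S \<inter> space M) \<inter> A) = prob (Y -` S \<inter> space M) * prob A"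
      using S A by (intro indep_setD[OF ind]) (auto simp: rv_events_def)
    moreover have "(\<lambda>\<omega>. (\<omega>, Y \<omega>)) -` (A \<times> S) \<inter> space M = (Y -` S \<inter> space M) \<inter> A"
      using AM(2) by auto
    ultimately show "emeasure (distr M N (\<lambda>\<omega>. \<omega>)) A * emeasure (distr M borel Y) S
        = emeasure (distr M (N \<Otimes>\<^sub>M borel) (\<lambda>\<omega>. (\<omega>, Y \<omega>))) (A \<times> S)"
      using A S AM by (subst emeasure_distr[OF pair]; (subst emeasure_distr[OF id])?; (subst emeasure_distr[OF Y])?)
        (auto simp: emeasure_eq_measure ennreal_mult[symmetric] mult.commute)
  qed (auto simp: N.sigma_finite_measure_axioms Y.sigma_finite_measure_axioms cong: sets_pair_measure_cong)
  have inth: "integrable (distr M N (\<lambda>\<omega>. \<omega>) \<Otimes>\<^sub>M distr M borel Y) h"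
    unfolding eq using int h by (subst integrable_distr_eq[OF pair]) auto
  have meas: "(\<lambda>\<omega>. LINT y|distr M borel Y. h (\<omega>, y)) \<in> borel_measurable N"
    using borel_measurable_integrable[OF NY.integrable_fst'[OF inth]] by simp
  have "(LINT \<omega>|M. h (\<omega>, Y \<omega>)) = integral\<^sup>L (distr M N (\<lambda>\<omega>. \<omega>) \<Otimes>\<^sub>M distr M borel Y) h"
    unfolding eq by (subst integral_distr[OF pair h]) simp
  also have "\<dots> = (LINT \<omega>|distr M N (\<lambda>\<omega>. \<omega>). (LINT y|distr M borel Y. h (\<omega>, y)))"
    by (rule NY.integral_fst'[OF inth, symmetric])
  also have "\<dots> = (LINT \<omega>|M. (LINT y|distr M borel Y. h (\<omega>, y)))"
    by (subst integral_distr[OF id meas]) simp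
  finally show "(LINT \<omega>|M. h (\<omega>, Y \<omega>)) = (LINT \<omega>|M. (LINT y|distr M borel Y. h (\<omega>, y)))" .
  show "integrable M (\<lambda>\<omega>. LINT y|distr M borel Y. h (\<omega>, y))"
    using NY.integrable_fst'[OF inth] by (subst (asm) integrable_distr_eq[OF id meas])
qed

text \<open>Independence makes the conditional probability of an event of \<open>Y\<close> given
  \<open>N\<close> constant; conditional independence then factorizes the probability of its
  intersection with \<open>G \<inter> b\<close>. The sets \<open>G \<inter> b\<close> form an
  intersection-stable generator of the larger sigma-algebra.\<close>

lemma (in prob_space) indep_set_sigma_of_cond_indep:
  fixes Y :: "'a \<Rightarrow> 'b::topological_space" and Z :: "'a \<Rightarrow> 'c::topological_space"
  assumes N: "subalgebra M N" and Y[measurable]: "Y \<in> borel_measurable M" and Z[measurable]: "Z \<in> borel_measurable M"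
    and ind: "indep_set (rv_events M Y) (sets N)" and ci: "cond_indep M N Y Z"
  shows "indep_set (rv_events M Y) (sets (sigma (space M) (sets N \<union> rv_events M Z)))"
proof -
  interpret N: finite_measure_subalgebra M N by unfold_locales (rule N)
  have spN: "space N = space M" and sN: "sets N \<subseteq> sets M" using N by (auto simp: subalgebra_def)
  define \<E> where "\<E> = {G \<inter> b | G b. G \<in> sets N \<and> b \<in> rv_events M Z}"
  have prod: "prob (y \<inter> (G \<inter> b)) = prob y * prob (G \<inter> b)"
    if y: "y \<in> rv_events M Y" and G: "G \<in> sets N" and b: "b \<in> rv_events M Z" for y G b
  proof -
    obtain S T where ST: "y = Y -` S \<inter> space M" "b = Z -` T \<inter> space M" and [measurable]: "S \<in> sets borel" "T \<in> sets borel"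
      using y b by (auto simp: rv_events_def)
    have GM[measurable]: "G \<in> sets M" using G sN by blast
    let ?f = "\<lambda>\<omega>. indicator S (Y \<omega>) :: real" and ?g = "\<lambda>\<omega>. indicator T (Z \<omega>) :: real"
    have int: "integrable M ?f" "integrable M ?g" "integrable M (\<lambda>\<omega>. ?f \<omega> * ?g \<omega>)"
      by (rule integrable_const_bound[where B = 1]; auto simp: indicator_def)+
    have cf: "AE \<omega> in M. real_cond_exp M N ?f \<omega> = prob y"
    proof (rule N.real_cond_exp_charact)
      fix B assume B: "B \<in> sets N"
      then have [measurable]: "B \<in> sets M" using sN by blast
      have "(\<integral>\<omega>\<in>B. ?f \<omega> \<partial>M) = prob (y \<inter> B)"
        unfolding set_lebesgue_integral_def ST
        by (subst Bochner_Integration.integral_cong[OF refl, where g = "indicator (Y -` S \<inter> space M \<inter> B)"])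
           (auto simp: indicator_def)
      also have "\<dots> = prob y * prob B" using indep_setD[OF ind y B] .
      also have "\<dots> = (\<integral>\<omega>\<in>B. prob y \<partial>M)" by (simp add: set_lebesgue_integral_def)
      finally show "(\<integral>\<omega>\<in>B. ?f \<omega> \<partial>M) = (\<integral>\<omega>\<in>B. prob y \<partial>M)" .
    qed (use int in auto)
    have "AE \<omega> in M. real_cond_exp M N (\<lambda>\<omega>. ?f \<omega> * ?g \<omega>) \<omega> = real_cond_exp M N ?f \<omega> * real_cond_exp M N ?g \<omega>"
      using ci unfolding cond_indep_def by simp
    then have ae: "AE \<omega> in M. real_cond_exp M N (\<lambda>\<omega>. ?f \<omega> * ?g \<omega>) \<omega> = prob y * real_cond_exp M N ?g \<omega>"
      using cf by eventually_elim simp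
    have "prob (y \<inter> (G \<inter> b)) = (\<integral>\<omega>\<in>G. ?f \<omega> * ?g \<omega> \<partial>M)"
      unfolding set_lebesgue_integral_def ST
      by (subst Bochner_Integration.integral_cong[OF refl, where g = "indicator (Y -` S \<inter> space M \<inter> (G \<inter> (Z -` T \<inter> space M)))"])
         (auto simp: indicator_def)
    also have "\<dots> = (\<integral>\<omega>\<in>G. real_cond_exp M N (\<lambda>\<omega>. ?f \<omega> * ?g \<omega>) \<omega> \<partial>M)"
      by (rule N.real_cond_exp_intA[OF int(3) G])
    also have "\<dots> = (\<integral>\<omega>\<in>G. prob y * real_cond_exp M N ?g \<omega> \<partial>M)"
      unfolding set_lebesgue_integral_def
      by (intro integral_cong_AE) (use ae in \<open>auto simp: borel_measurable_cond_exp2\<close>)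
    also have "\<dots> = prob y * (\<integral>\<omega>\<in>G. real_cond_exp M N ?g \<omega> \<partial>M)" by simp
    also have "(\<integral>\<omega>\<in>G. real_cond_exp M N ?g \<omega> \<partial>M) = (\<integral>\<omega>\<in>G. ?g \<omega> \<partial>M)"
      by (rule N.real_cond_exp_intA[OF int(2) G, symmetric])
    also have "\<dots> = prob (G \<inter> b)"
      unfolding set_lebesgue_integral_def ST
      by (subst Bochner_Integration.integral_cong[OF refl, where g = "indicator (G \<inter> (Z -` T \<inter> space M))"])
         (auto simp: indicator_def)
    finally show ?thesis .
  qed
  have Zs: "rv_events M Z \<subseteq> sets M" "rv_events M Y \<subseteq> sets M" using rv_events_sets(1) Y Z by blast+
  have \<E>M: "\<E> \<subseteq> sets M" using sN Zs unfolding \<E>_def by blast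
  have st: "Int_stable \<E>"
  proof (rule Int_stableI)
    fix a b assume "a \<in> \<E>" "b \<in> \<E>"
    then obtain G g G' g' where *: "a = G \<inter> g" "b = G' \<inter> g'" "G \<in> sets N" "G' \<in> sets N" "g \<in> rv_events M Z" "g' \<in> rv_events M Z"
      unfolding \<E>_def by blast
    then have "g \<inter> g' \<in> rv_events M Z" using rv_events_Int_stable[of M Z] unfolding Int_stable_def by blast
    moreover have "a \<inter> b = (G \<inter> G') \<inter> (g \<inter> g')" using * by blast
    ultimately show "a \<inter> b \<in> \<E>" unfolding \<E>_def using * by blast
  qed
  have "indep_set (rv_events M Y) \<E>"
    unfolding indep_sets2_eq using Zs \<E>M prod unfolding \<E>_def by blast
  then have "indep_set (sigma_sets (space M) (rv_events M Y)) (sigma_sets (space M) \<E>)"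
    by (rule indep_set_sigma_sets[OF _ rv_events_Int_stable st])
  moreover have "sets (sigma (space M) (sets N \<union> rv_events M Z)) = sigma_sets (space M) \<E>"
  proof -
    have top: "space M \<in> sets N" "space M \<in> rv_events M Z"
      using spN sets.top[of N] by (auto simp: rv_events_def intro: exI[of _ UNIV])
    have sub: "sets N \<union> rv_events M Z \<subseteq> \<E>"
    proof
      fix a assume "a \<in> sets N \<union> rv_events M Z"
      then have "a = a \<inter> space M \<and> a \<in> sets N \<or> a = space M \<inter> a \<and> a \<in> rv_events M Z"
        using sN Zs sets.sets_into_space[of a M] by blast
      then show "a \<in> \<E>" unfolding \<E>_def using top by blast
    qed
    have P: "sets N \<union> rv_events M Z \<subseteq> Pow (space M)" using sN Zs sets.sets_into_space by blast
    have "\<E> \<subseteq> sets (sigma (space M) (sets N \<union> rv_events M Z))"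
    proof
      fix a assume "a \<in> \<E>"
      then obtain G b where *: "a = G \<inter> b" "G \<in> sets N" "b \<in> rv_events M Z" unfolding \<E>_def by blast
      have "G \<in> sets (sigma (space M) (sets N \<union> rv_events M Z))" "b \<in> sets (sigma (space M) (sets N \<union> rv_events M Z))"
        unfolding sets_measure_of[OF P] using * by (auto intro: sigma_sets.Basic)
      then show "a \<in> sets (sigma (space M) (sets N \<union> rv_events M Z))"
        unfolding *(1) by (rule sets.Int)
    qed
    then have "\<E> \<subseteq> sigma_sets (space M) (sets N \<union> rv_events M Z)"
      unfolding sets_measure_of[OF P] .
    then show ?thesis
      unfolding sets_measure_of[OF P] using sub by (intro sigma_sets_eqI) (auto intro: sigma_sets.Basic)
  qed
  ultimately show ?thesis by (simp add: sigma_sets_rv_events)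
qed

text \<open>The series of the variables has finite expectation, so it converges almost surely and
  its terms tend to zero.\<close>

lemma (in prob_space) AE_tendsto_0_summable:
  fixes X :: "nat \<Rightarrow> 'a \<Rightarrow> real"
  assumes int: "\<And>n. integrable M (X n)" and nn: "\<And>n \<omega>. 0 \<le> X n \<omega>"
    and sum: "summable (\<lambda>n. LINT \<omega>|M. X n \<omega>)"
  shows "AE \<omega> in M. (\<lambda>n. X n \<omega>) \<longlonglongrightarrow> 0"
proof -
  have [measurable]: "X n \<in> borel_measurable M" for n using int by simp
  have "(\<integral>\<^sup>+\<omega>. (\<Sum>n. ennreal (X n \<omega>)) \<partial>M) = (\<Sum>n. \<integral>\<^sup>+\<omega>. ennreal (X n \<omega>) \<partial>M)"
    by (rule nn_integral_suminf) measurable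
  also have "\<dots> = (\<Sum>n. ennreal (LINT \<omega>|M. X n \<omega>))"
    by (simp add: nn_integral_eq_integral[OF int] nn)
  also have "\<dots> = ennreal (\<Sum>n. LINT \<omega>|M. X n \<omega>)"
    by (rule suminf_ennreal2[OF _ sum]) (simp add: nn Bochner_Integration.integral_nonneg)
  finally have "(\<integral>\<^sup>+\<omega>. (\<Sum>n. ennreal (X n \<omega>)) \<partial>M) \<noteq> \<infinity>" by simp
  then have "AE \<omega> in M. (\<Sum>n. ennreal (X n \<omega>)) \<noteq> \<infinity>"
    by (intro nn_integral_noteq_infinite) auto
  then show ?thesis
  proof eventually_elim
    case (elim \<omega>)
    then have "summable (\<lambda>n. X n \<omega>)" by (intro summable_suminf_not_top nn) simp
    then show ?case by (rule summable_LIMSEQ_zero)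
  qed
qed

section \<open>Distributed dual averaging\<close>

text \<open>Step \<open>n\<close> uses \<open>W n\<close>, \<open>xi n\<close> and
  \<open>g n\<close>, which are those of index n + 1 in the algorithm, and \<open>G n\<close> is the
  history before it. The gradients enter only as a random field \<open>gr\<close> with Lipschitz
  mean. In \<open>xi_pair\<close> the sigma-algebra also contains the sample of the other agent;
  this makes products of noises of different agents have mean zero.\<close>

locale dual_averaging = prob_space M
  for M :: "'w measure" +
  fixes X :: "(real^'d) set" and xs :: "real^'d"
    and gr :: "'m::finite \<Rightarrow> real^'d \<Rightarrow> real^'q \<Rightarrow> real^'d"
    and xi :: "nat \<Rightarrow> 'm \<Rightarrow> 'w \<Rightarrow> real^'q" and law :: "'m \<Rightarrow> (real^'q) measure"
    and W :: "nat \<Rightarrow> 'w \<Rightarrow> real^'m^'m" and g :: "nat \<Rightarrow> real"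
    and z :: "nat \<Rightarrow> 'm \<Rightarrow> 'w \<Rightarrow> real^'d" and G :: "nat \<Rightarrow> 'w measure"
    and L0 :: "'m \<Rightarrow> real^'q \<Rightarrow> real" and p L \<rho> :: real
  assumes X: "closed X" "convex X" "xs \<in> X"
    and gr_meas: "\<And>j. (\<lambda>(v, s). gr j v s) \<in> borel_measurable (restrict_space borel X \<Otimes>\<^sub>M borel)"
    and gr_bound: "\<And>j s v. v \<in> X \<Longrightarrow> norm (gr j v s) \<le> L0 j s"
    and L0_meas[measurable]: "\<And>j. L0 j \<in> borel_measurable borel"
    and p: "2 < p" "p \<le> 3"
    and L0_moment: "\<And>j. integrable (law j) (\<lambda>s. L0 j s powr p)"
    and xi_meas: "\<And>n j. xi n j \<in> borel_measurable (G (Suc n))"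
    and W_meas: "\<And>n. W n \<in> borel_measurable (G (Suc n))"
    and law: "\<And>n j. distr M borel (xi n j) = law j"
    and z_0: "\<And>j. z 0 j \<in> borel_measurable (G 0)"
    and z_Suc: "\<And>n j \<omega>. z (Suc n) j \<omega> = (\<Sum>i\<in>UNIV. (W n \<omega> $ j $ i) *\<^sub>R z n i \<omega>)
      - g n *\<^sub>R gr j (closest_point X (z n j \<omega>)) (xi n j \<omega>)"
    and G_sub: "\<And>n. subalgebra M (G n)" and G_mono: "\<And>n. sets (G n) \<subseteq> sets (G (Suc n))"
    and xi_indep: "\<And>n j. indep_set (rv_events M (xi n j)) (sets (G n))"
    and xi_pair: "\<And>n i j. i \<noteq> j \<Longrightarrow>
      indep_set (rv_events M (xi n i)) (sets (sigma (space M) (sets (G n) \<union> rv_events M (xi n j))))"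
    and W_indep: "\<And>n. indep_set (rv_events M (W n)) (sets (G n))"
    and W_stoch: "\<And>n. AE \<omega> in M. doubly_stochastic (W n \<omega>)"
    and W_contract: "\<And>n. onorm ((*v) (LINT \<omega>|M. transpose (W n \<omega>)
              ** (Finite_Cartesian_Product.mat 1 - (1 / real CARD('m)) *\<^sub>R (\<chi> i j. 1)) ** W n \<omega>)) \<le> \<rho>"
    and \<rho>: "0 \<le> \<rho>" "\<rho> < 1"
    and g_pos: "\<And>n. 0 < g n" and g_decr: "\<And>n. g (Suc n) \<le> g n"
    and g_div: "filterlim (\<lambda>n. \<Sum>i<n. g i) at_top sequentially"
    and g_sq: "summable (\<lambda>n. (g n)\<^sup>2)"
    and mean_Lipschitz: "\<And>j v w. v \<in> X \<Longrightarrow> w \<in> X \<Longrightarrow>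
      norm ((LINT s|law j. gr j v s) - (LINT s|law j. gr j w s)) \<le> L * norm (v - w)"
    and L: "0 < L"
    and ratio: "(\<lambda>n. (g n / g (Suc n) - 1) / g n) \<longlonglongrightarrow> 0"
    and limit: "AE \<omega> in M. (\<lambda>n. closest_point X ((1 / real CARD('m)) *\<^sub>R (\<Sum>j\<in>UNIV. z n j \<omega>))) \<longlonglongrightarrow> xs"
begin

definition x where "x n j \<omega> = closest_point X (z n j \<omega>)"
definition zb where "zb n \<omega> = (1 / real CARD('m)) *\<^sub>R (\<Sum>j\<in>UNIV. z n j \<omega>)"
definition xb where "xb n \<omega> = closest_point X (zb n \<omega>)"
definition mg where "mg j v = (LINT s|law j. gr j v s)"
definition cl where "cl j = (LINT s|law j. L0 j s)"
text \<open>One variable dominating every gradient and every noise term of step \<open>n\<close>, at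
  whatever points of \<open>X\<close> they are evaluated.\<close>

definition \<Lambda> where "\<Lambda> n \<omega> = (\<Sum>j\<in>UNIV. L0 j (xi n j \<omega>) + cl j)"
definition noise where "noise j v n \<omega> = gr j v (xi n j \<omega>) - mg j v"
definition \<epsilon> where "\<epsilon> n \<omega> = (1 / real CARD('m)) *\<^sub>R (\<Sum>j\<in>UNIV. noise j (x n j \<omega>) n \<omega>)"
text \<open>The noise of the same samples at the limit point. Unlike that of
  \<open>\<epsilon>\<close>, its conditional covariance given \<open>G n\<close> does not depend on
  the past.\<close>

definition \<epsilon>s where "\<epsilon>s n \<omega> = (1 / real CARD('m)) *\<^sub>R (\<Sum>j\<in>UNIV. noise j xs n \<omega>)"

lemma space_G: "space (G n) = space M" using G_sub by (simp add: subalgebra_def)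

lemma G_meas: "f \<in> measurable (G n) N \<Longrightarrow> f \<in> measurable M N"
  using measurable_from_subalg[OF G_sub] .

lemma G_meas_Suc: "f \<in> measurable (G n) N \<Longrightarrow> f \<in> measurable (G (Suc n)) N"
  using G_mono[of n] by (auto simp: measurable_def space_G)

lemma xi_M[measurable]: "xi n j \<in> borel_measurable M" by (rule G_meas[OF xi_meas])

lemma W_M[measurable]: "W n \<in> borel_measurable M" by (rule G_meas[OF W_meas])

lemma X_ne: "X \<noteq> {}" using X by blast

lemma x_X: "x n j \<omega> \<in> X" unfolding x_def by (rule closest_point_in_set[OF X(1) X_ne])

lemma xb_X: "xb n \<omega> \<in> X" unfolding xb_def by (rule closest_point_in_set[OF X(1) X_ne])

lemma closest_point_measurable[measurable]: "closest_point X \<in> borel_measurable borel"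
  by (intro borel_measurable_continuous_onI continuous_on_closest_point X X_ne)

lemma closest_point_restrict: "f \<in> borel_measurable N \<Longrightarrow> (\<lambda>\<omega>. closest_point X (f \<omega>)) \<in> measurable N (restrict_space borel X)"
  by (intro measurable_restrict_space2) (auto intro: closest_point_in_set[OF X(1) X_ne])

lemma gr_measurable:
  assumes "f \<in> measurable N (restrict_space borel X)" "h \<in> borel_measurable N"
  shows "(\<lambda>\<omega>. gr j (f \<omega>) (h \<omega>)) \<in> borel_measurable N"
  using measurable_compose[OF measurable_Pair[OF assms] gr_meas[of j]] by simp

lemma prob_law: "prob_space (law j)"
  using prob_space_distr[OF xi_M[of 0 j]] by (simp add: law)

lemma sets_law[measurable_cong]: "sets (law j) = sets borel"
  unfolding law[of 0 j, symmetric] by simp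

lemma space_law[simp]: "space (law j) = UNIV"
  unfolding law[of 0 j, symmetric] by simp

lemma z_meas: "z n j \<in> borel_measurable (G n)"
proof (induction n arbitrary: j)
  case (Suc n)
  have [measurable]: "\<And>j. z n j \<in> borel_measurable (G (Suc n))"
    using Suc by (intro G_meas_Suc)
  have [measurable]: "xi n j \<in> borel_measurable (G (Suc n))" "W n \<in> borel_measurable (G (Suc n))"
    by (rule xi_meas W_meas)+
  have [measurable]: "(\<lambda>\<omega>. gr j (closest_point X (z n j \<omega>)) (xi n j \<omega>)) \<in> borel_measurable (G (Suc n))"
    by (intro gr_measurable closest_point_restrict) measurable
  have [measurable]: "(\<lambda>\<omega>. W n \<omega> $ i $ j) \<in> borel_measurable (G (Suc n))" for i j
    by (rule measurable_compose[OF \<open>W n \<in> _\<close>]) (intro borel_measurable_continuous_onI continuous_intros)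
  show ?case unfolding z_Suc[abs_def] by measurable
qed (rule z_0)

lemma z_M[measurable]: "z n j \<in> borel_measurable M" by (rule G_meas[OF z_meas])

lemma x_meas: "x n j \<in> measurable (G n) (restrict_space borel X)"
  unfolding x_def[abs_def] by (rule closest_point_restrict[OF z_meas])

lemma x_M[measurable]: "x n j \<in> borel_measurable M"
  using G_meas[OF x_meas] by (rule measurable_restrict_space2_iff[THEN iffD1, THEN conjunct1])

lemma zb_meas: "zb n \<in> borel_measurable (G n)"
proof -
  note z_meas[measurable]
  show ?thesis unfolding zb_def[abs_def] by measurable
qed

lemma zb_M[measurable]: "zb n \<in> borel_measurable M" by (rule G_meas[OF zb_meas])

lemma xb_M[measurable]: "xb n \<in> borel_measurable M" unfolding xb_def[abs_def] by measurable

lemma mg_Lipschitz: "v \<in> X \<Longrightarrow> w \<in> X \<Longrightarrow> norm (mg j v - mg j w) \<le> L * norm (v - w)"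
  unfolding mg_def by (rule mean_Lipschitz)

lemma mg_meas: "mg j \<in> borel_measurable (restrict_space borel X)"
proof (rule borel_measurable_continuous_on_restrict)
  have "L-lipschitz_on X (mg j)"
    using mg_Lipschitz L by (auto simp: lipschitz_on_def dist_norm)
  then show "continuous_on X (mg j)" by (rule lipschitz_on_continuous_on)
qed

lemma mg_measurable: "f \<in> measurable N (restrict_space borel X) \<Longrightarrow> (\<lambda>\<omega>. mg j (f \<omega>)) \<in> borel_measurable N"
  by (rule measurable_compose[OF _ mg_meas])

lemma L0_nonneg: "0 \<le> L0 j s"
  using gr_bound[OF X(3), of j s] norm_ge_zero[of "gr j xs s"] by linarith

lemma gr_law_meas: "v \<in> X \<Longrightarrow> gr j v \<in> borel_measurable (law j)"
  using gr_measurable[of "\<lambda>_. v" "law j" "\<lambda>s. s" j] by (simp add: space_restrict_space)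

lemma L0_powr_integrable: "0 \<le> q \<Longrightarrow> q \<le> p \<Longrightarrow> integrable (law j) (\<lambda>s. L0 j s powr q)"
proof -
  assume q: "0 \<le> q" "q \<le> p"
  interpret l: prob_space "law j" by (rule prob_law)
  show ?thesis
  proof (rule Bochner_Integration.integrable_bound)
    show "integrable (law j) (\<lambda>s. 1 + L0 j s powr p)" using L0_moment by simp
    show "AE s in law j. norm (L0 j s powr q) \<le> norm (1 + L0 j s powr p)"
    proof (intro AE_I2)
      fix s
      have "L0 j s powr q \<le> 1 + L0 j s powr p"
      proof (cases "L0 j s \<le> 1")
        case True
        then have "L0 j s powr q \<le> 1" using q L0_nonneg by (intro powr_le1) auto
        then show ?thesis using powr_ge_zero[of "L0 j s" p] by linarith
      next
        case False
        then have "L0 j s powr q \<le> L0 j s powr p" using q by (intro powr_mono) auto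
        then show ?thesis by linarith
      qed
      then show "norm (L0 j s powr q) \<le> norm (1 + L0 j s powr p)" by simp
    qed
  qed measurable
qed

lemma L0_integrable: "integrable (law j) (L0 j)"
  using L0_powr_integrable[of 1 j] p L0_nonneg by (simp add: powr_one' cong: Bochner_Integration.integrable_cong)

lemma cl_nonneg: "0 \<le> cl j" unfolding cl_def using L0_nonneg by (simp add: Bochner_Integration.integral_nonneg)

lemma gr_integrable: "v \<in> X \<Longrightarrow> integrable (law j) (gr j v)"
  by (rule Bochner_Integration.integrable_bound[OF L0_integrable[of j]])
     (use gr_law_meas gr_bound L0_nonneg in auto)

lemma norm_mg_le: "v \<in> X \<Longrightarrow> norm (mg j v) \<le> cl j"
  unfolding mg_def cl_def
  by (rule order_trans[OF integral_norm_bound integral_mono])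
     (use gr_integrable L0_integrable gr_bound in auto)

lemma \<Lambda>_nonneg: "0 \<le> \<Lambda> n \<omega>" unfolding \<Lambda>_def using L0_nonneg cl_nonneg by (simp add: sum_nonneg)

lemma \<Lambda>_M[measurable]: "\<Lambda> n \<in> borel_measurable M" unfolding \<Lambda>_def[abs_def] by measurable

lemma L0_le_\<Lambda>: "L0 j (xi n j \<omega>) + cl j \<le> \<Lambda> n \<omega>"
  unfolding \<Lambda>_def using L0_nonneg cl_nonneg by (intro member_le_sum) auto

lemma gr_le_\<Lambda>: "v \<in> X \<Longrightarrow> norm (gr j v (xi n j \<omega>)) \<le> \<Lambda> n \<omega>"
  using gr_bound[of v j "xi n j \<omega>"] L0_le_\<Lambda>[of j n \<omega>] cl_nonneg[of j] by linarith

lemma noise_le: "v \<in> X \<Longrightarrow> norm (noise j v n \<omega>) \<le> L0 j (xi n j \<omega>) + cl j"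
  unfolding noise_def using norm_triangle_ineq4[of "gr j v (xi n j \<omega>)" "mg j v"] gr_bound[of v j "xi n j \<omega>"] norm_mg_le[of v j]
  by linarith

lemma noise_le_\<Lambda>: "v \<in> X \<Longrightarrow> norm (noise j v n \<omega>) \<le> \<Lambda> n \<omega>"
  using noise_le[of v j n \<omega>] L0_le_\<Lambda>[of j n \<omega>] by linarith

lemma average_noise_le: "(\<And>j. v j \<in> X) \<Longrightarrow> norm ((1 / real CARD('m)) *\<^sub>R (\<Sum>j\<in>UNIV. noise j (v j) n \<omega>)) \<le> \<Lambda> n \<omega>"
proof -
  assume v: "\<And>j. v j \<in> X"
  have "norm (\<Sum>j\<in>UNIV. noise j (v j) n \<omega>) \<le> \<Lambda> n \<omega>"
    unfolding \<Lambda>_def by (rule order_trans[OF norm_sum sum_mono]) (rule noise_le[OF v])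
  moreover have "1 / real CARD('m) \<le> 1" by (simp add: Suc_leI)
  ultimately have "1 / real CARD('m) * norm (\<Sum>j\<in>UNIV. noise j (v j) n \<omega>) \<le> 1 * \<Lambda> n \<omega>"
    by (intro mult_mono) auto
  then show ?thesis by simp
qed

lemma \<epsilon>_le: "norm (\<epsilon> n \<omega>) \<le> \<Lambda> n \<omega>" and \<epsilon>s_le: "norm (\<epsilon>s n \<omega>) \<le> \<Lambda> n \<omega>"
  unfolding \<epsilon>_def \<epsilon>s_def by (intro average_noise_le x_X X)+

lemma xs_restrict: "(\<lambda>_. xs) \<in> measurable N (restrict_space borel X)"
  using X(3) by (simp add: space_restrict_space)

lemma noise_M: "v \<in> measurable M (restrict_space borel X) \<Longrightarrow> (\<lambda>\<omega>. noise j (v \<omega>) n \<omega>) \<in> borel_measurable M"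
  unfolding noise_def by (intro borel_measurable_diff gr_measurable mg_measurable) auto

lemma \<epsilon>_M[measurable]: "\<epsilon> n \<in> borel_measurable M" and \<epsilon>s_M[measurable]: "\<epsilon>s n \<in> borel_measurable M"
  unfolding \<epsilon>_def[abs_def] \<epsilon>s_def[abs_def]
  by (intro borel_measurable_scaleR borel_measurable_const borel_measurable_sum noise_M G_meas[OF x_meas] xs_restrict)+

lemma \<epsilon>_meas: "\<epsilon> n \<in> borel_measurable (G (Suc n))"
  unfolding \<epsilon>_def[abs_def] noise_def
  by (intro borel_measurable_scaleR borel_measurable_const borel_measurable_sum borel_measurable_diff
      gr_measurable mg_measurable G_meas_Suc[OF x_meas] xi_meas)

definition C\<^sub>\<Lambda> where "C\<^sub>\<Lambda> = (\<Sum>j\<in>(UNIV :: 'm set). real CARD('m) powr p * 4 powr p * ((LINT s|law j. L0 j s powr p) + cl j powr p))"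

text \<open>The constant comes from estimating the p-th power of a sum over agents by m^p times that
  of the largest term, and from (a + b)^p <= 4^p (a^p + b^p). It does not depend on \<open>n\<close>
  because all samples of an agent have the same law.\<close>

lemma \<Lambda>_moment: "integrable M (\<lambda>\<omega>. \<Lambda> n \<omega> powr p)" "(LINT \<omega>|M. \<Lambda> n \<omega> powr p) \<le> C\<^sub>\<Lambda>"
proof -
  let ?m = "real CARD('m)"
  have pw: "(\<Sum>j\<in>(UNIV :: 'm set). f j) powr p \<le> (\<Sum>j\<in>UNIV. ?m powr p * f j powr p)" if f: "\<And>j. 0 \<le> f j" for f :: "'m \<Rightarrow> real"
  proof -
    have "Max (range f) \<in> range f" by (rule Max_in) auto
    then obtain k where "f k = Max (range f)" by (metis imageE)
    then have k: "f j \<le> f k" for j by simp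
    have "(\<Sum>j\<in>UNIV. f j) \<le> ?m * f k" using sum_bounded_above[of UNIV f "f k"] k by simp
    then have "(\<Sum>j\<in>UNIV. f j) powr p \<le> (?m * f k) powr p" using p f by (intro powr_mono2) (auto intro: sum_nonneg)
    also have "\<dots> = ?m powr p * f k powr p" using f by (simp add: powr_mult)
    also have "\<dots> \<le> (\<Sum>j\<in>UNIV. ?m powr p * f j powr p)" by (intro member_le_sum) auto
    finally show ?thesis .
  qed
  have le: "\<Lambda> n \<omega> powr p \<le> (\<Sum>j\<in>UNIV. ?m powr p * (4 powr p * (L0 j (xi n j \<omega>) powr p + cl j powr p)))" for \<omega>
  proof -
    have "(L0 j (xi n j \<omega>) + cl j) powr p \<le> 4 powr p * (L0 j (xi n j \<omega>) powr p + cl j powr p)" for j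
    proof -
      let ?a = "L0 j (xi n j \<omega>)" and ?b = "cl j"
      have ab: "0 \<le> ?a" "0 \<le> ?b" by (rule L0_nonneg cl_nonneg)+
      have "(?a + ?b) powr p \<le> (4 * max ?a ?b) powr p" using p ab by (intro powr_mono2) auto
      also have "\<dots> = 4 powr p * max ?a ?b powr p" using ab by (simp add: powr_mult)
      also have "max ?a ?b powr p \<le> ?a powr p + ?b powr p" by (auto simp: max_def)
      finally show ?thesis by simp
    qed
    then show ?thesis
      unfolding \<Lambda>_def using L0_nonneg cl_nonneg
      by (intro order_trans[OF pw] sum_mono mult_left_mono) auto
  qed
  have i: "integrable M (\<lambda>\<omega>. L0 j (xi n j \<omega>) powr p)" for j
    using L0_moment[of j] unfolding law[of n j, symmetric] by (subst (asm) integrable_distr_eq) auto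
  have e: "(LINT \<omega>|M. L0 j (xi n j \<omega>) powr p) = (LINT s|law j. L0 j s powr p)" for j
    unfolding law[of n j, symmetric] by (subst integral_distr) auto
  have I: "integrable M (\<lambda>\<omega>. \<Sum>j\<in>UNIV. ?m powr p * (4 powr p * (L0 j (xi n j \<omega>) powr p + cl j powr p)))"
    using i by (intro Bochner_Integration.integrable_sum integrable_mult_right Bochner_Integration.integrable_add) auto
  show int: "integrable M (\<lambda>\<omega>. \<Lambda> n \<omega> powr p)"
  proof (rule Bochner_Integration.integrable_bound[OF I])
    show "AE \<omega> in M. norm (\<Lambda> n \<omega> powr p) \<le> norm (\<Sum>j\<in>UNIV. ?m powr p * (4 powr p * (L0 j (xi n j \<omega>) powr p + cl j powr p)))"
      using le by (intro AE_I2) (auto intro: order_trans[OF _ abs_ge_self])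
  qed measurable
  have "(LINT \<omega>|M. \<Lambda> n \<omega> powr p) \<le> (LINT \<omega>|M. (\<Sum>j\<in>UNIV. ?m powr p * (4 powr p * (L0 j (xi n j \<omega>) powr p + cl j powr p))))"
    by (rule integral_mono[OF int I le])
  also have "\<dots> = C\<^sub>\<Lambda>"
    using i by (simp add: C\<^sub>\<Lambda>_def Bochner_Integration.integral_sum e prob_space mult_ac)
  finally show "(LINT \<omega>|M. \<Lambda> n \<omega> powr p) \<le> C\<^sub>\<Lambda>" .
qed

lemma \<Lambda>_sq: "integrable M (\<lambda>\<omega>. (\<Lambda> n \<omega>)\<^sup>2)" "(LINT \<omega>|M. (\<Lambda> n \<omega>)\<^sup>2) \<le> 1 + C\<^sub>\<Lambda>"
proof -
  have le: "(\<Lambda> n \<omega>)\<^sup>2 \<le> 1 + \<Lambda> n \<omega> powr p" for \<omega>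
  proof (cases "\<Lambda> n \<omega> \<le> 1")
    case True
    then have "(\<Lambda> n \<omega>)\<^sup>2 \<le> 1" using \<Lambda>_nonneg[of n \<omega>] by (simp add: power_le_one)
    then show ?thesis using powr_ge_zero[of "\<Lambda> n \<omega>" p] by linarith
  next
    case False
    then have "(\<Lambda> n \<omega>)\<^sup>2 = \<Lambda> n \<omega> powr 2" by (simp add: powr_numeral)
    also have "\<dots> \<le> \<Lambda> n \<omega> powr p" using False p by (intro powr_mono) auto
    finally show ?thesis by linarith
  qed
  have I: "integrable M (\<lambda>\<omega>. 1 + \<Lambda> n \<omega> powr p)" using \<Lambda>_moment by simp
  show int: "integrable M (\<lambda>\<omega>. (\<Lambda> n \<omega>)\<^sup>2)"
  proof (rule Bochner_Integration.integrable_bound[OF I])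
    show "AE \<omega> in M. norm ((\<Lambda> n \<omega>)\<^sup>2) \<le> norm (1 + \<Lambda> n \<omega> powr p)"
      using le by (intro AE_I2) (auto intro: order_trans[OF _ abs_ge_self])
  qed measurable
  have "(LINT \<omega>|M. (\<Lambda> n \<omega>)\<^sup>2) \<le> (LINT \<omega>|M. 1 + \<Lambda> n \<omega> powr p)"
    by (rule integral_mono[OF int I le])
  then show "(LINT \<omega>|M. (\<Lambda> n \<omega>)\<^sup>2) \<le> 1 + C\<^sub>\<Lambda>"
    using \<Lambda>_moment[of n] by (simp add: prob_space)
qed

lemma sq_integrable_dominated:
  fixes f :: "'w \<Rightarrow> 'c::{banach, second_countable_topology}"
  assumes "f \<in> borel_measurable M" "\<And>\<omega>. norm (f \<omega>) \<le> \<Lambda> n \<omega>"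
  shows "integrable M (\<lambda>\<omega>. (norm (f \<omega>))\<^sup>2)" "(LINT \<omega>|M. (norm (f \<omega>))\<^sup>2) \<le> 1 + C\<^sub>\<Lambda>"
proof -
  show i: "integrable M (\<lambda>\<omega>. (norm (f \<omega>))\<^sup>2)"
    by (rule Bochner_Integration.integrable_bound[OF \<Lambda>_sq(1)[of n]])
       (use assms \<Lambda>_nonneg in \<open>auto intro!: power_mono\<close>)
  have "(LINT \<omega>|M. (norm (f \<omega>))\<^sup>2) \<le> (LINT \<omega>|M. (\<Lambda> n \<omega>)\<^sup>2)"
    using i \<Lambda>_sq(1) assms(2) by (intro integral_mono) (auto intro: power_mono)
  then show "(LINT \<omega>|M. (norm (f \<omega>))\<^sup>2) \<le> 1 + C\<^sub>\<Lambda>" using \<Lambda>_sq(2)[of n] by linarith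
qed

lemma integrable_mult_sq:
  fixes f h :: "'w \<Rightarrow> real"
  assumes [measurable]: "f \<in> borel_measurable M" "h \<in> borel_measurable M"
    and i: "integrable M (\<lambda>\<omega>. (f \<omega>)\<^sup>2)" "integrable M (\<lambda>\<omega>. (h \<omega>)\<^sup>2)"
  shows "integrable M (\<lambda>\<omega>. f \<omega> * h \<omega>)"
proof (rule Bochner_Integration.integrable_bound)
  show "integrable M (\<lambda>\<omega>. (f \<omega>)\<^sup>2 + (h \<omega>)\<^sup>2)" using i by simp
  show "AE \<omega> in M. norm (f \<omega> * h \<omega>) \<le> norm ((f \<omega>)\<^sup>2 + (h \<omega>)\<^sup>2)"
  proof (intro AE_I2)
    fix \<omega>
    have "2 * (\<bar>f \<omega>\<bar> * \<bar>h \<omega>\<bar>) \<le> (f \<omega>)\<^sup>2 + (h \<omega>)\<^sup>2" "0 \<le> \<bar>f \<omega>\<bar> * \<bar>h \<omega>\<bar>"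
      using sum_squares_bound[of "\<bar>f \<omega>\<bar>" "\<bar>h \<omega>\<bar>"] by simp_all
    then have "\<bar>f \<omega> * h \<omega>\<bar> \<le> (f \<omega>)\<^sup>2 + (h \<omega>)\<^sup>2" unfolding abs_mult by linarith
    then show "norm (f \<omega> * h \<omega>) \<le> norm ((f \<omega>)\<^sup>2 + (h \<omega>)\<^sup>2)" by simp
  qed
qed measurable

text \<open>Freezing: for a fixed past the sample is integrated against its law, under which the
  noise is centred. \<open>N\<close> is a parameter because cross terms need the history enlarged by
  another sample, and \<open>h\<close> takes values in a Banach space because it will be real or
  complex.\<close>

lemma noise_mean_zero:
  fixes h :: "'w \<Rightarrow> 'c::{banach, second_countable_topology}"
  assumes N: "subalgebra M N" and ind: "indep_set (rv_events M (xi n j)) (sets N)"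
    and v: "v \<in> measurable N (restrict_space borel X)" and h: "h \<in> borel_measurable N"
    and int: "integrable M (\<lambda>\<omega>. (u \<bullet> noise j (v \<omega>) n \<omega>) *\<^sub>R h \<omega>)"
  shows "(LINT \<omega>|M. (u \<bullet> noise j (v \<omega>) n \<omega>) *\<^sub>R h \<omega>) = 0"
proof -
  define k where "k = (\<lambda>(\<omega>, s). (u \<bullet> (gr j (v \<omega>) s - mg j (v \<omega>))) *\<^sub>R h \<omega>)"
  have k: "k \<in> borel_measurable (N \<Otimes>\<^sub>M borel)"
    unfolding k_def case_prod_beta
    by (intro borel_measurable_scaleR borel_measurable_inner borel_measurable_diff borel_measurable_const
        gr_measurable mg_measurable measurable_compose[OF measurable_fst v] measurable_compose[OF measurable_fst h] measurable_snd)
  have vX: "v \<omega> \<in> X" if "\<omega> \<in> space M" for \<omega>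
    using measurable_space[OF v, of \<omega>] that N by (simp add: space_restrict_space subalgebra_def)
  have "(LINT \<omega>|M. k (\<omega>, xi n j \<omega>)) = (LINT \<omega>|M. (LINT s|distr M borel (xi n j). k (\<omega>, s)))"
    by (rule freezing(1)[OF N xi_M ind k]) (use int in \<open>simp add: k_def noise_def\<close>)
  also have "\<dots> = (LINT \<omega>|M. 0)"
  proof (intro Bochner_Integration.integral_cong refl)
    fix \<omega> assume "\<omega> \<in> space M"
    note i = gr_integrable[OF vX[OF this], of j]
    interpret l: prob_space "law j" by (rule prob_law)
    have "(LINT s|law j. k (\<omega>, s)) = (LINT s|law j. u \<bullet> (gr j (v \<omega>) s - mg j (v \<omega>))) *\<^sub>R h \<omega>"
      unfolding k_def case_prod_conv using i by (intro integral_scaleR_left) auto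
    also have "(LINT s|law j. u \<bullet> (gr j (v \<omega>) s - mg j (v \<omega>))) = 0"
      using i l.prob_space by (simp add: mg_def[symmetric])
    finally show "(LINT s|distr M borel (xi n j). k (\<omega>, s)) = 0" by (simp add: law)
  qed
  finally show ?thesis by (simp add: k_def noise_def)
qed

end

section \<open>Orthogonality of the noise and its martingale\<close>

context dual_averaging
begin

lemma \<epsilon>_orth:
  fixes h :: "'w \<Rightarrow> real^'d"
  assumes h: "h \<in> borel_measurable (G n)" and h2: "integrable M (\<lambda>\<omega>. (norm (h \<omega>))\<^sup>2)"
  shows "integrable M (\<lambda>\<omega>. h \<omega> \<bullet> \<epsilon> n \<omega>)" "(LINT \<omega>|M. h \<omega> \<bullet> \<epsilon> n \<omega>) = 0"
proof -
  note hM[measurable] = G_meas[OF h]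
  have nM[measurable]: "(\<lambda>\<omega>. noise j (x n j \<omega>) n \<omega>) \<in> borel_measurable M" for j
    by (rule noise_M[OF G_meas[OF x_meas]])
  have i: "integrable M (\<lambda>\<omega>. (b \<bullet> noise j (x n j \<omega>) n \<omega>) *\<^sub>R (h \<omega> \<bullet> b))" if b: "b \<in> Basis" for j b
  proof -
    have 1: "integrable M (\<lambda>\<omega>. (b \<bullet> noise j (x n j \<omega>) n \<omega>)\<^sup>2)"
    proof (rule Bochner_Integration.integrable_bound[OF \<Lambda>_sq(1)[of n]])
      show "AE \<omega> in M. norm ((b \<bullet> noise j (x n j \<omega>) n \<omega>)\<^sup>2) \<le> norm ((\<Lambda> n \<omega>)\<^sup>2)"
      proof (intro AE_I2)
        fix \<omega>
        have "\<bar>b \<bullet> noise j (x n j \<omega>) n \<omega>\<bar> \<le> \<bar>\<Lambda> n \<omega>\<bar>"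
          using Basis_le_norm[OF b, of "noise j (x n j \<omega>) n \<omega>"] noise_le_\<Lambda>[of "x n j \<omega>" j n \<omega>, OF x_X]
          by (simp add: inner_commute)
        then show "norm ((b \<bullet> noise j (x n j \<omega>) n \<omega>)\<^sup>2) \<le> norm ((\<Lambda> n \<omega>)\<^sup>2)"
          by (simp add: abs_le_square_iff)
      qed
    qed measurable
    have 2: "integrable M (\<lambda>\<omega>. (h \<omega> \<bullet> b)\<^sup>2)"
    proof (rule Bochner_Integration.integrable_bound[OF h2])
      show "AE \<omega> in M. norm ((h \<omega> \<bullet> b)\<^sup>2) \<le> norm ((norm (h \<omega>))\<^sup>2)"
        using Basis_le_norm[OF b] by (intro AE_I2) (simp add: abs_le_square_iff[symmetric])
    qed measurable
    show ?thesis
      using integrable_mult_sq[OF _ _ 1 2] by simp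
  qed
  \<comment> \<open>\<open>noise_mean_zero\<close> treats a fixed direction of the noise, so the
    inner product is expanded in coordinates.\<close>
  have eq: "h \<omega> \<bullet> \<epsilon> n \<omega> = (1 / real CARD('m)) * (\<Sum>j\<in>UNIV. \<Sum>b\<in>Basis. (b \<bullet> noise j (x n j \<omega>) n \<omega>) *\<^sub>R (h \<omega> \<bullet> b))" for \<omega>
  proof -
    have "h \<omega> \<bullet> noise j (x n j \<omega>) n \<omega> = (\<Sum>b\<in>Basis. (b \<bullet> noise j (x n j \<omega>) n \<omega>) *\<^sub>R (h \<omega> \<bullet> b))" for j
      by (subst euclidean_inner) (simp add: inner_commute mult.commute)
    then show ?thesis
      unfolding \<epsilon>_def inner_scaleR_right inner_sum_right by simp
  qed
  show "integrable M (\<lambda>\<omega>. h \<omega> \<bullet> \<epsilon> n \<omega>)"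
    unfolding eq using i by (intro integrable_mult_right Bochner_Integration.integrable_sum)
  have "(LINT \<omega>|M. (b \<bullet> noise j (x n j \<omega>) n \<omega>) *\<^sub>R (h \<omega> \<bullet> b)) = 0" if b: "b \<in> Basis" for j b
    by (rule noise_mean_zero[OF G_sub xi_indep x_meas _ i[OF b]])
       (intro borel_measurable_inner h borel_measurable_const)
  then show "(LINT \<omega>|M. h \<omega> \<bullet> \<epsilon> n \<omega>) = 0"
    unfolding eq using i by (simp add: Bochner_Integration.integral_sum)
qed

definition Mart where "Mart n \<omega> = (\<Sum>i<n. g i *\<^sub>R \<epsilon> i \<omega>)"

lemma Mart_Suc: "Mart (Suc n) \<omega> = Mart n \<omega> + g n *\<^sub>R \<epsilon> n \<omega>"
  by (simp add: Mart_def)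

lemma g_le_0: "g n \<le> g 0"
  by (induction n) (auto intro: order_trans[OF g_decr])

lemma Mart_meas: "Mart n \<in> borel_measurable (G n)"
proof (induction n)
  case (Suc n)
  have "Mart (Suc n) = (\<lambda>\<omega>. Mart n \<omega> + g n *\<^sub>R \<epsilon> n \<omega>)"
    by (rule ext) (rule Mart_Suc)
  then show ?case
    using \<epsilon>_meas[of n] G_meas_Suc[OF Suc] by simp
qed (simp add: Mart_def[abs_def])

lemma \<epsilon>_sq: "integrable M (\<lambda>\<omega>. (norm (\<epsilon> n \<omega>))\<^sup>2)" "(LINT \<omega>|M. (norm (\<epsilon> n \<omega>))\<^sup>2) \<le> 1 + C\<^sub>\<Lambda>"
  using sq_integrable_dominated[OF \<epsilon>_M \<epsilon>_le] by auto

lemma C\<^sub>\<Lambda>_nonneg: "0 \<le> C\<^sub>\<Lambda>"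
  using \<Lambda>_moment(2)[of 0] by (rule order_trans[rotated]) (auto intro!: Bochner_Integration.integral_nonneg)

lemma Mart_sq:
  shows "integrable M (\<lambda>\<omega>. (norm (Mart n \<omega>))\<^sup>2)" "(LINT \<omega>|M. (norm (Mart n \<omega>))\<^sup>2) \<le> (1 + C\<^sub>\<Lambda>) * (\<Sum>i<n. (g i)\<^sup>2)"
proof -
  have "integrable M (\<lambda>\<omega>. (norm (Mart n \<omega>))\<^sup>2) \<and> (LINT \<omega>|M. (norm (Mart n \<omega>))\<^sup>2) \<le> (1 + C\<^sub>\<Lambda>) * (\<Sum>i<n. (g i)\<^sup>2)"
  proof (induction n)
    case (Suc n)
    note [measurable] = G_meas[OF Mart_meas]
    have eq: "(norm (Mart (Suc n) \<omega>))\<^sup>2 = (norm (Mart n \<omega>))\<^sup>2 + 2 * g n * (Mart n \<omega> \<bullet> \<epsilon> n \<omega>) + (g n)\<^sup>2 * (norm (\<epsilon> n \<omega>))\<^sup>2" for \<omega>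
      unfolding power2_norm_eq_inner Mart_Suc
      by (simp add: inner_add_left inner_add_right inner_commute[of "\<epsilon> n \<omega>" "Mart n \<omega>"] power2_eq_square distrib_left)
    note o = \<epsilon>_orth[OF Mart_meas, of n] Suc[THEN conjunct1] \<epsilon>_sq[of n]
    have "(LINT \<omega>|M. (norm (Mart (Suc n) \<omega>))\<^sup>2) = (LINT \<omega>|M. (norm (Mart n \<omega>))\<^sup>2) + (g n)\<^sup>2 * (LINT \<omega>|M. (norm (\<epsilon> n \<omega>))\<^sup>2)"
      unfolding eq using o by simp
    also have "\<dots> \<le> (1 + C\<^sub>\<Lambda>) * (\<Sum>i<n. (g i)\<^sup>2) + (g n)\<^sup>2 * (1 + C\<^sub>\<Lambda>)"
      using Suc o by (intro add_mono mult_left_mono) auto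
    finally show ?case unfolding eq using o by (simp add: algebra_simps)
  qed (simp add: Mart_def)
  then show "integrable M (\<lambda>\<omega>. (norm (Mart n \<omega>))\<^sup>2)" "(LINT \<omega>|M. (norm (Mart n \<omega>))\<^sup>2) \<le> (1 + C\<^sub>\<Lambda>) * (\<Sum>i<n. (g i)\<^sup>2)"
    by auto
qed

definition S where "S n = (\<Sum>i<n. g i)"

lemma S_mono: "i \<le> j \<Longrightarrow> S i \<le> S j"
  unfolding S_def using g_pos by (intro sum_mono2) (auto simp: less_imp_le)

lemma S_lim: "filterlim S at_top sequentially"
  using g_div by (simp add: S_def[abs_def])

text \<open>
  No maximal inequality is needed: cutting time into blocks on which the step sizes add up to about
  \<open>1\<close>, the martingale is controlled in mean square at the ends of the blocks, and inside a block by
  the sum of the absolute increments.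
\<close>

lemma Mart_over_S: "AE \<omega> in M. (\<lambda>n. norm (Mart n \<omega>) / S n) \<longlonglongrightarrow> 0"
proof -
  \<comment> \<open>The first time the step sum reaches \<open>N\<close>. Block \<open>N\<close>
    runs from \<open>k N\<close> to \<open>k (Suc N)\<close> and has step sum at most 1 + g 0,
    because one step overshoots by at most \<open>g 0\<close>.\<close>
  define k where "k N = (LEAST n. real N \<le> S n)" for N :: nat
  have ex: "\<exists>n. real N \<le> S n" for N :: nat
    using S_lim unfolding filterlim_at_top eventually_sequentially by blast
  have k1: "real N \<le> S (k N)" for N unfolding k_def by (rule LeastI_ex[OF ex])
  have k2: "k N \<le> n" if "real N \<le> S n" for N n unfolding k_def using that by (rule Least_le)
  have k3: "S (k N) \<le> real N + g 0" for N
  proof (cases "k N")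
    case 0
    then show ?thesis using g_pos[of 0] by (simp add: S_def)
  next
    case (Suc n)
    then have "S n < real N" using k2[of N n] by linarith
    then show ?thesis unfolding Suc using g_le_0[of n] by (simp add: S_def)
  qed
  have kmono: "k N \<le> k (Suc N)" for N
    by (rule k2) (use k1[of "Suc N"] in simp)
  define I where "I N = {k N..<k (Suc N)}" for N
  have SI: "sum g (I N) \<le> 1 + g 0" for N
  proof -
    have "S (k (Suc N)) = S (k N) + sum g (I N)"
      unfolding S_def I_def lessThan_atLeast0 by (rule sum.atLeastLessThan_concat[symmetric]) (simp_all add: kmono)
    then show ?thesis using k3[of "Suc N"] k1[of N] by simp
  qed
  define V where "V N \<omega> = (\<Sum>i\<in>I N. g i * \<Lambda> i \<omega>)" for N \<omega>
  have V0: "0 \<le> V N \<omega>" for N \<omega> unfolding V_def using g_pos \<Lambda>_nonneg by (intro sum_nonneg mult_nonneg_nonneg) (auto simp: less_imp_le)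
  have [measurable]: "V N \<in> borel_measurable M" for N unfolding V_def[abs_def] by measurable
  \<comment> \<open>Cauchy-Schwarz with weights \<open>g i\<close>: as the weights in a block have
    bounded sum, the second moment of the block variation is bounded uniformly in the block.\<close>
  have V2: "(V N \<omega>)\<^sup>2 \<le> (1 + g 0) * (\<Sum>i\<in>I N. g i * (\<Lambda> i \<omega>)\<^sup>2)" for N \<omega>
  proof -
    have s: "sqrt (g i) * sqrt (g i) = g i" for i using g_pos[of i] by simp
    have "(V N \<omega>)\<^sup>2 = (\<Sum>i\<in>I N. sqrt (g i) * (sqrt (g i) * \<Lambda> i \<omega>))\<^sup>2"
      unfolding V_def by (simp only: mult.assoc[symmetric] s)
    also have "\<dots> \<le> (\<Sum>i\<in>I N. (sqrt (g i))\<^sup>2) * (\<Sum>i\<in>I N. (sqrt (g i) * \<Lambda> i \<omega>)\<^sup>2)"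
      by (rule Cauchy_Schwarz_ineq_sum)
    also have "\<dots> = sum g (I N) * (\<Sum>i\<in>I N. g i * (\<Lambda> i \<omega>)\<^sup>2)"
      using g_pos by (simp add: power_mult_distrib less_imp_le)
    also have "\<dots> \<le> (1 + g 0) * (\<Sum>i\<in>I N. g i * (\<Lambda> i \<omega>)\<^sup>2)"
      using SI g_pos by (intro mult_right_mono sum_nonneg) (auto simp: less_imp_le)
    finally show ?thesis .
  qed
  have iR: "integrable M (\<lambda>\<omega>. (1 + g 0) * (\<Sum>i\<in>I N. g i * (\<Lambda> i \<omega>)\<^sup>2))" for N
    using \<Lambda>_sq(1) by (intro integrable_mult_right Bochner_Integration.integrable_sum)
  have iV: "integrable M (\<lambda>\<omega>. (V N \<omega>)\<^sup>2)" for N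
    by (rule Bochner_Integration.integrable_bound[OF iR[of N]]) (use V2 in \<open>auto intro: order_trans[OF _ abs_ge_self]\<close>)
  have EV: "(LINT \<omega>|M. (V N \<omega>)\<^sup>2) \<le> (1 + g 0)\<^sup>2 * (1 + C\<^sub>\<Lambda>)" for N
  proof -
    have "(LINT \<omega>|M. (V N \<omega>)\<^sup>2) \<le> (LINT \<omega>|M. (1 + g 0) * (\<Sum>i\<in>I N. g i * (\<Lambda> i \<omega>)\<^sup>2))"
      by (rule integral_mono[OF iV iR V2])
    also have "\<dots> = (1 + g 0) * (\<Sum>i\<in>I N. g i * (LINT \<omega>|M. (\<Lambda> i \<omega>)\<^sup>2))"
      using \<Lambda>_sq(1) by (simp add: Bochner_Integration.integral_sum)
    also have "\<dots> \<le> (1 + g 0) * (\<Sum>i\<in>I N. g i * (1 + C\<^sub>\<Lambda>))"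
      using g_pos \<Lambda>_sq(2) by (intro mult_left_mono sum_mono) (auto simp: less_imp_le add_nonneg_nonneg)
    also have "\<dots> = (1 + g 0) * (sum g (I N) * (1 + C\<^sub>\<Lambda>))" by (simp add: sum_distrib_right)
    also have "\<dots> \<le> (1 + g 0) * ((1 + g 0) * (1 + C\<^sub>\<Lambda>))"
      using SI[of N] g_pos[of 0] C\<^sub>\<Lambda>_nonneg by (intro mult_left_mono mult_right_mono) auto
    finally show ?thesis by (simp add: power2_eq_square mult.assoc)
  qed
  define Q where "Q = (\<Sum>i. (g i)\<^sup>2)"
  have EM: "(LINT \<omega>|M. (norm (Mart n \<omega>))\<^sup>2) \<le> (1 + C\<^sub>\<Lambda>) * Q" for n
  proof -
    have "(\<Sum>i<n. (g i)\<^sup>2) \<le> Q" unfolding Q_def by (rule sum_le_suminf[OF g_sq]) auto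
    then show ?thesis using Mart_sq(2)[of n] C\<^sub>\<Lambda>_nonneg
      by (meson add_nonneg_nonneg mult_left_mono order_trans zero_le_one)
  qed
  note [measurable] = G_meas[OF Mart_meas]
  \<comment> \<open>Shifted by one so that the divisor is positive; dividing by the square of the
    block number makes the expectations summable.\<close>
  define Y where "Y N \<omega> = ((norm (Mart (k (Suc N)) \<omega>))\<^sup>2 + (V (Suc N) \<omega>)\<^sup>2) * inverse ((real (Suc N))\<^sup>2)" for N \<omega>
  have iY: "integrable M (Y N)" for N
    unfolding Y_def using Mart_sq(1) iV by (intro integrable_mult_left Bochner_Integration.integrable_add) auto
  have "summable (\<lambda>N. LINT \<omega>|M. Y N \<omega>)"
  proof (rule summable_comparison_test'[where N = 0])
    show "summable (\<lambda>N. ((1 + C\<^sub>\<Lambda>) * Q + (1 + g 0)\<^sup>2 * (1 + C\<^sub>\<Lambda>)) * inverse ((real (Suc N))\<^sup>2))"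
      by (intro summable_mult) (subst summable_Suc_iff, rule inverse_power_summable, simp)
    fix N
    have "(LINT \<omega>|M. Y N \<omega>) = ((LINT \<omega>|M. (norm (Mart (k (Suc N)) \<omega>))\<^sup>2) + (LINT \<omega>|M. (V (Suc N) \<omega>)\<^sup>2)) * inverse ((real (Suc N))\<^sup>2)"
      unfolding Y_def using Mart_sq(1) iV by simp
    also have "\<dots> \<le> ((1 + C\<^sub>\<Lambda>) * Q + (1 + g 0)\<^sup>2 * (1 + C\<^sub>\<Lambda>)) * inverse ((real (Suc N))\<^sup>2)"
      using EM EV by (intro mult_right_mono add_mono) auto
    finally show "norm (LINT \<omega>|M. Y N \<omega>) \<le> ((1 + C\<^sub>\<Lambda>) * Q + (1 + g 0)\<^sup>2 * (1 + C\<^sub>\<Lambda>)) * inverse ((real (Suc N))\<^sup>2)"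
      by (simp add: Y_def Bochner_Integration.integral_nonneg)
  qed
  then have "AE \<omega> in M. (\<lambda>N. Y N \<omega>) \<longlonglongrightarrow> 0"
    by (intro AE_tendsto_0_summable iY) (auto simp: Y_def)
  then show ?thesis
  proof eventually_elim
    case (elim \<omega>)
    \<comment> \<open>The number of the block that contains \<open>n\<close>, once the step sum has
      reached 1.\<close>
    define N where "N n = nat \<lfloor>S n\<rfloor>" for n
    have Nlim: "filterlim N at_top sequentially"
      unfolding N_def
      by (rule filterlim_compose[OF filterlim_nat_sequentially filterlim_compose[OF filterlim_floor_sequentially S_lim]])
    have Nlim': "filterlim (\<lambda>n. N n - 1) at_top sequentially"
      by (rule filterlim_compose[OF filterlim_minus_const_nat_at_top Nlim])
    have bound: "(norm (Mart n \<omega>) / S n)\<^sup>2 \<le> 2 * Y (N n - 1) \<omega>" if n: "1 \<le> N n" for n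
    proof -
      have Sn: "real (N n) \<le> S n" "S n < real (N n) + 1" "1 \<le> S n"
        using n unfolding N_def by linarith+
      have kn: "k (N n) \<le> n" by (rule k2[OF Sn(1)])
      have nk: "n < k (Suc (N n))"
      proof (rule ccontr)
        assume "\<not> n < k (Suc (N n))"
        then have "S (k (Suc (N n))) \<le> S n" by (intro S_mono) simp
        then show False using k1[of "Suc (N n)"] Sn(2) by simp
      qed
      have "Mart n \<omega> = Mart (k (N n)) \<omega> + (\<Sum>i\<in>{k (N n)..<n}. g i *\<^sub>R \<epsilon> i \<omega>)"
        unfolding Mart_def lessThan_atLeast0 by (rule sum.atLeastLessThan_concat[symmetric]) (simp_all add: kn)
      then have "norm (Mart n \<omega>) \<le> norm (Mart (k (N n)) \<omega>) + norm (\<Sum>i\<in>{k (N n)..<n}. g i *\<^sub>R \<epsilon> i \<omega>)"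
        by (simp add: norm_triangle_ineq)
      also have "norm (\<Sum>i\<in>{k (N n)..<n}. g i *\<^sub>R \<epsilon> i \<omega>) \<le> (\<Sum>i\<in>{k (N n)..<n}. g i * \<Lambda> i \<omega>)"
        using g_pos \<epsilon>_le by (intro order_trans[OF norm_sum sum_mono]) (auto simp: less_imp_le mult_left_mono abs_of_pos)
      also have "\<dots> \<le> V (N n) \<omega>"
        unfolding V_def I_def using nk g_pos \<Lambda>_nonneg by (intro sum_mono2) (auto simp: less_imp_le)
      finally have le: "norm (Mart n \<omega>) \<le> norm (Mart (k (N n)) \<omega>) + V (N n) \<omega>" by simp
      have "norm (Mart n \<omega>) / S n \<le> (norm (Mart (k (N n)) \<omega>) + V (N n) \<omega>) / real (N n)"
        using le Sn n V0 by (intro frac_le) auto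
      then have "(norm (Mart n \<omega>) / S n)\<^sup>2 \<le> ((norm (Mart (k (N n)) \<omega>) + V (N n) \<omega>) / real (N n))\<^sup>2"
        using Sn by (intro power_mono) auto
      also have "\<dots> = (norm (Mart (k (N n)) \<omega>) + V (N n) \<omega>)\<^sup>2 * inverse ((real (N n))\<^sup>2)"
        by (simp add: divide_inverse power_mult_distrib power_inverse)
      also have "\<dots> \<le> (2 * ((norm (Mart (k (N n)) \<omega>))\<^sup>2 + (V (N n) \<omega>)\<^sup>2)) * inverse ((real (N n))\<^sup>2)"
        using sum_squares_bound[of "norm (Mart (k (N n)) \<omega>)" "V (N n) \<omega>"]
        by (intro mult_right_mono) (auto simp: power2_sum)
      also have "\<dots> = 2 * Y (N n - 1) \<omega>" using n by (simp add: Y_def)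
      finally show ?thesis .
    qed
    have "(\<lambda>n. 2 * Y (N n - 1) \<omega>) \<longlonglongrightarrow> 2 * 0"
      by (intro tendsto_mult tendsto_const filterlim_compose[OF elim Nlim'])
    then have "(\<lambda>n. (norm (Mart n \<omega>) / S n)\<^sup>2) \<longlonglongrightarrow> 0"
    proof (rule Lim_null_comparison[rotated, OF tendsto_eq_rhs])
      have "\<forall>\<^sub>F n in sequentially. 1 \<le> N n"
        using Nlim unfolding filterlim_at_top by blast
      then show "\<forall>\<^sub>F n in sequentially. norm ((norm (Mart n \<omega>) / S n)\<^sup>2) \<le> 2 * Y (N n - 1) \<omega>"
        by eventually_elim (use bound in auto)
    qed simp
    from tendsto_real_sqrt[OF this] show ?case
    proof (rule Lim_transform_eventually[OF tendsto_eq_rhs])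
      show "\<forall>\<^sub>F n in sequentially. sqrt ((norm (Mart n \<omega>) / S n)\<^sup>2) = norm (Mart n \<omega>) / S n"
      proof (intro always_eventually allI)
        fix n
        have "0 \<le> S n" unfolding S_def using g_pos by (intro sum_nonneg) (auto simp: less_imp_le)
        then show "sqrt ((norm (Mart n \<omega>) / S n)\<^sup>2) = norm (Mart n \<omega>) / S n" by simp
      qed
    qed simp
  qed
qed

end

section \<open>Mixing by the weight matrices\<close>

definition coupling :: "real^'m^'m \<Rightarrow> real^'m^'m" where
  "coupling w = transpose w ** (Finite_Cartesian_Product.mat 1 - (1 / real CARD('m)) *\<^sub>R (\<chi> i j. 1)) ** w"

lemma coupling_continuous: "continuous_on T coupling"
  unfolding coupling_def[abs_def] matrix_matrix_mult_def Finite_Cartesian_Product.transpose_def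
  by (intro continuous_intros)

lemma centering_matrix:
  "(Finite_Cartesian_Product.mat 1 - (1 / real CARD('m)) *\<^sub>R (\<chi> i j. 1)) *v (v :: real^'m)
    = v - (\<chi> i. (1 / real CARD('m)) * (\<Sum>j\<in>UNIV. v $ j))"
proof -
  have "((\<chi> i j. 1) :: real^'m^'m) *v v = (\<chi> i. \<Sum>j\<in>UNIV. v $ j)"
    by (simp add: matrix_vector_mult_def)
  moreover have "(1 / real CARD('m)) *\<^sub>R ((\<chi> i. \<Sum>j\<in>UNIV. v $ j) :: real^'m) = (\<chi> i. (1 / real CARD('m)) * (\<Sum>j\<in>UNIV. v $ j))"
    unfolding Finite_Cartesian_Product.vec_eq_iff by simp
  ultimately show ?thesis
    by (simp add: matrix_vector_mult_diff_rdistrib scaleR_matrix_vector_assoc[symmetric])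
qed

text \<open>Column sums equal to one preserve the sum of the entries, which is zero, so the
  centering matrix fixes \<open>w *v v\<close>.\<close>

lemma coupling_form:
  fixes w :: "real^'m^'m" and v :: "real^'m"
  assumes w: "\<And>i. (\<Sum>j\<in>UNIV. w $ j $ i) = 1" and v: "(\<Sum>i\<in>UNIV. v $ i) = 0"
  shows "v \<bullet> (coupling w *v v) = (norm (w *v v))\<^sup>2"
proof -
  let ?C = "Finite_Cartesian_Product.mat 1 - (1 / real CARD('m)) *\<^sub>R (\<chi> i j. 1) :: real^'m^'m"
  have "(\<Sum>j\<in>UNIV. (w *v v) $ j) = (\<Sum>j\<in>UNIV. \<Sum>i\<in>UNIV. w $ j $ i * v $ i)"
    by (simp add: matrix_vector_mult_def)
  also have "\<dots> = (\<Sum>i\<in>UNIV. (\<Sum>j\<in>UNIV. w $ j $ i) * v $ i)"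
    by (subst sum.swap) (simp add: sum_distrib_right)
  finally have s: "(\<Sum>j\<in>UNIV. (w *v v) $ j) = 0" using w v by simp
  have "v \<bullet> (coupling w *v v) = (transpose w *v (?C *v (w *v v))) \<bullet> v"
    by (simp add: coupling_def matrix_vector_mul_assoc matrix_mul_assoc inner_commute)
  also have "\<dots> = (?C *v (w *v v)) \<bullet> (w *v v)" by (rule transpose_inner)
  also have "?C *v (w *v v) = w *v v"
    unfolding centering_matrix s by (simp add: Finite_Cartesian_Product.vec_eq_iff)
  finally show ?thesis by (simp add: dot_square_norm)
qed

lemma doubly_stochastic_norm_le: "doubly_stochastic w \<Longrightarrow> norm w \<le> real CARD('m)" for w :: "real^'m^'m"
proof -
  assume w: "doubly_stochastic w"
  have "norm w \<le> (\<Sum>i\<in>UNIV. norm (w $ i))" unfolding norm_vec_def by (rule L2_set_le_sum) simp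
  also have "\<dots> \<le> (\<Sum>i\<in>(UNIV :: 'm set). 1)"
  proof (rule sum_mono)
    fix i
    have "norm (w $ i) \<le> (\<Sum>j\<in>UNIV. \<bar>w $ i $ j\<bar>)" by (rule norm_le_l1_cart)
    also have "\<dots> = 1" using w by (simp add: doubly_stochastic_def)
    finally show "norm (w $ i) \<le> 1" .
  qed
  finally show ?thesis by simp
qed

lemma coupling_bounded: "\<exists>K. \<forall>w :: real^'m^'m. doubly_stochastic w \<longrightarrow> norm (coupling w) \<le> K"
proof -
  have "compact (coupling ` cball (0 :: real^'m^'m) (real CARD('m)))"
    by (intro compact_continuous_image coupling_continuous compact_cball)
  then obtain K where "\<And>y. y \<in> coupling ` cball (0 :: real^'m^'m) (real CARD('m)) \<Longrightarrow> norm y \<le> K"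
    using compact_imp_bounded bounded_iff by metis
  then show ?thesis using doubly_stochastic_norm_le by (intro exI[of _ K]) force
qed

context dual_averaging
begin

text \<open>Averaging over the agents removes the weights because their columns sum to one.\<close>

lemma zb_Suc: "AE \<omega> in M. \<forall>n. zb (Suc n) \<omega> = zb n \<omega>
    - g n *\<^sub>R ((1 / real CARD('m)) *\<^sub>R (\<Sum>j\<in>UNIV. gr j (x n j \<omega>) (xi n j \<omega>)))"
proof -
  have "AE \<omega> in M. \<forall>n. doubly_stochastic (W n \<omega>)" using W_stoch by (simp add: AE_all_countable)
  then show ?thesis
  proof eventually_elim
    case (elim \<omega>)
    show ?case
    proof
      fix n
      have "(\<Sum>j\<in>UNIV. \<Sum>i\<in>UNIV. (W n \<omega> $ j $ i) *\<^sub>R z n i \<omega>) = (\<Sum>i\<in>UNIV. (\<Sum>j\<in>UNIV. W n \<omega> $ j $ i) *\<^sub>R z n i \<omega>)"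
        by (subst sum.swap) (simp add: scaleR_sum_left)
      also have "\<dots> = (\<Sum>i\<in>UNIV. z n i \<omega>)" using elim by (simp add: doubly_stochastic_def)
      finally show "zb (Suc n) \<omega> = zb n \<omega> - g n *\<^sub>R ((1 / real CARD('m)) *\<^sub>R (\<Sum>j\<in>UNIV. gr j (x n j \<omega>) (xi n j \<omega>)))"
        by (simp add: zb_def z_Suc sum_subtractf x_def[symmetric] scaleR_diff_right scaleR_sum_right[symmetric] mult.commute)
    qed
  qed
qed

definition y where "y n j \<omega> = z n j \<omega> - zb n \<omega>"
definition V where "V n \<omega> = (\<Sum>j\<in>UNIV. (norm (y n j \<omega>))\<^sup>2)"
text \<open>The initial points need not be integrable, so second moments are taken on the events \<open>start R\<close>.\<close>

definition start :: "real \<Rightarrow> 'w set" where "start R = {\<omega>\<in>space M. \<forall>j. norm (z 0 j \<omega>) \<le> R}"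
definition I where "I R \<omega> = (indicator (start R) \<omega> :: real)"

lemma I_01: "I R \<omega> = 0 \<or> I R \<omega> = 1" "0 \<le> I R \<omega>" "I R \<omega> \<le> 1"
  by (auto simp: I_def indicator_def)

lemma start_G: "start R \<in> sets (G n)"
proof (induction n)
  case 0
  have "start R = (\<Inter>j. {\<omega>\<in>space (G 0). norm (z 0 j \<omega>) \<le> R})" by (auto simp: start_def space_G)
  also have "\<dots> \<in> sets (G 0)" using z_0[measurable] by (intro sets.countable_INT) auto
  finally show ?case .
qed (use G_mono in blast)

lemma start_M[measurable]: "start R \<in> sets M" using start_G[of R 0] G_sub[of 0] by (auto simp: subalgebra_def)

lemma I_meas: "I R \<in> borel_measurable (G n)"
  using start_G[of R n] unfolding I_def[abs_def] by measurable

lemma I_M[measurable]: "I R \<in> borel_measurable M" by (rule G_meas[OF I_meas[of R 0]])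

lemma sum_y: "(\<Sum>j\<in>UNIV. y n j \<omega>) = 0"
proof -
  have "(\<Sum>j\<in>(UNIV :: 'm set). zb n \<omega>) = (\<Sum>j\<in>UNIV. z n j \<omega>)"
    unfolding sum_constant_scaleR by (simp add: zb_def)
  then show ?thesis by (simp add: y_def sum_subtractf)
qed

lemma y_meas: "y n j \<in> borel_measurable (G n)"
  using z_meas[of n j] zb_meas[of n] unfolding y_def[abs_def] by simp

lemma y_M[measurable]: "y n j \<in> borel_measurable M" by (rule G_meas[OF y_meas])

lemma V_M[measurable]: "V n \<in> borel_measurable M" unfolding V_def[abs_def] by measurable

lemma V_nonneg: "0 \<le> V n \<omega>" unfolding V_def by (intro sum_nonneg) auto

lemma norm_sum_sq_le:
  fixes f :: "'m \<Rightarrow> real"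
  shows "(\<Sum>j\<in>UNIV. f j)\<^sup>2 \<le> real CARD('m) * (\<Sum>j\<in>UNIV. (f j)\<^sup>2)"
  using Cauchy_Schwarz_ineq_sum[of "\<lambda>_. 1" f UNIV] by simp

lemma Iz_integrable: "integrable M (\<lambda>\<omega>. I R \<omega> * (norm (z n j \<omega>))\<^sup>2)"
proof (induction n arbitrary: j)
  case 0
  show ?case
  proof (rule integrable_const_bound[where B = "R\<^sup>2"])
    show "AE \<omega> in M. norm (I R \<omega> * (norm (z 0 j \<omega>))\<^sup>2) \<le> R\<^sup>2"
      by (intro AE_I2) (auto simp: I_def indicator_def start_def intro: power_mono)
  qed measurable
next
  case (Suc n)
  let ?B = "\<lambda>\<omega>. 2 * real CARD('m) * (\<Sum>i\<in>UNIV. I R \<omega> * (norm (z n i \<omega>))\<^sup>2) + 2 * (g n)\<^sup>2 * (\<Lambda> n \<omega>)\<^sup>2"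
  have B: "integrable M ?B"
    using Suc \<Lambda>_sq(1) by (intro Bochner_Integration.integrable_add integrable_mult_right Bochner_Integration.integrable_sum) auto
  show ?case
  proof (rule Bochner_Integration.integrable_bound[OF B])
    show "AE \<omega> in M. norm (I R \<omega> * (norm (z (Suc n) j \<omega>))\<^sup>2) \<le> norm (?B \<omega>)"
      using W_stoch[of n]
    proof eventually_elim
      case (elim \<omega>)
      have w: "\<bar>W n \<omega> $ j $ i\<bar> \<le> 1" for i
      proof -
        have "W n \<omega> $ j $ i \<le> (\<Sum>i\<in>UNIV. W n \<omega> $ j $ i)"
          using elim by (intro member_le_sum) (auto simp: doubly_stochastic_def)
        then show ?thesis using elim by (simp add: doubly_stochastic_def)
      qed
      have "norm (z (Suc n) j \<omega>) \<le> norm (\<Sum>i\<in>UNIV. (W n \<omega> $ j $ i) *\<^sub>R z n i \<omega>) + norm (g n *\<^sub>R gr j (x n j \<omega>) (xi n j \<omega>))"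
        unfolding z_Suc x_def by (rule norm_triangle_ineq4)
      also have "norm (\<Sum>i\<in>UNIV. (W n \<omega> $ j $ i) *\<^sub>R z n i \<omega>) \<le> (\<Sum>i\<in>UNIV. norm (z n i \<omega>))"
        using w by (intro order_trans[OF norm_sum sum_mono]) (simp add: mult_left_le_one_le)
      also have "norm (g n *\<^sub>R gr j (x n j \<omega>) (xi n j \<omega>)) \<le> g n * \<Lambda> n \<omega>"
        using gr_le_\<Lambda>[OF x_X] g_pos[of n] by simp
      finally have "(norm (z (Suc n) j \<omega>))\<^sup>2 \<le> ((\<Sum>i\<in>UNIV. norm (z n i \<omega>)) + g n * \<Lambda> n \<omega>)\<^sup>2"
        by (intro power_mono) auto
      also have "\<dots> \<le> 2 * (\<Sum>i\<in>UNIV. norm (z n i \<omega>))\<^sup>2 + 2 * (g n * \<Lambda> n \<omega>)\<^sup>2"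
        using sum_squares_bound[of "\<Sum>i\<in>UNIV. norm (z n i \<omega>)" "g n * \<Lambda> n \<omega>"] by (simp add: power2_sum)
      also have "\<dots> \<le> 2 * (real CARD('m) * (\<Sum>i\<in>UNIV. (norm (z n i \<omega>))\<^sup>2)) + 2 * (g n * \<Lambda> n \<omega>)\<^sup>2"
        by (intro add_right_mono mult_left_mono norm_sum_sq_le) simp
      finally have "I R \<omega> * (norm (z (Suc n) j \<omega>))\<^sup>2 \<le> ?B \<omega>"
        using I_01(1)[of R \<omega>] by (auto simp: power_mult_distrib mult.assoc)
      moreover have "0 \<le> I R \<omega> * (norm (z (Suc n) j \<omega>))\<^sup>2" using I_01(2) by simp
      ultimately show ?case by simp
    qed
  qed measurable
qed

lemma IV_integrable: "integrable M (\<lambda>\<omega>. I R \<omega> * V n \<omega>)"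
proof (rule Bochner_Integration.integrable_bound)
  let ?B = "\<lambda>\<omega>. \<Sum>j\<in>(UNIV :: 'm set). 2 * (I R \<omega> * (norm (z n j \<omega>))\<^sup>2) + 2 * (real CARD('m) * (\<Sum>i\<in>UNIV. I R \<omega> * (norm (z n i \<omega>))\<^sup>2))"
  show "integrable M ?B"
    using Iz_integrable by (intro Bochner_Integration.integrable_sum Bochner_Integration.integrable_add integrable_mult_right) auto
  show "AE \<omega> in M. norm (I R \<omega> * V n \<omega>) \<le> norm (?B \<omega>)"
  proof (intro AE_I2)
    fix \<omega>
    have zb: "(norm (zb n \<omega>))\<^sup>2 \<le> real CARD('m) * (\<Sum>i\<in>UNIV. (norm (z n i \<omega>))\<^sup>2)"
    proof -
      have "1 / real CARD('m) * norm (\<Sum>j\<in>UNIV. z n j \<omega>) \<le> 1 * (\<Sum>j\<in>UNIV. norm (z n j \<omega>))"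
        by (intro mult_mono norm_sum) (auto simp: Suc_leI)
      then have "norm (zb n \<omega>) \<le> (\<Sum>j\<in>UNIV. norm (z n j \<omega>))" by (simp add: zb_def)
      then have "(norm (zb n \<omega>))\<^sup>2 \<le> (\<Sum>j\<in>UNIV. norm (z n j \<omega>))\<^sup>2" by (intro power_mono) auto
      also have "\<dots> \<le> real CARD('m) * (\<Sum>i\<in>UNIV. (norm (z n i \<omega>))\<^sup>2)" by (rule norm_sum_sq_le)
      finally show ?thesis .
    qed
    have "(norm (y n j \<omega>))\<^sup>2 \<le> 2 * (norm (z n j \<omega>))\<^sup>2 + 2 * (real CARD('m) * (\<Sum>i\<in>UNIV. (norm (z n i \<omega>))\<^sup>2))" for j
    proof -
      have "(norm (y n j \<omega>))\<^sup>2 \<le> (norm (z n j \<omega>) + norm (zb n \<omega>))\<^sup>2"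
        unfolding y_def by (intro power_mono norm_triangle_ineq4) auto
      also have "\<dots> \<le> 2 * (norm (z n j \<omega>))\<^sup>2 + 2 * (norm (zb n \<omega>))\<^sup>2"
        using sum_squares_bound[of "norm (z n j \<omega>)" "norm (zb n \<omega>)"] by (simp add: power2_sum)
      finally show ?thesis using zb by linarith
    qed
    then have "V n \<omega> \<le> (\<Sum>j\<in>UNIV. 2 * (norm (z n j \<omega>))\<^sup>2 + 2 * (real CARD('m) * (\<Sum>i\<in>UNIV. (norm (z n i \<omega>))\<^sup>2)))"
      unfolding V_def by (rule sum_mono)
    then have "I R \<omega> * V n \<omega> \<le> ?B \<omega>"
      using I_01(1)[of R \<omega>] by auto
    moreover have "0 \<le> I R \<omega> * V n \<omega>" using I_01(2) V_nonneg by simp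
    ultimately show "norm (I R \<omega> * V n \<omega>) \<le> norm (?B \<omega>)" by simp
  qed
qed measurable

text \<open>The weights mix agents, not coordinates: for each coordinate the deviations of all
  agents form a vector of zero sum on which \<open>W n\<close> acts as a matrix.\<close>

definition coord :: "nat \<Rightarrow> 'd \<Rightarrow> 'w \<Rightarrow> real^'m" where "coord n l \<omega> = (\<chi> p. y n p \<omega> $ l)"

lemma V_coord: "V n \<omega> = (\<Sum>l\<in>UNIV. (norm (coord n l \<omega>))\<^sup>2)"
proof -
  have "V n \<omega> = (\<Sum>j\<in>UNIV. \<Sum>l\<in>UNIV. (y n j \<omega> $ l)\<^sup>2)"
    unfolding V_def by (simp add: norm_vec_def L2_set_def sum_nonneg)
  also have "\<dots> = (\<Sum>l\<in>UNIV. \<Sum>j\<in>UNIV. (y n j \<omega> $ l)\<^sup>2)" by (rule sum.swap)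
  finally show ?thesis by (simp add: coord_def norm_vec_def L2_set_def sum_nonneg)
qed

text \<open>\<open>W n\<close> is independent of \<open>G n\<close>, so it can be integrated out
  with the deviations frozen. What remains is the quadratic form of the mean of
  \<open>coupling (W n)\<close>, whose operator norm is at most \<open>\<rho>\<close>. The mixed
  deviations can be written through \<open>coupling\<close> because the vectors
  \<open>coord n l\<close> have zero sum.\<close>

lemma mixing_contraction:
  "integrable M (\<lambda>\<omega>. I R \<omega> * (\<Sum>j\<in>UNIV. (norm (\<Sum>i\<in>UNIV. (W n \<omega> $ j $ i) *\<^sub>R y n i \<omega>))\<^sup>2))"
  "(LINT \<omega>|M. I R \<omega> * (\<Sum>j\<in>UNIV. (norm (\<Sum>i\<in>UNIV. (W n \<omega> $ j $ i) *\<^sub>R y n i \<omega>))\<^sup>2)) \<le> \<rho> * (LINT \<omega>|M. I R \<omega> * V n \<omega>)"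
proof -
  let ?F = "\<lambda>\<omega>. I R \<omega> * (\<Sum>j\<in>UNIV. (norm (\<Sum>i\<in>UNIV. (W n \<omega> $ j $ i) *\<^sub>R y n i \<omega>))\<^sup>2)"
  define h where "h = (\<lambda>(\<omega>, w). I R \<omega> * (\<Sum>l\<in>UNIV. coord n l \<omega> \<bullet> (coupling w *v coord n l \<omega>)))"
  define \<Phi> where "\<Phi> = (LINT \<omega>|M. coupling (W n \<omega>))"
  obtain K where K: "\<And>w :: real^'m^'m. doubly_stochastic w \<Longrightarrow> norm (coupling w) \<le> K" using coupling_bounded by blast
  have coupM: "coupling \<in> borel_measurable borel"
    by (rule borel_measurable_continuous_onI[OF coupling_continuous])
  have [measurable]: "(\<lambda>\<omega>. coupling (W n \<omega>)) \<in> borel_measurable M"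
    using measurable_compose[OF W_M coupM] by simp
  have ic: "integrable M (\<lambda>\<omega>. coupling (W n \<omega>))"
    by (rule integrable_const_bound[where B = K]) (use W_stoch[of n] K in auto)
  have coord_meas: "coord n l \<in> borel_measurable (G n)" for l
  proof -
    have "(\<lambda>\<omega>. y n p \<omega> $ l) \<in> borel_measurable (G n)" for p
      by (rule measurable_compose[OF y_meas]) (intro borel_measurable_continuous_onI continuous_intros)
    then show ?thesis
      by (subst borel_measurable_euclidean_space) (auto simp: Basis_vec_def inner_axis coord_def)
  qed
  have ae: "AE \<omega> in M. ?F \<omega> = h (\<omega>, W n \<omega>)"
    using W_stoch[of n]
  proof eventually_elim
    case (elim \<omega>)
    have "coord n l \<omega> \<bullet> (coupling (W n \<omega>) *v coord n l \<omega>) = (\<Sum>j\<in>UNIV. ((\<Sum>i\<in>UNIV. (W n \<omega> $ j $ i) *\<^sub>R y n i \<omega>) $ l)\<^sup>2)" for l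
    proof -
      have "(\<Sum>i\<in>UNIV. coord n l \<omega> $ i) = (\<Sum>j\<in>UNIV. y n j \<omega>) $ l" by (simp add: coord_def)
      then have "(\<Sum>i\<in>UNIV. coord n l \<omega> $ i) = 0" by (simp add: sum_y)
      then have "coord n l \<omega> \<bullet> (coupling (W n \<omega>) *v coord n l \<omega>) = (norm (W n \<omega> *v coord n l \<omega>))\<^sup>2"
        using elim by (intro coupling_form) (auto simp: doubly_stochastic_def)
      also have "\<dots> = (\<Sum>j\<in>UNIV. ((W n \<omega> *v coord n l \<omega>) $ j)\<^sup>2)"
        by (simp add: norm_vec_def L2_set_def sum_nonneg)
      also have "\<dots> = (\<Sum>j\<in>UNIV. ((\<Sum>i\<in>UNIV. (W n \<omega> $ j $ i) *\<^sub>R y n i \<omega>) $ l)\<^sup>2)"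
        by (simp add: matrix_vector_mult_def coord_def)
      finally show ?thesis .
    qed
    then have "(\<Sum>l\<in>UNIV. coord n l \<omega> \<bullet> (coupling (W n \<omega>) *v coord n l \<omega>))
        = (\<Sum>j\<in>UNIV. \<Sum>l\<in>UNIV. ((\<Sum>i\<in>UNIV. (W n \<omega> $ j $ i) *\<^sub>R y n i \<omega>) $ l)\<^sup>2)"
      by (simp only:) (rule sum.swap)
    also have "\<dots> = (\<Sum>j\<in>UNIV. (norm (\<Sum>i\<in>UNIV. (W n \<omega> $ j $ i) *\<^sub>R y n i \<omega>))\<^sup>2)"
      by (simp add: norm_vec_def L2_set_def sum_nonneg)
    finally show ?case by (simp add: h_def)
  qed
  have quad: "\<bar>v \<bullet> (A *v v)\<bar> \<le> (norm v)\<^sup>2 * onorm ((*v) A)" for A :: "real^'m^'m" and v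
  proof -
    have "\<bar>v \<bullet> (A *v v)\<bar> \<le> norm v * norm (A *v v)" by (rule Cauchy_Schwarz_ineq2)
    also have "\<dots> \<le> norm v * (onorm ((*v) A) * norm v)"
      by (intro mult_left_mono onorm matrix_vector_mul_bounded_linear) auto
    finally show ?thesis by (simp add: power2_eq_square mult_ac)
  qed
  have bl: "bounded_linear (\<lambda>A :: real^'m^'m. A *v v)" for v :: "real^'m"
    by (intro linear_conv_bounded_linear[THEN iffD1] linearI)
       (simp_all add: matrix_vector_mult_add_rdistrib scaleR_matrix_vector_assoc)
  have bl': "bounded_linear (\<lambda>A :: real^'m^'m. i * (\<Sum>l\<in>UNIV. f l \<bullet> (A *v f l)))" for i :: real and f :: "'d \<Rightarrow> real^'m"
    by (intro bounded_linear_const_mult bounded_linear_sum bounded_linear_inner_right_comp bl)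
  have hm: "h \<in> borel_measurable (G n \<Otimes>\<^sub>M borel)"
  proof -
    have "(\<lambda>q. coord n l (fst q) \<bullet> (coupling (snd q) *v coord n l (fst q))) \<in> borel_measurable (G n \<Otimes>\<^sub>M borel)" for l
    proof -
      have "continuous_on UNIV (\<lambda>q. fst q \<bullet> (coupling (snd q) *v fst q :: real^'m))"
        unfolding matrix_vector_mult_def
        by (intro continuous_intros continuous_on_compose2[OF coupling_continuous[of UNIV]]) auto
      then have c: "(\<lambda>q. fst q \<bullet> (coupling (snd q) *v fst q :: real^'m)) \<in> borel_measurable (borel \<Otimes>\<^sub>M borel)"
        unfolding borel_prod by (rule borel_measurable_continuous_onI)
      have "(\<lambda>q. (coord n l (fst q), snd q)) \<in> measurable (G n \<Otimes>\<^sub>M borel) (borel \<Otimes>\<^sub>M borel)"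
        by (intro measurable_Pair measurable_compose[OF measurable_fst coord_meas] measurable_snd)
      from measurable_compose[OF this c] show ?thesis by simp
    qed
    then show ?thesis
      unfolding h_def case_prod_beta
      by (intro borel_measurable_times borel_measurable_sum measurable_compose[OF measurable_fst I_meas])
  qed
  \<comment> \<open>For integrability only: a crude comparison of operator norm and matrix norm
    dominates the integrand by a multiple of \<open>I R \<omega> * V n \<omega>\<close>.\<close>
  obtain K2 where K2: "\<And>A :: real^'m^'m. onorm ((*v) A) \<le> K2 * norm A" "0 \<le> K2"
  proof -
    have "onorm ((*v) A) \<le> real (CARD('m) * CARD('m)) * norm A" for A :: "real^'m^'m"
    proof -
      have "onorm ((*v) A) \<le> (\<Sum>i\<in>UNIV. \<Sum>j\<in>UNIV. \<bar>A $ i $ j\<bar>)" by (rule onorm_le_matrix_component_sum)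
      also have "\<dots> \<le> (\<Sum>i\<in>(UNIV :: 'm set). \<Sum>j\<in>(UNIV :: 'm set). norm A)"
        by (intro sum_mono) (rule order_trans[OF component_le_norm_cart Finite_Cartesian_Product.norm_nth_le])
      finally show ?thesis by simp
    qed
    then show ?thesis by (intro that[of "real (CARD('m) * CARD('m))"]) auto
  qed
  have hi: "integrable M (\<lambda>\<omega>. h (\<omega>, W n \<omega>))"
  proof (rule Bochner_Integration.integrable_bound)
    show "integrable M (\<lambda>\<omega>. (K2 * K) * (I R \<omega> * V n \<omega>))" using IV_integrable by simp
    show "AE \<omega> in M. norm (h (\<omega>, W n \<omega>)) \<le> norm ((K2 * K) * (I R \<omega> * V n \<omega>))"
      using W_stoch[of n]
    proof eventually_elim
      case (elim \<omega>)
      have "onorm ((*v) (coupling (W n \<omega>))) \<le> K2 * K"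
        using K2(1)[of "coupling (W n \<omega>)"] mult_left_mono[OF K[OF elim] K2(2)] by linarith
      then have "\<bar>coord n l \<omega> \<bullet> (coupling (W n \<omega>) *v coord n l \<omega>)\<bar> \<le> (norm (coord n l \<omega>))\<^sup>2 * (K2 * K)" for l
        using order_trans[OF quad mult_left_mono] by (metis zero_le_power2)
      then have "\<bar>\<Sum>l\<in>UNIV. coord n l \<omega> \<bullet> (coupling (W n \<omega>) *v coord n l \<omega>)\<bar> \<le> (\<Sum>l\<in>UNIV. (norm (coord n l \<omega>))\<^sup>2 * (K2 * K))"
        by (intro order_trans[OF sum_abs sum_mono])
      then have "\<bar>\<Sum>l\<in>UNIV. coord n l \<omega> \<bullet> (coupling (W n \<omega>) *v coord n l \<omega>)\<bar> \<le> (K2 * K) * V n \<omega>"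
        by (simp add: V_coord sum_distrib_left mult.commute)
      then show ?case
        using I_01(1)[of R \<omega>] by (auto simp: h_def)
    qed
    show "(\<lambda>\<omega>. h (\<omega>, W n \<omega>)) \<in> borel_measurable M"
    proof -
      have "(\<lambda>\<omega>. (\<omega>, W n \<omega>)) \<in> measurable M (G n \<Otimes>\<^sub>M borel)"
        using G_meas[of "\<lambda>\<omega>. \<omega>" n "G n"] by (intro measurable_Pair) auto
      from measurable_compose[OF this hm] show ?thesis .
    qed
  qed
  have FM: "?F \<in> borel_measurable M"
  proof -
    have [measurable]: "(\<lambda>\<omega>. W n \<omega> $ i $ j) \<in> borel_measurable M" for i j
      by (rule measurable_compose[OF W_M]) (intro borel_measurable_continuous_onI continuous_intros)
    show ?thesis by measurable
  qed
  show "integrable M ?F"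
    using hi by (rule integrable_cong_AE_imp[OF _ FM]) (use ae in auto)
  have "integral\<^sup>L M ?F = (LINT \<omega>|M. h (\<omega>, W n \<omega>))"
    using ae FM borel_measurable_integrable[OF hi] by (intro integral_cong_AE) auto
  also have "\<dots> = (LINT \<omega>|M. (LINT w|distr M borel (W n). h (\<omega>, w)))"
    by (rule freezing(1)[OF G_sub W_M W_indep hm hi])
  also have "\<dots> = (LINT \<omega>|M. h' \<omega>)" if "h' = (\<lambda>\<omega>. I R \<omega> * (\<Sum>l\<in>UNIV. coord n l \<omega> \<bullet> (\<Phi> *v coord n l \<omega>)))" for h'
  proof (intro Bochner_Integration.integral_cong refl)
    fix \<omega>
    have "(LINT w|distr M borel (W n). h (\<omega>, w)) = (LINT \<omega>'|M. h (\<omega>, W n \<omega>'))"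
    proof (rule integral_distr[OF W_M])
      have "(\<lambda>w. I R \<omega> * (\<Sum>l\<in>UNIV. coord n l \<omega> \<bullet> (coupling w *v coord n l \<omega>))) \<in> borel_measurable borel"
        by (rule measurable_compose[OF coupM])
           (intro borel_measurable_continuous_onI linear_continuous_on bl')
      then show "(\<lambda>w. h (\<omega>, w)) \<in> borel_measurable borel" by (simp add: h_def)
    qed
    also have "\<dots> = h' \<omega>"
      unfolding h_def that case_prod_conv \<Phi>_def by (rule integral_bounded_linear[OF bl' ic])
    finally show "(LINT w|distr M borel (W n). h (\<omega>, w)) = h' \<omega>" .
  qed
  also have "(LINT \<omega>|M. I R \<omega> * (\<Sum>l\<in>UNIV. coord n l \<omega> \<bullet> (\<Phi> *v coord n l \<omega>))) \<le> (LINT \<omega>|M. \<rho> * (I R \<omega> * V n \<omega>))"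
  proof (rule integral_mono)
    have le: "\<bar>I R \<omega> * (\<Sum>l\<in>UNIV. coord n l \<omega> \<bullet> (\<Phi> *v coord n l \<omega>))\<bar> \<le> \<rho> * (I R \<omega> * V n \<omega>)" for \<omega>
    proof -
      have \<Phi>: "onorm ((*v) \<Phi>) \<le> \<rho>"
        using W_contract[of n] unfolding \<Phi>_def coupling_def .
      have "\<bar>\<Sum>l\<in>UNIV. coord n l \<omega> \<bullet> (\<Phi> *v coord n l \<omega>)\<bar> \<le> (\<Sum>l\<in>UNIV. (norm (coord n l \<omega>))\<^sup>2 * \<rho>)"
        by (intro order_trans[OF sum_abs sum_mono] order_trans[OF quad mult_left_mono[OF \<Phi>]]) auto
      then have "\<bar>\<Sum>l\<in>UNIV. coord n l \<omega> \<bullet> (\<Phi> *v coord n l \<omega>)\<bar> \<le> \<rho> * V n \<omega>"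
        by (simp add: V_coord sum_distrib_left mult.commute)
      then show ?thesis using I_01(1)[of R \<omega>] by auto
    qed
    show "I R \<omega> * (\<Sum>l\<in>UNIV. coord n l \<omega> \<bullet> (\<Phi> *v coord n l \<omega>)) \<le> \<rho> * (I R \<omega> * V n \<omega>)" for \<omega>
      using le[of \<omega>] by linarith
    show "integrable M (\<lambda>\<omega>. \<rho> * (I R \<omega> * V n \<omega>))" using IV_integrable by simp
    have [measurable]: "coord n l \<in> borel_measurable M" for l by (rule G_meas[OF coord_meas])
    have [measurable]: "(\<lambda>\<omega>. \<Phi> *v coord n l \<omega>) \<in> borel_measurable M" for l
      by (rule measurable_compose[OF G_meas[OF coord_meas]])
         (intro borel_measurable_continuous_onI linear_continuous_on matrix_vector_mul_bounded_linear)
    show "integrable M (\<lambda>\<omega>. I R \<omega> * (\<Sum>l\<in>UNIV. coord n l \<omega> \<bullet> (\<Phi> *v coord n l \<omega>)))"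
      by (rule Bochner_Integration.integrable_bound[OF \<open>integrable M (\<lambda>\<omega>. \<rho> * (I R \<omega> * V n \<omega>))\<close>])
         (use le in \<open>auto intro: order_trans[OF _ abs_ge_self]\<close>)
  qed
  finally show "integral\<^sup>L M ?F \<le> \<rho> * (LINT \<omega>|M. I R \<omega> * V n \<omega>)" by simp
qed

end

text \<open>Toeplitz: the finitely many terms with large \<open>c\<close> contribute a bounded
  amount, which the divergent sum of the weights outweighs.\<close>

lemma weighted_average_tendsto_0:
  fixes g c :: "nat \<Rightarrow> real"
  assumes g: "\<And>n. 0 \<le> g n" and div: "filterlim (\<lambda>n. \<Sum>i<n. g i) at_top sequentially"
    and c: "c \<longlonglongrightarrow> 0" and c0: "\<And>n. 0 \<le> c n"
  shows "(\<lambda>n. (\<Sum>i<n. g i * c i) / (\<Sum>i<n. g i)) \<longlonglongrightarrow> 0"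
proof (rule tendstoI)
  fix e :: real assume e: "0 < e"
  let ?S = "\<lambda>n. \<Sum>i<n. g i"
  have "\<forall>\<^sub>F n in sequentially. c n < e / 2" using c e by (intro order_tendstoD(2)) auto
  then obtain k where k: "\<And>n. n \<ge> k \<Longrightarrow> c n < e / 2" unfolding eventually_sequentially by blast
  define A where "A = (\<Sum>i<k. g i * c i)"
  have "\<forall>\<^sub>F n in sequentially. max 1 (4 * A / e) \<le> ?S n"
    using div unfolding filterlim_at_top by blast
  then show "\<forall>\<^sub>F n in sequentially. dist ((\<Sum>i<n. g i * c i) / ?S n) 0 < e"
    using eventually_ge_at_top[of k]
  proof eventually_elim
    case (elim n)
    have S: "1 \<le> ?S n" "4 * A / e \<le> ?S n" using elim by auto
    have "(\<Sum>i<n. g i * c i) = A + (\<Sum>i=k..<n. g i * c i)"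
      unfolding A_def lessThan_atLeast0 by (rule sum.atLeastLessThan_concat[symmetric]) (simp_all add: elim)
    also have "(\<Sum>i=k..<n. g i * c i) \<le> (\<Sum>i=k..<n. g i * (e / 2))"
      using k g by (intro sum_mono mult_left_mono) (auto simp: less_imp_le)
    also have "\<dots> = (\<Sum>i=k..<n. g i) * (e / 2)" by (simp add: sum_distrib_right)
    also have "\<dots> \<le> ?S n * (e / 2)"
      using g e by (intro mult_right_mono sum_mono2) auto
    finally have "(\<Sum>i<n. g i * c i) \<le> A + ?S n * (e / 2)" by simp
    moreover have "A \<le> ?S n * (e / 4)" using S(2) e by (simp add: field_simps)
    moreover have "0 < ?S n * e" using S(1) e by simp
    ultimately have "(\<Sum>i<n. g i * c i) < ?S n * e" by simp
    then have "(\<Sum>i<n. g i * c i) / ?S n < e" using S(1) by (simp add: divide_less_eq mult.commute)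
    moreover have "0 \<le> (\<Sum>i<n. g i * c i) / ?S n"
      using S(1) g c0 by (intro divide_nonneg_nonneg sum_nonneg mult_nonneg_nonneg) auto
    ultimately show ?case by (simp add: dist_real_def)
  qed
qed

text \<open>Dividing by the scale \<open>h\<close> costs the factor h n / h (Suc n), which is
  eventually at most 1 + c g n / 2 by the ratio condition; this uses up half of the contraction. The
  halved rate, and the bound 2 on that factor in front of \<open>b\<close>, give 4 b / c. The scales
  will be \<open>g\<close> for second moments and its square root for first moments.\<close>

lemma scaled_contraction:
  fixes u g h :: "nat \<Rightarrow> real"
  assumes g: "\<And>n. 0 < g n" and g0: "g \<longlonglongrightarrow> 0" and div: "filterlim (\<lambda>n. \<Sum>i<n. g i) at_top sequentially"
    and ratio: "(\<lambda>n. (g n / g (Suc n) - 1) / g n) \<longlonglongrightarrow> 0"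
    and h: "\<And>n. 0 < h n" and hr: "\<And>n. h n / h (Suc n) \<le> g n / g (Suc n)"
    and u: "\<forall>\<^sub>F n in sequentially. u (Suc n) \<le> (1 - c * g n) * u n + g n * (b * h n)" and u0: "\<And>n. 0 \<le> u n"
    and c: "0 < c" and b: "0 \<le> b" and e: "0 < e"
  shows "\<forall>\<^sub>F n in sequentially. u n \<le> (4 * b / c + e) * h n"
proof -
  define w where "w n = u n / h n" for n
  have cg: "\<forall>\<^sub>F n in sequentially. c * g n < 1"
  proof (rule order_tendstoD(2))
    show "(\<lambda>n. c * g n) \<longlonglongrightarrow> c * 0" by (intro tendsto_intros g0)
  qed simp
  have R: "\<forall>\<^sub>F n in sequentially. (g n / g (Suc n) - 1) / g n < c / 2"
    using ratio c by (intro order_tendstoD(2)) auto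
  have "\<forall>\<^sub>F n in sequentially. w (Suc n) \<le> (1 - c / 2 * g n) * w n + g n * (2 * b)"
    using u cg R
  proof eventually_elim
    case (elim n)
    have r: "g n / g (Suc n) \<le> 1 + c / 2 * g n" using elim(3) unfolding pos_divide_less_eq[OF g[of n]] by linarith
    have w0: "0 \<le> w n" using u0[of n] h[of n] by (simp add: w_def)
    have "w (Suc n) \<le> ((1 - c * g n) * u n + g n * (b * h n)) / h (Suc n)"
      unfolding w_def using elim(1) h[of "Suc n"] by (intro divide_right_mono) auto
    also have "\<dots> = (h n / h (Suc n)) * ((1 - c * g n) * w n + g n * b)"
      using h[of n] h[of "Suc n"] by (simp add: w_def field_simps)
    also have "\<dots> \<le> (1 + c / 2 * g n) * ((1 - c * g n) * w n + g n * b)"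
      using elim(2) w0 g[of n] b order_trans[OF hr r] by (intro mult_right_mono add_nonneg_nonneg mult_nonneg_nonneg) auto
    also have "\<dots> \<le> (1 - c / 2 * g n) * w n + g n * (2 * b)"
    proof -
      have "(1 + c / 2 * g n) * (1 - c * g n) \<le> 1 - c / 2 * g n"
        using mult_nonneg_nonneg[of "c * g n" "c * g n"] c g[of n] by (simp add: algebra_simps)
      then have "(1 + c / 2 * g n) * (1 - c * g n) * w n \<le> (1 - c / 2 * g n) * w n"
        using w0 by (rule mult_right_mono)
      moreover have "(1 + c / 2 * g n) * (g n * b) \<le> 2 * (g n * b)"
        using elim(2) g[of n] b by (intro mult_right_mono) auto
      ultimately show ?thesis by (simp add: algebra_simps)
    qed
    finally show ?case .
  qed
  then have "\<forall>\<^sub>F n in sequentially. w n \<le> 2 * b / (c / 2) + e"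
    by (rule contraction_eventually_le)
       (use g div c e cg in \<open>auto simp: less_imp_le elim: eventually_mono\<close>)
  then show ?thesis
    by eventually_elim (use h in \<open>simp add: w_def pos_divide_le_eq\<close>)
qed

section \<open>Rates of consensus and the direction of the average\<close>

context dual_averaging
begin

lemma g_lim: "g \<longlonglongrightarrow> 0"
  using tendsto_real_sqrt[OF summable_LIMSEQ_zero[OF g_sq]] g_pos by (simp add: less_imp_le)

lemma ratio_lim: "(\<lambda>n. g n / g (Suc n)) \<longlonglongrightarrow> 1"
proof -
  have "(\<lambda>n. 1 + g n * ((g n / g (Suc n) - 1) / g n)) \<longlonglongrightarrow> 1 + 0 * 0"
    by (intro tendsto_intros g_lim ratio)
  moreover have "1 + g n * ((g n / g (Suc n) - 1) / g n) = g n / g (Suc n)" for n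
    using g_pos[of n] by simp
  ultimately show ?thesis by simp
qed

definition u where "u R n = (LINT \<omega>|M. I R \<omega> * V n \<omega>)"

lemma u_nonneg: "0 \<le> u R n"
  unfolding u_def using I_01(2) V_nonneg by (intro Bochner_Integration.integral_nonneg mult_nonneg_nonneg)

lemma norm_diff_sq_le:
  fixes a b :: "'c::real_inner"
  assumes "0 < (t::real)"
  shows "(norm (a - b))\<^sup>2 \<le> (1 + t) * (norm a)\<^sup>2 + (1 + 1 / t) * (norm b)\<^sup>2"
proof -
  have "0 \<le> (norm (t *\<^sub>R a + b))\<^sup>2 / t" using assms by simp
  also have "\<dots> = t * (norm a)\<^sup>2 + 2 * (a \<bullet> b) + (norm b)\<^sup>2 / t"
    using assms unfolding power2_norm_eq_inner
    by (simp add: inner_add_left inner_add_right inner_commute[of b a] power2_eq_square field_simps)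
  finally show ?thesis
    unfolding power2_norm_eq_inner by (simp add: inner_diff_left inner_diff_right inner_commute[of b a] algebra_simps)
qed

text \<open>Young's inequality with this parameter enlarges the contraction factor
  \<open>\<rho>\<close> to (1 + \<theta>) \<rho>, which is still below 1.\<close>

definition \<theta> where "\<theta> = (1 - \<rho>) / 2"
definition K\<^sub>u where "K\<^sub>u = (1 + 1 / \<theta>) * (4 * real CARD('m)) * (1 + C\<^sub>\<Lambda>)"

lemma \<theta>: "0 < \<theta>" "0 \<le> (1 + \<theta>) * \<rho>" "(1 + \<theta>) * \<rho> < 1"
proof -
  show t: "0 < \<theta>" using \<rho> by (simp add: \<theta>_def)
  then show "0 \<le> (1 + \<theta>) * \<rho>" using \<rho> by simp
  have "0 < (1 - \<rho>) * (2 - \<rho>)" using \<rho> by simp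
  then show "(1 + \<theta>) * \<rho> < 1" by (simp add: \<theta>_def field_simps)
qed

text \<open>The deviations are mixed and then shifted by \<open>g n\<close> times a gradient minus
  the average gradient, a difference of norm at most 2 \<open>\<Lambda> n\<close>. Its square,
  summed over the agents, explains the factor 4 m in \<open>K\<^sub>u\<close>. The mixed part
  contracts in expectation, and Young's inequality separates the two.\<close>

lemma u_Suc: "u R (Suc n) \<le> (1 + \<theta>) * \<rho> * u R n + K\<^sub>u * (g n)\<^sup>2"
proof -
  let ?F = "\<lambda>\<omega>. I R \<omega> * (\<Sum>j\<in>UNIV. (norm (\<Sum>i\<in>UNIV. (W n \<omega> $ j $ i) *\<^sub>R y n i \<omega>))\<^sup>2)"
  let ?m = "real CARD('m)"
  let ?B = "\<lambda>\<omega>. (1 + \<theta>) * ?F \<omega> + (1 + 1 / \<theta>) * (4 * ?m) * (g n)\<^sup>2 * (\<Lambda> n \<omega>)\<^sup>2"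
  have B: "integrable M ?B"
    using mixing_contraction(1) \<Lambda>_sq(1) by (intro Bochner_Integration.integrable_add integrable_mult_right)
  have "u R (Suc n) \<le> integral\<^sup>L M ?B"
    unfolding u_def
  proof (rule integral_mono_AE[OF IV_integrable B])
    show "AE \<omega> in M. I R \<omega> * V (Suc n) \<omega> \<le> ?B \<omega>"
      using zb_Suc W_stoch[of n]
    proof eventually_elim
      case (elim \<omega>)
      define gb where "gb = (1 / ?m) *\<^sub>R (\<Sum>j\<in>UNIV. gr j (x n j \<omega>) (xi n j \<omega>))"
      define wy where "wy j = (\<Sum>i\<in>UNIV. (W n \<omega> $ j $ i) *\<^sub>R y n i \<omega>)" for j
      have gb: "norm gb \<le> \<Lambda> n \<omega>"
      proof -
        have "norm (\<Sum>j\<in>UNIV. gr j (x n j \<omega>) (xi n j \<omega>)) \<le> (\<Sum>j\<in>(UNIV :: 'm set). \<Lambda> n \<omega>)"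
          by (rule order_trans[OF norm_sum sum_mono]) (rule gr_le_\<Lambda>[OF x_X])
        then show ?thesis by (simp add: gb_def divide_le_eq mult.commute)
      qed
      have yS: "y (Suc n) j \<omega> = wy j - g n *\<^sub>R (gr j (x n j \<omega>) (xi n j \<omega>) - gb)" for j
      proof -
        have "wy j = (\<Sum>i\<in>UNIV. (W n \<omega> $ j $ i) *\<^sub>R z n i \<omega>) - (\<Sum>i\<in>UNIV. W n \<omega> $ j $ i) *\<^sub>R zb n \<omega>"
          by (simp add: wy_def y_def scaleR_diff_right sum_subtractf scaleR_sum_left)
        also have "(\<Sum>i\<in>UNIV. W n \<omega> $ j $ i) = 1" using elim(2) by (simp add: doubly_stochastic_def)
        finally have "wy j = (\<Sum>i\<in>UNIV. (W n \<omega> $ j $ i) *\<^sub>R z n i \<omega>) - zb n \<omega>" by simp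
        moreover have "zb (Suc n) \<omega> = zb n \<omega> - g n *\<^sub>R gb"
          using elim(1)[rule_format, of n] unfolding gb_def .
        ultimately show ?thesis
          by (simp add: y_def z_Suc x_def[symmetric] scaleR_diff_right)
      qed
      have "(norm (y (Suc n) j \<omega>))\<^sup>2 \<le> (1 + \<theta>) * (norm (wy j))\<^sup>2 + (1 + 1 / \<theta>) * (4 * (g n)\<^sup>2 * (\<Lambda> n \<omega>)\<^sup>2)" for j
      proof -
        have "norm (g n *\<^sub>R (gr j (x n j \<omega>) (xi n j \<omega>) - gb)) \<le> g n * (2 * \<Lambda> n \<omega>)"
        proof -
          have "norm (gr j (x n j \<omega>) (xi n j \<omega>) - gb) \<le> 2 * \<Lambda> n \<omega>"
            using norm_triangle_ineq4[of "gr j (x n j \<omega>) (xi n j \<omega>)" gb] gb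
              gr_le_\<Lambda>[of "x n j \<omega>" j n \<omega>, OF x_X] by linarith
          then show ?thesis using g_pos[of n] by (simp add: mult_left_mono)
        qed
        then have "(norm (g n *\<^sub>R (gr j (x n j \<omega>) (xi n j \<omega>) - gb)))\<^sup>2 \<le> (g n * (2 * \<Lambda> n \<omega>))\<^sup>2"
          by (intro power_mono) auto
        also have "\<dots> = 4 * (g n)\<^sup>2 * (\<Lambda> n \<omega>)\<^sup>2" by (simp add: power_mult_distrib)
        finally have "(1 + 1 / \<theta>) * (norm (g n *\<^sub>R (gr j (x n j \<omega>) (xi n j \<omega>) - gb)))\<^sup>2 \<le> (1 + 1 / \<theta>) * (4 * (g n)\<^sup>2 * (\<Lambda> n \<omega>)\<^sup>2)"
          using \<theta>(1) by (intro mult_left_mono) auto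
        then show ?thesis
          using norm_diff_sq_le[OF \<theta>(1), of "wy j" "g n *\<^sub>R (gr j (x n j \<omega>) (xi n j \<omega>) - gb)"] yS[of j] by simp
      qed
      then have "V (Suc n) \<omega> \<le> (\<Sum>j\<in>UNIV. (1 + \<theta>) * (norm (wy j))\<^sup>2 + (1 + 1 / \<theta>) * (4 * (g n)\<^sup>2 * (\<Lambda> n \<omega>)\<^sup>2))"
        unfolding V_def by (rule sum_mono)
      also have "\<dots> = (1 + \<theta>) * (\<Sum>j\<in>UNIV. (norm (wy j))\<^sup>2) + (1 + 1 / \<theta>) * (4 * ?m) * (g n)\<^sup>2 * (\<Lambda> n \<omega>)\<^sup>2"
        by (simp add: sum.distrib sum_distrib_left)
      finally show ?case
        using I_01(1)[of R \<omega>] \<theta>(1) by (auto simp: wy_def)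
    qed
  qed
  also have "\<dots> = (1 + \<theta>) * integral\<^sup>L M ?F + (1 + 1 / \<theta>) * (4 * ?m) * (g n)\<^sup>2 * (LINT \<omega>|M. (\<Lambda> n \<omega>)\<^sup>2)"
    using mixing_contraction(1)[of R n] \<Lambda>_sq(1)[of n] by simp
  also have "\<dots> \<le> (1 + \<theta>) * (\<rho> * u R n) + (1 + 1 / \<theta>) * (4 * ?m) * (g n)\<^sup>2 * (1 + C\<^sub>\<Lambda>)"
    using mixing_contraction(2)[of R n] \<Lambda>_sq(2)[of n] \<theta>(1) unfolding u_def
    by (intro add_mono mult_left_mono) auto
  finally show ?thesis by (simp add: K\<^sub>u_def mult_ac)
qed

lemma K\<^sub>u_nonneg: "0 \<le> K\<^sub>u" unfolding K\<^sub>u_def using \<theta>(1) C\<^sub>\<Lambda>_nonneg by simp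

text \<open>Summing the recursion leaves a multiple of the sum of squared steps. Summability yields
  almost sure consensus, whereas the rate relative to \<open>g\<close> serves for the
  remainder.\<close>

lemma u_summable: "summable (u R)"
proof -
  define \<kappa> where "\<kappa> = (1 + \<theta>) * \<rho>"
  define Q where "Q = (\<Sum>i. (g i)\<^sup>2)"
  have \<kappa>: "0 \<le> \<kappa>" "\<kappa> < 1" using \<theta> by (auto simp: \<kappa>_def)
  show ?thesis
  proof (rule summableI_nonneg_bounded)
    fix n
    have "(\<Sum>i<n. u R i) \<le> (\<Sum>i<Suc n. u R i)" using u_nonneg by simp
    also have "\<dots> = u R 0 + (\<Sum>i<n. u R (Suc i))" by (rule sum.lessThan_Suc_shift)
    also have "(\<Sum>i<n. u R (Suc i)) \<le> (\<Sum>i<n. \<kappa> * u R i + K\<^sub>u * (g i)\<^sup>2)"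
      by (intro sum_mono) (simp add: \<kappa>_def u_Suc)
    also have "\<dots> = \<kappa> * (\<Sum>i<n. u R i) + K\<^sub>u * (\<Sum>i<n. (g i)\<^sup>2)" by (simp add: sum.distrib sum_distrib_left)
    also have "K\<^sub>u * (\<Sum>i<n. (g i)\<^sup>2) \<le> K\<^sub>u * Q"
      unfolding Q_def using K\<^sub>u_nonneg by (intro mult_left_mono sum_le_suminf[OF g_sq]) auto
    finally have "(1 - \<kappa>) * (\<Sum>i<n. u R i) \<le> u R 0 + K\<^sub>u * Q" by (simp add: algebra_simps)
    then show "(\<Sum>i<n. u R i) \<le> (u R 0 + K\<^sub>u * Q) / (1 - \<kappa>)"
      using \<kappa> by (simp add: le_divide_eq mult.commute)
  qed (rule u_nonneg)
qed

text \<open>The ratio of consecutive steps tends to 1, so u / g still contracts at a fixed rate,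
  with an inhomogeneity of order \<open>g\<close>.\<close>

lemma u_over_g: "(\<lambda>n. u R n / g n) \<longlonglongrightarrow> 0"
proof -
  define \<kappa> where "\<kappa> = (1 + \<theta>) * \<rho>"
  have \<kappa>: "0 \<le> \<kappa>" "\<kappa> < 1" using \<theta> by (auto simp: \<kappa>_def)
  have r: "(\<lambda>n. \<kappa> * (g n / g (Suc n))) \<longlonglongrightarrow> \<kappa> * 1" by (intro tendsto_intros ratio_lim)
  have ev: "\<forall>\<^sub>F n in sequentially. \<kappa> * (g n / g (Suc n)) < (1 + \<kappa>) / 2"
    using order_tendstoD(2)[OF r, of "(1 + \<kappa>) / 2"] \<kappa> by simp
  show ?thesis
  proof (rule contraction_tendsto_0'[where c = "(1 - \<kappa>) / 2" and g = "\<lambda>_. 1" and b = "\<lambda>n. K\<^sub>u * g n * (g n / g (Suc n))"])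
    show "\<forall>\<^sub>F n in sequentially. u R (Suc n) / g (Suc n)
        \<le> (1 - (1 - \<kappa>) / 2 * 1) * (u R n / g n) + 1 * (K\<^sub>u * g n * (g n / g (Suc n)))"
      using ev
    proof eventually_elim
      case (elim n)
      have "u R (Suc n) / g (Suc n) \<le> (\<kappa> * u R n + K\<^sub>u * (g n)\<^sup>2) / g (Suc n)"
        using u_Suc[of R n] g_pos[of "Suc n"] by (intro divide_right_mono) (auto simp: \<kappa>_def)
      also have "\<dots> = \<kappa> * (g n / g (Suc n)) * (u R n / g n) + K\<^sub>u * g n * (g n / g (Suc n))"
        using g_pos[of n] by (simp add: add_divide_distrib power2_eq_square)
      also have "\<kappa> * (g n / g (Suc n)) * (u R n / g n) \<le> (1 + \<kappa>) / 2 * (u R n / g n)"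
        using elim u_nonneg[of R n] g_pos[of n] by (intro mult_right_mono) auto
      finally show ?case by (simp add: field_simps)
    qed
    have "(\<lambda>n. K\<^sub>u * g n * (g n / g (Suc n))) \<longlonglongrightarrow> K\<^sub>u * 0 * 1" by (intro tendsto_intros g_lim ratio_lim)
    then show "(\<lambda>n. K\<^sub>u * g n * (g n / g (Suc n))) \<longlonglongrightarrow> 0" by simp
    show "filterlim (\<lambda>n. \<Sum>i<n. (1::real)) at_top sequentially" by (simp add: filterlim_real_sequentially)
    show "0 \<le> u R n / g n" for n using u_nonneg[of R n] g_pos[of n] by simp
  qed (use \<kappa> in auto)
qed

lemma start_exhausts: "\<omega> \<in> space M \<Longrightarrow> \<exists>R. \<forall>R'\<ge>R. \<omega> \<in> start (real R')" for R :: nat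
proof -
  assume \<omega>: "\<omega> \<in> space M"
  obtain R where R: "(\<Sum>j\<in>UNIV. norm (z 0 j \<omega>)) \<le> real R" using real_arch_simple by blast
  have "norm (z 0 j \<omega>) \<le> real R" for j
    using member_le_sum[of j UNIV "\<lambda>j. norm (z 0 j \<omega>)"] R by simp
  then have "norm (z 0 j \<omega>) \<le> real R'" if "R \<le> R'" for j R'
    using that by (meson of_nat_mono order_trans)
  then show ?thesis using \<omega> by (intro exI[of _ R]) (auto simp: start_def)
qed

lemma consensus: "AE \<omega> in M. \<forall>j. (\<lambda>n. y n j \<omega>) \<longlonglongrightarrow> 0"
proof -
  have "AE \<omega> in M. \<forall>R::nat. (\<lambda>n. I (real R) \<omega> * V n \<omega>) \<longlonglongrightarrow> 0"
    unfolding AE_all_countable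
    using u_summable by (intro allI AE_tendsto_0_summable IV_integrable) (auto simp: u_def[abs_def] I_01(2) V_nonneg)
  then show ?thesis
    using AE_space
  proof eventually_elim
    case (elim \<omega>)
    obtain R where "\<omega> \<in> start (real R)" using start_exhausts[OF elim(2)] by blast
    then have V: "(\<lambda>n. V n \<omega>) \<longlonglongrightarrow> 0" using elim(1)[rule_format, of R] by (simp add: I_def)
    show ?case
    proof
      fix j
      have "(\<lambda>n. (norm (y n j \<omega>))\<^sup>2) \<longlonglongrightarrow> 0"
      proof (rule tendsto_sandwich[OF _ _ tendsto_const V])
        show "\<forall>\<^sub>F n in sequentially. (norm (y n j \<omega>))\<^sup>2 \<le> V n \<omega>"
          unfolding V_def by (intro always_eventually allI member_le_sum) auto
      qed simp
      from tendsto_real_sqrt[OF this] show "(\<lambda>n. y n j \<omega>) \<longlonglongrightarrow> 0"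
        by (simp add: tendsto_norm_zero_iff)
    qed
  qed
qed

lemma x_xb_le: "norm (x n j \<omega> - xb n \<omega>) \<le> norm (y n j \<omega>)"
  using closest_point_lipschitz[OF X(2,1) X_ne, of "z n j \<omega>" "zb n \<omega>"]
  by (simp add: x_def xb_def y_def dist_norm)

lemma xb_limit: "AE \<omega> in M. (\<lambda>n. xb n \<omega>) \<longlonglongrightarrow> xs"
  using limit by (simp add: xb_def zb_def)

lemma x_limit: "AE \<omega> in M. \<forall>j. (\<lambda>n. x n j \<omega>) \<longlonglongrightarrow> xs"
  using consensus xb_limit
proof eventually_elim
  case (elim \<omega>)
  show ?case
  proof
    fix j
    have "(\<lambda>n. x n j \<omega> - xb n \<omega>) \<longlonglongrightarrow> 0"
      by (rule Lim_null_comparison[OF _ tendsto_norm_zero[OF elim(1)[rule_format, of j]]]) (simp add: x_xb_le)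
    from tendsto_add[OF this elim(2)] show "(\<lambda>n. x n j \<omega>) \<longlonglongrightarrow> xs" by simp
  qed
qed

definition gb where "gb = (1 / real CARD('m)) *\<^sub>R (\<Sum>j\<in>(UNIV :: 'm set). mg j xs)"

text \<open>\<open>zb n\<close> is its initial value minus S gb, minus the weighted sum of the drift
  errors, minus the martingale. The drift errors vanish by convergence of the iterates, so their
  weighted sum is o(S); the martingale is o(S) by \<open>Mart_over_S\<close>.\<close>

lemma zb_over_S: "AE \<omega> in M. (\<lambda>n. norm (zb n \<omega> + S n *\<^sub>R gb) / S n) \<longlonglongrightarrow> 0"
  using zb_Suc x_limit Mart_over_S
proof eventually_elim
  case (elim \<omega>)
  let ?m = "real CARD('m)"
  define r where "r n = (1 / ?m) *\<^sub>R (\<Sum>j\<in>UNIV. mg j (x n j \<omega>)) - gb" for n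
  have zb: "zb n \<omega> + S n *\<^sub>R gb = zb 0 \<omega> - (\<Sum>i<n. g i *\<^sub>R r i) - Mart n \<omega>" for n
  proof (induction n)
    case (Suc n)
    have "(1 / ?m) *\<^sub>R (\<Sum>j\<in>UNIV. gr j (x n j \<omega>) (xi n j \<omega>)) = r n + gb + \<epsilon> n \<omega>"
      by (simp add: r_def \<epsilon>_def noise_def sum_subtractf scaleR_diff_right)
    then have "zb (Suc n) \<omega> = zb n \<omega> - g n *\<^sub>R (r n + gb + \<epsilon> n \<omega>)"
      using elim(1)[rule_format, of n] by (simp only:)
    then have "zb (Suc n) \<omega> + S (Suc n) *\<^sub>R gb = (zb n \<omega> + S n *\<^sub>R gb) - g n *\<^sub>R r n - g n *\<^sub>R \<epsilon> n \<omega>"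
      by (simp add: S_def scaleR_add_left scaleR_add_right)
    also have "\<dots> = zb 0 \<omega> - (\<Sum>i<Suc n. g i *\<^sub>R r i) - Mart (Suc n) \<omega>"
      unfolding Suc Mart_Suc by simp
    finally show ?case .
  qed (simp add: S_def Mart_def)
  have r_le: "norm (r n) \<le> (\<Sum>j\<in>UNIV. L * norm (x n j \<omega> - xs))" for n
  proof -
    have "r n = (1 / ?m) *\<^sub>R (\<Sum>j\<in>UNIV. mg j (x n j \<omega>) - mg j xs)"
      by (simp add: r_def gb_def sum_subtractf scaleR_diff_right)
    then have "norm (r n) = 1 / ?m * norm (\<Sum>j\<in>UNIV. mg j (x n j \<omega>) - mg j xs)" by simp
    also have "\<dots> \<le> 1 * (\<Sum>j\<in>UNIV. L * norm (x n j \<omega> - xs))"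
      by (intro mult_mono order_trans[OF norm_sum sum_mono] mg_Lipschitz x_X X) (auto simp: Suc_leI)
    finally show ?thesis by simp
  qed
  have "(\<lambda>n. \<Sum>j\<in>UNIV. L * norm (x n j \<omega> - xs)) \<longlonglongrightarrow> (\<Sum>j\<in>(UNIV :: 'm set). L * norm (xs - xs))"
    using elim(2) by (intro tendsto_intros) auto
  then have "(\<lambda>n. \<Sum>j\<in>UNIV. L * norm (x n j \<omega> - xs)) \<longlonglongrightarrow> 0" by simp
  then have "(\<lambda>n. (\<Sum>i<n. g i * (\<Sum>j\<in>UNIV. L * norm (x i j \<omega> - xs))) / (\<Sum>i<n. g i)) \<longlonglongrightarrow> 0"
    using g_pos g_div L by (intro weighted_average_tendsto_0) (auto simp: less_imp_le intro!: sum_nonneg)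
  moreover have "(\<lambda>n. norm (zb 0 \<omega>) / S n) \<longlonglongrightarrow> 0"
    by (rule real_tendsto_divide_at_top[OF tendsto_const S_lim])
  ultimately have "(\<lambda>n. norm (zb 0 \<omega>) / S n + (\<Sum>i<n. g i * (\<Sum>j\<in>UNIV. L * norm (x i j \<omega> - xs))) / S n
      + norm (Mart n \<omega>) / S n) \<longlonglongrightarrow> 0 + 0 + 0"
    unfolding S_def[symmetric] by (intro tendsto_add elim(3))
  then have lim: "(\<lambda>n. norm (zb 0 \<omega>) / S n + (\<Sum>i<n. g i * (\<Sum>j\<in>UNIV. L * norm (x i j \<omega> - xs))) / S n
      + norm (Mart n \<omega>) / S n) \<longlonglongrightarrow> 0" by simp
  show ?case
  proof (rule tendsto_sandwich[OF _ _ tendsto_const lim])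
    have S0: "0 \<le> S n" for n unfolding S_def using g_pos by (intro sum_nonneg) (auto simp: less_imp_le)
    show "\<forall>\<^sub>F n in sequentially. 0 \<le> norm (zb n \<omega> + S n *\<^sub>R gb) / S n" using S0 by simp
    show "\<forall>\<^sub>F n in sequentially. norm (zb n \<omega> + S n *\<^sub>R gb) / S n \<le> norm (zb 0 \<omega>) / S n
        + (\<Sum>i<n. g i * (\<Sum>j\<in>UNIV. L * norm (x i j \<omega> - xs))) / S n + norm (Mart n \<omega>) / S n"
    proof (intro always_eventually allI)
      fix n
      have "norm (\<Sum>i<n. g i *\<^sub>R r i) \<le> (\<Sum>i<n. g i * (\<Sum>j\<in>UNIV. L * norm (x i j \<omega> - xs)))"
        using r_le g_pos by (intro order_trans[OF norm_sum sum_mono]) (simp add: abs_of_pos mult_left_mono less_imp_le)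
      then have "norm (zb n \<omega> + S n *\<^sub>R gb) \<le> norm (zb 0 \<omega>)
        + (\<Sum>i<n. g i * (\<Sum>j\<in>UNIV. L * norm (x i j \<omega> - xs))) + norm (Mart n \<omega>)"
        unfolding zb using norm_triangle_ineq4[of "zb 0 \<omega> - (\<Sum>i<n. g i *\<^sub>R r i)" "Mart n \<omega>"]
          norm_triangle_ineq4[of "zb 0 \<omega>" "\<Sum>i<n. g i *\<^sub>R r i"] by linarith
      from divide_right_mono[OF this S0[of n]]
      show "norm (zb n \<omega> + S n *\<^sub>R gb) / S n \<le> norm (zb 0 \<omega>) / S n
        + (\<Sum>i<n. g i * (\<Sum>j\<in>UNIV. L * norm (x i j \<omega> - xs))) / S n + norm (Mart n \<omega>) / S n"
        by (simp add: add_divide_distrib)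
    qed
  qed
qed

end

section \<open>Identification and comparison with the linear recursion\<close>

lemma (in prob_space) expectation_abs_le_sqrt:
  fixes f :: "'a \<Rightarrow> real"
  assumes [measurable]: "f \<in> borel_measurable M" and i: "integrable M (\<lambda>\<omega>. (f \<omega>)\<^sup>2)"
  shows "integrable M f" "(LINT \<omega>|M. f \<omega>) \<le> sqrt (LINT \<omega>|M. (f \<omega>)\<^sup>2)"
proof -
  show f: "integrable M f" by (rule square_integrable_imp_integrable[OF _ i]) simp
  have "0 \<le> variance f" by (rule variance_positive)
  then have "(LINT \<omega>|M. f \<omega>)\<^sup>2 \<le> (LINT \<omega>|M. (f \<omega>)\<^sup>2)"
    using variance_eq[OF f i] by simp
  then show "(LINT \<omega>|M. f \<omega>) \<le> sqrt (LINT \<omega>|M. (f \<omega>)\<^sup>2)"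
    by (rule real_le_rsqrt)
qed

text \<open>Continuity of single gradients in the point is demanded only after projection: this
  removes the directions in which the gradient of a function convex on \<open>X\<close> may be
  discontinuous at \<open>xs\<close>. The mean gradients are governed by \<open>expansion\<close>
  instead.\<close>

locale polyhedral_dual_averaging = dual_averaging M X xs gr xi law W g z G L0 p L \<rho>
  for M :: "'w measure" and X :: "(real^'d) set" and xs
    and gr :: "'m::finite \<Rightarrow> real^'d \<Rightarrow> real^'q \<Rightarrow> real^'d"
    and xi law W g z G L0 p L \<rho> +
  fixes B :: "real^'d^'d1" and b and C :: "real^'d^'d2" and c and Hf :: "real^'d^'d" and c0 eps \<mu> :: real
  assumes X_feasible: "X = feasible B b C c"
    and active: "B *v xs = b" and inactive: "\<And>i. (C *v xs) $ i < c $ i"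
    and cq: "- (\<Sum>j\<in>UNIV. LINT s|law j. gr j xs s) \<in> rel_interior {transpose B *v l | l. \<forall>i. 0 \<le> l $ i}"
    and expansion: "\<And>v. v \<in> X \<Longrightarrow> norm (v - xs) \<le> eps \<Longrightarrow>
      norm ((\<Sum>j\<in>UNIV. LINT s|law j. gr j v s) - (\<Sum>j\<in>UNIV. LINT s|law j. gr j xs s) - Hf *v (v - xs)) \<le> c0 * (norm (v - xs))\<^sup>2"
    and c0: "0 < c0" and eps: "0 < eps" and \<mu>: "0 < \<mu>"
    and second_order: "\<And>v. B *v v = 0 \<Longrightarrow> \<mu> * (norm v)\<^sup>2 \<le> v \<bullet> (Hf *v v)"
    and tangential_continuity: "\<And>j s. continuous (at xs within X) (\<lambda>v. null_proj B *v gr j v s)"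
begin

definition P where "P = null_proj B"
definition H where "H = (1 / real CARD('m)) *\<^sub>R (P ** Hf ** P)"
definition \<kappa> where "\<kappa> = \<mu> / real CARD('m)"

lemma \<kappa>_pos: "0 < \<kappa>" using \<mu> by (simp add: \<kappa>_def)

lemma P_iff: "P *v v = v \<longleftrightarrow> B *v v = 0"
  using null_proj_kernel(1,2)[of B v] unfolding P_def by metis

lemma P_idem: "P *v (P *v v) = P *v v" using null_proj_kernel(1)[of B v] by (simp add: P_iff) (simp add: P_def)

lemma P_inner: "(P *v v) \<bullet> w = v \<bullet> (P *v w)" unfolding P_def by (rule null_proj_self_adjoint)

lemma norm_P_le: "norm (P *v v) \<le> norm v" unfolding P_def by (rule norm_null_proj_le)

lemma P_gradient: "P *v (\<Sum>j\<in>UNIV. mg j xs) = 0"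
proof -
  obtain l where "- (\<Sum>j\<in>UNIV. mg j xs) = transpose B *v l"
    using cq rel_interior_subset unfolding mg_def[symmetric] by blast
  then have "P *v - (\<Sum>j\<in>UNIV. mg j xs) = 0" by (simp add: P_def null_proj_kernel(3))
  then show ?thesis by (simp add: vec.neg)
qed

lemma H_apply: "H *v v = (1 / real CARD('m)) *\<^sub>R (P *v (Hf *v (P *v v)))"
  by (simp add: H_def scaleR_matrix_vector_assoc[symmetric] matrix_vector_mul_assoc matrix_mul_assoc)

lemma PH: "P *v (H *v v) = H *v v" by (simp add: H_apply matrix_vector_mult_scaleR P_idem)

lemma H_coercive: "P *v v = v \<Longrightarrow> \<kappa> * (norm v)\<^sup>2 \<le> v \<bullet> (H *v v)"
proof -
  assume v: "P *v v = v"
  have "v \<bullet> (H *v v) = (1 / real CARD('m)) * (v \<bullet> (Hf *v v))"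
    using P_inner[of v "Hf *v v"] by (simp add: H_apply v)
  moreover have "(1 / real CARD('m)) * (\<mu> * (norm v)\<^sup>2) \<le> (1 / real CARD('m)) * (v \<bullet> (Hf *v v))"
    using second_order[of v] v by (intro mult_left_mono) (auto simp: P_iff)
  ultimately show ?thesis by (simp add: \<kappa>_def)
qed

lemma H_bound: obtains K where "0 < K" "\<And>v. norm (H *v v) \<le> K * norm v"
  using bounded_linear.pos_bounded[OF matrix_vector_mul_bounded_linear[of H]] by (metis mult.commute)

text \<open>In the expanded square, coercivity gives -2 \<kappa> g and the second-order term is at
  most \<kappa> g once g K^2 < \<kappa>. The rate for the norm is half as large, as 1 - \<kappa> g
  is at most the square of 1 - \<kappa> g / 2.\<close>

lemma step_contraction:
  "\<forall>\<^sub>F n in sequentially. \<kappa> / 2 * g n < 1 \<and> (\<forall>v. P *v v = v \<longrightarrow>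
    (norm (v - g n *\<^sub>R (H *v v)))\<^sup>2 \<le> (1 - \<kappa> * g n) * (norm v)\<^sup>2 \<and> norm (v - g n *\<^sub>R (H *v v)) \<le> (1 - \<kappa> / 2 * g n) * norm v)"
proof -
  obtain K where K: "0 < K" "\<And>v. norm (H *v v) \<le> K * norm v" using H_bound by blast
  have "(\<lambda>n. g n * K\<^sup>2) \<longlonglongrightarrow> 0 * K\<^sup>2" by (intro tendsto_intros g_lim)
  then have 1: "\<forall>\<^sub>F n in sequentially. g n * K\<^sup>2 < \<kappa>" by (rule order_tendstoD) (simp add: \<kappa>_pos)
  have "(\<lambda>n. \<kappa> / 2 * g n) \<longlonglongrightarrow> \<kappa> / 2 * 0" by (intro tendsto_intros g_lim)
  then have 2: "\<forall>\<^sub>F n in sequentially. \<kappa> / 2 * g n < 1" by (rule order_tendstoD) simp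
  show ?thesis
    using 1 2
  proof eventually_elim
    case (elim n)
    show ?case
    proof (intro conjI allI impI elim(2))
      fix v assume v: "P *v v = v"
      note g = g_pos[of n]
      have "(norm (v - g n *\<^sub>R (H *v v)))\<^sup>2 = (norm v)\<^sup>2 - 2 * (g n * (v \<bullet> (H *v v))) + (g n)\<^sup>2 * (norm (H *v v))\<^sup>2"
        unfolding power2_norm_eq_inner
        by (simp add: inner_diff_left inner_diff_right inner_commute[of "H *v v" v] power2_eq_square right_diff_distrib)
      moreover have "g n * (\<kappa> * (norm v)\<^sup>2) \<le> g n * (v \<bullet> (H *v v))"
        using H_coercive[OF v] g by (intro mult_left_mono) auto
      moreover have "(g n)\<^sup>2 * (norm (H *v v))\<^sup>2 \<le> g n * (\<kappa> * (norm v)\<^sup>2)"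
      proof -
        have "(g n)\<^sup>2 * (norm (H *v v))\<^sup>2 \<le> (g n)\<^sup>2 * (K * norm v)\<^sup>2"
          using K(2) by (intro mult_left_mono power_mono) auto
        also have "\<dots> = g n * ((g n * K\<^sup>2) * (norm v)\<^sup>2)" by (simp add: power2_eq_square mult_ac)
        also have "\<dots> \<le> g n * (\<kappa> * (norm v)\<^sup>2)"
          using elim(1) g by (intro mult_left_mono mult_right_mono) auto
        finally show ?thesis .
      qed
      ultimately have "(norm (v - g n *\<^sub>R (H *v v)))\<^sup>2 \<le> (norm v)\<^sup>2 - g n * (\<kappa> * (norm v)\<^sup>2)" by linarith
      then show sq: "(norm (v - g n *\<^sub>R (H *v v)))\<^sup>2 \<le> (1 - \<kappa> * g n) * (norm v)\<^sup>2" by (simp add: algebra_simps)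
      have "(1 - \<kappa> * g n) * (norm v)\<^sup>2 \<le> (1 - \<kappa> / 2 * g n)\<^sup>2 * (norm v)\<^sup>2"
        using zero_le_power2[of "\<kappa> / 2 * g n"] by (intro mult_right_mono) (auto simp: power2_diff)
      with sq have "(norm (v - g n *\<^sub>R (H *v v)))\<^sup>2 \<le> ((1 - \<kappa> / 2 * g n) * norm v)\<^sup>2" by (simp add: power_mult_distrib)
      then show "norm (v - g n *\<^sub>R (H *v v)) \<le> (1 - \<kappa> / 2 * g n) * norm v"
        by (rule power2_le_imp_le) (use elim(2) in simp)
    qed
  qed
qed

text \<open>The linear recursion that \<open>xb n - xs\<close> follows once the active constraints have been identified.\<close>

primrec Del :: "nat \<Rightarrow> 'w \<Rightarrow> real^'d" where
  "Del 0 = (\<lambda>\<omega>. 0)"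
| "Del (Suc n) = (\<lambda>\<omega>. Del n \<omega> - g n *\<^sub>R (H *v Del n \<omega> + P *v \<epsilon> n \<omega>))"

lemma matrix_apply_measurable: "f \<in> borel_measurable N \<Longrightarrow> (\<lambda>\<omega>. A *v f \<omega>) \<in> borel_measurable N" for A :: "real^'a^'b"
  by (erule measurable_compose) (intro borel_measurable_continuous_onI linear_continuous_on matrix_vector_mul_bounded_linear)

lemma Del_meas: "Del n \<in> borel_measurable (G n)"
proof (induction n)
  case (Suc n)
  show ?case unfolding Del.simps
    by (intro borel_measurable_diff borel_measurable_scaleR borel_measurable_add borel_measurable_const
        matrix_apply_measurable G_meas_Suc[OF Suc] \<epsilon>_meas)
qed simp

lemma Del_M[measurable]: "Del n \<in> borel_measurable M" by (rule G_meas[OF Del_meas])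

lemma P_Del: "P *v Del n \<omega> = Del n \<omega>"
  by (induction n) (simp_all add: matrix_vector_mult_diff_distrib matrix_vector_right_distrib matrix_vector_mult_scaleR PH P_idem)

lemma P\<epsilon>_sq: "integrable M (\<lambda>\<omega>. (norm (P *v \<epsilon> n \<omega>))\<^sup>2)" "(LINT \<omega>|M. (norm (P *v \<epsilon> n \<omega>))\<^sup>2) \<le> 1 + C\<^sub>\<Lambda>"
proof -
  have "(\<lambda>\<omega>. P *v \<epsilon> n \<omega>) \<in> borel_measurable M" by (intro matrix_apply_measurable) measurable
  then show "integrable M (\<lambda>\<omega>. (norm (P *v \<epsilon> n \<omega>))\<^sup>2)" "(LINT \<omega>|M. (norm (P *v \<epsilon> n \<omega>))\<^sup>2) \<le> 1 + C\<^sub>\<Lambda>"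
    using sq_integrable_dominated[of "\<lambda>\<omega>. P *v \<epsilon> n \<omega>" n] order_trans[OF norm_P_le \<epsilon>_le] by auto
qed

definition D2 where "D2 n = (LINT \<omega>|M. (norm (Del n \<omega>))\<^sup>2)"

text \<open>The noise is orthogonal to the drift part, which is measurable with respect to
  \<open>G n\<close>, so second moments add. Square integrability is carried along the induction
  because the orthogonality requires it.\<close>

lemma Del_sq: "integrable M (\<lambda>\<omega>. (norm (Del n \<omega>))\<^sup>2)"
  and Del_sq_Suc: "D2 (Suc n) \<le> (LINT \<omega>|M. (norm (Del n \<omega> - g n *\<^sub>R (H *v Del n \<omega>)))\<^sup>2) + (g n)\<^sup>2 * (1 + C\<^sub>\<Lambda>)"
  and Del_step_sq: "integrable M (\<lambda>\<omega>. (norm (Del n \<omega> - g n *\<^sub>R (H *v Del n \<omega>)))\<^sup>2)"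
proof -
  obtain K where K: "0 < K" "\<And>v. norm (H *v v) \<le> K * norm v" using H_bound by blast
  have a_sq: "integrable M (\<lambda>\<omega>. (norm (Del n \<omega> - g n *\<^sub>R (H *v Del n \<omega>)))\<^sup>2)" if "integrable M (\<lambda>\<omega>. (norm (Del n \<omega>))\<^sup>2)" for n
  proof (rule Bochner_Integration.integrable_bound)
    show "integrable M (\<lambda>\<omega>. (1 + g n * K)\<^sup>2 * (norm (Del n \<omega>))\<^sup>2)" using that by simp
    show "(\<lambda>\<omega>. (norm (Del n \<omega> - g n *\<^sub>R (H *v Del n \<omega>)))\<^sup>2) \<in> borel_measurable M"
      using matrix_apply_measurable[OF Del_M, of H n] by measurable
    show "AE \<omega> in M. norm ((norm (Del n \<omega> - g n *\<^sub>R (H *v Del n \<omega>)))\<^sup>2) \<le> norm ((1 + g n * K)\<^sup>2 * (norm (Del n \<omega>))\<^sup>2)"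
    proof (intro AE_I2)
      fix \<omega>
      have "norm (Del n \<omega> - g n *\<^sub>R (H *v Del n \<omega>)) \<le> norm (Del n \<omega>) + g n * norm (H *v Del n \<omega>)"
        using norm_triangle_ineq4[of "Del n \<omega>" "g n *\<^sub>R (H *v Del n \<omega>)"] g_pos[of n] by simp
      also have "\<dots> \<le> norm (Del n \<omega>) + g n * (K * norm (Del n \<omega>))"
        using K(2) g_pos[of n] by (intro add_left_mono mult_left_mono) auto
      also have "\<dots> = (1 + g n * K) * norm (Del n \<omega>)" by (simp add: algebra_simps)
      finally have "(norm (Del n \<omega> - g n *\<^sub>R (H *v Del n \<omega>)))\<^sup>2 \<le> ((1 + g n * K) * norm (Del n \<omega>))\<^sup>2" by (intro power_mono) auto
      then show "norm ((norm (Del n \<omega> - g n *\<^sub>R (H *v Del n \<omega>)))\<^sup>2) \<le> norm ((1 + g n * K)\<^sup>2 * (norm (Del n \<omega>))\<^sup>2)"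
        by (simp add: power_mult_distrib)
    qed
  qed
  have main: "integrable M (\<lambda>\<omega>. (norm (Del (Suc n) \<omega>))\<^sup>2) \<and>
      D2 (Suc n) \<le> (LINT \<omega>|M. (norm (Del n \<omega> - g n *\<^sub>R (H *v Del n \<omega>)))\<^sup>2) + (g n)\<^sup>2 * (1 + C\<^sub>\<Lambda>)"
    if i: "integrable M (\<lambda>\<omega>. (norm (Del n \<omega>))\<^sup>2)" for n
  proof -
    define a where "a = (\<lambda>\<omega>. Del n \<omega> - g n *\<^sub>R (H *v Del n \<omega>))"
    have a: "a \<in> borel_measurable (G n)" unfolding a_def
      by (intro borel_measurable_diff borel_measurable_scaleR borel_measurable_const matrix_apply_measurable Del_meas)
    have Pa: "P *v a \<omega> = a \<omega>" for \<omega>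
      by (simp add: a_def matrix_vector_mult_diff_distrib matrix_vector_mult_scaleR PH P_Del)
    have a2: "integrable M (\<lambda>\<omega>. (norm (a \<omega>))\<^sup>2)" unfolding a_def by (rule a_sq[OF i])
    note o = \<epsilon>_orth[OF a a2] P\<epsilon>_sq[of n]
    have eq: "(norm (Del (Suc n) \<omega>))\<^sup>2 = (norm (a \<omega>))\<^sup>2 - 2 * g n * (a \<omega> \<bullet> \<epsilon> n \<omega>) + (g n)\<^sup>2 * (norm (P *v \<epsilon> n \<omega>))\<^sup>2" for \<omega>
    proof -
      have "Del (Suc n) \<omega> = a \<omega> - g n *\<^sub>R (P *v \<epsilon> n \<omega>)" by (simp add: a_def scaleR_add_right)
      moreover have "a \<omega> \<bullet> (P *v \<epsilon> n \<omega>) = a \<omega> \<bullet> \<epsilon> n \<omega>" using P_inner[of "a \<omega>" "\<epsilon> n \<omega>"] Pa by simp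
      ultimately show ?thesis unfolding power2_norm_eq_inner
        by (simp add: inner_diff_left inner_diff_right inner_commute[of "P *v \<epsilon> n \<omega>" "a \<omega>"] power2_eq_square right_diff_distrib)
    qed
    have "D2 (Suc n) = (LINT \<omega>|M. (norm (a \<omega>))\<^sup>2) + (g n)\<^sup>2 * (LINT \<omega>|M. (norm (P *v \<epsilon> n \<omega>))\<^sup>2)"
      unfolding D2_def eq using a2 o by simp
    also have "\<dots> \<le> (LINT \<omega>|M. (norm (a \<omega>))\<^sup>2) + (g n)\<^sup>2 * (1 + C\<^sub>\<Lambda>)"
      using o by (intro add_left_mono mult_left_mono) auto
    finally show ?thesis unfolding eq using a2 o by (simp add: a_def)
  qed
  have int: "integrable M (\<lambda>\<omega>. (norm (Del n \<omega>))\<^sup>2)" for n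
  proof (induction n)
    case (Suc n)
    from main[OF Suc] show ?case by blast
  qed simp
  show "integrable M (\<lambda>\<omega>. (norm (Del n \<omega>))\<^sup>2)"
    "D2 (Suc n) \<le> (LINT \<omega>|M. (norm (Del n \<omega> - g n *\<^sub>R (H *v Del n \<omega>)))\<^sup>2) + (g n)\<^sup>2 * (1 + C\<^sub>\<Lambda>)"
    "integrable M (\<lambda>\<omega>. (norm (Del n \<omega> - g n *\<^sub>R (H *v Del n \<omega>)))\<^sup>2)"
    using int main[OF int] a_sq[OF int] by auto
qed

lemma ratio_ge: "1 \<le> g n / g (Suc n)" using g_decr[of n] g_pos[of "Suc n"] by simp

text \<open>The noise enters the second moment with \<open>(g n)\<^sup>2\<close> while the
  contraction has rate \<open>g n\<close>, so their quotient \<open>g n\<close> is the scale for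
  \<open>scaled_contraction\<close>.\<close>

lemma D2_bound: obtains K where "0 < K" "\<forall>\<^sub>F n in sequentially. D2 n \<le> K * g n"
proof -
  have "\<forall>\<^sub>F n in sequentially. D2 n \<le> (4 * (1 + C\<^sub>\<Lambda>) / \<kappa> + 1) * g n"
  proof (rule scaled_contraction[OF g_pos g_lim g_div ratio g_pos])
    show "\<forall>\<^sub>F n in sequentially. D2 (Suc n) \<le> (1 - \<kappa> * g n) * D2 n + g n * ((1 + C\<^sub>\<Lambda>) * g n)"
      using step_contraction
    proof eventually_elim
      case (elim n)
      have "(LINT \<omega>|M. (norm (Del n \<omega> - g n *\<^sub>R (H *v Del n \<omega>)))\<^sup>2) \<le> (LINT \<omega>|M. (1 - \<kappa> * g n) * (norm (Del n \<omega>))\<^sup>2)"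
        using elim P_Del Del_sq Del_step_sq by (intro integral_mono) auto
      also have "\<dots> = (1 - \<kappa> * g n) * D2 n" by (simp add: D2_def)
      finally show ?case using Del_sq_Suc[of n] by (simp add: power2_eq_square mult_ac)
    qed
    show "0 \<le> D2 n" for n unfolding D2_def by (intro Bochner_Integration.integral_nonneg) auto
  qed (use \<kappa>_pos C\<^sub>\<Lambda>_nonneg in auto)
  moreover have "0 < 4 * (1 + C\<^sub>\<Lambda>) / \<kappa> + 1" using \<kappa>_pos C\<^sub>\<Lambda>_nonneg by (intro add_nonneg_pos divide_nonneg_pos) auto
  ultimately show ?thesis using that by blast
qed

text \<open>With v = -m gb, the vector zb - xb - (S / m) v equals (zb + S gb) - xb. It is o(S)
  because \<open>xb\<close> converges, so \<open>active_constraints_identified\<close> applies with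
  S / m as the length.\<close>

lemma identification:
  "AE \<omega> in M. \<forall>\<^sub>F n in sequentially. B *v (xb n \<omega> - xs) = 0 \<and> P *v (zb n \<omega> - xs) = xb n \<omega> - xs"
proof -
  define v where "v = - (\<Sum>j\<in>UNIV. mg j xs)"
  have cq': "v \<in> rel_interior {transpose B *v l | l. \<forall>i. 0 \<le> l $ i}"
    using cq by (simp add: v_def mg_def)
  obtain \<delta> \<eta> where \<delta>: "0 < \<delta>" "0 < \<eta>" "\<And>z x S. x = closest_point X z \<Longrightarrow> norm (x - xs) < \<delta> \<Longrightarrow> 0 < S \<Longrightarrow>
      norm (z - x - S *\<^sub>R v) \<le> \<eta> * S \<Longrightarrow> B *v (x - xs) = 0"
    by (rule active_constraints_identified[OF X_feasible active inactive cq']) (rule that; blast)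
  obtain \<delta>' where \<delta>': "0 < \<delta>'" "\<And>z x. x = closest_point X z \<Longrightarrow> norm (x - xs) < \<delta>' \<Longrightarrow> null_proj B *v (z - x) = 0"
    by (rule closest_point_near_vertex[OF X_feasible active inactive]) (rule that; blast)
  let ?m = "real CARD('m)"
  have vgb: "v = - (?m *\<^sub>R gb)" by (simp add: v_def gb_def)
  show ?thesis
    using xb_limit zb_over_S
  proof eventually_elim
    case (elim \<omega>)
    have "(\<lambda>n. norm (xb n \<omega> - xs)) \<longlonglongrightarrow> 0"
      using elim(1) by (simp add: LIM_zero_iff tendsto_norm_zero_iff)
    then have e1: "\<forall>\<^sub>F n in sequentially. norm (xb n \<omega> - xs) < min \<delta> \<delta>'"
      by (rule order_tendstoD) (use \<delta> \<delta>' in simp)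
    have "(\<lambda>n. norm (xb n \<omega>) / S n) \<longlonglongrightarrow> 0"
      by (rule real_tendsto_divide_at_top[OF tendsto_norm[OF elim(1)] S_lim])
    from tendsto_add[OF elim(2) this]
    have "(\<lambda>n. norm (zb n \<omega> + S n *\<^sub>R gb) / S n + norm (xb n \<omega>) / S n) \<longlonglongrightarrow> 0" by simp
    then have e2: "\<forall>\<^sub>F n in sequentially. norm (zb n \<omega> + S n *\<^sub>R gb) / S n + norm (xb n \<omega>) / S n < \<eta> / ?m"
      by (rule order_tendstoD) (use \<delta>(2) in simp)
    have e3: "\<forall>\<^sub>F n in sequentially. 1 \<le> S n" using S_lim unfolding filterlim_at_top by blast
    show ?case
      using e1 e2 e3
    proof eventually_elim
      case (elim n)
      have S: "0 < S n" using elim(3) by linarith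
      have "B *v (xb n \<omega> - xs) = 0"
      proof (rule \<delta>(3)[of _ "zb n \<omega>" "S n / ?m"])
        show "xb n \<omega> = closest_point X (zb n \<omega>)" by (simp add: xb_def)
        show "norm (xb n \<omega> - xs) < \<delta>" using elim(1) by simp
        show "0 < S n / ?m" using S by simp
        have "zb n \<omega> - xb n \<omega> - (S n / ?m) *\<^sub>R v = (zb n \<omega> + S n *\<^sub>R gb) - xb n \<omega>" by (simp add: vgb)
        then have "norm (zb n \<omega> - xb n \<omega> - (S n / ?m) *\<^sub>R v) \<le> norm (zb n \<omega> + S n *\<^sub>R gb) + norm (xb n \<omega>)"
          by (simp only: norm_triangle_ineq4)
        also have "\<dots> = (norm (zb n \<omega> + S n *\<^sub>R gb) / S n + norm (xb n \<omega>) / S n) * S n"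
          using S by (simp add: field_simps)
        also have "\<dots> \<le> (\<eta> / ?m) * S n" using elim(2) S by (intro mult_right_mono) auto
        finally show "norm (zb n \<omega> - xb n \<omega> - (S n / ?m) *\<^sub>R v) \<le> \<eta> * (S n / ?m)" by simp
      qed
      moreover have "P *v (zb n \<omega> - xb n \<omega>) = 0"
        unfolding P_def by (rule \<delta>'(2)) (use elim(1) in \<open>auto simp: xb_def\<close>)
      ultimately have "P *v (zb n \<omega> - xb n \<omega>) + P *v (xb n \<omega> - xs) = xb n \<omega> - xs"
        using P_iff[of "xb n \<omega> - xs"] by simp
      then show ?case
        using \<open>B *v (xb n \<omega> - xs) = 0\<close> by (simp add: matrix_vector_mult_diff_distrib)
    qed
  qed
qed

text \<open>
  The identification time is not a stopping time, so the remainder is estimated pathwise on \<open>good \<delta> K\<close>,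
  whose probability tends to \<open>1\<close> with \<open>K\<close>.
\<close>

definition good :: "real \<Rightarrow> nat \<Rightarrow> 'w set" where
  "good \<delta> K = {\<omega>\<in>start (real K). (\<forall>n\<ge>K. B *v (xb n \<omega> - xs) = 0 \<and> P *v (zb n \<omega> - xs) = xb n \<omega> - xs \<and> norm (xb n \<omega> - xs) \<le> \<delta>)
    \<and> (\<forall>n. zb (Suc n) \<omega> = zb n \<omega> - g n *\<^sub>R ((1 / real CARD('m)) *\<^sub>R (\<Sum>j\<in>UNIV. gr j (x n j \<omega>) (xi n j \<omega>))))}"

lemma good_M[measurable]: "good \<delta> K \<in> sets M"
proof -
  have [measurable]: "(\<lambda>\<omega>. B *v (xb n \<omega> - xs)) \<in> borel_measurable M" "(\<lambda>\<omega>. P *v (zb n \<omega> - xs)) \<in> borel_measurable M" for n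
    by (intro matrix_apply_measurable; measurable)+
  have [measurable]: "(\<lambda>\<omega>. gr j (x n j \<omega>) (xi n j \<omega>)) \<in> borel_measurable M" for n j
    by (intro gr_measurable G_meas[OF x_meas]) measurable
  have "good \<delta> K = start (real K) \<inter> {\<omega>\<in>space M. (\<forall>n\<in>{K..}. B *v (xb n \<omega> - xs) = 0 \<and> P *v (zb n \<omega> - xs) = xb n \<omega> - xs \<and> norm (xb n \<omega> - xs) \<le> \<delta>)
    \<and> (\<forall>n. zb (Suc n) \<omega> = zb n \<omega> - g n *\<^sub>R ((1 / real CARD('m)) *\<^sub>R (\<Sum>j\<in>UNIV. gr j (x n j \<omega>) (xi n j \<omega>))))}"
    unfolding good_def start_def by auto
  also have "\<dots> \<in> sets M" by measurable
  finally show ?thesis .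
qed

lemma good_prob:
  assumes \<delta>: "0 < \<delta>"
  shows "(\<lambda>K. prob (good \<delta> K)) \<longlonglongrightarrow> 1"
proof -
  \<comment> \<open>\<open>K\<close> bounds the initial points and the identification time at once,
    so the events increase with \<open>K\<close>.\<close>
  have "incseq (good \<delta>)"
  proof (rule incseq_SucI)
    fix K
    have "start (real K) \<subseteq> start (real (Suc K))" by (auto simp: start_def intro: order_trans)
    then show "good \<delta> K \<subseteq> good \<delta> (Suc K)" unfolding good_def by auto
  qed
  then have "(\<lambda>K. prob (good \<delta> K)) \<longlonglongrightarrow> prob (\<Union>K. good \<delta> K)"
    by (intro finite_Lim_measure_incseq) auto
  moreover have "prob (\<Union>K. good \<delta> K) = 1"
  proof (rule prob_eq_1[THEN iffD2])
    show "(\<Union>K. good \<delta> K) \<in> events" by measurable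
    show "AE \<omega> in M. \<omega> \<in> (\<Union>K. good \<delta> K)"
      using identification zb_Suc xb_limit AE_space
    proof eventually_elim
      case (elim \<omega>)
      have "(\<lambda>n. norm (xb n \<omega> - xs)) \<longlonglongrightarrow> 0"
        using elim(3) by (simp add: LIM_zero_iff tendsto_norm_zero_iff)
      then have "\<forall>\<^sub>F n in sequentially. norm (xb n \<omega> - xs) < \<delta>" using \<delta> by (rule order_tendstoD)
      with elim(1) have "\<forall>\<^sub>F n in sequentially. B *v (xb n \<omega> - xs) = 0 \<and> P *v (zb n \<omega> - xs) = xb n \<omega> - xs \<and> norm (xb n \<omega> - xs) \<le> \<delta>"
        by eventually_elim auto
      then obtain K1 where K1: "\<And>n. n \<ge> K1 \<Longrightarrow> B *v (xb n \<omega> - xs) = 0 \<and> P *v (zb n \<omega> - xs) = xb n \<omega> - xs \<and> norm (xb n \<omega> - xs) \<le> \<delta>"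
        unfolding eventually_sequentially by blast
      obtain R where R: "\<And>R'. R' \<ge> R \<Longrightarrow> \<omega> \<in> start (real R')" using start_exhausts[OF elim(4)] by blast
      have "\<omega> \<in> good \<delta> (max K1 R)"
        unfolding good_def using K1 R[of "max K1 R"] elim(2) by auto
      then show ?case by blast
    qed
  qed
  ultimately show ?thesis by simp
qed

text \<open>Formed with \<open>zb\<close>, whose recursion has no projection onto \<open>X\<close>
  to undo and holds at all times; on \<open>good \<delta> K\<close> the first term equals
  \<open>xb n \<omega> - xs\<close> from time \<open>K\<close> on.\<close>

definition Wd where "Wd n \<omega> = P *v (zb n \<omega> - xs) - Del n \<omega>"

lemma Wd_M[measurable]: "Wd n \<in> borel_measurable M"
proof -
  have [measurable]: "(\<lambda>\<omega>. P *v (zb n \<omega> - xs)) \<in> borel_measurable M"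
    by (intro matrix_apply_measurable) measurable
  show ?thesis unfolding Wd_def[abs_def] by measurable
qed

text \<open>The noise is the same in both recursions and cancels. What is left of the drift is the
  consensus error, bounded through the Lipschitz constant, and the Taylor error, at most c0 \<delta>
  times the norm of xb - xs since that norm is at most \<delta>. Writing xb - xs = Wd + Del, the
  part with \<open>Wd\<close> is absorbed by half of the contraction rate because c0 \<delta> <=
  \<kappa> / 4.\<close>

lemma Wd_step:
  assumes \<omega>: "\<omega> \<in> good \<delta> K" and n: "K \<le> n" and \<delta>: "0 < \<delta>" "\<delta> \<le> eps" "c0 * \<delta> \<le> \<kappa> / 4"
    and con: "norm (Wd n \<omega> - g n *\<^sub>R (H *v Wd n \<omega>)) \<le> (1 - \<kappa> / 2 * g n) * norm (Wd n \<omega>)"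
  shows "norm (Wd (Suc n) \<omega>) \<le> (1 - \<kappa> / 4 * g n) * norm (Wd n \<omega>) + g n * (L * sqrt (V n \<omega>) + c0 * \<delta> * norm (Del n \<omega>))"
proof -
  let ?m = "real CARD('m)"
  define d where "d = P *v (zb n \<omega> - xs)"
  have d: "B *v (xb n \<omega> - xs) = 0" "d = xb n \<omega> - xs" "norm d \<le> \<delta>"
    using \<omega> n unfolding good_def d_def by auto
  have Pd: "P *v d = d" unfolding d_def by (rule P_idem)
  have rec: "zb (Suc n) \<omega> = zb n \<omega> - g n *\<^sub>R ((1 / ?m) *\<^sub>R (\<Sum>j\<in>UNIV. gr j (x n j \<omega>) (xi n j \<omega>)))"
    using \<omega> unfolding good_def by blast
  define q where "q = (1 / ?m) *\<^sub>R (P *v (\<Sum>j\<in>UNIV. mg j (x n j \<omega>))) - H *v d"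
  have gr: "(1 / ?m) *\<^sub>R (\<Sum>j\<in>UNIV. gr j (x n j \<omega>) (xi n j \<omega>)) = (1 / ?m) *\<^sub>R (\<Sum>j\<in>UNIV. mg j (x n j \<omega>)) + \<epsilon> n \<omega>"
    by (simp add: \<epsilon>_def noise_def sum_subtractf scaleR_diff_right)
  have "P *v (zb (Suc n) \<omega> - xs) = d - g n *\<^sub>R (q + H *v d + P *v \<epsilon> n \<omega>)"
    unfolding rec gr d_def q_def
    by (simp add: matrix_vector_mult_diff_distrib matrix_vector_right_distrib matrix_vector_mult_scaleR)
  then have "Wd (Suc n) \<omega> = (d - g n *\<^sub>R (q + H *v d + P *v \<epsilon> n \<omega>)) - (Del n \<omega> - g n *\<^sub>R (H *v Del n \<omega> + P *v \<epsilon> n \<omega>))"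
    by (simp only: Wd_def Del.simps)
  moreover have "Wd n \<omega> = d - Del n \<omega>" by (simp only: Wd_def d_def)
  ultimately have "Wd (Suc n) \<omega> = (Wd n \<omega> - g n *\<^sub>R (H *v Wd n \<omega>)) - g n *\<^sub>R q"
    by (simp add: matrix_vector_mult_diff_distrib scaleR_add_right scaleR_diff_right)
  then have "norm (Wd (Suc n) \<omega>) \<le> norm (Wd n \<omega> - g n *\<^sub>R (H *v Wd n \<omega>)) + g n * norm q"
    using norm_triangle_ineq4[of "Wd n \<omega> - g n *\<^sub>R (H *v Wd n \<omega>)" "g n *\<^sub>R q"] g_pos[of n] by simp
  also have "norm q \<le> L * sqrt (V n \<omega>) + c0 * \<delta> * (norm (Wd n \<omega>) + norm (Del n \<omega>))"
  proof -
    define A where "A = (\<Sum>j\<in>UNIV. mg j (x n j \<omega>) - mg j (xb n \<omega>))"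
    define D where "D = (\<Sum>j\<in>UNIV. mg j (xb n \<omega>)) - (\<Sum>j\<in>UNIV. mg j xs) - Hf *v d"
    have A: "norm A \<le> ?m * (L * sqrt (V n \<omega>))"
    proof -
      have "norm (mg j (x n j \<omega>) - mg j (xb n \<omega>)) \<le> L * sqrt (V n \<omega>)" for j
      proof -
        have "norm (mg j (x n j \<omega>) - mg j (xb n \<omega>)) \<le> L * norm (x n j \<omega> - xb n \<omega>)"
          by (intro mg_Lipschitz x_X xb_X)
        also have "norm (x n j \<omega> - xb n \<omega>) \<le> sqrt (V n \<omega>)"
        proof (rule order_trans[OF x_xb_le real_le_rsqrt])
          show "(norm (y n j \<omega>))\<^sup>2 \<le> V n \<omega>" unfolding V_def by (intro member_le_sum) auto
        qed
        finally show ?thesis using L by (simp add: mult_left_mono)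
      qed
      then have "norm A \<le> (\<Sum>j\<in>(UNIV :: 'm set). L * sqrt (V n \<omega>))"
        unfolding A_def by (intro order_trans[OF norm_sum sum_mono])
      then show ?thesis by simp
    qed
    have D: "norm D \<le> c0 * \<delta> * norm d"
    proof -
      have "norm D \<le> c0 * (norm d)\<^sup>2"
        unfolding D_def d(2) mg_def using d \<delta> by (intro expansion xb_X) auto
      also have "\<dots> \<le> c0 * (\<delta> * norm d)"
        using d(3) c0 by (intro mult_left_mono) (auto simp: power2_eq_square mult_right_mono)
      finally show ?thesis by simp
    qed
    have "q = (1 / ?m) *\<^sub>R (P *v (A + D))"
      using P_gradient unfolding q_def H_apply Pd A_def D_def
      by (simp add: sum_subtractf matrix_vector_mult_diff_distrib matrix_vector_right_distrib scaleR_diff_right scaleR_add_right vec.neg)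
    then have "norm q = 1 / ?m * norm (P *v (A + D))" by simp
    also have "\<dots> \<le> 1 / ?m * (?m * (L * sqrt (V n \<omega>)) + c0 * \<delta> * norm d)"
      using norm_P_le[of "A + D"] norm_triangle_ineq[of A D] A D by (intro mult_left_mono) auto
    also have "\<dots> = L * sqrt (V n \<omega>) + 1 / ?m * (c0 * \<delta> * norm d)" by (simp add: field_simps)
    also have "1 / ?m * (c0 * \<delta> * norm d) \<le> 1 * (c0 * \<delta> * norm d)"
      using c0 \<delta> by (intro mult_right_mono) (auto simp: Suc_leI)
    also have "1 * (c0 * \<delta> * norm d) \<le> c0 * \<delta> * (norm (Wd n \<omega>) + norm (Del n \<omega>))"
    proof -
      have "d = Wd n \<omega> + Del n \<omega>" by (simp add: Wd_def d_def)
      then show ?thesis using c0 \<delta> norm_triangle_ineq[of "Wd n \<omega>" "Del n \<omega>"] by (simp add: mult_left_mono)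
    qed
    finally show ?thesis by simp
  qed
  finally have "norm (Wd (Suc n) \<omega>) \<le> (1 - \<kappa> / 2 * g n) * norm (Wd n \<omega>)
      + g n * (L * sqrt (V n \<omega>) + c0 * \<delta> * (norm (Wd n \<omega>) + norm (Del n \<omega>)))"
    using con g_pos[of n] by (simp add: mult_left_mono)
  also have "\<dots> = (1 - \<kappa> / 2 * g n) * norm (Wd n \<omega>) + g n * ((c0 * \<delta>) * norm (Wd n \<omega>))
      + g n * (L * sqrt (V n \<omega>) + c0 * \<delta> * norm (Del n \<omega>))" by (simp add: algebra_simps)
  also have "g n * ((c0 * \<delta>) * norm (Wd n \<omega>)) \<le> g n * (\<kappa> / 4 * norm (Wd n \<omega>))"
    using \<delta>(3) g_pos[of n] by (intro mult_left_mono mult_right_mono) auto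
  finally show ?thesis by (simp add: algebra_simps)
qed

end

section \<open>The remainder at the scale of the square root of the step\<close>

context polyhedral_dual_averaging
begin

lemma Izb_integrable: "integrable M (\<lambda>\<omega>. I R \<omega> * norm (zb n \<omega>))"
proof (rule Bochner_Integration.integrable_bound)
  show "integrable M (\<lambda>\<omega>. \<Sum>j\<in>(UNIV :: 'm set). 1 + I R \<omega> * (norm (z n j \<omega>))\<^sup>2)"
    using Iz_integrable by (intro Bochner_Integration.integrable_sum Bochner_Integration.integrable_add) auto
  show "AE \<omega> in M. norm (I R \<omega> * norm (zb n \<omega>)) \<le> norm (\<Sum>j\<in>(UNIV :: 'm set). 1 + I R \<omega> * (norm (z n j \<omega>))\<^sup>2)"
  proof (intro AE_I2)
    fix \<omega>
    have 1: "t \<le> 1 + t\<^sup>2" for t :: real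
      using zero_le_power2[of "t - 1"] zero_le_power2[of t] by (simp add: power2_diff) (smt (verit) zero_le_power2)
    have "1 / real CARD('m) * norm (\<Sum>j\<in>UNIV. z n j \<omega>) \<le> 1 * (\<Sum>j\<in>UNIV. norm (z n j \<omega>))"
      by (intro mult_mono norm_sum) (auto simp: Suc_leI)
    then have "norm (zb n \<omega>) \<le> (\<Sum>j\<in>UNIV. norm (z n j \<omega>))" by (simp add: zb_def)
    also have "\<dots> \<le> (\<Sum>j\<in>UNIV. 1 + (norm (z n j \<omega>))\<^sup>2)" by (intro sum_mono 1)
    finally have "I R \<omega> * norm (zb n \<omega>) \<le> (\<Sum>j\<in>UNIV. 1 + I R \<omega> * (norm (z n j \<omega>))\<^sup>2)"
      using I_01(1)[of R \<omega>] by auto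
    moreover have "0 \<le> I R \<omega> * norm (zb n \<omega>)" using I_01(2) by simp
    ultimately show "norm (I R \<omega> * norm (zb n \<omega>)) \<le> norm (\<Sum>j\<in>(UNIV :: 'm set). 1 + I R \<omega> * (norm (z n j \<omega>))\<^sup>2)" by simp
  qed
qed measurable

lemma Del_integrable: "integrable M (\<lambda>\<omega>. norm (Del n \<omega>))" and Del_abs_le: "(LINT \<omega>|M. norm (Del n \<omega>)) \<le> sqrt (D2 n)"
  using expectation_abs_le_sqrt[of "\<lambda>\<omega>. norm (Del n \<omega>)"] Del_sq[of n] by (auto simp: D2_def)

lemma ISV_integrable: "integrable M (\<lambda>\<omega>. I R \<omega> * sqrt (V n \<omega>))" and ISV_le: "(LINT \<omega>|M. I R \<omega> * sqrt (V n \<omega>)) \<le> sqrt (u R n)"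
proof -
  have eq: "(I R \<omega> * sqrt (V n \<omega>))\<^sup>2 = I R \<omega> * V n \<omega>" for \<omega>
    using I_01(1)[of R \<omega>] V_nonneg[of n \<omega>] by auto
  show "integrable M (\<lambda>\<omega>. I R \<omega> * sqrt (V n \<omega>))" "(LINT \<omega>|M. I R \<omega> * sqrt (V n \<omega>)) \<le> sqrt (u R n)"
    using expectation_abs_le_sqrt[of "\<lambda>\<omega>. I R \<omega> * sqrt (V n \<omega>)"] IV_integrable[of R n] unfolding eq by (auto simp: u_def)
qed

lemma good_start: "indicator (good \<delta> K) \<omega> \<le> I (real K) \<omega>"
  by (auto simp: I_def indicator_def good_def)

lemma good_Wd_integrable: "integrable M (\<lambda>\<omega>. indicator (good \<delta> K) \<omega> * norm (Wd n \<omega>))"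
proof (rule Bochner_Integration.integrable_bound)
  show "integrable M (\<lambda>\<omega>. I (real K) \<omega> * norm (zb n \<omega>) + norm xs + norm (Del n \<omega>))"
    using Izb_integrable Del_integrable by simp
  show "AE \<omega> in M. norm (indicator (good \<delta> K) \<omega> * norm (Wd n \<omega>)) \<le> norm (I (real K) \<omega> * norm (zb n \<omega>) + norm xs + norm (Del n \<omega>))"
  proof (intro AE_I2)
    fix \<omega>
    have "norm (Wd n \<omega>) \<le> norm (zb n \<omega>) + norm xs + norm (Del n \<omega>)"
      unfolding Wd_def using norm_triangle_ineq4[of "P *v (zb n \<omega> - xs)" "Del n \<omega>"] norm_P_le[of "zb n \<omega> - xs"]
        norm_triangle_ineq4[of "zb n \<omega>" xs] by linarith
    then have "indicator (good \<delta> K) \<omega> * norm (Wd n \<omega>) \<le> I (real K) \<omega> * norm (zb n \<omega>) + norm xs + norm (Del n \<omega>)"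
      using good_start[of \<delta> K \<omega>] I_01(1)[of "real K" \<omega>] by (auto simp: indicator_def split: if_splits)
    moreover have "0 \<le> indicator (good \<delta> K) \<omega> * norm (Wd n \<omega>)" by simp
    ultimately show "norm (indicator (good \<delta> K) \<omega> * norm (Wd n \<omega>)) \<le> norm (I (real K) \<omega> * norm (zb n \<omega>) + norm xs + norm (Del n \<omega>))"
      by simp
  qed
qed measurable

lemma u_eventually: "0 < \<delta> \<Longrightarrow> \<forall>\<^sub>F n in sequentially. sqrt (u R n) \<le> \<delta> * sqrt (g n)"
proof -
  assume \<delta>: "0 < \<delta>"
  then have "\<forall>\<^sub>F n in sequentially. u R n / g n < \<delta>\<^sup>2" using u_over_g by (intro order_tendstoD(2)) auto
  then show ?thesis
  proof eventually_elim
    case (elim n)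
    then have "u R n \<le> \<delta>\<^sup>2 * g n" using g_pos[of n] by (simp add: pos_divide_less_eq less_imp_le)
    then have "sqrt (u R n) \<le> sqrt (\<delta>\<^sup>2 * g n)" by simp
    then show ?case using \<delta> by (simp add: real_sqrt_mult)
  qed
qed

text \<open>\<open>C'\<close> depends neither on \<delta> nor on \<open>K\<close>, so \<delta> can
  be chosen for a prescribed accuracy and \<open>K\<close> after it. The factor \<delta> is explicit
  in the Taylor error and available for the consensus error, which is negligible compared with
  \<open>sqrt (g n)\<close>.\<close>

lemma remainder_expectation:
  obtains C' where "0 < C'" "\<And>\<delta> K j. 0 < \<delta> \<Longrightarrow> \<delta> \<le> eps \<Longrightarrow> c0 * \<delta> \<le> \<kappa> / 4 \<Longrightarrow>
    \<forall>\<^sub>F n in sequentially. integrable M (\<lambda>\<omega>. indicator (good \<delta> K) \<omega> * norm (x n j \<omega> - xs - Del n \<omega>)) \<and>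
      (LINT \<omega>|M. indicator (good \<delta> K) \<omega> * norm (x n j \<omega> - xs - Del n \<omega>)) \<le> C' * \<delta> * sqrt (g n)"
proof -
  obtain KD where KD: "0 < KD" "\<forall>\<^sub>F n in sequentially. D2 n \<le> KD * g n" using D2_bound by blast
  \<comment> \<open>\<open>L\<close> weights the consensus error, eventually below \<delta>
    \<open>sqrt (g n)\<close>; c0 \<open>sqrt KD\<close> comes from the Taylor error and the first
    moment of \<open>Del\<close>.\<close>
  define b where "b = L + c0 * sqrt KD"
  have b: "0 \<le> b" using L c0 KD(1) by (simp add: b_def)
  \<comment> \<open>The bound 4 b / (\<kappa> / 4) from \<open>scaled_contraction\<close>, one unit
    for its slack \<delta>, and one for the consensus error that separates \<open>x n j\<close> from
    \<open>xb n\<close>.\<close>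
  define C' where "C' = 4 * b / (\<kappa> / 4) + 2"
  have C': "0 < C'" unfolding C'_def using b \<kappa>_pos by (intro add_nonneg_pos) auto
  show ?thesis
  proof (rule that[OF C'])
    fix \<delta> :: real and K j assume \<delta>: "0 < \<delta>" "\<delta> \<le> eps" "c0 * \<delta> \<le> \<kappa> / 4"
    define w where "w n = (LINT \<omega>|M. indicator (good \<delta> K) \<omega> * norm (Wd n \<omega>))" for n
    have "\<forall>\<^sub>F n in sequentially. w n \<le> (4 * (b * \<delta>) / (\<kappa> / 4) + \<delta>) * sqrt (g n)"
    proof (rule scaled_contraction[OF g_pos g_lim g_div ratio])
      show "0 < sqrt (g n)" for n using g_pos by simp
      show "sqrt (g n) / sqrt (g (Suc n)) \<le> g n / g (Suc n)" for n
      proof -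
        have "sqrt (g n / g (Suc n)) \<le> sqrt ((g n / g (Suc n))\<^sup>2)"
          using ratio_ge[of n] by (intro real_sqrt_le_mono self_le_power) auto
        then show ?thesis using ratio_ge[of n] by (simp add: real_sqrt_divide)
      qed
      show "\<forall>\<^sub>F n in sequentially. w (Suc n) \<le> (1 - \<kappa> / 4 * g n) * w n + g n * (b * \<delta> * sqrt (g n))"
        using step_contraction KD(2) u_eventually[OF \<delta>(1), of "real K"] eventually_ge_at_top[of K]
      proof eventually_elim
        case (elim n)
        have PW: "P *v Wd n \<omega> = Wd n \<omega>" for \<omega>
          unfolding Wd_def by (simp add: matrix_vector_mult_diff_distrib[of P "P *v _"] P_idem P_Del)
        let ?r = "\<lambda>\<omega>. (1 - \<kappa> / 4 * g n) * (indicator (good \<delta> K) \<omega> * norm (Wd n \<omega>))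
            + g n * (L * (I (real K) \<omega> * sqrt (V n \<omega>)) + c0 * \<delta> * norm (Del n \<omega>))"
        have ir: "integrable M ?r"
          using good_Wd_integrable ISV_integrable Del_integrable by simp
        have "w (Suc n) \<le> integral\<^sup>L M ?r"
          unfolding w_def
        proof (rule integral_mono[OF good_Wd_integrable ir])
          fix \<omega>
          show "indicator (good \<delta> K) \<omega> * norm (Wd (Suc n) \<omega>) \<le> ?r \<omega>"
          proof (cases "\<omega> \<in> good \<delta> K")
            case True
            then have "I (real K) \<omega> = 1" using good_start[of \<delta> K \<omega>] I_01(1)[of "real K" \<omega>] by auto
            then show ?thesis using True Wd_step[OF True elim(4) \<delta>] elim(1) PW by simp
          next
            case False
            then show ?thesis using g_pos[of n] L c0 \<delta> I_01(2) V_nonneg by simp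
          qed
        qed
        also have "\<dots> = (1 - \<kappa> / 4 * g n) * w n + g n * (L * (LINT \<omega>|M. I (real K) \<omega> * sqrt (V n \<omega>)) + c0 * \<delta> * (LINT \<omega>|M. norm (Del n \<omega>)))"
          unfolding w_def using good_Wd_integrable[of \<delta> K n] ISV_integrable[of "real K" n] Del_integrable[of n] by simp
        also have "\<dots> \<le> (1 - \<kappa> / 4 * g n) * w n + g n * (L * (\<delta> * sqrt (g n)) + c0 * \<delta> * (sqrt KD * sqrt (g n)))"
        proof -
          have "(LINT \<omega>|M. norm (Del n \<omega>)) \<le> sqrt KD * sqrt (g n)"
            using Del_abs_le[of n] real_sqrt_le_mono[OF elim(2)] by (simp add: real_sqrt_mult)
          moreover have "(LINT \<omega>|M. I (real K) \<omega> * sqrt (V n \<omega>)) \<le> \<delta> * sqrt (g n)"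
            using ISV_le[of "real K" n] elim(3) by linarith
          ultimately show ?thesis
            using g_pos[of n] L c0 \<delta> by (intro add_left_mono mult_left_mono add_mono) auto
        qed
        also have "\<dots> = (1 - \<kappa> / 4 * g n) * w n + g n * (b * \<delta> * sqrt (g n))"
          by (simp add: b_def algebra_simps)
        finally show ?case .
      qed
      show "0 \<le> w n" for n unfolding w_def by (intro Bochner_Integration.integral_nonneg) auto
    qed (use \<kappa>_pos b \<delta> in auto)
    then show "\<forall>\<^sub>F n in sequentially. integrable M (\<lambda>\<omega>. indicator (good \<delta> K) \<omega> * norm (x n j \<omega> - xs - Del n \<omega>)) \<and>
      (LINT \<omega>|M. indicator (good \<delta> K) \<omega> * norm (x n j \<omega> - xs - Del n \<omega>)) \<le> C' * \<delta> * sqrt (g n)"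
      using u_eventually[OF \<delta>(1), of "real K"] eventually_ge_at_top[of K]
    proof eventually_elim
      case (elim n)
      let ?f = "\<lambda>\<omega>. indicator (good \<delta> K) \<omega> * norm (x n j \<omega> - xs - Del n \<omega>)"
      let ?r = "\<lambda>\<omega>. I (real K) \<omega> * sqrt (V n \<omega>) + indicator (good \<delta> K) \<omega> * norm (Wd n \<omega>)"
      have ir: "integrable M ?r" using ISV_integrable good_Wd_integrable by simp
      have le: "?f \<omega> \<le> ?r \<omega>" for \<omega>
      proof (cases "\<omega> \<in> good \<delta> K")
        case True
        then have I1: "I (real K) \<omega> = 1" using good_start[of \<delta> K \<omega>] I_01(1)[of "real K" \<omega>] by auto
        have "P *v (zb n \<omega> - xs) = xb n \<omega> - xs" using True elim(3) by (auto simp: good_def)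
        then have "x n j \<omega> - xs - Del n \<omega> = (x n j \<omega> - xb n \<omega>) + Wd n \<omega>" by (simp add: Wd_def)
        then have "norm (x n j \<omega> - xs - Del n \<omega>) \<le> norm (x n j \<omega> - xb n \<omega>) + norm (Wd n \<omega>)"
          by (simp only: norm_triangle_ineq)
        also have "norm (x n j \<omega> - xb n \<omega>) \<le> sqrt (V n \<omega>)"
        proof (rule order_trans[OF x_xb_le real_le_rsqrt])
          show "(norm (y n j \<omega>))\<^sup>2 \<le> V n \<omega>" unfolding V_def by (intro member_le_sum) auto
        qed
        finally show ?thesis using True I1 by simp
      next
        case False
        then show ?thesis using I_01(2) V_nonneg by simp
      qed
      have if': "integrable M ?f"
        by (rule Bochner_Integration.integrable_bound[OF ir]) (use le in \<open>auto intro: order_trans[OF _ abs_ge_self]\<close>)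
      have "integral\<^sup>L M ?f \<le> integral\<^sup>L M ?r" by (rule integral_mono[OF if' ir le])
      also have "\<dots> = (LINT \<omega>|M. I (real K) \<omega> * sqrt (V n \<omega>)) + w n"
        unfolding w_def using ISV_integrable[of "real K" n] good_Wd_integrable[of \<delta> K n] by simp
      also have "\<dots> \<le> \<delta> * sqrt (g n) + (4 * (b * \<delta>) / (\<kappa> / 4) + \<delta>) * sqrt (g n)"
        using ISV_le[of "real K" n] elim by linarith
      also have "\<dots> = C' * \<delta> * sqrt (g n)" by (simp add: C'_def algebra_simps)
      finally show ?case using if' by simp
    qed
  qed
qed

text \<open>Markov's inequality on the good event, with \<delta> chosen so that the quotient is at
  most e / 2, and then \<open>K\<close> so large that the complement has probability below e /
  2.\<close>

lemma remainder_negligible: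
  assumes \<eta>: "0 < \<eta>" and e: "0 < e"
  shows "\<forall>\<^sub>F n in sequentially. prob {\<omega>\<in>space M. \<eta> < norm ((1 / sqrt (g n)) *\<^sub>R (x n j \<omega> - xs) - (1 / sqrt (g n)) *\<^sub>R Del n \<omega>)} \<le> e"
proof -
  obtain C' where C': "0 < C'" "\<And>\<delta> K j. 0 < \<delta> \<Longrightarrow> \<delta> \<le> eps \<Longrightarrow> c0 * \<delta> \<le> \<kappa> / 4 \<Longrightarrow>
    \<forall>\<^sub>F n in sequentially. integrable M (\<lambda>\<omega>. indicator (good \<delta> K) \<omega> * norm (x n j \<omega> - xs - Del n \<omega>)) \<and>
      (LINT \<omega>|M. indicator (good \<delta> K) \<omega> * norm (x n j \<omega> - xs - Del n \<omega>)) \<le> C' * \<delta> * sqrt (g n)"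
    by (rule remainder_expectation) (rule that; blast)
  define \<delta> where "\<delta> = min eps (min (\<kappa> / (4 * c0)) (\<eta> * e / (2 * C')))"
  have \<delta>: "0 < \<delta>" "\<delta> \<le> eps" "c0 * \<delta> \<le> \<kappa> / 4" "C' * \<delta> \<le> \<eta> * e / 2"
  proof -
    show "0 < \<delta>" "\<delta> \<le> eps" using eps \<kappa>_pos c0 \<eta> e C'(1) by (auto simp: \<delta>_def)
    have "\<delta> \<le> \<kappa> / (4 * c0)" "\<delta> \<le> \<eta> * e / (2 * C')" by (auto simp: \<delta>_def)
    then show "c0 * \<delta> \<le> \<kappa> / 4" "C' * \<delta> \<le> \<eta> * e / 2" using c0 C'(1) by (simp_all add: field_simps)
  qed
  have "\<forall>\<^sub>F K in sequentially. 1 - e / 2 < prob (good \<delta> K)"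
    using good_prob[OF \<delta>(1)] e by (intro order_tendstoD(1)) auto
  then obtain K where K: "1 - e / 2 < prob (good \<delta> K)" unfolding eventually_sequentially by blast
  show ?thesis
    using C'(2)[OF \<delta>(1-3), of K j]
  proof eventually_elim
    case (elim n)
    let ?f = "\<lambda>\<omega>. indicator (good \<delta> K) \<omega> * norm (x n j \<omega> - xs - Del n \<omega>)"
    let ?A = "{\<omega>\<in>space M. \<eta> < norm ((1 / sqrt (g n)) *\<^sub>R (x n j \<omega> - xs) - (1 / sqrt (g n)) *\<^sub>R Del n \<omega>)}"
    have s: "0 < sqrt (g n)" using g_pos by simp
    have nm: "norm ((1 / sqrt (g n)) *\<^sub>R (x n j \<omega> - xs) - (1 / sqrt (g n)) *\<^sub>R Del n \<omega>) = norm (x n j \<omega> - xs - Del n \<omega>) / sqrt (g n)" for \<omega>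
      using s by (simp add: scaleR_diff_right[symmetric])
    have "?A \<subseteq> {\<omega>\<in>space M. \<eta> * sqrt (g n) \<le> ?f \<omega>} \<union> (space M - good \<delta> K)"
      unfolding nm using s by (auto simp: pos_less_divide_eq)
    then have "prob ?A \<le> prob ({\<omega>\<in>space M. \<eta> * sqrt (g n) \<le> ?f \<omega>} \<union> (space M - good \<delta> K))"
      by (intro finite_measure_mono) measurable
    also have "\<dots> \<le> prob {\<omega>\<in>space M. \<eta> * sqrt (g n) \<le> ?f \<omega>} + prob (space M - good \<delta> K)"
      by (intro measure_Un_le) measurable
    also have "prob {\<omega>\<in>space M. \<eta> * sqrt (g n) \<le> ?f \<omega>} \<le> integral\<^sup>L M ?f / (\<eta> * sqrt (g n))"
      using elim \<eta> s by (intro integral_Markov_inequality_measure[where A = "space M"]) auto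
    also have "\<dots> \<le> (C' * \<delta> * sqrt (g n)) / (\<eta> * sqrt (g n))"
      using elim \<eta> s by (intro divide_right_mono) auto
    also have "\<dots> = C' * \<delta> / \<eta>" using s by simp
    also have "\<dots> \<le> e / 2" using \<delta>(4) \<eta> by (simp add: field_simps)
    also have "prob (space M - good \<delta> K) \<le> e / 2" using K by (simp add: prob_compl)
    finally show ?case by simp
  qed
qed

end

text \<open>Of the two standard bounds |u|^3 / 6 and |u|^2, the first is used for |u| <= 1 and the
  second beyond; a power with exponent between 2 and 3 dominates the one in use.\<close>

lemma iexp_second_order_bound:
  assumes "2 \<le> p" "p \<le> (3::real)"
  shows "cmod (iexp (- u) - (1 - \<i> * u - u\<^sup>2 / 2)) \<le> \<bar>u\<bar> powr p"
proof -
  have s: "(\<Sum>k\<le>2. (\<i> * complex_of_real (- u)) ^ k / fact k) = 1 - \<i> * u - u\<^sup>2 / 2"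
    by (simp add: eval_nat_numeral power_mult_distrib mult.assoc[symmetric]) (simp add: mult_ac flip: mult.assoc)
  have 1: "cmod (iexp (- u) - (1 - \<i> * u - u\<^sup>2 / 2)) \<le> \<bar>u\<bar> ^ 3 / 6"
    using iexp_approx1[of "- u" 2] unfolding s by (simp add: eval_nat_numeral)
  have 2: "cmod (iexp (- u) - (1 - \<i> * u - u\<^sup>2 / 2)) \<le> \<bar>u\<bar> ^ 2"
    using iexp_approx2[of "- u" 2] unfolding s by (simp add: eval_nat_numeral)
  show ?thesis
  proof (cases "u = 0")
    case False
    show ?thesis
    proof (cases "\<bar>u\<bar> \<le> 1")
      case True
      have "\<bar>u\<bar> ^ 3 / 6 \<le> \<bar>u\<bar> powr 3" using False by (simp add: powr_numeral)
      also have "\<dots> \<le> \<bar>u\<bar> powr p" using True assms by (intro powr_mono') auto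
      finally show ?thesis using 1 by linarith
    next
      case F: False
      have "\<bar>u\<bar> ^ 2 = \<bar>u\<bar> powr 2" using False by (simp add: powr_numeral)
      also have "\<dots> \<le> \<bar>u\<bar> powr p" using F assms by (intro powr_mono) auto
      finally show ?thesis using 2 by linarith
    qed
  qed (use 2 in simp)
qed

lemma exp_second_order_bound:
  assumes "\<bar>x::real\<bar> \<le> 1"
  shows "\<bar>exp x - 1 - x\<bar> \<le> x\<^sup>2"
proof -
  have "exp x \<le> 1 + x + x\<^sup>2"
  proof (cases "0 \<le> x")
    case False
    then have x: "x < 0" by simp
    have "(1 - x) * exp x \<le> exp (- x) * exp x"
      using exp_ge_add_one_self[of "- x"] by (intro mult_right_mono) auto
    also have "\<dots> = 1" by (simp flip: exp_add)
    \<comment> \<open>The product is 1 - x^3, which is at least 1 for negative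
      \<open>x\<close>.\<close>
    also have "1 \<le> (1 - x) * (1 + x + x\<^sup>2)"
      using x mult_nonpos_nonneg[of x "x * x"] by (simp add: algebra_simps power2_eq_square)
    finally show ?thesis using x by simp
  qed (use assms exp_bound in auto)
  then show ?thesis using exp_ge_add_one_self[of x] zero_le_power2[of x] unfolding abs_le_iff by linarith
qed

section \<open>Linear recursions with martingale noise\<close>

text \<open>\<open>E\<close> is the noise that drives the recursion; \<open>Es\<close> is a
  comparison noise whose second moments are given exactly by \<open>T\<close>. Both moment
  conditions are required against the functions iexp(s . D n) only, which are what the noise is
  multiplied with when characteristic functions are compared.\<close>

locale linear_noise_recursion = prob_space M + lyapunov_flow H P T \<kappa>
  for M :: "'w measure" and H P T :: "real^'d^'d" and \<kappa> :: real +
  fixes g :: "nat \<Rightarrow> real" and D E Es :: "nat \<Rightarrow> 'w \<Rightarrow> real^'d" and p C :: real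
  assumes g_pos: "\<And>n. 0 < g n" and g_lim: "g \<longlonglongrightarrow> 0"
    and g_div: "filterlim (\<lambda>n. \<Sum>i<n. g i) at_top sequentially"
    and ratio: "(\<lambda>n. (g n / g (Suc n) - 1) / g n) \<longlonglongrightarrow> 0" and ratio_ge: "\<And>n. 1 \<le> g n / g (Suc n)"
    and D_meas[measurable]: "\<And>n. D n \<in> borel_measurable M"
    and E_meas[measurable]: "\<And>n. E n \<in> borel_measurable M"
    and Es_meas[measurable]: "\<And>n. Es n \<in> borel_measurable M"
    and D_int: "\<And>n. integrable M (\<lambda>\<omega>. norm (D n \<omega>))"
    and D_Suc: "\<And>n \<omega>. D (Suc n) \<omega> = D n \<omega> - g n *\<^sub>R (H *v D n \<omega> + E n \<omega>)"
    and PD: "\<And>n \<omega>. P *v D n \<omega> = D n \<omega>"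
    and p: "2 < p" "p \<le> 3"
    and E_moment: "\<And>n. integrable M (\<lambda>\<omega>. norm (E n \<omega>) powr p)" "\<And>n. (LINT \<omega>|M. norm (E n \<omega>) powr p) \<le> C"
    and E_sq: "\<And>n. integrable M (\<lambda>\<omega>. (norm (E n \<omega>))\<^sup>2)"
    and Es_sq: "\<And>n. integrable M (\<lambda>\<omega>. (norm (Es n \<omega>))\<^sup>2)"
    and orth: "\<And>n s t. (CLINT \<omega>|M. iexp (s \<bullet> D n \<omega>) * complex_of_real (t \<bullet> E n \<omega>)) = 0"
    and var: "\<And>n s t. P *v t = t \<Longrightarrow> (CLINT \<omega>|M. iexp (s \<bullet> D n \<omega>) * complex_of_real ((t \<bullet> Es n \<omega>)\<^sup>2))
        = (CLINT \<omega>|M. iexp (s \<bullet> D n \<omega>)) * complex_of_real (t \<bullet> (T *v t))"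
    and diff: "(\<lambda>n. LINT \<omega>|M. norm (E n \<omega> - Es n \<omega>) * (norm (E n \<omega>) + norm (Es n \<omega>))) \<longlonglongrightarrow> 0"
    and Tpsd: "\<And>v. 0 \<le> v \<bullet> (T *v v)"
begin

definition s where "s n = 1 / sqrt (g n)"
definition ratio' where "ratio' n = g n / g (Suc n)"
definition \<phi> where "\<phi> n t = (CLINT \<omega>|M. iexp (t \<bullet> (s n *\<^sub>R D n \<omega>)))"
definition \<psi> where "\<psi> t = complex_of_real (exp (- lyap t t / 2))"
text \<open>The transposed step of the rescaled recursion: without noise, the product of
  \<open>t\<close> with \<open>s (Suc n) *\<^sub>R D (Suc n) \<omega>\<close> is that of
  \<open>B n t\<close> with \<open>s n *\<^sub>R D n \<omega>\<close>.\<close>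

definition B where "B n t = (s (Suc n) / s n) *\<^sub>R (t - g n *\<^sub>R (transpose H *v t))"
definition \<delta> where "\<delta> n = (LINT \<omega>|M. norm (E n \<omega> - Es n \<omega>) * (norm (E n \<omega>) + norm (Es n \<omega>)))"

lemma s_pos: "0 < s n" by (simp add: s_def g_pos)

lemma s_ratio: "(s (Suc n) / s n)\<^sup>2 = ratio' n" "(s (Suc n) * g n)\<^sup>2 = ratio' n * g n"
  using g_pos[of n] g_pos[of "Suc n"]
  by (auto simp: s_def ratio'_def power_divide power_mult_distrib power2_eq_square real_sqrt_mult_self)

lemma ratio_pos: "0 < ratio' n" by (simp add: ratio'_def g_pos)

lemma C_nonneg: "0 \<le> C"
  using E_moment(2)[of 0] by (rule order_trans[rotated]) (auto intro!: Bochner_Integration.integral_nonneg)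

lemma cross_integrable: "integrable M (\<lambda>\<omega>. norm (E n \<omega> - Es n \<omega>) * (norm (E n \<omega>) + norm (Es n \<omega>)))"
proof (rule Bochner_Integration.integrable_bound)
  show "integrable M (\<lambda>\<omega>. 2 * (norm (E n \<omega>))\<^sup>2 + 2 * (norm (Es n \<omega>))\<^sup>2)"
    using E_sq Es_sq by simp
  show "AE \<omega> in M. norm (norm (E n \<omega> - Es n \<omega>) * (norm (E n \<omega>) + norm (Es n \<omega>)))
      \<le> norm (2 * (norm (E n \<omega>))\<^sup>2 + 2 * (norm (Es n \<omega>))\<^sup>2)"
  proof (intro AE_I2)
    fix \<omega>
    have "norm (E n \<omega> - Es n \<omega>) * (norm (E n \<omega>) + norm (Es n \<omega>)) \<le> (norm (E n \<omega>) + norm (Es n \<omega>)) * (norm (E n \<omega>) + norm (Es n \<omega>))"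
      by (intro mult_right_mono norm_triangle_ineq4) simp
    also have "\<dots> \<le> 2 * (norm (E n \<omega>))\<^sup>2 + 2 * (norm (Es n \<omega>))\<^sup>2"
      using sum_squares_bound[of "norm (E n \<omega>)" "norm (Es n \<omega>)"] by (simp add: power2_eq_square algebra_simps)
    finally show "norm (norm (E n \<omega> - Es n \<omega>) * (norm (E n \<omega>) + norm (Es n \<omega>)))
      \<le> norm (2 * (norm (E n \<omega>))\<^sup>2 + 2 * (norm (Es n \<omega>))\<^sup>2)" by simp
  qed
qed measurable

text \<open>Taylor expansion of the factor contributed by the new noise: the first-order term
  vanishes by orthogonality, the second-order term is evaluated after replacing \<open>E\<close> by
  \<open>Es\<close> at the cost of \<open>\<delta> n\<close>, and the remainder is of order g^(p/2),
  which is o(g) since p > 2.\<close>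

lemma char_step:
  assumes t: "P *v t = t"
  shows "cmod (\<phi> (Suc n) t - \<phi> n (B n t) * complex_of_real (1 - ratio' n * g n * (t \<bullet> (T *v t)) / 2))
    \<le> (s (Suc n) * g n) powr p * norm t powr p * C + ratio' n * g n * (norm t)\<^sup>2 * \<delta> n / 2"
proof -
  define r where "r = s (Suc n) * g n"
  have r: "0 < r" using s_pos g_pos by (simp add: r_def)
  define u where "u = (\<lambda>\<omega>. r * (t \<bullet> E n \<omega>))"
  define v where "v = (\<lambda>\<omega>. r * (t \<bullet> Es n \<omega>))"
  define e where "e = (\<lambda>\<omega>. iexp (B n t \<bullet> (s n *\<^sub>R D n \<omega>)))"
  have [measurable]: "u \<in> borel_measurable M" "v \<in> borel_measurable M" "e \<in> borel_measurable M"
    by (simp_all add: u_def v_def e_def)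
  have ne: "cmod (e \<omega>) = 1" for \<omega> by (simp add: e_def)
  have ie: "integrable M e" by (rule integrable_const_bound[where B = 1]) (auto simp: ne)
  have u_le: "\<bar>u \<omega>\<bar> \<le> r * norm t * norm (E n \<omega>)" for \<omega>
    using Cauchy_Schwarz_ineq2[of t "E n \<omega>"] r by (simp add: u_def abs_mult mult.assoc)
  have v_le: "\<bar>v \<omega>\<bar> \<le> r * norm t * norm (Es n \<omega>)" for \<omega>
    using Cauchy_Schwarz_ineq2[of t "Es n \<omega>"] r by (simp add: v_def abs_mult mult.assoc)
  have iu2: "integrable M (\<lambda>\<omega>. (u \<omega>)\<^sup>2)"
  proof (rule Bochner_Integration.integrable_bound)
    show "integrable M (\<lambda>\<omega>. (r * norm t)\<^sup>2 * (norm (E n \<omega>))\<^sup>2)" using E_sq by simp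
    show "AE \<omega> in M. norm ((u \<omega>)\<^sup>2) \<le> norm ((r * norm t)\<^sup>2 * (norm (E n \<omega>))\<^sup>2)"
      using power_mono[OF u_le, of _ 2] by (intro AE_I2) (simp add: power_mult_distrib)
  qed measurable
  have iv2: "integrable M (\<lambda>\<omega>. (v \<omega>)\<^sup>2)"
  proof (rule Bochner_Integration.integrable_bound)
    show "integrable M (\<lambda>\<omega>. (r * norm t)\<^sup>2 * (norm (Es n \<omega>))\<^sup>2)" using Es_sq by simp
    show "AE \<omega> in M. norm ((v \<omega>)\<^sup>2) \<le> norm ((r * norm t)\<^sup>2 * (norm (Es n \<omega>))\<^sup>2)"
      using power_mono[OF v_le, of _ 2] by (intro AE_I2) (simp add: power_mult_distrib)
  qed measurable
  have iu: "integrable M u"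
    using square_integrable_imp_integrable[OF _ iu2] by simp
  have mul: "integrable M (\<lambda>\<omega>. e \<omega> * complex_of_real (f \<omega>))" if "integrable M f" for f
    by (rule Bochner_Integration.integrable_bound[OF that]) (use that in \<open>auto simp: norm_mult ne\<close>)
  have iup: "integrable M (\<lambda>\<omega>. \<bar>u \<omega>\<bar> powr p)" and up: "(LINT \<omega>|M. \<bar>u \<omega>\<bar> powr p) \<le> r powr p * norm t powr p * C"
  proof -
    have le: "\<bar>u \<omega>\<bar> powr p \<le> r powr p * norm t powr p * norm (E n \<omega>) powr p" for \<omega>
      using powr_mono2[OF _ _ u_le, of p] p r by (simp add: powr_mult)
    show "integrable M (\<lambda>\<omega>. \<bar>u \<omega>\<bar> powr p)"
      by (rule Bochner_Integration.integrable_bound[of M "\<lambda>\<omega>. r powr p * norm t powr p * norm (E n \<omega>) powr p"])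
         (use le E_moment(1)[of n] in auto)
    then have "(LINT \<omega>|M. \<bar>u \<omega>\<bar> powr p) \<le> (LINT \<omega>|M. r powr p * norm t powr p * norm (E n \<omega>) powr p)"
      using le E_moment(1)[of n] by (intro integral_mono) auto
    also have "\<dots> \<le> r powr p * norm t powr p * C"
      using E_moment(2)[of n] by (simp add: mult_left_mono)
    finally show "(LINT \<omega>|M. \<bar>u \<omega>\<bar> powr p) \<le> r powr p * norm t powr p * C" .
  qed
  define w where "w = (\<lambda>\<omega>. iexp (- u \<omega>) - (1 - \<i> * u \<omega> - (u \<omega>)\<^sup>2 / 2))"
  have [measurable]: "w \<in> borel_measurable M" by (simp add: w_def)
  have w_le: "cmod (w \<omega>) \<le> \<bar>u \<omega>\<bar> powr p" for \<omega>
    unfolding w_def using p by (intro iexp_second_order_bound) auto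
  have iw: "integrable M (\<lambda>\<omega>. e \<omega> * w \<omega>)"
    by (rule Bochner_Integration.integrable_bound[OF iup]) (use w_le in \<open>auto simp: norm_mult ne\<close>)
  \<comment> \<open>The square of \<open>u\<close> is split into that of \<open>v\<close> and the
    difference, because the variance is known exactly for \<open>Es\<close> and not for
    \<open>E\<close>.\<close>
  have eq: "iexp (t \<bullet> (s (Suc n) *\<^sub>R D (Suc n) \<omega>)) = e \<omega> * w \<omega> + e \<omega> - \<i> * (e \<omega> * u \<omega>)
      - (e \<omega> * complex_of_real ((u \<omega>)\<^sup>2 - (v \<omega>)\<^sup>2)) / 2 - (e \<omega> * complex_of_real ((v \<omega>)\<^sup>2)) / 2" for \<omega>
  proof -
    have "t \<bullet> (s (Suc n) *\<^sub>R D (Suc n) \<omega>) = B n t \<bullet> (s n *\<^sub>R D n \<omega>) + - u \<omega>"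
      using s_pos[of n] transpose_inner[of H t "D n \<omega>"]
      by (simp add: D_Suc B_def u_def r_def inner_diff_left inner_diff_right inner_add_right algebra_simps)
    then have "iexp (t \<bullet> (s (Suc n) *\<^sub>R D (Suc n) \<omega>)) = e \<omega> * iexp (- u \<omega>)"
      by (simp only: e_def of_real_add distrib_left exp_add)
    also have "iexp (- u \<omega>) = w \<omega> + (1 - \<i> * u \<omega> - (u \<omega>)\<^sup>2 / 2)" by (simp add: w_def)
    finally show ?thesis by (simp add: algebra_simps diff_divide_distrib)
  qed
  have o: "(CLINT \<omega>|M. e \<omega> * u \<omega>) = 0"
    using orth[of "s n *\<^sub>R B n t" n t] by (simp add: e_def u_def mult.left_commute)
  have v: "(CLINT \<omega>|M. e \<omega> * complex_of_real ((v \<omega>)\<^sup>2)) = \<phi> n (B n t) * complex_of_real (r\<^sup>2 * (t \<bullet> (T *v t)))"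
    using var[OF t, of "s n *\<^sub>R B n t" n]
    by (simp add: e_def v_def \<phi>_def power_mult_distrib mult.left_commute)
  have "\<phi> (Suc n) t = (CLINT \<omega>|M. e \<omega> * w \<omega>) + (CLINT \<omega>|M. e \<omega>) - \<i> * (CLINT \<omega>|M. e \<omega> * u \<omega>)
      - (CLINT \<omega>|M. e \<omega> * complex_of_real ((u \<omega>)\<^sup>2 - (v \<omega>)\<^sup>2)) / 2 - (CLINT \<omega>|M. e \<omega> * complex_of_real ((v \<omega>)\<^sup>2)) / 2"
    unfolding \<phi>_def eq using iw ie mul[OF iu] mul[OF Bochner_Integration.integrable_diff[OF iu2 iv2]] mul[OF iv2]
    by simp
  then have "\<phi> (Suc n) t - \<phi> n (B n t) * complex_of_real (1 - ratio' n * g n * (t \<bullet> (T *v t)) / 2)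
      = (CLINT \<omega>|M. e \<omega> * w \<omega>) - (CLINT \<omega>|M. e \<omega> * complex_of_real ((u \<omega>)\<^sup>2 - (v \<omega>)\<^sup>2)) / 2"
    unfolding o v s_ratio(2)[of n, folded r_def, symmetric] by (simp add: e_def \<phi>_def algebra_simps)
  also have "cmod \<dots> \<le> cmod (CLINT \<omega>|M. e \<omega> * w \<omega>) + cmod (CLINT \<omega>|M. e \<omega> * complex_of_real ((u \<omega>)\<^sup>2 - (v \<omega>)\<^sup>2)) / 2"
    by (rule order_trans[OF norm_triangle_ineq4]) (simp add: norm_divide)
  also have "cmod (CLINT \<omega>|M. e \<omega> * w \<omega>) \<le> r powr p * norm t powr p * C"
  proof -
    have "cmod (CLINT \<omega>|M. e \<omega> * w \<omega>) \<le> (LINT \<omega>|M. cmod (e \<omega> * w \<omega>))" by (rule integral_norm_bound)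
    also have "\<dots> \<le> (LINT \<omega>|M. \<bar>u \<omega>\<bar> powr p)"
      using integrable_norm[OF iw] iup w_le by (intro integral_mono) (auto simp: norm_mult ne)
    finally show ?thesis using up by linarith
  qed
  also have "cmod (CLINT \<omega>|M. e \<omega> * complex_of_real ((u \<omega>)\<^sup>2 - (v \<omega>)\<^sup>2)) \<le> ratio' n * g n * (norm t)\<^sup>2 * \<delta> n"
  proof -
    have "cmod (CLINT \<omega>|M. e \<omega> * complex_of_real ((u \<omega>)\<^sup>2 - (v \<omega>)\<^sup>2)) \<le> (LINT \<omega>|M. cmod (e \<omega> * complex_of_real ((u \<omega>)\<^sup>2 - (v \<omega>)\<^sup>2)))"
      by (rule integral_norm_bound)
    also have "\<dots> \<le> (LINT \<omega>|M. (r\<^sup>2 * (norm t)\<^sup>2) * (norm (E n \<omega> - Es n \<omega>) * (norm (E n \<omega>) + norm (Es n \<omega>))))"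
    proof (rule integral_mono)
      show "integrable M (\<lambda>\<omega>. cmod (e \<omega> * complex_of_real ((u \<omega>)\<^sup>2 - (v \<omega>)\<^sup>2)))"
        by (rule integrable_norm[OF mul[OF Bochner_Integration.integrable_diff[OF iu2 iv2]]])
      show "integrable M (\<lambda>\<omega>. (r\<^sup>2 * (norm t)\<^sup>2) * (norm (E n \<omega> - Es n \<omega>) * (norm (E n \<omega>) + norm (Es n \<omega>))))"
        using cross_integrable[of n] by (rule integrable_mult_right)
      fix \<omega>
      have "(u \<omega>)\<^sup>2 - (v \<omega>)\<^sup>2 = r\<^sup>2 * ((t \<bullet> (E n \<omega> - Es n \<omega>)) * (t \<bullet> (E n \<omega> + Es n \<omega>)))"
        by (simp add: u_def v_def inner_diff_right inner_add_right power2_eq_square algebra_simps)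
      then have "cmod (e \<omega> * complex_of_real ((u \<omega>)\<^sup>2 - (v \<omega>)\<^sup>2)) = r\<^sup>2 * (\<bar>t \<bullet> (E n \<omega> - Es n \<omega>)\<bar> * \<bar>t \<bullet> (E n \<omega> + Es n \<omega>)\<bar>)"
        by (simp only: norm_mult ne norm_of_real abs_mult abs_power2 mult_1)
      also have "\<dots> \<le> r\<^sup>2 * ((norm t * norm (E n \<omega> - Es n \<omega>)) * (norm t * (norm (E n \<omega>) + norm (Es n \<omega>))))"
        by (intro mult_left_mono mult_mono Cauchy_Schwarz_ineq2
            order_trans[OF Cauchy_Schwarz_ineq2 mult_left_mono[OF norm_triangle_ineq]]) auto
      finally show "cmod (e \<omega> * complex_of_real ((u \<omega>)\<^sup>2 - (v \<omega>)\<^sup>2)) \<le> (r\<^sup>2 * (norm t)\<^sup>2) * (norm (E n \<omega> - Es n \<omega>) * (norm (E n \<omega>) + norm (Es n \<omega>)))"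
        by (simp add: power2_eq_square mult_ac)
    qed
    also have "\<dots> = ratio' n * g n * (norm t)\<^sup>2 * \<delta> n"
      by (simp add: \<delta>_def r_def s_ratio)
    finally show ?thesis .
  qed
  finally show ?thesis by (simp add: r_def)
qed

lemma quadratic_bound: "\<exists>K>0. \<forall>v. norm (transpose H *v v) \<le> K * norm v \<and> v \<bullet> (T *v v) \<le> K * (norm v)\<^sup>2 \<and> lyap v v \<le> K * (norm v)\<^sup>2"
proof -
  obtain K1 where K1: "0 < K1" "\<And>v. norm (transpose H *v v) \<le> norm v * K1"
    using bounded_linear.pos_bounded[OF matrix_vector_mul_bounded_linear[of "transpose H"]] by blast
  obtain K2 where K2: "0 < K2" "\<And>v. norm (T *v v) \<le> norm v * K2"
    using bounded_linear.pos_bounded[OF matrix_vector_mul_bounded_linear[of T]] by blast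
  have "\<exists>K. \<forall>v. lyap v v \<le> K * (norm v)\<^sup>2"
  proof -
    define K where "K = (LINT b|lborel. indicator {0..} b *\<^sub>R (K2 * exp (- (2 * \<kappa>) * b)))"
    have "lyap v v \<le> K * (norm v)\<^sup>2" for v
    proof -
      have int: "integrable lborel (\<lambda>t. indicator {0..} t *\<^sub>R (K2 * exp (- (2 * \<kappa>) * t)))"
        using exp_decay_integrable[of "2 * \<kappa>"] \<kappa> by (simp add: set_integrable_def mult.left_commute)
      have "lyap v v \<le> (LINT t|lborel. (norm v)\<^sup>2 * (indicator {0..} t *\<^sub>R (K2 * exp (- (2 * \<kappa>) * t))))"
        unfolding lyap_def set_lebesgue_integral_def
      proof (rule integral_mono)
        show "integrable lborel (\<lambda>t. indicator {0..} t *\<^sub>R (flow v t \<bullet> (T *v flow v t)))"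
          using flow_form_integrable[of v v] by (simp add: set_integrable_def)
        show "integrable lborel (\<lambda>t. (norm v)\<^sup>2 * (indicator {0..} t *\<^sub>R (K2 * exp (- (2 * \<kappa>) * t))))"
          using int by (rule integrable_mult_right)
        fix t :: real
        show "indicator {0..} t *\<^sub>R (flow v t \<bullet> (T *v flow v t)) \<le> (norm v)\<^sup>2 * (indicator {0..} t *\<^sub>R (K2 * exp (- (2 * \<kappa>) * t)))"
        proof (cases "0 \<le> t")
          case True
          have "flow v t \<bullet> (T *v flow v t) \<le> norm (flow v t) * (norm (flow v t) * K2)"
            by (rule order_trans[OF norm_cauchy_schwarz mult_left_mono[OF K2(2)]]) simp
          also have "\<dots> \<le> (exp (- \<kappa> * t) * norm v) * ((exp (- \<kappa> * t) * norm v) * K2)"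
            using flow_decay[OF True] K2(1) by (intro mult_mono) auto
          also have "\<dots> = (norm v)\<^sup>2 * (K2 * exp (- (2 * \<kappa>) * t))"
            by (simp add: power2_eq_square mult_ac flip: exp_add)
          finally show ?thesis using True by simp
        qed simp
      qed
      also have "\<dots> = K * (norm v)\<^sup>2" by (simp add: K_def)
      finally show ?thesis .
    qed
    then show ?thesis by blast
  qed
  then obtain K3 where K3: "\<And>v. lyap v v \<le> K3 * (norm v)\<^sup>2" by blast
  define K where "K = max K1 (max K2 K3)"
  have "norm (transpose H *v v) \<le> K * norm v \<and> v \<bullet> (T *v v) \<le> K * (norm v)\<^sup>2 \<and> lyap v v \<le> K * (norm v)\<^sup>2" for v
  proof (intro conjI)
    show "norm (transpose H *v v) \<le> K * norm v"
      using K1(2)[of v] mult_right_mono[of K1 K "norm v"] by (simp add: K_def mult.commute)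
    have "v \<bullet> (T *v v) \<le> K2 * (norm v)\<^sup>2"
      using order_trans[OF norm_cauchy_schwarz mult_left_mono[OF K2(2)], of v v] by (simp add: power2_eq_square mult_ac)
    also have "\<dots> \<le> K * (norm v)\<^sup>2" by (intro mult_right_mono) (auto simp: K_def)
    finally show "v \<bullet> (T *v v) \<le> K * (norm v)\<^sup>2" .
    show "lyap v v \<le> K * (norm v)\<^sup>2"
      by (rule order_trans[OF K3 mult_right_mono]) (auto simp: K_def)
  qed
  moreover have "0 < K" using K1(1) by (simp add: K_def)
  ultimately show ?thesis by blast
qed

lemma ratio'_tendsto: "ratio' \<longlonglongrightarrow> 1" and g_ratio'_ge: "1 \<le> ratio' n"
proof -
  have "(\<lambda>n. 1 + g n * ((g n / g (Suc n) - 1) / g n)) \<longlonglongrightarrow> 1 + 0 * 0"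
    by (intro tendsto_intros g_lim ratio)
  moreover have "1 + g n * ((g n / g (Suc n) - 1) / g n) = ratio' n" for n
    using g_pos[of n] by (simp add: ratio'_def)
  ultimately show "ratio' \<longlonglongrightarrow> 1" by simp
  show "1 \<le> ratio' n" using ratio_ge by (simp add: ratio'_def)
qed

lemma H_inner: "t \<bullet> (transpose H *v t) = t \<bullet> (H *v t)"
  using transpose_inner[of H t t] by (simp add: inner_commute)

lemma PB: "P *v t = t \<Longrightarrow> P *v B n t = B n t"
proof -
  assume t: "P *v t = t"
  have "P ** transpose H = transpose H" using HP Psym by (metis matrix_transpose_mul)
  then show "P *v B n t = B n t"
    using t by (simp add: B_def matrix_vector_mult_scaleR matrix_vector_mult_diff_distrib matrix_vector_mul_assoc)
qed

text \<open>Passing from the scale of step n to that of n + 1 multiplies the square by the step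
  ratio, which is at most 1 + \<kappa> g. The condition g K^2 < \<kappa> / 2 leaves 1 - 3/2 \<kappa>
  g for the squared drift, and the product of the two is below (1 - \<kappa> g / 4)^2.\<close>

lemma B_contraction: "\<forall>\<^sub>F n in sequentially. \<forall>t. P *v t = t \<longrightarrow> norm (B n t) \<le> (1 - \<kappa> / 4 * g n) * norm t"
proof -
  obtain K where K: "0 < K" "\<And>v. norm (transpose H *v v) \<le> K * norm v" using quadratic_bound by blast
  have "(\<lambda>n. g n * K\<^sup>2) \<longlonglongrightarrow> 0 * K\<^sup>2" by (intro tendsto_intros g_lim)
  then have 1: "\<forall>\<^sub>F n in sequentially. g n * K\<^sup>2 < \<kappa> / 2"
    by (rule order_tendstoD) (use \<kappa> in simp)
  have 2: "\<forall>\<^sub>F n in sequentially. (g n / g (Suc n) - 1) / g n < \<kappa>"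
    using ratio \<kappa> by (rule order_tendstoD)
  have "(\<lambda>n. \<kappa> / 4 * g n) \<longlonglongrightarrow> \<kappa> / 4 * 0" by (intro tendsto_intros g_lim)
  then have 3: "\<forall>\<^sub>F n in sequentially. \<kappa> / 4 * g n < 1"
    by (rule order_tendstoD) simp
  show ?thesis
    using 1 2 3
  proof eventually_elim
    case (elim n)
    show ?case
    proof (intro allI impI)
      fix t assume t: "P *v t = t"
      have g: "0 < g n" by (rule g_pos)
      have r: "ratio' n \<le> 1 + \<kappa> * g n"
        using elim(2) g by (simp add: ratio'_def divide_less_eq)
      have "(norm (B n t))\<^sup>2 = ratio' n * (norm (t - g n *\<^sub>R (transpose H *v t)))\<^sup>2"
      proof -
        have "norm (B n t) = (s (Suc n) / s n) * norm (t - g n *\<^sub>R (transpose H *v t))"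
          using s_pos[of n] s_pos[of "Suc n"] by (simp add: B_def)
        then show ?thesis by (simp only: power_mult_distrib s_ratio)
      qed
      also have "(norm (t - g n *\<^sub>R (transpose H *v t)))\<^sup>2
          = (norm t)\<^sup>2 - 2 * g n * (t \<bullet> (H *v t)) + (g n)\<^sup>2 * (norm (transpose H *v t))\<^sup>2"
        unfolding power2_norm_eq_inner
        by (simp add: inner_diff_left inner_diff_right inner_commute[of "transpose H *v t" t] H_inner power2_eq_square
            right_diff_distrib)
      also have "ratio' n * \<dots> \<le> ratio' n * ((1 - 3 / 2 * \<kappa> * g n) * (norm t)\<^sup>2)"
      proof (rule mult_left_mono)
        have "g n * (2 * (t \<bullet> (H *v t))) \<ge> g n * (2 * (\<kappa> * (norm t)\<^sup>2))"
          using coercive[OF t] g by (intro mult_left_mono) auto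
        moreover have "(g n)\<^sup>2 * (norm (transpose H *v t))\<^sup>2 \<le> (g n)\<^sup>2 * (K * norm t)\<^sup>2"
          using K by (intro mult_left_mono power_mono) auto
        moreover have "(g n)\<^sup>2 * (K * norm t)\<^sup>2 = g n * (g n * K\<^sup>2) * (norm t)\<^sup>2"
          by (simp add: power2_eq_square mult_ac)
        moreover have "g n * (g n * K\<^sup>2) * (norm t)\<^sup>2 \<le> g n * (\<kappa> / 2) * (norm t)\<^sup>2"
          using elim(1) g by (intro mult_right_mono mult_left_mono) auto
        ultimately show "(norm t)\<^sup>2 - 2 * g n * (t \<bullet> (H *v t)) + (g n)\<^sup>2 * (norm (transpose H *v t))\<^sup>2
            \<le> (1 - 3 / 2 * \<kappa> * g n) * (norm t)\<^sup>2"
          by (simp only: left_diff_distrib mult_1) (simp add: algebra_simps del: power_mult_distrib)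
      qed (use ratio_pos[of n] in simp)
      also have "\<dots> \<le> (1 - \<kappa> / 4 * g n)\<^sup>2 * (norm t)\<^sup>2"
      proof -
        have "ratio' n * (1 - 3 / 2 * \<kappa> * g n) \<le> (1 - \<kappa> / 4 * g n)\<^sup>2"
        proof (cases "0 \<le> 1 - 3 / 2 * \<kappa> * g n")
          case True
          then have "ratio' n * (1 - 3 / 2 * \<kappa> * g n) \<le> (1 + \<kappa> * g n) * (1 - 3 / 2 * \<kappa> * g n)"
            using r by (intro mult_right_mono)
          also have "\<dots> = (1 - \<kappa> / 4 * g n)\<^sup>2 - (\<kappa> * g n)\<^sup>2 * (25 / 16)"
            by (simp add: power2_eq_square algebra_simps)
          finally show ?thesis using zero_le_power2[of "\<kappa> * g n"] by linarith
        next
          case False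
          then have "ratio' n * (1 - 3 / 2 * \<kappa> * g n) \<le> 0"
            using ratio_pos[of n] by (intro mult_nonneg_nonpos) auto
          then show ?thesis by (smt (verit) zero_le_power2)
        qed
        from mult_right_mono[OF this, of "(norm t)\<^sup>2"] show ?thesis by (simp add: mult.assoc)
      qed
      finally have "(norm (B n t))\<^sup>2 \<le> ((1 - \<kappa> / 4 * g n) * norm t)\<^sup>2"
        by (simp add: power_mult_distrib)
      then show "norm (B n t) \<le> (1 - \<kappa> / 4 * g n) * norm t"
        by (rule power2_le_imp_le) (use elim(3) in simp)
    qed
  qed
qed

text \<open>By the Lyapunov equation \<open>lyap (B n t) (B n t)\<close> is the step ratio times
  lyap t t - g t . T t + O(g^2), so the exponents of \<psi> at \<open>t\<close> and at
  \<open>B n t\<close> differ by g t . T t / 2 up to o(g). The error is at least quadratic in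
  \<open>t\<close>; on a ball this is turned into a single factor \<open>norm t\<close>.\<close>

lemma normal_step:
  assumes \<rho>: "0 < \<rho>"
  obtains \<eta> where "\<eta> \<longlonglongrightarrow> 0" "\<And>n. 0 \<le> \<eta> n"
    "\<forall>\<^sub>F n in sequentially. \<forall>t. P *v t = t \<longrightarrow> norm t \<le> \<rho> \<longrightarrow>
      cmod (\<psi> t - \<psi> (B n t) * complex_of_real (1 - ratio' n * g n * (t \<bullet> (T *v t)) / 2)) \<le> g n * \<eta> n * norm t"
proof -
  obtain K where K: "0 < K" "\<And>v. norm (transpose H *v v) \<le> K * norm v" "\<And>v. v \<bullet> (T *v v) \<le> K * (norm v)\<^sup>2"
    "\<And>v. lyap v v \<le> K * (norm v)\<^sup>2" using quadratic_bound by blast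
  define R where "R n = (g n / g (Suc n) - 1) / g n" for n
  have R0: "0 \<le> R n" for n using ratio_ge[of n] g_pos[of n] by (simp add: R_def)
  have Rr: "ratio' n - 1 = g n * R n" for n using g_pos[of n] by (simp add: R_def ratio'_def)
  define a where "a n = (R n * K + ratio' n * g n * K ^ 3) / 2" for n
  define b where "b n = ratio' n * K / 2 + a n" for n
  have a0: "0 \<le> a n" and b0: "0 \<le> b n" for n
    using R0[of n] ratio_pos[of n] g_pos[of n] K(1) by (auto simp: a_def b_def)
  have al: "a \<longlonglongrightarrow> 0"
  proof -
    have "(\<lambda>n. (R n * K + ratio' n * g n * K ^ 3) / 2) \<longlonglongrightarrow> (0 * K + 1 * 0 * K ^ 3) / 2"
      unfolding R_def by (intro tendsto_intros ratio ratio'_tendsto g_lim) simp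
    then show ?thesis by (simp add: a_def[abs_def])
  qed
  have bl: "b \<longlonglongrightarrow> 1 * K / 2 + 0"
    unfolding b_def by (intro tendsto_intros ratio'_tendsto al) simp
  define \<eta> where "\<eta> n = a n * \<rho> + g n * (b n)\<^sup>2 * \<rho> ^ 3" for n
  have "\<eta> \<longlonglongrightarrow> 0 * \<rho> + 0 * (1 * K / 2 + 0)\<^sup>2 * \<rho> ^ 3"
    unfolding \<eta>_def by (intro tendsto_intros al bl g_lim)
  then have \<eta>l: "\<eta> \<longlonglongrightarrow> 0" by simp
  have \<eta>0: "0 \<le> \<eta> n" for n using a0 g_pos[of n] \<rho> by (simp add: \<eta>_def)
  have "(\<lambda>n. g n * b n * \<rho>\<^sup>2) \<longlonglongrightarrow> 0 * (1 * K / 2 + 0) * \<rho>\<^sup>2"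
    by (intro tendsto_intros bl g_lim)
  then have "\<forall>\<^sub>F n in sequentially. g n * b n * \<rho>\<^sup>2 < 1"
    by (rule order_tendstoD) simp
  then have "\<forall>\<^sub>F n in sequentially. \<forall>t. P *v t = t \<longrightarrow> norm t \<le> \<rho> \<longrightarrow>
      cmod (\<psi> t - \<psi> (B n t) * complex_of_real (1 - ratio' n * g n * (t \<bullet> (T *v t)) / 2)) \<le> g n * \<eta> n * norm t"
  proof eventually_elim
    case (elim n)
    show ?case
    proof (intro allI impI)
      fix t assume t: "P *v t = t" and t\<rho>: "norm t \<le> \<rho>"
      have g: "0 < g n" by (rule g_pos)
      define q where "q = lyap t t"
      define q' where "q' = lyap (transpose H *v t) (transpose H *v t)"
      \<comment> \<open>\<open>y\<close> is the exact difference of the exponents and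
        \<open>x0\<close> its leading part. What separates them is the change of scale, through
        \<open>R\<close>, and the term of second order in the step.\<close>
      define x0 where "x0 = ratio' n * g n * (t \<bullet> (T *v t)) / 2"
      define y where "y = (q - lyap (B n t) (B n t)) / 2"
      have q: "0 \<le> q" "q \<le> K * (norm t)\<^sup>2"
        using lyap_nonneg[OF Tpsd, of t] K(4) by (auto simp: q_def)
      have q': "0 \<le> q'" "q' \<le> K ^ 3 * (norm t)\<^sup>2"
      proof -
        show "0 \<le> q'" using lyap_nonneg[OF Tpsd] by (simp add: q'_def)
        have "q' \<le> K * (norm (transpose H *v t))\<^sup>2" using K(4) by (simp add: q'_def)
        also have "\<dots> \<le> K * (K * norm t)\<^sup>2" using K(1,2) by (intro mult_left_mono power_mono) auto
        finally show "q' \<le> K ^ 3 * (norm t)\<^sup>2" by (simp add: power_mult_distrib power2_eq_square power3_eq_cube mult_ac)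
      qed
      have "lyap (B n t) (B n t) = (s (Suc n) / s n)\<^sup>2 * (q - g n * (2 * lyap (transpose H *v t) t) + (g n)\<^sup>2 * q')"
      proof -
        let ?w = "g n *\<^sub>R (transpose H *v t)"
        have "lyap (t - ?w) (t - ?w) = lyap t t - lyap ?w t - (lyap t ?w - lyap ?w ?w)"
          by (simp only: linear_diff[OF lyap_linear(1)] linear_diff[OF lyap_linear(2)])
        then have "lyap (t - ?w) (t - ?w) = q - g n * (2 * lyap (transpose H *v t) t) + (g n)\<^sup>2 * q'"
          by (simp add: lyap_scaleR q_def q'_def lyap_commute[of t "transpose H *v t"] power2_eq_square)
        then show ?thesis
          by (simp only: B_def lyap_scaleR) (simp add: power2_eq_square)
      qed
      then have "lyap (B n t) (B n t) = ratio' n * (q - g n * (t \<bullet> (T *v t)) + (g n)\<^sup>2 * q')"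
        by (simp add: s_ratio lyapunov_equation t)
      then have y: "x0 - y = g n * (R n * q + ratio' n * g n * q') / 2"
      proof -
        have "2 * (x0 - y) = (ratio' n - 1) * q + ratio' n * (g n)\<^sup>2 * q'"
          unfolding y_def x0_def \<open>lyap (B n t) (B n t) = ratio' n * (q - g n * (t \<bullet> (T *v t)) + (g n)\<^sup>2 * q')\<close>
          by (simp add: field_simps)
        also have "\<dots> = g n * (R n * q + ratio' n * g n * q')"
          unfolding Rr by (simp add: power2_eq_square algebra_simps)
        finally show ?thesis by simp
      qed
      have d0: "0 \<le> x0 - y" unfolding y
        using g R0[of n] ratio_pos[of n] q q' by (intro divide_nonneg_pos mult_nonneg_nonneg add_nonneg_nonneg) auto
      have d1: "x0 - y \<le> g n * a n * (norm t)\<^sup>2"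
      proof -
        have "R n * q + ratio' n * g n * q' \<le> R n * (K * (norm t)\<^sup>2) + ratio' n * g n * (K ^ 3 * (norm t)\<^sup>2)"
          using g R0[of n] ratio_pos[of n] q q' by (intro add_mono mult_left_mono) auto
        also have "\<dots> = 2 * a n * (norm t)\<^sup>2" by (simp add: a_def algebra_simps)
        finally have "g n * (R n * q + ratio' n * g n * q') \<le> g n * (2 * a n * (norm t)\<^sup>2)"
          using g by (intro mult_left_mono) auto
        then show ?thesis unfolding y by simp
      qed
      have x0: "0 \<le> x0" "x0 \<le> g n * (ratio' n * K / 2) * (norm t)\<^sup>2"
      proof -
        show "0 \<le> x0" using Tpsd[of t] g ratio_pos[of n] by (simp add: x0_def)
        have "(ratio' n * g n / 2) * (t \<bullet> (T *v t)) \<le> (ratio' n * g n / 2) * (K * (norm t)\<^sup>2)"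
          using K(3) g ratio_pos[of n] by (intro mult_left_mono) auto
        then show "x0 \<le> g n * (ratio' n * K / 2) * (norm t)\<^sup>2" by (simp add: x0_def mult_ac)
      qed
      have ay: "\<bar>y\<bar> \<le> g n * b n * (norm t)\<^sup>2"
      proof -
        have "0 \<le> g n * (ratio' n * K / 2) * (norm t)\<^sup>2" "0 \<le> g n * a n * (norm t)\<^sup>2"
          using g ratio_pos[of n] K(1) a0[of n] by auto
        moreover have "g n * b n * (norm t)\<^sup>2 = g n * (ratio' n * K / 2) * (norm t)\<^sup>2 + g n * a n * (norm t)\<^sup>2"
          by (simp add: b_def algebra_simps)
        ultimately show ?thesis using d0 d1 x0 by linarith
      qed
      also have "\<dots> \<le> g n * b n * \<rho>\<^sup>2"
        using g b0[of n] t\<rho> by (intro mult_left_mono power_mono) auto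
      finally have y1: "\<bar>- y\<bar> \<le> 1" using elim by simp
      have t2: "(norm t)\<^sup>2 \<le> \<rho> * norm t" "(norm t)^4 \<le> \<rho> ^ 3 * norm t"
      proof -
        show "(norm t)\<^sup>2 \<le> \<rho> * norm t" using t\<rho> by (simp add: power2_eq_square mult_right_mono)
        have "(norm t) ^ 3 * norm t \<le> \<rho> ^ 3 * norm t" using t\<rho> by (intro mult_right_mono power_mono) auto
        then show "(norm t)^4 \<le> \<rho> ^ 3 * norm t" by (simp add: eval_nat_numeral)
      qed
      have "\<bar>exp (- y) - (1 - x0)\<bar> \<le> \<bar>exp (- y) - 1 - - y\<bar> + (x0 - y)"
        using d0 by linarith
      also have "\<dots> \<le> y\<^sup>2 + g n * a n * (norm t)\<^sup>2"
        using exp_second_order_bound[OF y1] d1 by simp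
      also have "y\<^sup>2 \<le> (g n * b n * (norm t)\<^sup>2)\<^sup>2"
        using power_mono[OF ay, of 2] by simp
      also have "(g n * b n * (norm t)\<^sup>2)\<^sup>2 = g n * (g n * (b n)\<^sup>2) * (norm t)^4"
        by (simp add: power_mult_distrib power2_eq_square eval_nat_numeral mult_ac)
      also have "g n * (g n * (b n)\<^sup>2) * (norm t)^4 + g n * a n * (norm t)\<^sup>2
          \<le> g n * (g n * (b n)\<^sup>2) * (\<rho> ^ 3 * norm t) + g n * a n * (\<rho> * norm t)"
        using t2 g a0[of n] by (intro add_mono mult_left_mono) auto
      also have "\<dots> = g n * \<eta> n * norm t" by (simp add: \<eta>_def algebra_simps)
      finally have main: "\<bar>exp (- y) - (1 - x0)\<bar> \<le> g n * \<eta> n * norm t" by simp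
      have "exp (- lyap t t / 2) = exp (- lyap (B n t) (B n t) / 2) * exp (- y)"
        by (simp add: y_def q_def field_simps flip: exp_add)
      then have "\<psi> t - \<psi> (B n t) * complex_of_real (1 - x0) = complex_of_real (exp (- lyap (B n t) (B n t) / 2) * (exp (- y) - (1 - x0)))"
        by (simp add: \<psi>_def algebra_simps)
      also have "cmod \<dots> \<le> 1 * \<bar>exp (- y) - (1 - x0)\<bar>"
        unfolding norm_of_real abs_mult
        using lyap_nonneg[OF Tpsd, of "B n t"] by (intro mult_right_mono) auto
      finally show "cmod (\<psi> t - \<psi> (B n t) * complex_of_real (1 - ratio' n * g n * (t \<bullet> (T *v t)) / 2)) \<le> g n * \<eta> n * norm t"
        by (simp only: x0_def[symmetric] mult_1 order_trans[OF _ main])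
    qed
  qed
  then show ?thesis using that \<eta>l \<eta>0 by blast
qed

text \<open>Both functions equal 1 at 0, and at a fixed time their distance on the ball is at most
  q0 \<open>norm t\<close>. If it is at most Q n \<open>norm t\<close> at time n, the next step
  gives the same with \<open>Q (Suc n)\<close>, because \<open>B n\<close> contracts the argument.
  The slope \<open>Q\<close> obeys a contracting recursion with vanishing inhomogeneity.\<close>

lemma char_tendsto_within:
  assumes t: "P *v t = t"
  shows "(\<lambda>n. \<phi> n t) \<longlonglongrightarrow> \<psi> t"
proof -
  \<comment> \<open>A ball around 0 that contains \<open>t\<close> and has positive radius even for
    t = 0; its part in the range of \<open>P\<close> is eventually mapped into itself by
    \<open>B n\<close>.\<close>
  define \<rho> where "\<rho> = norm t + 1"
  have \<rho>: "0 < \<rho>" by (simp add: \<rho>_def add_nonneg_pos)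
  obtain K where K: "0 < K" "\<And>v. v \<bullet> (T *v v) \<le> K * (norm v)\<^sup>2" "\<And>v. lyap v v \<le> K * (norm v)\<^sup>2"
    using quadratic_bound by blast
  obtain \<eta> where \<eta>: "\<eta> \<longlonglongrightarrow> 0" "\<And>n. 0 \<le> \<eta> n"
    "\<forall>\<^sub>F n in sequentially. \<forall>t. P *v t = t \<longrightarrow> norm t \<le> \<rho> \<longrightarrow>
      cmod (\<psi> t - \<psi> (B n t) * complex_of_real (1 - ratio' n * g n * (t \<bullet> (T *v t)) / 2)) \<le> g n * \<eta> n * norm t"
    using normal_step[OF \<rho>] by blast
  \<comment> \<open>The three errors of one step, divided by \<open>g n\<close> and
    \<open>norm t\<close>: the Taylor remainder, the replacement of the noise, and the defect of
    \<psi>. The powers of \<rho> come from estimating surplus powers of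
    \<open>norm t\<close>.\<close>
  define \<theta> where "\<theta> n = ratio' n powr (p / 2) * g n powr (p / 2 - 1) * \<rho> powr (p - 1) * C + ratio' n * \<rho> * \<delta> n / 2 + \<eta> n" for n
  have \<delta>0: "0 \<le> \<delta> n" for n unfolding \<delta>_def by (intro Bochner_Integration.integral_nonneg) auto
  have \<theta>0: "0 \<le> \<theta> n" for n
    using C_nonneg ratio_pos[of n] \<rho> \<delta>0[of n] \<eta>(2)[of n] by (simp add: \<theta>_def)
  have gp: "(\<lambda>n. g n powr (p / 2 - 1)) \<longlonglongrightarrow> 0"
    using tendsto_powr'[OF g_lim tendsto_const[of "p / 2 - 1"]] p g_pos by (simp add: less_imp_le)
  have \<theta>l: "\<theta> \<longlonglongrightarrow> 0"
  proof -
    have "(\<lambda>n. ratio' n powr (p / 2) * g n powr (p / 2 - 1) * \<rho> powr (p - 1) * C + ratio' n * \<rho> * \<delta> n / 2 + \<eta> n)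
      \<longlonglongrightarrow> 1 powr (p / 2) * 0 * \<rho> powr (p - 1) * C + 1 * \<rho> * 0 / 2 + 0"
      by (intro tendsto_intros ratio'_tendsto gp \<eta>(1) diff[folded \<delta>_def]) auto
    then show ?thesis by (simp add: \<theta>_def[abs_def])
  qed
  have "(\<lambda>n. ratio' n * g n * (K * \<rho>\<^sup>2) / 2) \<longlonglongrightarrow> 1 * 0 * (K * \<rho>\<^sup>2) / 2"
    by (intro tendsto_intros ratio'_tendsto g_lim) simp
  then have e1: "\<forall>\<^sub>F n in sequentially. ratio' n * g n * (K * \<rho>\<^sup>2) / 2 < 1"
    by (rule order_tendstoD) simp
  have "(\<lambda>n. \<kappa> / 4 * g n) \<longlonglongrightarrow> \<kappa> / 4 * 0" by (intro tendsto_intros g_lim)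
  then have e2: "\<forall>\<^sub>F n in sequentially. \<kappa> / 4 * g n < 1"
    by (rule order_tendstoD) simp
  define d where "d n t = cmod (\<phi> n t - \<psi> t)" for n t
  have "\<forall>\<^sub>F n in sequentially. \<kappa> / 4 * g n < 1 \<and> (\<forall>t. P *v t = t \<longrightarrow> norm t \<le> \<rho> \<longrightarrow>
      norm (B n t) \<le> (1 - \<kappa> / 4 * g n) * norm t \<and> d (Suc n) t \<le> d n (B n t) + g n * \<theta> n * norm t)"
    using \<eta>(3) B_contraction e1 e2
  proof eventually_elim
    case (elim n)
    show ?case
    proof (intro conjI allI impI elim(4))
      fix t assume t: "P *v t = t" "norm t \<le> \<rho>"
      show "norm (B n t) \<le> (1 - \<kappa> / 4 * g n) * norm t" using elim(2) t by blast
      define c where "c = 1 - ratio' n * g n * (t \<bullet> (T *v t)) / 2"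
      have g: "0 < g n" by (rule g_pos)
      have "\<bar>c\<bar> \<le> 1"
      proof -
        have "ratio' n * g n / 2 * (t \<bullet> (T *v t)) \<le> ratio' n * g n / 2 * (K * \<rho>\<^sup>2)"
          using t g ratio_pos[of n] K by (intro mult_left_mono order_trans[OF K(2)] power_mono) auto
        moreover have "0 \<le> ratio' n * g n * (t \<bullet> (T *v t))"
          using Tpsd[of t] g ratio_pos[of n] by simp
        ultimately show ?thesis using elim(3) by (simp add: c_def abs_le_iff)
      qed
      have s1: "cmod (\<phi> (Suc n) t - \<phi> n (B n t) * complex_of_real c) \<le> g n * (\<theta> n - \<eta> n) * norm t"
      proof -
        have "(s (Suc n) * g n) powr p * norm t powr p * C \<le> g n * (ratio' n powr (p / 2) * g n powr (p / 2 - 1) * \<rho> powr (p - 1) * C) * norm t"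
        proof -
          have "s (Suc n) * g n = sqrt (ratio' n * g n)"
            using s_ratio(2)[of n] s_pos[of "Suc n"] g by (metis mult_pos_pos order_less_imp_le real_sqrt_unique)
          then have "(s (Suc n) * g n) powr p = (ratio' n * g n) powr (p / 2)"
            using ratio_pos[of n] g by (simp add: powr_half_sqrt[symmetric] powr_powr)
          also have "\<dots> = ratio' n powr (p / 2) * g n powr ((p / 2 - 1) + 1)"
            using ratio_pos[of n] g by (simp add: powr_mult)
          also have "\<dots> = ratio' n powr (p / 2) * (g n powr (p / 2 - 1) * g n powr 1)"
            by (simp only: powr_add)
          finally have 1: "(s (Suc n) * g n) powr p = g n * (ratio' n powr (p / 2) * g n powr (p / 2 - 1))"
            using g by simp
          have 2: "norm t powr p \<le> \<rho> powr (p - 1) * norm t"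
          proof (cases "t = 0")
            case False
            have "norm t powr p = norm t powr ((p - 1) + 1)" by simp
            also have "\<dots> = norm t powr (p - 1) * norm t powr 1" by (simp only: powr_add)
            also have "\<dots> \<le> \<rho> powr (p - 1) * norm t" using t p False by (intro mult_mono powr_mono2) auto
            finally show ?thesis .
          qed simp
          have "(s (Suc n) * g n) powr p * (norm t powr p * C) \<le> (s (Suc n) * g n) powr p * ((\<rho> powr (p - 1) * norm t) * C)"
            using 2 C_nonneg by (intro mult_left_mono mult_right_mono) auto
          then show ?thesis unfolding 1 by (simp add: mult_ac)
        qed
        moreover have "ratio' n * g n * (norm t)\<^sup>2 * \<delta> n / 2 \<le> g n * (ratio' n * \<rho> * \<delta> n / 2) * norm t"
        proof -
          have "(norm t)\<^sup>2 \<le> \<rho> * norm t" using t by (simp add: power2_eq_square mult_right_mono)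
          then have "(ratio' n * g n * \<delta> n / 2) * (norm t)\<^sup>2 \<le> (ratio' n * g n * \<delta> n / 2) * (\<rho> * norm t)"
            using ratio_pos[of n] g \<delta>0[of n] by (intro mult_left_mono) auto
          then show ?thesis by (simp add: mult_ac)
        qed
        ultimately have "cmod (\<phi> (Suc n) t - \<phi> n (B n t) * complex_of_real c)
            \<le> g n * (ratio' n powr (p / 2) * g n powr (p / 2 - 1) * \<rho> powr (p - 1) * C) * norm t + g n * (ratio' n * \<rho> * \<delta> n / 2) * norm t"
          using char_step[OF t(1), of n, folded c_def] by linarith
        also have "\<dots> = g n * (\<theta> n - \<eta> n) * norm t" by (simp add: \<theta>_def algebra_simps)
        finally show ?thesis .
      qed
      have s2: "cmod (\<psi> t - \<psi> (B n t) * complex_of_real c) \<le> g n * \<eta> n * norm t"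
        using elim(1) t unfolding c_def by blast
      have "\<phi> (Suc n) t - \<psi> t = (\<phi> (Suc n) t - \<phi> n (B n t) * complex_of_real c)
          + (\<phi> n (B n t) - \<psi> (B n t)) * complex_of_real c - (\<psi> t - \<psi> (B n t) * complex_of_real c)"
        by (simp add: algebra_simps)
      then have "d (Suc n) t \<le> cmod (\<phi> (Suc n) t - \<phi> n (B n t) * complex_of_real c)
          + cmod ((\<phi> n (B n t) - \<psi> (B n t)) * complex_of_real c) + cmod (\<psi> t - \<psi> (B n t) * complex_of_real c)"
        unfolding d_def using norm_triangle_ineq4 norm_triangle_ineq by (smt (verit))
      also have "cmod ((\<phi> n (B n t) - \<psi> (B n t)) * complex_of_real c) \<le> d n (B n t) * 1"
        unfolding norm_mult d_def norm_of_real using \<open>\<bar>c\<bar> \<le> 1\<close> by (intro mult_left_mono) auto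
      finally show "d (Suc n) t \<le> d n (B n t) + g n * \<theta> n * norm t"
        using s1 s2 by (simp add: algebra_simps)
    qed
  qed
  then obtain n0 where n0: "\<And>n. n \<ge> n0 \<Longrightarrow> \<kappa> / 4 * g n < 1"
    "\<And>n t. n \<ge> n0 \<Longrightarrow> P *v t = t \<Longrightarrow> norm t \<le> \<rho> \<Longrightarrow> norm (B n t) \<le> (1 - \<kappa> / 4 * g n) * norm t"
    "\<And>n t. n \<ge> n0 \<Longrightarrow> P *v t = t \<Longrightarrow> norm t \<le> \<rho> \<Longrightarrow> d (Suc n) t \<le> d n (B n t) + g n * \<theta> n * norm t"
    unfolding eventually_sequentially by blast
  define q0 where "q0 = s n0 * (LINT \<omega>|M. norm (D n0 \<omega>)) + K * \<rho>"
  have q0: "0 \<le> q0"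
    using s_pos[of n0] K(1) \<rho> by (simp add: q0_def Bochner_Integration.integral_nonneg)
  have start: "d n0 t \<le> q0 * norm t" if "norm t \<le> \<rho>" for t
  proof -
    have "cmod (\<phi> n0 t - 1) \<le> norm t * (s n0 * (LINT \<omega>|M. norm (D n0 \<omega>)))"
    proof -
      let ?X = "\<lambda>\<omega>. t \<bullet> (s n0 *\<^sub>R D n0 \<omega>)"
      have int: "integrable M (\<lambda>\<omega>. iexp (?X \<omega>))"
        by (rule integrable_const_bound[where B = 1]) auto
      have "\<phi> n0 t - 1 = (CLINT \<omega>|M. iexp (?X \<omega>) - 1)"
        unfolding \<phi>_def using int by (subst Bochner_Integration.integral_diff) (auto simp: prob_space)
      also have "cmod \<dots> \<le> (LINT \<omega>|M. cmod (iexp (?X \<omega>) - 1))" by (rule integral_norm_bound)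
      also have "\<dots> \<le> (LINT \<omega>|M. norm t * (s n0 * norm (D n0 \<omega>)))"
      proof (rule integral_mono)
        show "integrable M (\<lambda>\<omega>. cmod (iexp (?X \<omega>) - 1))" using int by (intro integrable_norm) auto
        show "integrable M (\<lambda>\<omega>. norm t * (s n0 * norm (D n0 \<omega>)))" using D_int[of n0] by (intro integrable_mult_right)
        show "cmod (iexp (?X \<omega>) - 1) \<le> norm t * (s n0 * norm (D n0 \<omega>))" for \<omega>
          using iexp_approx1[of "?X \<omega>" 0] Cauchy_Schwarz_ineq2[of t "s n0 *\<^sub>R D n0 \<omega>"] s_pos[of n0] by simp
      qed
      also have "\<dots> = norm t * (s n0 * (LINT \<omega>|M. norm (D n0 \<omega>)))" by simp
      finally show ?thesis .
    qed
    moreover have "cmod (1 - \<psi> t) \<le> K * \<rho> * norm t"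
    proof -
      have l: "0 \<le> lyap t t" by (rule lyap_nonneg[OF Tpsd])
      have "cmod (1 - \<psi> t) = \<bar>1 - exp (- lyap t t / 2)\<bar>"
        unfolding \<psi>_def using norm_of_real[of "1 - exp (- lyap t t / 2)", where ?'a = complex] by simp
      also have "\<dots> \<le> lyap t t"
        using exp_ge_add_one_self[of "- lyap t t / 2"] l by (simp add: abs_if)
      also have "\<dots> \<le> K * (norm t)\<^sup>2" by (rule K)
      also have "\<dots> \<le> K * (\<rho> * norm t)"
        using that K(1) by (intro mult_left_mono) (auto simp: power2_eq_square mult_right_mono)
      finally show ?thesis by (simp add: mult.assoc)
    qed
    ultimately have "cmod (\<phi> n0 t - 1 + (1 - \<psi> t)) \<le> norm t * (s n0 * (LINT \<omega>|M. norm (D n0 \<omega>))) + K * \<rho> * norm t"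
      using norm_triangle_ineq[of "\<phi> n0 t - 1" "1 - \<psi> t"] by linarith
    then show ?thesis by (simp add: d_def q0_def algebra_simps)
  qed
  \<comment> \<open>Constant until \<open>n0\<close>, so that the recursion starts there with the
    value \<open>q0\<close>.\<close>
  define Q where "Q = rec_nat q0 (\<lambda>n q. if n < n0 then q0 else (1 - \<kappa> / 4 * g n) * q + g n * \<theta> n)"
  have QS: "Q (Suc n) = (if n < n0 then q0 else (1 - \<kappa> / 4 * g n) * Q n + g n * \<theta> n)" and Q0: "Q 0 = q0" for n
    by (simp_all add: Q_def)
  have Qn0: "Q n0 = q0"
    by (cases n0) (simp_all add: Q0 QS)
  have Qpos: "0 \<le> Q n" for n
  proof (induction n)
    case (Suc n)
    then show ?case
      using q0 \<theta>0[of n] g_pos[of n] n0(1)[of n] by (auto simp: QS not_less intro!: add_nonneg_nonneg mult_nonneg_nonneg)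
  qed (simp add: Q0 q0)
  have bound: "d n t \<le> Q n * norm t" if "n \<ge> n0" "P *v t = t" "norm t \<le> \<rho>" for n t
    using that
  proof (induction n arbitrary: t rule: dec_induct)
    case base
    then show ?case using start by (simp add: Qn0)
  next
    case (step n)
    have c: "norm (B n t) \<le> (1 - \<kappa> / 4 * g n) * norm t" using n0(2) step by auto
    have c1: "0 \<le> 1 - \<kappa> / 4 * g n" using n0(1)[of n] step by simp
    have "(1 - \<kappa> / 4 * g n) * norm t \<le> 1 * norm t"
      using g_pos[of n] \<kappa> by (intro mult_right_mono) auto
    then have "norm (B n t) \<le> \<rho>" using c step.prems by linarith
    then have "d n (B n t) \<le> Q n * norm (B n t)"
      using step.IH PB step.prems by blast
    also have "\<dots> \<le> Q n * ((1 - \<kappa> / 4 * g n) * norm t)"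
      using c Qpos by (intro mult_left_mono) auto
    finally have "d (Suc n) t \<le> Q n * ((1 - \<kappa> / 4 * g n) * norm t) + g n * \<theta> n * norm t"
      using n0(3)[OF step.hyps(1) step.prems] by linarith
    also have "\<dots> = Q (Suc n) * norm t"
      using step.hyps(1) by (simp add: QS algebra_simps)
    finally show ?case .
  qed
  have "Q \<longlonglongrightarrow> 0"
  proof (rule contraction_tendsto_0'[where c = "\<kappa> / 4" and g = g and b = \<theta>])
    show "\<forall>\<^sub>F n in sequentially. Q (Suc n) \<le> (1 - \<kappa> / 4 * g n) * Q n + g n * \<theta> n"
      using eventually_ge_at_top[of n0] by eventually_elim (simp add: QS)
    show "\<forall>\<^sub>F n in sequentially. \<kappa> / 4 * g n \<le> 1"
      using e2 by eventually_elim simp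
  qed (use Qpos g_pos g_div \<kappa> \<theta>l in \<open>auto simp: less_imp_le\<close>)
  then have "(\<lambda>n. Q n * norm t) \<longlonglongrightarrow> 0"
    by (rule tendsto_mult_left_zero)
  moreover have "\<forall>\<^sub>F n in sequentially. norm (\<phi> n t - \<psi> t) \<le> Q n * norm t"
    using eventually_ge_at_top[of n0]
    by eventually_elim (use bound t in \<open>auto simp: d_def \<rho>_def\<close>)
  ultimately have "(\<lambda>n. \<phi> n t - \<psi> t) \<longlonglongrightarrow> 0"
    by (rule Lim_null_comparison[rotated])
  then show ?thesis by (simp add: LIM_zero_iff)
qed

theorem char_tendsto: "(\<lambda>n. CLINT \<omega>|M. iexp (t \<bullet> ((1 / sqrt (g n)) *\<^sub>R D n \<omega>))) \<longlonglongrightarrow> complex_of_real (exp (- lyap t t / 2))"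
proof -
  have "P *v (P *v t) = P *v t" by (simp add: matrix_vector_mul_assoc PP)
  from char_tendsto_within[OF this] have "(\<lambda>n. \<phi> n (P *v t)) \<longlonglongrightarrow> \<psi> t"
    by (simp add: \<psi>_def lyap_P)
  moreover have "\<phi> n (P *v t) = (CLINT \<omega>|M. iexp (t \<bullet> ((1 / sqrt (g n)) *\<^sub>R D n \<omega>)))" for n
    by (simp add: \<phi>_def s_def Pinner PD)
  ultimately show ?thesis by (simp add: \<psi>_def)
qed

end

section \<open>Asymptotic normality\<close>

lemma cov_matrix_form:
  fixes V :: "'w \<Rightarrow> real^'d"
  assumes "prob_space N" and V[measurable]: "V \<in> borel_measurable N" and V2: "integrable N (\<lambda>\<omega>. (norm (V \<omega>))\<^sup>2)"
  defines "m \<equiv> LINT \<omega>|N. V \<omega>"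
  shows "t \<bullet> (cov_matrix N V *v w) = (LINT \<omega>|N. (t \<bullet> (V \<omega> - m)) * (w \<bullet> (V \<omega> - m)))"
    and "transpose (cov_matrix N V) = cov_matrix N V"
proof -
  interpret N: prob_space N by fact
  have iV: "integrable N V"
  proof (rule Bochner_Integration.integrable_bound)
    show "integrable N (\<lambda>\<omega>. 1 + (norm (V \<omega>))\<^sup>2)" using V2 by simp
    have 1: "s \<le> 1 + s\<^sup>2" for s :: real
    proof -
      have "0 \<le> s\<^sup>2 - 2 * s + 1" using zero_le_power2[of "s - 1"] by (simp add: power2_diff)
      moreover have "0 \<le> s\<^sup>2" by simp
      ultimately show ?thesis by linarith
    qed
    then show "AE \<omega> in N. norm (V \<omega>) \<le> norm (1 + (norm (V \<omega>))\<^sup>2)" by simp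
  qed measurable
  have m: "(LINT \<omega>|N. V \<omega> $ i) = m $ i" for i
    unfolding m_def by (rule integral_bounded_linear[OF bounded_linear_vec_nth iV])
  have [measurable]: "(\<lambda>\<omega>. V \<omega> $ i) \<in> borel_measurable N" for i
    by (rule measurable_compose[OF V]) (intro borel_measurable_continuous_onI continuous_intros)
  have i: "integrable N (\<lambda>\<omega>. (V \<omega> $ i - m $ i) * (V \<omega> $ j - m $ j))" for i j
  proof (rule Bochner_Integration.integrable_bound)
    show "integrable N (\<lambda>\<omega>. 2 * (norm (V \<omega>))\<^sup>2 + 2 * (norm m)\<^sup>2)" using V2 by simp
    show "AE \<omega> in N. norm ((V \<omega> $ i - m $ i) * (V \<omega> $ j - m $ j)) \<le> norm (2 * (norm (V \<omega>))\<^sup>2 + 2 * (norm m)\<^sup>2)"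
    proof (intro AE_I2)
      fix \<omega>
      have c: "\<bar>V \<omega> $ k - m $ k\<bar> \<le> norm (V \<omega>) + norm m" for k
        using component_le_norm_cart[of "V \<omega> - m" k] norm_triangle_ineq4[of "V \<omega>" m] by simp
      have "\<bar>(V \<omega> $ i - m $ i) * (V \<omega> $ j - m $ j)\<bar> \<le> (norm (V \<omega>) + norm m) * (norm (V \<omega>) + norm m)"
        unfolding abs_mult using c by (intro mult_mono) auto
      also have "\<dots> \<le> 2 * (norm (V \<omega>))\<^sup>2 + 2 * (norm m)\<^sup>2"
        using sum_squares_bound[of "norm (V \<omega>)" "norm m"] by (simp add: power2_eq_square algebra_simps)
      finally show "norm ((V \<omega> $ i - m $ i) * (V \<omega> $ j - m $ j)) \<le> norm (2 * (norm (V \<omega>))\<^sup>2 + 2 * (norm m)\<^sup>2)" by simp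
    qed
  qed measurable
  have "t \<bullet> (cov_matrix N V *v w) = (\<Sum>i\<in>UNIV. \<Sum>j\<in>UNIV. t $ i * w $ j * (LINT \<omega>|N. (V \<omega> $ i - m $ i) * (V \<omega> $ j - m $ j)))"
    by (simp add: inner_vec_def matrix_vector_mult_def cov_matrix_def m sum_distrib_left mult_ac)
  also have "\<dots> = (LINT \<omega>|N. (\<Sum>i\<in>UNIV. \<Sum>j\<in>UNIV. t $ i * w $ j * ((V \<omega> $ i - m $ i) * (V \<omega> $ j - m $ j))))"
    using i by (simp add: Bochner_Integration.integral_sum)
  also have "\<dots> = (LINT \<omega>|N. (t \<bullet> (V \<omega> - m)) * (w \<bullet> (V \<omega> - m)))"
    by (intro Bochner_Integration.integral_cong refl) (simp add: inner_vec_def sum_product mult_ac)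
  finally show "t \<bullet> (cov_matrix N V *v w) = (LINT \<omega>|N. (t \<bullet> (V \<omega> - m)) * (w \<bullet> (V \<omega> - m)))" .
  show "transpose (cov_matrix N V) = cov_matrix N V"
    by (simp add: cov_matrix_def Finite_Cartesian_Product.transpose_def mult.commute)
qed

lemma norm_sq_measurable:
  fixes f :: "'w \<Rightarrow> 'a::real_normed_vector"
  shows "f \<in> borel_measurable N \<Longrightarrow> (\<lambda>\<omega>. (norm (f \<omega>))\<^sup>2) \<in> borel_measurable N"
  by (rule measurable_compose[where g = "\<lambda>v. (norm v)\<^sup>2" and N = borel]) (auto intro!: borel_measurable_continuous_onI continuous_intros)

section \<open>The projected noise as input of the linear recursion\<close>

context polyhedral_dual_averaging
begin

definition Sb where "Sb = (1 / (real CARD('m))\<^sup>2) *\<^sub>R (\<Sum>j\<in>(UNIV :: 'm set). cov_matrix (law j) (gr j xs))"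
definition T where "T = P ** Sb ** P"

lemma L0_sq: "integrable (law j) (\<lambda>s. (L0 j s)\<^sup>2)"
proof -
  have "(L0 j s)\<^sup>2 = L0 j s powr 2" for s using L0_nonneg[of j s] by (cases "L0 j s = 0") (simp_all add: powr_numeral)
  then show ?thesis using L0_powr_integrable[of 2 j] p by simp
qed

lemma gr_sq: "v \<in> X \<Longrightarrow> integrable (law j) (\<lambda>s. (norm (gr j v s))\<^sup>2)"
  by (rule Bochner_Integration.integrable_bound[OF L0_sq[of j]])
     (use gr_law_meas gr_bound L0_nonneg in \<open>auto intro!: power_mono borel_measurable_power borel_measurable_norm\<close>)

lemma cov_form: "t \<bullet> (cov_matrix (law j) (gr j xs) *v w) = (LINT s|law j. (t \<bullet> (gr j xs s - mg j xs)) * (w \<bullet> (gr j xs s - mg j xs)))"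
  using cov_matrix_form(1)[OF prob_law gr_law_meas[OF X(3)] gr_sq[OF X(3)]] by (simp add: mg_def)

lemma Sb_apply: "Sb *v w = (1 / (real CARD('m))\<^sup>2) *\<^sub>R (\<Sum>j\<in>(UNIV :: 'm set). cov_matrix (law j) (gr j xs) *v w)"
proof -
  have "(\<Sum>j\<in>A. f j) *v w = (\<Sum>j\<in>A. f j *v w)" for A and f :: "'m \<Rightarrow> real^'d^'d"
    by (induction A rule: infinite_finite_induct) (simp_all add: matrix_vector_mult_add_rdistrib)
  then show ?thesis by (simp add: Sb_def scaleR_matrix_vector_assoc[symmetric])
qed

lemma Sb_sym: "transpose Sb = Sb"
proof -
  have "transpose (\<Sum>j\<in>A. f j) = (\<Sum>j\<in>A. transpose (f j))" for A and f :: "'m \<Rightarrow> real^'d^'d"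
    by (simp add: Finite_Cartesian_Product.transpose_def Finite_Cartesian_Product.vec_eq_iff)
  moreover have "transpose (cov_matrix (law j) (gr j xs)) = cov_matrix (law j) (gr j xs)" for j
    by (rule cov_matrix_form(2)[OF prob_law gr_law_meas[OF X(3)] gr_sq[OF X(3)]])
  ultimately show ?thesis
    by (simp add: Sb_def transpose_scalar)
qed

lemma P_transpose: "transpose P = P"
proof -
  have "(transpose P *v x) \<bullet> y = (P *v x) \<bullet> y" for x y
    unfolding transpose_inner by (simp add: P_inner)
  then have "transpose P *v x = P *v x" for x using vector_eq_rdot by blast
  then show ?thesis by (simp add: matrix_eq)
qed

lemma T_apply: "T *v w = P *v (Sb *v (P *v w))"
  by (simp add: T_def matrix_vector_mul_assoc matrix_mul_assoc)

lemma T_form: "P *v t = t \<Longrightarrow> t \<bullet> (T *v t) = t \<bullet> (Sb *v t)"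
  using P_inner[of t "Sb *v t"] by (simp add: T_apply)

lemma Sb_form: "t \<bullet> (Sb *v t) = (1 / (real CARD('m))\<^sup>2) * (\<Sum>j\<in>(UNIV :: 'm set). LINT s|law j. (t \<bullet> (gr j xs s - mg j xs))\<^sup>2)"
  by (simp add: Sb_apply inner_sum_right cov_form power2_eq_square)

lemma T_psd: "0 \<le> v \<bullet> (T *v v)"
proof -
  have "v \<bullet> (T *v v) = (P *v v) \<bullet> (Sb *v (P *v v))" by (simp add: T_apply P_inner)
  also have "0 \<le> \<dots>" unfolding Sb_form
    by (intro mult_nonneg_nonneg sum_nonneg Bochner_Integration.integral_nonneg) auto
  finally show ?thesis .
qed

sublocale flow: lyapunov_flow H P T \<kappa>
proof
  show "P ** P = P" by (simp add: matrix_eq matrix_vector_mul_assoc[symmetric] P_idem)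
  show "transpose P = P" by (rule P_transpose)
  show "P ** H = H" by (simp add: matrix_eq matrix_vector_mul_assoc[symmetric] PH)
  show "H ** P = H" by (simp add: matrix_eq matrix_vector_mul_assoc[symmetric] H_apply P_idem)
  show "transpose T = T" by (simp add: T_def matrix_transpose_mul P_transpose Sb_sym matrix_mul_assoc)
  show "0 < \<kappa>" by (rule \<kappa>_pos)
  show "\<kappa> * (norm v)\<^sup>2 \<le> v \<bullet> (H *v v)" if "P *v v = v" for v using that by (rule H_coercive)
qed

lemma iexp_Del_meas: "(\<lambda>\<omega>. iexp (s \<bullet> Del n \<omega>)) \<in> borel_measurable (G n)"
  by (rule measurable_compose[OF Del_meas]) (intro borel_measurable_continuous_onI continuous_intros)

lemma noise_law_meas: "(\<lambda>s. t \<bullet> (gr j xs s - mg j xs)) \<in> borel_measurable borel"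
proof -
  have "gr j xs \<in> borel_measurable borel"
    using gr_law_meas[OF X(3), of j] by (simp add: measurable_cong_sets[OF sets_law refl])
  then show ?thesis by measurable
qed

lemma inner_noise_sq: "v \<in> measurable M (restrict_space borel X) \<Longrightarrow> integrable M (\<lambda>\<omega>. (t \<bullet> noise j (v \<omega>) n \<omega>)\<^sup>2)"
proof (rule Bochner_Integration.integrable_bound)
  assume v: "v \<in> measurable M (restrict_space borel X)"
  show "integrable M (\<lambda>\<omega>. (norm t)\<^sup>2 * (\<Lambda> n \<omega>)\<^sup>2)" using \<Lambda>_sq(1) by simp
  show "(\<lambda>\<omega>. (t \<bullet> noise j (v \<omega>) n \<omega>)\<^sup>2) \<in> borel_measurable M" using noise_M[OF v, of j n] by measurable
  show "AE \<omega> in M. norm ((t \<bullet> noise j (v \<omega>) n \<omega>)\<^sup>2) \<le> norm ((norm t)\<^sup>2 * (\<Lambda> n \<omega>)\<^sup>2)"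
  proof (intro AE_I2)
    fix \<omega> assume "\<omega> \<in> space M"
    then have "v \<omega> \<in> X" using measurable_space[OF v] by (simp add: space_restrict_space)
    then have "\<bar>t \<bullet> noise j (v \<omega>) n \<omega>\<bar> \<le> norm t * \<Lambda> n \<omega>"
      by (intro order_trans[OF Cauchy_Schwarz_ineq2 mult_left_mono[OF noise_le_\<Lambda>]]) auto
    then have "\<bar>t \<bullet> noise j (v \<omega>) n \<omega>\<bar>\<^sup>2 \<le> (norm t * \<Lambda> n \<omega>)\<^sup>2" by (intro power_mono) auto
    then show "norm ((t \<bullet> noise j (v \<omega>) n \<omega>)\<^sup>2) \<le> norm ((norm t)\<^sup>2 * (\<Lambda> n \<omega>)\<^sup>2)" by (simp add: power_mult_distrib)
  qed
qed

lemma scaleR_iexp_integrable: "integrable M f \<Longrightarrow> integrable M (\<lambda>\<omega>. f \<omega> *\<^sub>R iexp (s \<bullet> Del n \<omega>))"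
proof (rule Bochner_Integration.integrable_bound)
  assume i: "integrable M f"
  then show "integrable M f" .
  show "(\<lambda>\<omega>. f \<omega> *\<^sub>R iexp (s \<bullet> Del n \<omega>)) \<in> borel_measurable M"
    by (intro borel_measurable_scaleR borel_measurable_integrable[OF i] G_meas[OF iexp_Del_meas])
  show "AE \<omega> in M. norm (f \<omega> *\<^sub>R iexp (s \<bullet> Del n \<omega>)) \<le> norm (f \<omega>)"
    by (intro AE_I2) (simp add: norm_exp_i_times)
qed

lemma noise_orth_iexp: "(CLINT \<omega>|M. iexp (s \<bullet> Del n \<omega>) * complex_of_real (t \<bullet> (P *v \<epsilon> n \<omega>))) = 0"
proof -
  let ?t = "P *v t"
  have i: "integrable M (\<lambda>\<omega>. (?t \<bullet> noise j (x n j \<omega>) n \<omega>) *\<^sub>R iexp (s \<bullet> Del n \<omega>))" for j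
  proof -
    have m: "(\<lambda>\<omega>. noise j (x n j \<omega>) n \<omega>) \<in> borel_measurable M" by (rule noise_M[OF G_meas[OF x_meas]])
    show ?thesis
      by (rule scaleR_iexp_integrable[OF expectation_abs_le_sqrt(1)[OF _ inner_noise_sq[OF G_meas[OF x_meas]]]])
         (intro borel_measurable_inner borel_measurable_const m)
  qed
  have "iexp (s \<bullet> Del n \<omega>) * complex_of_real (t \<bullet> (P *v \<epsilon> n \<omega>))
      = (1 / real CARD('m)) *\<^sub>R (\<Sum>j\<in>UNIV. (?t \<bullet> noise j (x n j \<omega>) n \<omega>) *\<^sub>R iexp (s \<bullet> Del n \<omega>))" for \<omega>
  proof -
    have "t \<bullet> (P *v \<epsilon> n \<omega>) = (1 / real CARD('m)) * (\<Sum>j\<in>UNIV. ?t \<bullet> noise j (x n j \<omega>) n \<omega>)"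
      unfolding P_inner[symmetric] \<epsilon>_def inner_scaleR_right inner_sum_right ..
    then have "complex_of_real (t \<bullet> (P *v \<epsilon> n \<omega>)) = complex_of_real (1 / real CARD('m)) * (\<Sum>j\<in>UNIV. complex_of_real (?t \<bullet> noise j (x n j \<omega>) n \<omega>))"
      by (simp only: of_real_mult of_real_sum)
    then show ?thesis by (simp add: scaleR_conv_of_real sum_distrib_left mult_ac)
  qed
  moreover have "(LINT \<omega>|M. (?t \<bullet> noise j (x n j \<omega>) n \<omega>) *\<^sub>R iexp (s \<bullet> Del n \<omega>)) = 0" for j
    by (rule noise_mean_zero[OF G_sub xi_indep x_meas iexp_Del_meas i])
  ultimately show ?thesis using i by (simp add: Bochner_Integration.integral_sum)
qed

text \<open>The square is expanded over pairs of agents. A diagonal term is frozen and gives the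
  variance under \<open>law j\<close>. An off-diagonal one vanishes, since the noise of agent
  \<open>i\<close> is centred and independent of the history together with the sample of agent
  \<open>j\<close>.\<close>

lemma noise_variance_iexp:
  assumes t: "P *v t = t"
  shows "(CLINT \<omega>|M. iexp (s \<bullet> Del n \<omega>) * complex_of_real ((t \<bullet> (P *v \<epsilon>s n \<omega>))\<^sup>2))
        = (CLINT \<omega>|M. iexp (s \<bullet> Del n \<omega>)) * complex_of_real (t \<bullet> (T *v t))"
proof -
  let ?m = "real CARD('m)"
  define \<nu> where "\<nu> j \<omega> = t \<bullet> noise j xs n \<omega>" for j \<omega>
  define e where "e \<omega> = iexp (s \<bullet> Del n \<omega>)" for \<omega>
  have \<nu>M[measurable]: "\<nu> j \<in> borel_measurable M" for j
    unfolding \<nu>_def[abs_def] using noise_M[OF xs_restrict, of j n] by measurable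
  have \<nu>2: "integrable M (\<lambda>\<omega>. (\<nu> j \<omega>)\<^sup>2)" for j
    unfolding \<nu>_def by (rule inner_noise_sq[OF xs_restrict])
  have i: "integrable M (\<lambda>\<omega>. (\<nu> i \<omega> * \<nu> j \<omega>) *\<^sub>R e \<omega>)" for i j
    unfolding e_def by (intro scaleR_iexp_integrable integrable_mult_sq \<nu>2) measurable
  have diag: "(LINT \<omega>|M. (\<nu> j \<omega> * \<nu> j \<omega>) *\<^sub>R e \<omega>) = (LINT s|law j. (t \<bullet> (gr j xs s - mg j xs))\<^sup>2) *\<^sub>R (LINT \<omega>|M. e \<omega>)" for j
  proof -
    define k where "k = (\<lambda>(\<omega>, s). (t \<bullet> (gr j xs s - mg j xs))\<^sup>2 *\<^sub>R e \<omega>)"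
    have k: "k \<in> borel_measurable (G n \<Otimes>\<^sub>M borel)"
      unfolding k_def case_prod_beta e_def
      by (intro borel_measurable_scaleR borel_measurable_power measurable_compose[OF measurable_snd noise_law_meas]
          measurable_compose[OF measurable_fst iexp_Del_meas])
    have "(LINT \<omega>|M. k (\<omega>, xi n j \<omega>)) = (LINT \<omega>|M. (LINT s|distr M borel (xi n j). k (\<omega>, s)))"
      by (rule freezing(1)[OF G_sub xi_M xi_indep k])
         (use i[of j j] in \<open>simp add: k_def \<nu>_def noise_def power2_eq_square\<close>)
    also have "\<dots> = (LINT \<omega>|M. (LINT s|law j. (t \<bullet> (gr j xs s - mg j xs))\<^sup>2) *\<^sub>R e \<omega>)"
    proof (intro Bochner_Integration.integral_cong refl)
      fix \<omega>
      have "integrable (law j) (\<lambda>s. (t \<bullet> (gr j xs s - mg j xs))\<^sup>2)"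
        using \<nu>2[of j] unfolding law[of n j, symmetric] \<nu>_def noise_def
        by (subst integrable_distr_eq) (auto intro!: borel_measurable_power noise_law_meas)
      then show "(LINT s|distr M borel (xi n j). k (\<omega>, s)) = (LINT s|law j. (t \<bullet> (gr j xs s - mg j xs))\<^sup>2) *\<^sub>R e \<omega>"
        unfolding law k_def case_prod_conv by (intro integral_scaleR_left)
    qed
    finally show ?thesis by (simp add: k_def \<nu>_def noise_def power2_eq_square)
  qed
  have off: "(LINT \<omega>|M. (\<nu> i \<omega> * \<nu> j \<omega>) *\<^sub>R e \<omega>) = 0" if ij: "i \<noteq> j" for i j
  proof -
    \<comment> \<open>The history enlarged by the sample of agent \<open>j\<close>, so that the
      remaining factors of the product become measurable.\<close>
    define N where "N = sigma (space M) (sets (G n) \<union> rv_events M (xi n j))"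
    have Pow: "sets (G n) \<union> rv_events M (xi n j) \<subseteq> Pow (space M)"
      using sets.sets_into_space[of _ "G n"] space_G rv_events_sets(2)[OF xi_M] by auto
    have sN: "sets N = sigma_sets (space M) (sets (G n) \<union> rv_events M (xi n j))"
      unfolding N_def by (rule sets_measure_of[OF Pow])
    have spN: "space N = space M" unfolding N_def by (rule space_measure_of[OF Pow])
    have GN: "sets (G n) \<subseteq> sets N" and xN: "rv_events M (xi n j) \<subseteq> sets N" unfolding sN by auto
    have NM: "subalgebra M N"
      unfolding subalgebra_def spN sN using G_sub[of n] rv_events_sets(1)[OF xi_M[of n j]]
      by (auto simp: subalgebra_def intro!: sets.sigma_sets_subset)
    have N1: "f \<in> measurable N K" if "f \<in> measurable (G n) K" for f :: "'w \<Rightarrow> 'x" and K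
      using that GN by (auto simp: measurable_def space_G spN)
    have N2: "xi n j \<in> borel_measurable N"
      using xN by (intro measurableI) (auto simp: spN rv_events_def)
    have \<nu>N: "\<nu> j \<in> borel_measurable N"
      unfolding \<nu>_def[abs_def] noise_def using measurable_compose[OF N2 noise_law_meas] .
    have "(LINT \<omega>|M. (t \<bullet> noise i ((\<lambda>_. xs) \<omega>) n \<omega>) *\<^sub>R (\<nu> j \<omega> *\<^sub>R e \<omega>)) = 0"
    proof (rule noise_mean_zero[OF NM _ xs_restrict])
      show "indep_set (rv_events M (xi n i)) (sets N)" unfolding N_def by (rule xi_pair[OF ij])
      show "(\<lambda>\<omega>. \<nu> j \<omega> *\<^sub>R e \<omega>) \<in> borel_measurable N"
        unfolding e_def by (intro borel_measurable_scaleR \<nu>N N1[OF iexp_Del_meas])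
      show "integrable M (\<lambda>\<omega>. (t \<bullet> noise i xs n \<omega>) *\<^sub>R (\<nu> j \<omega> *\<^sub>R e \<omega>))"
        using i[of i j] by (simp add: \<nu>_def)
    qed
    then show ?thesis by (simp add: \<nu>_def)
  qed
  have "e \<omega> * complex_of_real ((t \<bullet> (P *v \<epsilon>s n \<omega>))\<^sup>2) = (1 / ?m\<^sup>2) *\<^sub>R (\<Sum>i\<in>UNIV. \<Sum>j\<in>UNIV. (\<nu> i \<omega> * \<nu> j \<omega>) *\<^sub>R e \<omega>)" for \<omega>
  proof -
    have "t \<bullet> (P *v \<epsilon>s n \<omega>) = (1 / ?m) * (\<Sum>j\<in>UNIV. \<nu> j \<omega>)"
      by (simp add: P_inner[symmetric] t \<epsilon>s_def inner_sum_right \<nu>_def)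
    then have "(t \<bullet> (P *v \<epsilon>s n \<omega>))\<^sup>2 = (1 / ?m\<^sup>2) * (\<Sum>i\<in>UNIV. \<Sum>j\<in>UNIV. \<nu> i \<omega> * \<nu> j \<omega>)"
      by (simp add: power_divide power2_eq_square[of "sum _ _"] sum_product)
    then have "complex_of_real ((t \<bullet> (P *v \<epsilon>s n \<omega>))\<^sup>2) * e \<omega> = (1 / ?m\<^sup>2) *\<^sub>R ((\<Sum>i\<in>UNIV. \<Sum>j\<in>UNIV. \<nu> i \<omega> * \<nu> j \<omega>) *\<^sub>R e \<omega>)"
      by (simp only: scaleR_conv_of_real of_real_mult mult.assoc)
    then show ?thesis by (simp only: scaleR_sum_left mult.commute)
  qed
  then have "(CLINT \<omega>|M. e \<omega> * complex_of_real ((t \<bullet> (P *v \<epsilon>s n \<omega>))\<^sup>2)) = (1 / ?m\<^sup>2) *\<^sub>R (\<Sum>i\<in>UNIV. \<Sum>j\<in>UNIV. (LINT \<omega>|M. (\<nu> i \<omega> * \<nu> j \<omega>) *\<^sub>R e \<omega>))"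
    using i by (simp add: Bochner_Integration.integral_sum)
  also have "(\<Sum>i\<in>UNIV. \<Sum>j\<in>UNIV. (LINT \<omega>|M. (\<nu> i \<omega> * \<nu> j \<omega>) *\<^sub>R e \<omega>)) = (\<Sum>i\<in>UNIV. (LINT s|law i. (t \<bullet> (gr i xs s - mg i xs))\<^sup>2) *\<^sub>R (LINT \<omega>|M. e \<omega>))"
  proof (intro sum.cong refl)
    fix i
    have "(\<Sum>j\<in>UNIV. (LINT \<omega>|M. (\<nu> i \<omega> * \<nu> j \<omega>) *\<^sub>R e \<omega>)) = (\<Sum>j\<in>UNIV. if j = i then (LINT \<omega>|M. (\<nu> i \<omega> * \<nu> i \<omega>) *\<^sub>R e \<omega>) else 0)"
      using off by (intro sum.cong) auto
    then show "(\<Sum>j\<in>UNIV. (LINT \<omega>|M. (\<nu> i \<omega> * \<nu> j \<omega>) *\<^sub>R e \<omega>)) = (LINT s|law i. (t \<bullet> (gr i xs s - mg i xs))\<^sup>2) *\<^sub>R (LINT \<omega>|M. e \<omega>)"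
      by (simp add: diag)
  qed
  also have "(1 / ?m\<^sup>2) *\<^sub>R \<dots> = (t \<bullet> (T *v t)) *\<^sub>R (LINT \<omega>|M. e \<omega>)"
    unfolding T_form[OF t] Sb_form by (simp only: scaleR_sum_left[symmetric] scaleR_scaleR)
  finally show ?thesis by (simp add: e_def scaleR_conv_of_real mult.commute)
qed

text \<open>Dominated convergence for a fixed sequence of points, with 4 times the square of
  \<open>L0\<close> as the bound; for each sample the projected gradient is continuous at
  \<open>xs\<close>.\<close>

lemma tangential_gr_tendsto:
  assumes "(\<lambda>n. v n) \<longlonglongrightarrow> xs" "\<And>n. v n \<in> X"
  shows "(\<lambda>n. LINT s|law j. (norm (P *v (gr j (v n) s - gr j xs s)))\<^sup>2) \<longlonglongrightarrow> 0"
proof -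
  have meas: "(\<lambda>s. (norm (P *v (gr j (v n) s - gr j xs s)))\<^sup>2) \<in> borel_measurable (law j)" for n
    by (intro norm_sq_measurable matrix_apply_measurable borel_measurable_diff gr_law_meas assms X)
  have "(\<lambda>n. LINT s|law j. (norm (P *v (gr j (v n) s - gr j xs s)))\<^sup>2) \<longlonglongrightarrow> (LINT s|law j. (0::real))"
  proof (rule integral_dominated_convergence)
    show "integrable (law j) (\<lambda>s. 4 * (L0 j s)\<^sup>2)" using L0_sq by simp
    show "AE s in law j. (\<lambda>n. (norm (P *v (gr j (v n) s - gr j xs s)))\<^sup>2) \<longlonglongrightarrow> 0"
    proof (intro AE_I2)
      fix s
      have "(\<lambda>n. P *v gr j (v n) s) \<longlonglongrightarrow> P *v gr j xs s"
        unfolding P_def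
        by (rule continuous_within_tendsto_compose[OF tangential_continuity _ assms(1)]) (use assms(2) in simp)
      then have "(\<lambda>n. P *v (gr j (v n) s - gr j xs s)) \<longlonglongrightarrow> 0"
        by (simp add: matrix_vector_mult_diff_distrib LIM_zero_iff)
      then have "(\<lambda>n. (norm (P *v (gr j (v n) s - gr j xs s)))\<^sup>2) \<longlonglongrightarrow> 0\<^sup>2"
        by (intro tendsto_power tendsto_norm_zero)
      then show "(\<lambda>n. (norm (P *v (gr j (v n) s - gr j xs s)))\<^sup>2) \<longlonglongrightarrow> 0" by simp
    qed
    show "AE s in law j. norm ((norm (P *v (gr j (v n) s - gr j xs s)))\<^sup>2) \<le> 4 * (L0 j s)\<^sup>2" for n
    proof (intro AE_I2)
      fix s
      have "norm (P *v (gr j (v n) s - gr j xs s)) \<le> 2 * L0 j s"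
        using norm_P_le[of "gr j (v n) s - gr j xs s"] norm_triangle_ineq4[of "gr j (v n) s" "gr j xs s"]
          gr_bound[OF assms(2)[of n], of j s] gr_bound[OF X(3), of j s] by linarith
      then have "(norm (P *v (gr j (v n) s - gr j xs s)))\<^sup>2 \<le> (2 * L0 j s)\<^sup>2" by (intro power_mono) auto
      then show "norm ((norm (P *v (gr j (v n) s - gr j xs s)))\<^sup>2) \<le> 4 * (L0 j s)\<^sup>2" by (simp add: power_mult_distrib)
    qed
  qed (use meas in auto)
  then show ?thesis by simp
qed

text \<open>The current point depends on the past only, so the sample can be integrated out with the
  point frozen. Dominated convergence then acts twice: in the sample along a convergent sequence of
  points, and in \<omega> along the almost sure limit of \<open>x n j\<close>.\<close>

lemma gr_difference:
  defines "d \<equiv> \<lambda>n j \<omega>. (norm (P *v (gr j (x n j \<omega>) (xi n j \<omega>) - gr j xs (xi n j \<omega>))))\<^sup>2"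
  shows "integrable M (d n j)" "(\<lambda>n. LINT \<omega>|M. d n j \<omega>) \<longlonglongrightarrow> 0"
proof -
  define k where "k n = (\<lambda>(\<omega>, s). (norm (P *v (gr j (x n j \<omega>) s - gr j xs s)))\<^sup>2)" for n
  have k: "k n \<in> borel_measurable (G n \<Otimes>\<^sub>M borel)" for n
    unfolding k_def case_prod_beta
    by (intro norm_sq_measurable matrix_apply_measurable borel_measurable_diff
        gr_measurable measurable_compose[OF measurable_fst x_meas] measurable_snd xs_restrict)
  have dk: "d n j \<omega> = k n (\<omega>, xi n j \<omega>)" for n \<omega> by (simp add: d_def k_def)
  have dM: "d n j \<in> borel_measurable M" for n
    unfolding d_def
    by (intro norm_sq_measurable matrix_apply_measurable borel_measurable_diff
        gr_measurable G_meas[OF x_meas] xi_M xs_restrict)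
  have int: "integrable M (d n j)" for n
  proof (rule Bochner_Integration.integrable_bound)
    show "integrable M (\<lambda>\<omega>. 4 * (\<Lambda> n \<omega>)\<^sup>2)" using \<Lambda>_sq(1) by simp
    show "AE \<omega> in M. norm (d n j \<omega>) \<le> norm (4 * (\<Lambda> n \<omega>)\<^sup>2)"
    proof (intro AE_I2)
      fix \<omega>
      have "norm (P *v (gr j (x n j \<omega>) (xi n j \<omega>) - gr j xs (xi n j \<omega>))) \<le> 2 * \<Lambda> n \<omega>"
        using norm_P_le[of "gr j (x n j \<omega>) (xi n j \<omega>) - gr j xs (xi n j \<omega>)"]
          norm_triangle_ineq4[of "gr j (x n j \<omega>) (xi n j \<omega>)" "gr j xs (xi n j \<omega>)"]
          gr_le_\<Lambda>[of "x n j \<omega>" j n \<omega>, OF x_X] gr_le_\<Lambda>[OF X(3), of j n \<omega>] by linarith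
      then have "d n j \<omega> \<le> (2 * \<Lambda> n \<omega>)\<^sup>2" unfolding d_def by (intro power_mono) auto
      then show "norm (d n j \<omega>) \<le> norm (4 * (\<Lambda> n \<omega>)\<^sup>2)" by (simp add: d_def power_mult_distrib)
    qed
  qed (rule dM)
  show "integrable M (d n j)" by (rule int)
  have ik: "integrable M (\<lambda>\<omega>. k n (\<omega>, xi n j \<omega>))" for n using int[of n] by (simp add: dk[abs_def])
  note fr = freezing[OF G_sub xi_M xi_indep k ik, unfolded law]
  have eq: "(LINT s|law j. k n (\<omega>, s)) = (LINT s|law j. (norm (P *v (gr j (x n j \<omega>) s - gr j xs s)))\<^sup>2)" for n \<omega>
    by (simp add: k_def)
  have "(\<lambda>n. LINT \<omega>|M. (LINT s|law j. k n (\<omega>, s))) \<longlonglongrightarrow> (LINT \<omega>|M. (0::real))"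
  proof (rule integral_dominated_convergence)
    show "AE \<omega> in M. (\<lambda>n. LINT s|law j. k n (\<omega>, s)) \<longlonglongrightarrow> 0"
      using x_limit
    proof eventually_elim
      case (elim \<omega>)
      show ?case unfolding eq by (rule tangential_gr_tendsto) (use elim x_X in auto)
    qed
    show "(\<lambda>\<omega>. LINT s|law j. k n (\<omega>, s)) \<in> borel_measurable M" for n
      using fr(2) by (rule borel_measurable_integrable)
    show "integrable M (\<lambda>_. 4 * (LINT s|law j. (L0 j s)\<^sup>2))" by simp
    show "AE \<omega> in M. norm (LINT s|law j. k n (\<omega>, s)) \<le> 4 * (LINT s|law j. (L0 j s)\<^sup>2)" for n
    proof (intro AE_I2)
      fix \<omega>
      have le: "(norm (P *v (gr j (x n j \<omega>) s - gr j xs s)))\<^sup>2 \<le> 4 * (L0 j s)\<^sup>2" for s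
      proof -
        have "norm (P *v (gr j (x n j \<omega>) s - gr j xs s)) \<le> 2 * L0 j s"
          using norm_P_le[of "gr j (x n j \<omega>) s - gr j xs s"] norm_triangle_ineq4[of "gr j (x n j \<omega>) s" "gr j xs s"]
            gr_bound[OF x_X[of n j \<omega>], of j s] gr_bound[OF X(3), of j s] by linarith
        then have "(norm (P *v (gr j (x n j \<omega>) s - gr j xs s)))\<^sup>2 \<le> (2 * L0 j s)\<^sup>2" by (intro power_mono) auto
        then show ?thesis by (simp add: power_mult_distrib)
      qed
      have meas: "(\<lambda>s. (norm (P *v (gr j (x n j \<omega>) s - gr j xs s)))\<^sup>2) \<in> borel_measurable (law j)"
        by (intro norm_sq_measurable matrix_apply_measurable borel_measurable_diff gr_law_meas x_X X)
      have i: "integrable (law j) (\<lambda>s. (norm (P *v (gr j (x n j \<omega>) s - gr j xs s)))\<^sup>2)"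
        by (rule Bochner_Integration.integrable_bound[of "law j" "\<lambda>s. 4 * (L0 j s)\<^sup>2"])
           (use L0_sq le meas in auto)
      have "(LINT s|law j. (norm (P *v (gr j (x n j \<omega>) s - gr j xs s)))\<^sup>2) \<le> (LINT s|law j. 4 * (L0 j s)\<^sup>2)"
        using i L0_sq le by (intro integral_mono) auto
      then show "norm (LINT s|law j. k n (\<omega>, s)) \<le> 4 * (LINT s|law j. (L0 j s)\<^sup>2)"
        unfolding eq by (simp add: Bochner_Integration.integral_nonneg)
    qed
  qed simp
  moreover have "(LINT \<omega>|M. (LINT s|law j. k n (\<omega>, s))) = (LINT \<omega>|M. d n j \<omega>)" for n
    using fr(1)[of n] by (simp add: dk)
  ultimately show "(\<lambda>n. LINT \<omega>|M. d n j \<omega>) \<longlonglongrightarrow> 0" by simp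
qed

lemma mg_difference:
  "integrable M (\<lambda>\<omega>. (norm (mg j (x n j \<omega>) - mg j xs))\<^sup>2)" "(\<lambda>n. LINT \<omega>|M. (norm (mg j (x n j \<omega>) - mg j xs))\<^sup>2) \<longlonglongrightarrow> 0"
proof -
  have meas: "(\<lambda>\<omega>. (norm (mg j (x n j \<omega>) - mg j xs))\<^sup>2) \<in> borel_measurable M" for n
    by (rule norm_sq_measurable[OF borel_measurable_diff[OF mg_measurable[OF G_meas[OF x_meas]] borel_measurable_const]])
  have le: "norm ((norm (mg j (x n j \<omega>) - mg j xs))\<^sup>2) \<le> (2 * cl j)\<^sup>2" for n \<omega>
  proof -
    have "norm (mg j (x n j \<omega>) - mg j xs) \<le> 2 * cl j"
      using norm_triangle_ineq4[of "mg j (x n j \<omega>)" "mg j xs"] norm_mg_le[OF x_X[of n j \<omega>], of j] norm_mg_le[OF X(3), of j] by linarith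
    then show ?thesis using power_mono[OF _ norm_ge_zero, of "mg j (x n j \<omega>) - mg j xs" "2 * cl j" 2] by simp
  qed
  show "integrable M (\<lambda>\<omega>. (norm (mg j (x n j \<omega>) - mg j xs))\<^sup>2)"
    by (rule integrable_const_bound[where B = "(2 * cl j)\<^sup>2"]) (use le meas in auto)
  have "(\<lambda>n. LINT \<omega>|M. (norm (mg j (x n j \<omega>) - mg j xs))\<^sup>2) \<longlonglongrightarrow> (LINT \<omega>|M. (0::real))"
  proof (rule integral_dominated_convergence)
    show "AE \<omega> in M. (\<lambda>n. (norm (mg j (x n j \<omega>) - mg j xs))\<^sup>2) \<longlonglongrightarrow> 0"
      using x_limit
    proof eventually_elim
      case (elim \<omega>)
      have "(\<lambda>n. L * norm (x n j \<omega> - xs)) \<longlonglongrightarrow> L * norm (xs - xs)"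
        using elim by (intro tendsto_intros) auto
      then have lim: "(\<lambda>n. L * norm (x n j \<omega> - xs)) \<longlonglongrightarrow> 0" by simp
      have "\<forall>\<^sub>F n in sequentially. norm (mg j (x n j \<omega>) - mg j xs) \<le> L * norm (x n j \<omega> - xs)"
        by (intro always_eventually allI mg_Lipschitz x_X X(3))
      then have "(\<lambda>n. mg j (x n j \<omega>) - mg j xs) \<longlonglongrightarrow> 0" using lim by (rule Lim_null_comparison)
      from tendsto_power[OF tendsto_norm_zero[OF this], of 2]
      have "(\<lambda>n. (norm (mg j (x n j \<omega>) - mg j xs))\<^sup>2) \<longlonglongrightarrow> 0\<^sup>2" .
      then show ?case by simp
    qed
    show "integrable M (\<lambda>_. (2 * cl j)\<^sup>2)" by simp
  qed (use meas le in auto)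
  then show "(\<lambda>n. LINT \<omega>|M. (norm (mg j (x n j \<omega>) - mg j xs))\<^sup>2) \<longlonglongrightarrow> 0" by simp
qed

lemma P\<epsilon>_M[measurable]: "(\<lambda>\<omega>. P *v \<epsilon> n \<omega>) \<in> borel_measurable M" and P\<epsilon>s_M[measurable]: "(\<lambda>\<omega>. P *v \<epsilon>s n \<omega>) \<in> borel_measurable M"
  by (intro matrix_apply_measurable \<epsilon>_M \<epsilon>s_M)+

text \<open>The difference splits into sampled gradients, which converge only through
  \<open>P\<close>, and mean gradients, which are Lipschitz in the point.\<close>

lemma noise_difference:
  "integrable M (\<lambda>\<omega>. (norm (P *v \<epsilon> n \<omega> - P *v \<epsilon>s n \<omega>))\<^sup>2)"
  "(\<lambda>n. LINT \<omega>|M. (norm (P *v \<epsilon> n \<omega> - P *v \<epsilon>s n \<omega>))\<^sup>2) \<longlonglongrightarrow> 0"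
proof -
  let ?m = "real CARD('m)"
  let ?d = "\<lambda>n j \<omega>. (norm (P *v (gr j (x n j \<omega>) (xi n j \<omega>) - gr j xs (xi n j \<omega>))))\<^sup>2"
  let ?e = "\<lambda>n j \<omega>. (norm (mg j (x n j \<omega>) - mg j xs))\<^sup>2"
  let ?B = "\<lambda>n \<omega>. ?m * (\<Sum>j\<in>UNIV. 2 * ?d n j \<omega> + 2 * ?e n j \<omega>)"
  have iB: "integrable M (?B n)" for n
    using gr_difference(1) mg_difference(1)
    by (intro integrable_mult_right Bochner_Integration.integrable_sum Bochner_Integration.integrable_add)
  have le: "(norm (P *v \<epsilon> n \<omega> - P *v \<epsilon>s n \<omega>))\<^sup>2 \<le> ?B n \<omega>" for n \<omega>
  proof -
    let ?a = "\<lambda>j. P *v (gr j (x n j \<omega>) (xi n j \<omega>) - gr j xs (xi n j \<omega>))"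
    let ?b = "\<lambda>j. mg j (x n j \<omega>) - mg j xs"
    have "P *v \<epsilon> n \<omega> - P *v \<epsilon>s n \<omega> = (1 / ?m) *\<^sub>R (\<Sum>j\<in>UNIV. ?a j - P *v ?b j)"
    proof -
      have 1: "P *v \<epsilon> n \<omega> - P *v \<epsilon>s n \<omega> = P *v (\<epsilon> n \<omega> - \<epsilon>s n \<omega>)"
        by (rule matrix_vector_mult_diff_distrib[symmetric])
      have 2: "\<epsilon> n \<omega> - \<epsilon>s n \<omega> = (1 / ?m) *\<^sub>R (\<Sum>j\<in>UNIV. (gr j (x n j \<omega>) (xi n j \<omega>) - gr j xs (xi n j \<omega>)) - ?b j)"
        unfolding \<epsilon>_def \<epsilon>s_def scaleR_diff_right[symmetric] sum_subtractf[symmetric] noise_def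
        by (intro arg_cong2[where f = scaleR] refl sum.cong) (simp add: algebra_simps)
      have 3: "P *v (\<Sum>j\<in>UNIV. (gr j (x n j \<omega>) (xi n j \<omega>) - gr j xs (xi n j \<omega>)) - ?b j) = (\<Sum>j\<in>UNIV. ?a j - P *v ?b j)"
        unfolding vec.sum by (intro sum.cong refl matrix_vector_mult_diff_distrib)
      show ?thesis unfolding 1 2 matrix_vector_mult_scaleR 3 ..
    qed
    then have "norm (P *v \<epsilon> n \<omega> - P *v \<epsilon>s n \<omega>) = 1 / ?m * norm (\<Sum>j\<in>UNIV. ?a j - P *v ?b j)" by simp
    also have "\<dots> \<le> 1 * (\<Sum>j\<in>UNIV. norm (?a j) + norm (?b j))"
    proof (intro mult_mono order_trans[OF norm_sum sum_mono])
      show "norm (?a j - P *v ?b j) \<le> norm (?a j) + norm (?b j)" for j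
        using norm_triangle_ineq4[of "?a j" "P *v ?b j"] norm_P_le[of "?b j"] by linarith
    qed (auto simp: Suc_leI)
    finally have "(norm (P *v \<epsilon> n \<omega> - P *v \<epsilon>s n \<omega>))\<^sup>2 \<le> (\<Sum>j\<in>UNIV. norm (?a j) + norm (?b j))\<^sup>2"
      by (intro power_mono) auto
    also have "\<dots> \<le> ?m * (\<Sum>j\<in>UNIV. (norm (?a j) + norm (?b j))\<^sup>2)" by (rule norm_sum_sq_le)
    also have "\<dots> \<le> ?B n \<omega>"
    proof (intro mult_left_mono sum_mono)
      show "(norm (?a j) + norm (?b j))\<^sup>2 \<le> 2 * (norm (?a j))\<^sup>2 + 2 * (norm (?b j))\<^sup>2" for j
        using sum_squares_bound[of "norm (?a j)" "norm (?b j)"] by (simp add: power2_sum)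
    qed simp
    finally show ?thesis .
  qed
  show int: "integrable M (\<lambda>\<omega>. (norm (P *v \<epsilon> n \<omega> - P *v \<epsilon>s n \<omega>))\<^sup>2)" for n
    by (rule Bochner_Integration.integrable_bound[OF iB[of n]])
       (use le[of n] in \<open>auto intro: order_trans[OF _ abs_ge_self]\<close>)
  have "(\<lambda>n. ?m * (\<Sum>j\<in>UNIV. 2 * (LINT \<omega>|M. ?d n j \<omega>) + 2 * (LINT \<omega>|M. ?e n j \<omega>))) \<longlonglongrightarrow> ?m * (\<Sum>j\<in>(UNIV :: 'm set). 2 * 0 + 2 * 0)"
    by (intro tendsto_intros gr_difference(2) mg_difference(2))
  then have lim: "(\<lambda>n. integral\<^sup>L M (?B n)) \<longlonglongrightarrow> 0"
    using gr_difference(1) mg_difference(1) by (simp add: Bochner_Integration.integral_sum)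
  show "(\<lambda>n. LINT \<omega>|M. (norm (P *v \<epsilon> n \<omega> - P *v \<epsilon>s n \<omega>))\<^sup>2) \<longlonglongrightarrow> 0"
  proof (rule tendsto_sandwich[OF _ _ tendsto_const lim])
    show "\<forall>\<^sub>F n in sequentially. (LINT \<omega>|M. (norm (P *v \<epsilon> n \<omega> - P *v \<epsilon>s n \<omega>))\<^sup>2) \<le> integral\<^sup>L M (?B n)"
      by (intro always_eventually allI integral_mono int iB le)
  qed (auto intro!: always_eventually Bochner_Integration.integral_nonneg)
qed

text \<open>Young's inequality with parameter \<tau> bounds the product by the vanishing mean square
  difference divided by \<tau>, plus \<tau> times a bounded second moment; \<tau> is fixed before n
  grows.\<close>

lemma noise_cross_difference:
  "(\<lambda>n. LINT \<omega>|M. norm (P *v \<epsilon> n \<omega> - P *v \<epsilon>s n \<omega>) * (norm (P *v \<epsilon> n \<omega>) + norm (P *v \<epsilon>s n \<omega>))) \<longlonglongrightarrow> 0"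
proof -
  let ?f = "\<lambda>n \<omega>. norm (P *v \<epsilon> n \<omega> - P *v \<epsilon>s n \<omega>)"
  let ?h = "\<lambda>n \<omega>. norm (P *v \<epsilon> n \<omega>) + norm (P *v \<epsilon>s n \<omega>)"
  let ?F = "\<lambda>n. LINT \<omega>|M. (?f n \<omega>)\<^sup>2"
  have h_le: "?h n \<omega> \<le> 2 * \<Lambda> n \<omega>" "0 \<le> ?h n \<omega>" for n \<omega>
    using order_trans[OF norm_P_le \<epsilon>_le, of n \<omega>] order_trans[OF norm_P_le \<epsilon>s_le, of n \<omega>] by auto
  have bound: "0 \<le> (LINT \<omega>|M. ?f n \<omega> * ?h n \<omega>) \<and> (LINT \<omega>|M. ?f n \<omega> * ?h n \<omega>) \<le> ?F n / \<tau> + 4 * (1 + C\<^sub>\<Lambda>) * \<tau>" if \<tau>: "0 < \<tau>" for n \<tau>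
  proof -
    have iR: "integrable M (\<lambda>\<omega>. (?f n \<omega>)\<^sup>2 / \<tau> + 4 * \<tau> * (\<Lambda> n \<omega>)\<^sup>2)"
      using noise_difference(1)[of n] \<Lambda>_sq(1)[of n] by simp
    have le: "?f n \<omega> * ?h n \<omega> \<le> (?f n \<omega>)\<^sup>2 / \<tau> + 4 * \<tau> * (\<Lambda> n \<omega>)\<^sup>2" for \<omega>
    proof -
      have "?f n \<omega> * ?h n \<omega> \<le> ?f n \<omega> * (2 * \<Lambda> n \<omega>)" using h_le by (intro mult_left_mono) auto
      also have "\<dots> \<le> (?f n \<omega>)\<^sup>2 / \<tau> + \<tau> * (2 * \<Lambda> n \<omega>)\<^sup>2"
      proof -
        have "0 \<le> (?f n \<omega> - \<tau> * (2 * \<Lambda> n \<omega>))\<^sup>2 / \<tau>" using \<tau> by simp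
        also have "\<dots> = (?f n \<omega>)\<^sup>2 / \<tau> - 2 * (?f n \<omega> * (2 * \<Lambda> n \<omega>)) + \<tau> * (2 * \<Lambda> n \<omega>)\<^sup>2"
          using \<tau> by (simp add: power2_diff power2_eq_square field_simps)
        finally have "2 * (?f n \<omega> * (2 * \<Lambda> n \<omega>)) \<le> (?f n \<omega>)\<^sup>2 / \<tau> + \<tau> * (2 * \<Lambda> n \<omega>)\<^sup>2" by linarith
        moreover have "0 \<le> ?f n \<omega> * (2 * \<Lambda> n \<omega>)" using \<Lambda>_nonneg by simp
        ultimately show ?thesis by linarith
      qed
      finally show ?thesis by (simp add: power_mult_distrib mult_ac)
    qed
    have i: "integrable M (\<lambda>\<omega>. ?f n \<omega> * ?h n \<omega>)"
      by (rule Bochner_Integration.integrable_bound[OF iR]) (use le h_le(2) in \<open>auto intro: order_trans[OF _ abs_ge_self]\<close>)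
    have "(LINT \<omega>|M. ?f n \<omega> * ?h n \<omega>) \<le> (LINT \<omega>|M. (?f n \<omega>)\<^sup>2 / \<tau> + 4 * \<tau> * (\<Lambda> n \<omega>)\<^sup>2)"
      by (rule integral_mono[OF i iR le])
    also have "\<dots> = ?F n / \<tau> + 4 * \<tau> * (LINT \<omega>|M. (\<Lambda> n \<omega>)\<^sup>2)"
      using noise_difference(1)[of n] \<Lambda>_sq(1)[of n] by simp
    also have "\<dots> \<le> ?F n / \<tau> + 4 * \<tau> * (1 + C\<^sub>\<Lambda>)"
      using \<Lambda>_sq(2)[of n] \<tau> by (intro add_left_mono mult_left_mono) auto
    finally show ?thesis using h_le(2) by (auto simp: mult_ac intro!: Bochner_Integration.integral_nonneg)
  qed
  show ?thesis
  proof (rule tendstoI)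
    fix e :: real assume e: "0 < e"
    define \<tau> where "\<tau> = e / (8 * (1 + C\<^sub>\<Lambda>))"
    have \<tau>: "0 < \<tau>" "4 * (1 + C\<^sub>\<Lambda>) * \<tau> = e / 2"
      using e C\<^sub>\<Lambda>_nonneg by (auto simp: \<tau>_def field_simps add_nonneg_pos)
    have "(\<lambda>n. ?F n / \<tau>) \<longlonglongrightarrow> 0 / \<tau>" by (intro tendsto_divide noise_difference(2) tendsto_const) (use \<tau> in simp)
    then have "\<forall>\<^sub>F n in sequentially. ?F n / \<tau> < e / 2" using e by (intro order_tendstoD(2)) auto
    then show "\<forall>\<^sub>F n in sequentially. dist (LINT \<omega>|M. ?f n \<omega> * ?h n \<omega>) 0 < e"
    proof eventually_elim
      case (elim n)
      have "(LINT \<omega>|M. ?f n \<omega> * ?h n \<omega>) < e" "0 \<le> (LINT \<omega>|M. ?f n \<omega> * ?h n \<omega>)"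
        using bound[OF \<tau>(1), of n] \<tau>(2) elim by linarith+
      then show ?case unfolding dist_real_def by linarith
    qed
  qed
qed

sublocale recursion: linear_noise_recursion M H P T \<kappa> g Del "\<lambda>n \<omega>. P *v \<epsilon> n \<omega>" "\<lambda>n \<omega>. P *v \<epsilon>s n \<omega>" p C\<^sub>\<Lambda>
proof unfold_locales
  fix n
  have le: "norm (P *v \<epsilon> n \<omega>) powr p \<le> \<Lambda> n \<omega> powr p" for \<omega>
    using order_trans[OF norm_P_le \<epsilon>_le] p by (intro powr_mono2) auto
  show i: "integrable M (\<lambda>\<omega>. norm (P *v \<epsilon> n \<omega>) powr p)"
    by (rule Bochner_Integration.integrable_bound[OF \<Lambda>_moment(1)[of n]]) (use le in auto)
  show "(LINT \<omega>|M. norm (P *v \<epsilon> n \<omega>) powr p) \<le> C\<^sub>\<Lambda>"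
    using integral_mono[OF i \<Lambda>_moment(1) le] \<Lambda>_moment(2)[of n] by linarith
  show "integrable M (\<lambda>\<omega>. (norm (P *v \<epsilon>s n \<omega>))\<^sup>2)"
    using sq_integrable_dominated(1)[OF P\<epsilon>s_M, of n n] order_trans[OF norm_P_le \<epsilon>s_le] by blast
qed (use g_pos g_lim g_div ratio ratio_ge Del_integrable P_Del p P\<epsilon>_sq noise_orth_iexp noise_variance_iexp
      noise_cross_difference T_psd in \<open>auto\<close>)

end

text \<open>Slutsky's argument: the exponentials differ by at most \<open>norm t\<close> times
  \<eta> off a small event and by at most 2 on it, and tightness passes from \<open>D\<close> to
  \<open>Y\<close> with the radius increased by 1.\<close>

lemma (in prob_space) converges_in_distribution_perturbation:
  fixes Y D :: "nat \<Rightarrow> 'a \<Rightarrow> 'b::euclidean_space"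
  assumes Y[measurable]: "\<And>k. Y k \<in> borel_measurable M" and D[measurable]: "\<And>k. D k \<in> borel_measurable M"
    and N: "prob_space N" "sets N = sets borel"
    and char: "\<And>t. (\<lambda>k. CLINT \<omega>|M. iexp (t \<bullet> D k \<omega>)) \<longlonglongrightarrow> (CLINT x|N. iexp (t \<bullet> x))"
    and tight: "\<And>\<epsilon>. 0 < \<epsilon> \<Longrightarrow> \<exists>R. \<forall>\<^sub>F k in sequentially. prob {\<omega>\<in>space M. R < norm (D k \<omega>)} \<le> \<epsilon>"
    and close: "\<And>\<eta> \<epsilon>. 0 < \<eta> \<Longrightarrow> 0 < \<epsilon> \<Longrightarrow> \<forall>\<^sub>F k in sequentially. prob {\<omega>\<in>space M. \<eta> < norm (Y k \<omega> - D k \<omega>)} \<le> \<epsilon>"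
  shows "converges_in_distribution M Y N"
proof (rule converges_in_distribution_char[OF Y N])
  fix t :: 'b
  have iexp_meas[measurable]: "(\<lambda>\<omega>. iexp (t \<bullet> f \<omega>)) \<in> borel_measurable M" if [measurable]: "f \<in> borel_measurable M" for f
    by (rule measurable_compose[OF that]) (intro borel_measurable_continuous_onI continuous_intros)
  have int: "integrable M (\<lambda>\<omega>. iexp (t \<bullet> f \<omega>))" if "f \<in> borel_measurable M" for f
    by (rule integrable_const_bound[where B = 1]) (use iexp_meas[OF that] in \<open>auto simp: norm_exp_i_times\<close>)
  have "(\<lambda>k. (CLINT \<omega>|M. iexp (t \<bullet> Y k \<omega>)) - (CLINT \<omega>|M. iexp (t \<bullet> D k \<omega>))) \<longlonglongrightarrow> 0"
  proof (rule tendstoI)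
    fix e :: real assume e: "0 < e"
    define \<eta> where "\<eta> = e / (3 * (norm t + 1))"
    have "0 < norm t + 1" using norm_ge_zero[of t] by linarith
    then have "norm t / (norm t + 1) \<le> 1" by simp
    from mult_left_mono[OF this, of "e / 3"] e
    have \<eta>: "0 < \<eta>" "norm t * \<eta> \<le> e / 3"
      by (auto simp: \<eta>_def mult_ac intro!: divide_pos_pos mult_pos_pos add_nonneg_pos)
    have "\<forall>\<^sub>F k in sequentially. prob {\<omega>\<in>space M. \<eta> < norm (Y k \<omega> - D k \<omega>)} \<le> e / 6"
      by (rule close[OF \<eta>(1)]) (use e in simp)
    then show "\<forall>\<^sub>F k in sequentially. dist ((CLINT \<omega>|M. iexp (t \<bullet> Y k \<omega>)) - (CLINT \<omega>|M. iexp (t \<bullet> D k \<omega>))) 0 < e"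
    proof eventually_elim
      case (elim k)
      let ?A = "{\<omega>\<in>space M. \<eta> < norm (Y k \<omega> - D k \<omega>)}"
      have le: "cmod (iexp (t \<bullet> Y k \<omega>) - iexp (t \<bullet> D k \<omega>)) \<le> norm t * \<eta> + 2 * indicator ?A \<omega>" if "\<omega> \<in> space M" for \<omega>
      proof (cases "\<omega> \<in> ?A")
        case True
        have "0 \<le> norm t * \<eta>" using \<eta>(1) by simp
        then show ?thesis
          using True norm_triangle_ineq4[of "iexp (t \<bullet> Y k \<omega>)" "iexp (t \<bullet> D k \<omega>)"] by (simp add: norm_exp_i_times)
      next
        case False
        have "iexp (t \<bullet> Y k \<omega>) - iexp (t \<bullet> D k \<omega>) = iexp (t \<bullet> D k \<omega>) * (iexp (t \<bullet> (Y k \<omega> - D k \<omega>)) - 1)"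
          by (simp add: inner_diff_right right_diff_distrib flip: exp_add)
        then have "cmod (iexp (t \<bullet> Y k \<omega>) - iexp (t \<bullet> D k \<omega>)) = cmod (iexp (t \<bullet> (Y k \<omega> - D k \<omega>)) - 1)"
          by (simp only: norm_mult norm_exp_i_times mult_1)
        also have "\<dots> \<le> \<bar>t \<bullet> (Y k \<omega> - D k \<omega>)\<bar>"
          using iexp_approx1[of "t \<bullet> (Y k \<omega> - D k \<omega>)" 0] by simp
        also have "\<dots> \<le> norm t * norm (Y k \<omega> - D k \<omega>)" by (rule Cauchy_Schwarz_ineq2)
        also have "\<dots> \<le> norm t * \<eta>" using False that by (intro mult_left_mono) auto
        finally show ?thesis using False by simp
      qed
      have "cmod ((CLINT \<omega>|M. iexp (t \<bullet> Y k \<omega>)) - (CLINT \<omega>|M. iexp (t \<bullet> D k \<omega>)))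
          = cmod (CLINT \<omega>|M. iexp (t \<bullet> Y k \<omega>) - iexp (t \<bullet> D k \<omega>))"
        by (simp only: Bochner_Integration.integral_diff[OF int[OF Y] int[OF D]])
      also have "\<dots> \<le> (LINT \<omega>|M. norm t * \<eta> + 2 * indicator ?A \<omega>)"
      proof (rule order_trans[OF integral_norm_bound integral_mono])
        show "integrable M (\<lambda>\<omega>. norm (iexp (t \<bullet> Y k \<omega>) - iexp (t \<bullet> D k \<omega>)))"
          by (intro integrable_norm Bochner_Integration.integrable_diff int Y D)
        have "?A \<in> events" by measurable
        then show "integrable M (\<lambda>\<omega>. norm t * \<eta> + 2 * indicator ?A \<omega>)" by (simp add: emeasure_eq_measure)
      qed (rule le)
      also have "\<dots> = norm t * \<eta> + 2 * prob ?A"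
      proof -
        have "?A \<in> events" by measurable
        then show ?thesis by (simp add: emeasure_eq_measure prob_space)
      qed
      also have "\<dots> < e" using elim \<eta>(2) e by linarith
      finally show ?case by (simp add: dist_norm)
    qed
  qed
  from tendsto_add[OF this char[of t]]
  show "(\<lambda>k. CLINT \<omega>|M. iexp (t \<bullet> Y k \<omega>)) \<longlonglongrightarrow> (CLINT x|N. iexp (t \<bullet> x))" by simp
next
  fix e :: real assume e: "0 < e"
  obtain R where "\<forall>\<^sub>F k in sequentially. prob {\<omega>\<in>space M. R < norm (D k \<omega>)} \<le> e / 2"
    using tight[of "e / 2"] e by auto
  moreover have "\<forall>\<^sub>F k in sequentially. prob {\<omega>\<in>space M. 1 < norm (Y k \<omega> - D k \<omega>)} \<le> e / 2"
    by (rule close) (use e in auto)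
  ultimately have "\<forall>\<^sub>F k in sequentially. prob {\<omega>\<in>space M. R + 1 < norm (Y k \<omega>)} \<le> e"
  proof eventually_elim
    case (elim k)
    have "prob {\<omega>\<in>space M. R + 1 < norm (Y k \<omega>)}
        \<le> prob ({\<omega>\<in>space M. R < norm (D k \<omega>)} \<union> {\<omega>\<in>space M. 1 < norm (Y k \<omega> - D k \<omega>)})"
    proof (rule finite_measure_mono)
      show "{\<omega>\<in>space M. R + 1 < norm (Y k \<omega>)} \<subseteq> {\<omega>\<in>space M. R < norm (D k \<omega>)} \<union> {\<omega>\<in>space M. 1 < norm (Y k \<omega> - D k \<omega>)}"
      proof
        fix \<omega> assume "\<omega> \<in> {\<omega>\<in>space M. R + 1 < norm (Y k \<omega>)}"
        moreover have "norm (Y k \<omega>) \<le> norm (Y k \<omega> - D k \<omega>) + norm (D k \<omega>)"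
          using norm_triangle_ineq[of "Y k \<omega> - D k \<omega>" "D k \<omega>"] by simp
        ultimately show "\<omega> \<in> {\<omega>\<in>space M. R < norm (D k \<omega>)} \<union> {\<omega>\<in>space M. 1 < norm (Y k \<omega> - D k \<omega>)}"
          by auto
      qed
    qed measurable
    also have "\<dots> \<le> prob {\<omega>\<in>space M. R < norm (D k \<omega>)} + prob {\<omega>\<in>space M. 1 < norm (Y k \<omega> - D k \<omega>)}"
      by (intro measure_Un_le) measurable
    finally show ?case using elim by linarith
  qed
  then show "\<exists>R. \<forall>\<^sub>F k in sequentially. prob {\<omega>\<in>space M. R < norm (Y k \<omega>)} \<le> e" by blast
qed

context polyhedral_dual_averaging
begin

text \<open>Chebyshev's inequality; the radius is chosen so that the bound K g on the second moment
  gives exactly \<open>e\<close>.\<close>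

lemma scaled_Del_tight:
  assumes e: "0 < e"
  shows "\<exists>R. \<forall>\<^sub>F n in sequentially. prob {\<omega>\<in>space M. R < norm ((1 / sqrt (g n)) *\<^sub>R Del n \<omega>)} \<le> e"
proof -
  obtain K where K: "0 < K" and ev: "\<forall>\<^sub>F n in sequentially. D2 n \<le> K * g n" by (rule D2_bound)
  let ?R = "sqrt (K / e)"
  from ev have "\<forall>\<^sub>F n in sequentially. prob {\<omega>\<in>space M. ?R < norm ((1 / sqrt (g n)) *\<^sub>R Del n \<omega>)} \<le> e"
  proof eventually_elim
    case (elim n)
    have c: "0 < K / e * g n" using K e g_pos[of n] by simp
    have "prob {\<omega>\<in>space M. ?R < norm ((1 / sqrt (g n)) *\<^sub>R Del n \<omega>)}
        \<le> prob {\<omega>\<in>space M. K / e * g n \<le> (norm (Del n \<omega>))\<^sup>2}"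
    proof (rule finite_measure_mono)
      show "{\<omega>\<in>space M. ?R < norm ((1 / sqrt (g n)) *\<^sub>R Del n \<omega>)} \<subseteq> {\<omega>\<in>space M. K / e * g n \<le> (norm (Del n \<omega>))\<^sup>2}"
      proof safe
        fix \<omega> assume "?R < norm ((1 / sqrt (g n)) *\<^sub>R Del n \<omega>)"
        then have "?R * sqrt (g n) \<le> norm (Del n \<omega>)" using g_pos[of n] by (simp add: field_simps)
        then have "(?R * sqrt (g n))\<^sup>2 \<le> (norm (Del n \<omega>))\<^sup>2"
          using K e g_pos[of n] by (intro power_mono) auto
        then show "K / e * g n \<le> (norm (Del n \<omega>))\<^sup>2"
          using K e g_pos[of n] by (simp add: power_mult_distrib less_imp_le)
      qed
    qed measurable
    also have "\<dots> \<le> D2 n / (K / e * g n)"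
      unfolding D2_def using Del_sq[of n] c by (intro integral_Markov_inequality_measure[where A = "space M"]) auto
    also have "\<dots> \<le> (K * g n) / (K / e * g n)" using elim c by (intro divide_right_mono) auto
    also have "\<dots> = e" using K e g_pos[of n] by simp
    finally show ?case .
  qed
  then show ?thesis by blast
qed

text \<open>The covariance inherits symmetry and nonnegativity from \<open>lyap\<close>, so a normal
  law with it exists. The limit is proved for \<open>Del\<close> and carried over to the iterates,
  the remainder being negligible.\<close>

theorem asymptotic_normality:
  fixes e :: "nat \<Rightarrow> 'd" and U :: "real^'d^'d"
  assumes enum: "bij_betw e {..<CARD('d)} UNIV" and r: "r \<le> CARD('d)"
    and U: "is_orthonormal_basis (\<lambda>i. column (e i) U) {..<r} {v. B *v v = 0}"
  shows "\<exists>N. is_multivariate_normal N 0 (asymptotic_cov e r U P H Sb) \<and>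
    converges_in_distribution M (\<lambda>n \<omega>. (1 / sqrt (g n)) *\<^sub>R (x n j \<omega> - xs)) N"
proof -
  let ?\<Sigma> = "asymptotic_cov e r U P H Sb"
  have form: "t \<bullet> (?\<Sigma> *v w) = flow.lyap t w" for t w
    using U by (intro flow.asymptotic_cov_form[OF enum r _ T_def]) (simp add: P_iff)
  have "(transpose ?\<Sigma> *v t) \<bullet> w = (?\<Sigma> *v t) \<bullet> w" for t w
    unfolding transpose_inner form
    by (subst inner_commute) (simp add: form flow.lyap_commute[of t w])
  then have "transpose ?\<Sigma> *v t = ?\<Sigma> *v t" for t using vector_eq_rdot by blast
  then have sym: "transpose ?\<Sigma> = ?\<Sigma>" by (simp add: matrix_eq)
  obtain N where N: "is_multivariate_normal N 0 ?\<Sigma>"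
    using multivariate_normal_exists[OF sym] flow.lyap_nonneg[OF T_psd] form by metis
  have "converges_in_distribution M (\<lambda>n \<omega>. (1 / sqrt (g n)) *\<^sub>R (x n j \<omega> - xs)) N"
  proof (rule converges_in_distribution_perturbation[where D = "\<lambda>n \<omega>. (1 / sqrt (g n)) *\<^sub>R Del n \<omega>"])
    show "prob_space N" "sets N = sets borel" using N by (auto simp: is_multivariate_normal_def)
    fix t
    have "(CLINT x|N. iexp (t \<bullet> x)) = complex_of_real (exp (- flow.lyap t t / 2))"
      using N by (simp add: is_multivariate_normal_def form exp_of_real[symmetric])
    then show "(\<lambda>n. CLINT \<omega>|M. iexp (t \<bullet> ((1 / sqrt (g n)) *\<^sub>R Del n \<omega>))) \<longlonglongrightarrow> (CLINT x|N. iexp (t \<bullet> x))"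
      using recursion.char_tendsto[of t] by simp
  next
    show "(\<lambda>\<omega>. (1 / sqrt (g n)) *\<^sub>R (x n j \<omega> - xs)) \<in> borel_measurable M" for n by measurable
    show "(\<lambda>\<omega>. (1 / sqrt (g n)) *\<^sub>R Del n \<omega>) \<in> borel_measurable M" for n by measurable
  qed (rule scaled_Del_tight remainder_negligible, assumption+)+
  with N show ?thesis by blast
qed

end

section \<open>Gradients of functions that are convex on a polyhedron\<close>

lemma grad_eq:
  assumes "GDERIV f x :> D"
  shows "grad f x = D"
  unfolding grad_def
proof (rule the_equality)
  fix E assume "GDERIV f x :> E"
  then have "(\<lambda>h. h \<bullet> E) = (\<lambda>h. h \<bullet> D)"
    using assms unfolding gderiv_def by (rule has_derivative_unique)
  then have "h \<bullet> E = h \<bullet> D" for h by (rule fun_cong)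
  then show "E = D" using vector_eq_ldot by blast
qed (rule assms)

lemma GDERIV_grad:
  fixes f :: "'a::euclidean_space \<Rightarrow> real"
  assumes "f differentiable (at x)"
  shows "GDERIV f x :> grad f x"
proof -
  obtain f' where f': "(f has_derivative f') (at x)" using assms by (auto simp: differentiable_def)
  interpret f': bounded_linear f' by (rule has_derivative_bounded_linear[OF f'])
  have "f' h = h \<bullet> (\<Sum>b\<in>Basis. f' b *\<^sub>R b)" for h
  proof -
    have "f' h = f' (\<Sum>b\<in>Basis. (h \<bullet> b) *\<^sub>R b)" by (simp only: euclidean_representation)
    also have "\<dots> = h \<bullet> (\<Sum>b\<in>Basis. f' b *\<^sub>R b)"
      by (simp add: f'.sum f'.scaleR inner_sum_right mult.commute)
    finally show ?thesis .
  qed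
  then have "f' = (\<lambda>h. h \<bullet> (\<Sum>b\<in>Basis. f' b *\<^sub>R b))" by (rule ext)
  with f' have D: "GDERIV f x :> (\<Sum>b\<in>Basis. f' b *\<^sub>R b)" by (simp only: gderiv_def)
  then show ?thesis unfolding grad_eq[OF D] .
qed

lemma GDERIV_sum:
  fixes f :: "'i \<Rightarrow> 'a::real_inner \<Rightarrow> real"
  shows "(\<And>i. i \<in> I \<Longrightarrow> GDERIV (f i) x :> D i) \<Longrightarrow> GDERIV (\<lambda>x. \<Sum>i\<in>I. f i x) x :> (\<Sum>i\<in>I. D i)"
  unfolding gderiv_def inner_sum_right by (rule has_derivative_sum)

lemma GDERIV_directional:
  assumes "GDERIV h u :> D"
  shows "((\<lambda>s. (h (u + s *\<^sub>R d) - h u) / s) \<longlongrightarrow> D \<bullet> d) (at 0)"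
proof -
  have "((\<lambda>s. u + s *\<^sub>R d) has_derivative (\<lambda>s. s *\<^sub>R d)) (at 0)" by (auto intro!: derivative_eq_intros)
  from has_derivative_compose[OF this, of h "\<lambda>h. h \<bullet> D"] assms
  have "((\<lambda>s. h (u + s *\<^sub>R d)) has_derivative (\<lambda>s. (s *\<^sub>R d) \<bullet> D)) (at 0)" by (simp add: gderiv_def)
  moreover have "(\<lambda>s. (s *\<^sub>R d) \<bullet> D) = (*) (D \<bullet> d)" by (auto simp: inner_commute)
  ultimately have "((\<lambda>s. h (u + s *\<^sub>R d)) has_field_derivative (D \<bullet> d)) (at 0)" by (simp add: has_field_derivative_def)
  then show ?thesis by (simp add: has_field_derivative_iff)
qed

text \<open>Only difference quotients at \<open>u\<close> towards \<open>y\<close> are used, from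
  one side, so that convexity on \<open>X\<close> is enough.\<close>

lemma convex_gradient_ineq:
  assumes h: "convex_on X h" and uy: "u \<in> X" "y \<in> X" and D: "GDERIV h u :> D"
  shows "h u + D \<bullet> (y - u) \<le> h y"
proof -
  have "((\<lambda>s. (h (u + s *\<^sub>R (y - u)) - h u) / s) \<longlongrightarrow> D \<bullet> (y - u)) (at_right 0)"
    using GDERIV_directional[OF D, of "y - u"] by (rule filterlim_mono) (auto simp: at_within_le_at)
  moreover have "\<forall>\<^sub>F s in at_right 0. (h (u + s *\<^sub>R (y - u)) - h u) / s \<le> h y - h u"
  proof (rule eventually_at_rightI[of 0 1])
    fix s :: real assume s: "s \<in> {0<..<1}"
    have "h ((1 - s) *\<^sub>R u + s *\<^sub>R y) \<le> (1 - s) * h u + s * h y"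
      using s by (intro convex_onD[OF h _ _ uy]) auto
    moreover have "(1 - s) *\<^sub>R u + s *\<^sub>R y = u + s *\<^sub>R (y - u)" by (simp add: algebra_simps)
    ultimately show "(h (u + s *\<^sub>R (y - u)) - h u) / s \<le> h y - h u" using s by (simp add: field_simps)
  qed simp
  ultimately have "D \<bullet> (y - u) \<le> h y - h u"
    by (rule tendsto_upperbound) simp
  then show ?thesis by simp
qed

text \<open>
  Since \<open>h\<close> is convex on \<open>X\<close> only, its gradient need not be continuous at boundary points of \<open>X\<close>; if both
  \<open>d\<close> and \<open>- d\<close> are feasible directions at \<open>xs\<close>, the difference quotients along them squeeze it.
\<close>

lemma convex_gradient_tendsto:
  fixes h :: "'a::euclidean_space \<Rightarrow> real"
  assumes h: "convex_on X h" and D: "\<And>v. v \<in> X \<Longrightarrow> GDERIV h v :> D v" and K: "\<And>v. v \<in> X \<Longrightarrow> norm (D v) \<le> K"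
    and xs: "xs \<in> X" and dir: "\<forall>\<^sub>F t in at_right 0. xs + t *\<^sub>R d \<in> X" "\<forall>\<^sub>F t in at_right 0. xs + t *\<^sub>R (- d) \<in> X"
  shows "((\<lambda>v. D v \<bullet> d) \<longlongrightarrow> D xs \<bullet> d) (at xs within X)"
proof -
  \<comment> \<open>Upper semicontinuity of the directional derivative. A difference quotient at
    \<open>xs\<close> below \<open>a\<close> is fixed first; the gradient inequality at
    \<open>v\<close> towards \<open>xs + t *\<^sub>R d\<close> then bounds t times
    \<open>D v \<bullet> d\<close> by a quantity continuous at \<open>xs\<close>. Applied to d and
    -d this gives both sides.\<close>
  have upper: "\<forall>\<^sub>F v in at xs within X. D v \<bullet> d < a"
    if dir: "\<forall>\<^sub>F t in at_right 0. xs + t *\<^sub>R d \<in> X" and a: "D xs \<bullet> d < a" for d a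
  proof -
    obtain a' where a': "D xs \<bullet> d < a'" "a' < a" using dense[OF a] by blast
    have "((\<lambda>t. (h (xs + t *\<^sub>R d) - h xs) / t) \<longlongrightarrow> D xs \<bullet> d) (at_right 0)"
      using GDERIV_directional[OF D[OF xs], of d] by (rule filterlim_mono) (auto simp: at_within_le_at)
    then have "\<forall>\<^sub>F t in at_right 0. (h (xs + t *\<^sub>R d) - h xs) / t < a'"
      using a'(1) by (rule order_tendstoD(2))
    then have "\<forall>\<^sub>F t in at_right 0. 0 < t \<and> xs + t *\<^sub>R d \<in> X \<and> (h (xs + t *\<^sub>R d) - h xs) / t < a'"
      using dir eventually_at_right_less[of "0::real"] by eventually_elim simp
    then obtain t where t: "0 < t" "xs + t *\<^sub>R d \<in> X" "(h (xs + t *\<^sub>R d) - h xs) / t < a'"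
      using eventually_happens'[OF trivial_limit_at_right_real] by blast
    have id: "((\<lambda>v. v) \<longlongrightarrow> xs) (at xs within X)" by (rule tendsto_ident_at)
    have "isCont h xs" using D[OF xs] unfolding gderiv_def by (rule has_derivative_continuous)
    then have hl: "(h \<longlongrightarrow> h xs) (at xs within X)"
      using at_within_le_at[of xs X] filterlim_mono[of h "nhds (h xs)" "at xs"] by (auto simp: isCont_def)
    have "((\<lambda>v. (h (xs + t *\<^sub>R d) - h v + K * norm (xs - v)) / t) \<longlongrightarrow> (h (xs + t *\<^sub>R d) - h xs + K * norm (xs - xs)) / t) (at xs within X)"
      using t(1) by (intro tendsto_intros hl id) auto
    then have "\<forall>\<^sub>F v in at xs within X. (h (xs + t *\<^sub>R d) - h v + K * norm (xs - v)) / t < a"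
      by (rule order_tendstoD(2)) (use t(3) a'(2) in simp)
    moreover have "\<forall>\<^sub>F v in at xs within X. v \<in> X" by (simp add: eventually_at_filter)
    ultimately show ?thesis
    proof eventually_elim
      case (elim v)
      have "h v + D v \<bullet> (xs + t *\<^sub>R d - v) \<le> h (xs + t *\<^sub>R d)"
        by (rule convex_gradient_ineq[OF h elim(2) t(2) D[OF elim(2)]])
      moreover have "D v \<bullet> (xs + t *\<^sub>R d - v) = t * (D v \<bullet> d) + D v \<bullet> (xs - v)"
        by (simp add: inner_diff_right inner_add_right)
      moreover have "- (D v \<bullet> (xs - v)) \<le> K * norm (xs - v)"
        using Cauchy_Schwarz_ineq2[of "D v" "xs - v"] mult_right_mono[OF K[OF elim(2)], of "norm (xs - v)"] by simp
      ultimately have "t * (D v \<bullet> d) \<le> h (xs + t *\<^sub>R d) - h v + K * norm (xs - v)" by linarith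
      then have "D v \<bullet> d \<le> (h (xs + t *\<^sub>R d) - h v + K * norm (xs - v)) / t"
        using t(1) by (simp add: pos_le_divide_eq mult.commute)
      then show ?case using elim(1) by linarith
    qed
  qed
  show ?thesis
  proof (rule order_tendstoI)
    fix a assume "a < D xs \<bullet> d"
    then have "\<forall>\<^sub>F v in at xs within X. D v \<bullet> (- d) < - a" by (intro upper dir) simp
    then show "\<forall>\<^sub>F v in at xs within X. a < D v \<bullet> d" by simp
  qed (rule upper[OF dir(1)])
qed

text \<open>Along the null space of \<open>B\<close> the active constraints stay equalities, and the
  inactive ones keep some slack for small \<open>t\<close>.\<close>

lemma feasible_tangent_direction:
  assumes "B *v xs = b" "\<And>i. (C *v xs) $ i < c $ i" "B *v d = 0"
  shows "\<forall>\<^sub>F t in at_right 0. xs + t *\<^sub>R d \<in> feasible B b C c"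
proof -
  have "\<forall>\<^sub>F t in at_right 0. (C *v xs) $ i + t * (C *v d) $ i < c $ i" for i
  proof -
    have "((\<lambda>t. (C *v xs) $ i + t * (C *v d) $ i) \<longlongrightarrow> (C *v xs) $ i + 0 * (C *v d) $ i) (at_right 0)"
      by (intro tendsto_intros)
    then show ?thesis by (rule order_tendstoD(2)) (use assms(2) in simp)
  qed
  then have "\<forall>\<^sub>F t in at_right 0. \<forall>i. (C *v xs) $ i + t * (C *v d) $ i < c $ i"
    by (rule eventually_all_finite)
  then show ?thesis
    by eventually_elim
       (use assms in \<open>auto simp: feasible_def matrix_vector_right_distrib matrix_vector_mult_scaleR less_imp_le\<close>)
qed

lemma tangential_gradient_continuous:
  fixes h :: "real^'d \<Rightarrow> real"
  assumes h: "convex_on X h" and D: "\<And>v. v \<in> X \<Longrightarrow> GDERIV h v :> D v" and K: "\<And>v. v \<in> X \<Longrightarrow> norm (D v) \<le> K"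
    and X: "X = feasible B b C c" and xs: "xs \<in> X" "B *v xs = b" "\<And>i. (C *v xs) $ i < c $ i"
  shows "continuous (at xs within X) (\<lambda>v. null_proj B *v D v)"
  unfolding continuous_within
proof (rule vec_tendstoI)
  fix i
  \<comment> \<open>Coordinate \<open>i\<close> of a projected vector is its product with this
    direction, which is feasible at \<open>xs\<close> with both signs.\<close>
  define d where "d = null_proj B *v axis i 1"
  have d: "B *v d = 0" "B *v (- d) = 0" unfolding d_def by (simp_all add: null_proj_kernel vec.neg)
  have "(null_proj B *v v) $ i = v \<bullet> d" for v :: "real^'d"
    by (simp add: d_def null_proj_self_adjoint[symmetric] inner_axis)
  moreover have "((\<lambda>v. D v \<bullet> d) \<longlongrightarrow> D xs \<bullet> d) (at xs within X)"
    by (rule convex_gradient_tendsto[OF h D K xs(1) feasible_tangent_direction[OF xs(2,3) d(1), folded X]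
          feasible_tangent_direction[OF xs(2,3) d(2), folded X]])
  ultimately show "((\<lambda>v. (null_proj B *v D v) $ i) \<longlongrightarrow> (null_proj B *v D xs) $ i) (at xs within X)" by simp
qed

lemma power_step_facts:
  fixes a \<alpha> :: real
  assumes "0 < a" "1 / 2 < \<alpha>" "\<alpha> < 1"
  defines "g \<equiv> \<lambda>n. a / real (Suc n) powr \<alpha>"
  shows "0 < g n" "g (Suc n) \<le> g n" "filterlim (\<lambda>n. \<Sum>i<n. g i) at_top sequentially"
    "summable (\<lambda>n. (g n)\<^sup>2)" "(\<lambda>n. (g n / g (Suc n) - 1) / g n) \<longlonglongrightarrow> 0"
proof -
  show pos: "0 < g n" for n using assms(1) by (simp add: g_def)
  show "g (Suc n) \<le> g n"
    unfolding g_def using assms by (intro divide_left_mono powr_mono2 mult_pos_pos) auto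
  \<comment> \<open>Comparison for the divergence: each of the first \<open>n\<close> steps is at
    least \<open>a / real n powr \<alpha>\<close>.\<close>
  have lim: "filterlim (\<lambda>n. a * real n powr (1 - \<alpha>)) at_top sequentially"
    using assms by real_asymp
  show "filterlim (\<lambda>n. \<Sum>i<n. g i) at_top sequentially"
  proof (rule filterlim_at_top_mono[OF lim always_eventually[OF allI]])
    fix n
    show "a * real n powr (1 - \<alpha>) \<le> (\<Sum>i<n. g i)"
    proof (cases "n = 0")
      case False
      have "a * real n powr (1 - \<alpha>) = real (card {..<n}) * (a / real n powr \<alpha>)"
        using False by (simp add: powr_diff)
      also have "\<dots> \<le> (\<Sum>i<n. g i)"
        unfolding g_def using assms False by (intro sum_bounded_below divide_left_mono powr_mono2 mult_pos_pos) auto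
      finally show ?thesis .
    qed simp
  qed
  have sq: "(g n)\<^sup>2 = a\<^sup>2 * real (Suc n) powr (- 2 * \<alpha>)" for n
    by (simp add: g_def power_divide powr_minus divide_inverse power2_eq_square powr_add[symmetric] inverse_mult_distrib[symmetric]
        mult_ac del: inverse_mult_distrib)
  have "summable (\<lambda>n. real (Suc n) powr (- 2 * \<alpha>))"
    by (subst summable_Suc_iff, subst summable_real_powr_iff) (use assms in simp)
  then show "summable (\<lambda>n. (g n)\<^sup>2)" unfolding sq by (rule summable_mult)
  have "(\<lambda>n. (a / (real n + 1) powr \<alpha> / (a / (real n + 2) powr \<alpha>) - 1) / (a / (real n + 1) powr \<alpha>)) \<longlonglongrightarrow> 0"
    using assms by real_asymp
  then show "(\<lambda>n. (g n / g (Suc n) - 1) / g n) \<longlonglongrightarrow> 0" by (simp add: g_def add_ac)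
qed

section \<open>The filtration of the algorithm\<close>

context prob_space
begin

context
  fixes z0 :: "'m \<Rightarrow> 'a \<Rightarrow> 'b::topological_space" and \<xi>s :: "'m \<Rightarrow> nat \<Rightarrow> 'a \<Rightarrow> 'c::topological_space"
    and A :: "nat \<Rightarrow> 'a \<Rightarrow> 'd::topological_space"
  assumes z0: "\<And>j. z0 j \<in> borel_measurable M"
    and \<xi>s: "\<And>j k. 1 \<le> k \<Longrightarrow> \<xi>s j k \<in> borel_measurable M" and A: "\<And>k. 1 \<le> k \<Longrightarrow> A k \<in> borel_measurable M"
begin

abbreviation past where "past k \<equiv> (\<Union>j. rv_events M (z0 j)) \<union> (\<Union>j. \<Union>t\<in>{1..<k}. rv_events M (\<xi>s j t))
      \<union> (\<Union>t\<in>{1..<k}. rv_events M (A t))"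

lemma past_sets: "past k \<subseteq> sets M"
  using rv_events_sets(1)[OF z0] rv_events_sets(1)[OF \<xi>s] rv_events_sets(1)[OF A] by fastforce

lemma sets_history: "sets (history M z0 \<xi>s A k) = sigma_sets (space M) (past k)"
  and space_history: "space (history M z0 \<xi>s A k) = space M"
proof -
  have "past k \<subseteq> Pow (space M)" using past_sets[of k] sets.sets_into_space by blast
  then show "sets (history M z0 \<xi>s A k) = sigma_sets (space M) (past k)" "space (history M z0 \<xi>s A k) = space M"
    unfolding history_def by (rule sets_measure_of, rule space_measure_of)
qed

lemma subalgebra_history: "subalgebra M (history M z0 \<xi>s A k)"
  unfolding subalgebra_def sets_history space_history using sets.sigma_sets_subset[OF past_sets] by simp

lemma history_mono: "k \<le> l \<Longrightarrow> sets (history M z0 \<xi>s A k) \<subseteq> sets (history M z0 \<xi>s A l)"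
  unfolding sets_history by (intro sigma_sets_mono') fastforce

lemma measurable_history: "rv_events M Y \<subseteq> past k \<Longrightarrow> Y \<in> borel_measurable (history M z0 \<xi>s A k)"
  by (rule measurableI) (auto simp: space_history sets_history rv_events_def intro!: sigma_sets.Basic)

lemma history_measurable_initial: "z0 j \<in> borel_measurable (history M z0 \<xi>s A k)"
  by (rule measurable_history) blast

lemma history_measurable_sample: "1 \<le> t \<Longrightarrow> t < k \<Longrightarrow> \<xi>s j t \<in> borel_measurable (history M z0 \<xi>s A k)"
  by (rule measurable_history) fastforce

lemma history_measurable_weights: "1 \<le> t \<Longrightarrow> t < k \<Longrightarrow> A t \<in> borel_measurable (history M z0 \<xi>s A k)"
  by (rule measurable_history) fastforce

lemma subalgebra_sigma_rv_events:
  assumes N: "subalgebra M N" and Y: "Y \<in> borel_measurable M"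
  shows "subalgebra M (sigma (space M) (sets N \<union> rv_events M Y))"
    "sets (sigma (space M) (sets N \<union> rv_events M Y)) = sigma_sets (space M) (sets N \<union> rv_events M Y)"
proof -
  have sub: "sets N \<union> rv_events M Y \<subseteq> sets M" using N rv_events_sets(1)[OF Y] by (auto simp: subalgebra_def)
  then have Pow: "sets N \<union> rv_events M Y \<subseteq> Pow (space M)" using sets.sets_into_space by blast
  show eq: "sets (sigma (space M) (sets N \<union> rv_events M Y)) = sigma_sets (space M) (sets N \<union> rv_events M Y)"
    by (rule sets_measure_of[OF Pow])
  show "subalgebra M (sigma (space M) (sets N \<union> rv_events M Y))"
    unfolding subalgebra_def eq space_measure_of[OF Pow] using sets.sigma_sets_subset[OF sub] by simp
qed

text \<open>\<open>indep_set_sigma_of_cond_indep\<close> is applied twice: first the weights and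
  then the other sample are adjoined to the history without destroying independence. Passing to the
  smaller sigma-algebra without the weights finishes the argument.\<close>

lemma sample_indep_of_other_sample:
  assumes k: "1 \<le> k"
    and fresh: "indep_set (rv_events M (\<xi>s i k)) (sets (history M z0 \<xi>s A k))"
    and ciA: "cond_indep M (history M z0 \<xi>s A k) (\<xi>s i k) (A k)"
    and ci\<xi>: "cond_indep M (history_with_weights M z0 \<xi>s A k) (\<xi>s i k) (\<xi>s j k)"
  shows "indep_set (rv_events M (\<xi>s i k)) (sets (sigma (space M) (sets (history M z0 \<xi>s A k) \<union> rv_events M (\<xi>s j k))))"
proof -
  let ?N = "history M z0 \<xi>s A k" and ?N' = "history_with_weights M z0 \<xi>s A k"
  note N' = subalgebra_sigma_rv_events[OF subalgebra_history A[OF k], of k, folded history_with_weights_def]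
  have "indep_set (rv_events M (\<xi>s i k)) (sets ?N')"
    unfolding history_with_weights_def
    by (rule indep_set_sigma_of_cond_indep[OF subalgebra_history \<xi>s[OF k] A[OF k] fresh ciA])
  from indep_set_sigma_of_cond_indep[OF N'(1) \<xi>s[OF k] \<xi>s[OF k] this ci\<xi>]
  have *: "indep_set (rv_events M (\<xi>s i k)) (sets (sigma (space M) (sets ?N' \<union> rv_events M (\<xi>s j k))))" .
  have "sets ?N \<subseteq> sets ?N'" unfolding N'(2) by auto
  then have "sets (sigma (space M) (sets ?N \<union> rv_events M (\<xi>s j k))) \<subseteq> sets (sigma (space M) (sets ?N' \<union> rv_events M (\<xi>s j k)))"
    unfolding subalgebra_sigma_rv_events(2)[OF subalgebra_history \<xi>s[OF k]] subalgebra_sigma_rv_events(2)[OF N'(1) \<xi>s[OF k]]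
    by (intro sigma_sets_mono') auto
  then show ?thesis
    using * unfolding indep_set_def by (elim indep_sets_mono_sets) (auto split: bool.split)
qed

end

end

theorem theorem3:
  fixes M :: "'w measure"
    and \<xi> :: "'m::finite \<Rightarrow> 'w \<Rightarrow> real^'q"
    and F :: "'m \<Rightarrow> real^'d \<Rightarrow> real^'q \<Rightarrow> real"
    and f :: "'m \<Rightarrow> real^'d \<Rightarrow> real" and fsum :: "real^'d \<Rightarrow> real"
    and B :: "real^'d^'d1" and b :: "real^'d1"
    and C :: "real^'d^'d2" and c :: "real^'d2"
    and X :: "(real^'d) set"
    and z0 :: "'m \<Rightarrow> 'w \<Rightarrow> real^'d"
    and \<xi>s :: "'m \<Rightarrow> nat \<Rightarrow> 'w \<Rightarrow> real^'q"
    and A :: "nat \<Rightarrow> 'w \<Rightarrow> real^'m^'m"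
    and \<alpha>s :: "nat \<Rightarrow> real" and a \<alpha> :: real
    and z x :: "nat \<Rightarrow> 'm \<Rightarrow> 'w \<Rightarrow> real^'d"
    and zbar xbar :: "nat \<Rightarrow> 'w \<Rightarrow> real^'d"
    and Fk Fk' :: "nat \<Rightarrow> 'w measure"
    and xs :: "real^'d"
    and L0 :: "'m \<Rightarrow> real^'q \<Rightarrow> real" and p L c0 \<epsilon> \<mu> :: real
    and Hf :: "real^'d^'d"
    and P H U Sbar :: "real^'d^'d" and e :: "nat \<Rightarrow> 'd" and Y :: "(real^'d) set" and r :: nat
  assumes prob: "prob_space M"
    and xi_rv: "\<And>j. \<xi> j \<in> borel_measurable M"
    \<comment> \<open>the problem\<close>
    and X_def: "X = feasible B b C c"
    and F_integrable: "\<And>j v. v \<in> X \<Longrightarrow> integrable M (\<lambda>\<omega>. F j v (\<xi> j \<omega>))"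
    and f_def: "f = (\<lambda>j v. LINT \<omega>|M. F j v (\<xi> j \<omega>))"
    and fsum_def: "fsum = (\<lambda>v. \<Sum>j\<in>UNIV. f j v)"
    \<comment> \<open>the algorithm\<close>
    and z0_rv: "\<And>j. z0 j \<in> borel_measurable M"
    and z_def: "z = dual_iter X F z0 \<xi>s A \<alpha>s"
    and x_def: "\<And>k j. k \<ge> 1 \<Longrightarrow> x k j = (\<lambda>\<omega>. mirror_map X (z (k - 1) j \<omega>))"
    and zbar_def: "zbar = (\<lambda>k \<omega>. (1 / real CARD('m)) *\<^sub>R (\<Sum>j\<in>UNIV. z k j \<omega>))"
    and xbar_def: "\<And>k. xbar (Suc k) = (\<lambda>\<omega>. mirror_map X (zbar k \<omega>))"
    and Fk_def: "Fk = history M z0 \<xi>s A"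
    and Fk'_def: "Fk' = history_with_weights M z0 \<xi>s A"
    \<comment> \<open>the limit point\<close>
    and xs_min: "xs \<in> minimizers fsum X"
    and xs_limit: "AE \<omega> in M. (\<lambda>k. xbar k \<omega>) \<longlonglongrightarrow> xs"
    and active: "B *v xs = b"
    and inactive: "\<And>i. (C *v xs) $ i < c $ i"
    \<comment> \<open>objective\<close>
    and F_diff: "\<And>j s v. v \<in> X \<Longrightarrow> (\<lambda>v. F j v s) differentiable (at v)"
    and F_convex: "\<And>j s. convex_on X (\<lambda>v. F j v s)"
    and grad_measurable: "\<And>j. (\<lambda>(v, s). grad (\<lambda>v. F j v s) v)
            \<in> borel_measurable (restrict_space borel X \<Otimes>\<^sub>M borel)"
    and L0_meas: "\<And>j. L0 j \<in> borel_measurable borel"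
    and F_Lipschitz: "\<And>j s v w. v \<in> X \<Longrightarrow> w \<in> X \<Longrightarrow> \<bar>F j v s - F j w s\<bar> \<le> L0 j s * norm (v - w)"
    and grad_bound: "\<And>j s v. v \<in> X \<Longrightarrow> norm (grad (\<lambda>v. F j v s) v) \<le> L0 j s"
    and p_gt: "p > 2"
    and L0_moment: "\<And>j. integrable M (\<lambda>\<omega>. L0 j (\<xi> j \<omega>) powr p)"
    and f_grad: "\<And>j v. v \<in> X \<Longrightarrow> GDERIV (f j) v :> (LINT \<omega>|M. grad (\<lambda>v. F j v (\<xi> j \<omega>)) v)"
    and L_pos: "L > 0"
    and f_smooth: "\<And>j v w. v \<in> X \<Longrightarrow> w \<in> X \<Longrightarrow> norm (grad (f j) v - grad (f j) w) \<le> L * norm (v - w)"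
    and hessian: "is_hessian_within fsum X xs Hf"
    and c0_pos: "c0 > 0" and eps_pos: "\<epsilon> > 0"
    and expansion: "\<And>v. v \<in> X \<Longrightarrow> norm (v - xs) \<le> \<epsilon> \<Longrightarrow>
            norm (grad fsum v - grad fsum xs - Hf *v (v - xs)) \<le> c0 * (norm (v - xs))\<^sup>2"
    and mu_pos: "\<mu> > 0"
    and second_order: "\<And>v. B *v v = 0 \<Longrightarrow> v \<bullet> (Hf *v v) \<ge> \<mu> * (norm v)\<^sup>2"
    \<comment> \<open>constraint qualification\<close>
    and cq: "- grad fsum xs \<in> rel_interior {transpose B *v l | l. \<forall>i. 0 \<le> l $ i}"
    \<comment> \<open>weight matrices\<close>
    and A_indep: "prob_space.indep_vars M (\<lambda>_. borel) A {1..}"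
    and A_ident: "\<And>k. k \<ge> 1 \<Longrightarrow> distr M borel (A k) = distr M borel (A 1)"
    and A_stoch: "\<And>k. k \<ge> 1 \<Longrightarrow> AE \<omega> in M. doubly_stochastic (A k \<omega>)"
    and A_contract: "\<And>k. k \<ge> 1 \<Longrightarrow>
            onorm ((*v) (LINT \<omega>|M. transpose (A k \<omega>)
              ** (Finite_Cartesian_Product.mat 1 - (1 / real CARD('m)) *\<^sub>R (\<chi> i j. 1)) ** A k \<omega>)) < 1"
    and A_indep_past: "\<And>k. k \<ge> 1 \<Longrightarrow> prob_space.indep_set M (rv_events M (A k)) (sets (Fk k))"
    \<comment> \<open>step-size\<close>
    and step: "\<And>k. k \<ge> 1 \<Longrightarrow> \<alpha>s k = a / real k powr \<alpha>"
    and alpha_range: "2 / 3 < \<alpha>" "\<alpha> < 1" and a_pos: "a > 0"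
    \<comment> \<open>sampling\<close>
    and xi_iid: "\<And>j. prob_space.indep_vars M (\<lambda>_. borel) (\<xi>s j) {1..}"
    and xi_law: "\<And>j k. k \<ge> 1 \<Longrightarrow> distr M borel (\<xi>s j k) = distr M borel (\<xi> j)"
    and xi_fresh: "\<And>j k. k \<ge> 1 \<Longrightarrow> prob_space.indep_set M (rv_events M (\<xi>s j k)) (sets (Fk k))"
    and xi_cond_indep: "\<And>i j k. k \<ge> 1 \<Longrightarrow> i \<noteq> j \<Longrightarrow> cond_indep M (Fk' k) (\<xi>s i k) (\<xi>s j k)"
    and xi_A_cond_indep: "\<And>j k. k \<ge> 1 \<Longrightarrow> cond_indep M (Fk k) (\<xi>s j k) (A k)"
    \<comment> \<open>covariance\<close>
    and cov_cont: "continuous (at xs within X)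
            (\<lambda>v. \<Sum>j\<in>UNIV. cov_matrix M (\<lambda>\<omega>. grad (\<lambda>v. F j v (\<xi> j \<omega>)) v))"
    \<comment> \<open>notation of the conclusion\<close>
    and P_def: "P = null_proj B"
    and H_def: "H = (1 / real CARD('m)) *\<^sub>R (P ** Hf ** P)"
    and Sbar_def: "Sbar = (1 / (real CARD('m))\<^sup>2) *\<^sub>R
            (\<Sum>j\<in>UNIV. cov_matrix M (\<lambda>\<omega>. grad (\<lambda>v. F j v (\<xi> j \<omega>)) xs))"
    and Y_def: "Y = {v. B *v v = 0}"
    and r_def: "r = dim Y"
    and enum: "bij_betw e {..<CARD('d)} UNIV"
    and U_Y: "is_orthonormal_basis (\<lambda>i. column (e i) U) {..<r} Y"
    and U_Yperp: "is_orthonormal_basis (\<lambda>i. column (e i) U) {r..<CARD('d)} (Y\<^sup>\<bottom>)"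
  shows "\<forall>j. \<exists>N. is_multivariate_normal N 0 (asymptotic_cov e r U P H Sbar) \<and>
           converges_in_distribution M (\<lambda>k \<omega>. (1 / sqrt (\<alpha>s k)) *\<^sub>R (x k j \<omega> - xs)) N"
proof -
  interpret prob_space M by (rule prob)
  define gr where "gr j v s = grad (\<lambda>v. F j v s) v" for j v s
  define law where "law j = distr M borel (\<xi> j)" for j
  \<comment> \<open>Steps are numbered from 1 in the algorithm and from 0 in the locale.\<close>
  define g where "g n = \<alpha>s (Suc n)" for n
  \<comment> \<open>Integrability of a power of \<open>L0\<close> passes to smaller exponents; the
    cap at 3 is what the Taylor estimate of the exponential requires.\<close>
  define p' where "p' = min p 3"
  define K where "K k = (LINT \<omega>|M. transpose (A k \<omega>)
    ** (Finite_Cartesian_Product.mat 1 - (1 / real CARD('m)) *\<^sub>R (\<chi> i j. 1)) ** A k \<omega>)" for k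
  have X: "closed X" "convex X" unfolding X_def by (rule feasible_closed feasible_convex)+
  have xs: "xs \<in> X" using xs_min by (simp add: minimizers_def)
  then have X_ne: "X \<noteq> {}" by blast
  note mirror = mirror_map_eq_closest_point[OF X X_ne]
  have \<xi>s_M: "\<xi>s j k \<in> borel_measurable M" if "1 \<le> k" for j k
    using xi_iid[of j] that by (simp add: indep_vars_def)
  have A_M: "A k \<in> borel_measurable M" if "1 \<le> k" for k
    using A_indep that by (simp add: indep_vars_def)
  have F_grad: "GDERIV (\<lambda>v. F j v s) v :> gr j v s" if "v \<in> X" for j v s
    unfolding gr_def by (rule GDERIV_grad[OF F_diff[OF that]])
  have gr_meas: "(\<lambda>(v, s). gr j v s) \<in> borel_measurable (restrict_space borel X \<Otimes>\<^sub>M borel)" for j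
    unfolding gr_def by (rule grad_measurable)
  have gr_borel: "gr j v \<in> borel_measurable borel" if "v \<in> X" for j v
  proof -
    have "(\<lambda>s. (v, s)) \<in> measurable borel (restrict_space borel X \<Otimes>\<^sub>M borel)"
      using that by (intro measurable_Pair measurable_const measurable_ident_sets refl) (simp add: space_restrict_space)
    from measurable_compose[OF this gr_meas[of j]] show ?thesis by simp
  qed
  have L0_nonneg: "0 \<le> L0 j s" for j s
    using grad_bound[OF xs, of j s] norm_ge_zero order_trans by blast
  have mean: "(LINT s|law j. gr j v s) = grad (f j) v" if "v \<in> X" for j v
  proof -
    have "(LINT s|law j. gr j v s) = (LINT \<omega>|M. grad (\<lambda>v. F j v (\<xi> j \<omega>)) v)"
      unfolding law_def by (subst integral_distr[OF xi_rv gr_borel[OF that]]) (simp add: gr_def)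
    then show ?thesis using grad_eq[OF f_grad[OF that]] by simp
  qed
  have fsum_grad: "grad fsum v = (\<Sum>j\<in>UNIV. LINT s|law j. gr j v s)" if "v \<in> X" for v
  proof -
    have "GDERIV fsum v :> (\<Sum>j\<in>UNIV. grad (f j) v)"
      unfolding fsum_def using f_grad[OF that] grad_eq[OF f_grad[OF that]] by (intro GDERIV_sum) simp
    then show ?thesis using grad_eq mean[OF that] by simp
  qed
  have g_eq: "g = (\<lambda>n. a / real (Suc n) powr \<alpha>)" by (auto simp: g_def step)
  have step_facts: "0 < g n" "g (Suc n) \<le> g n" "filterlim (\<lambda>n. \<Sum>i<n. g i) at_top sequentially"
    "summable (\<lambda>n. (g n)\<^sup>2)" "(\<lambda>n. (g n / g (Suc n) - 1) / g n) \<longlonglongrightarrow> 0" for n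
  proof -
    have "1 / 2 < \<alpha>" using alpha_range by simp
    note power_step_facts[OF a_pos this alpha_range(2)]
    then show "0 < g n" "g (Suc n) \<le> g n" "filterlim (\<lambda>n. \<Sum>i<n. g i) at_top sequentially"
      "summable (\<lambda>n. (g n)\<^sup>2)" "(\<lambda>n. (g n / g (Suc n) - 1) / g n) \<longlonglongrightarrow> 0"
      unfolding g_eq .
  qed
  \<comment> \<open>The weights are identically distributed, so the mean coupling matrix is the same
    at every step and its norm serves as a common \<open>\<rho>\<close>.\<close>
  have K_eq: "K k = K 1" if "1 \<le> k" for k
  proof -
    let ?k = "\<lambda>w :: real^'m^'m. transpose w ** (Finite_Cartesian_Product.mat 1 - (1 / real CARD('m)) *\<^sub>R (\<chi> i j. 1)) ** w"
    have c: "?k \<in> borel_measurable borel"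
      unfolding matrix_matrix_mult_def Finite_Cartesian_Product.transpose_def
      by (intro borel_measurable_continuous_onI continuous_on_vec_lambda continuous_on_sum continuous_on_mult
          continuous_on_component continuous_on_const continuous_on_id)
    have K: "K l = (LINT w|distr M borel (A l). ?k w)" if "1 \<le> l" for l
      unfolding K_def by (rule integral_distr[OF A_M[OF that] c, symmetric])
    show ?thesis unfolding K[OF that] K[OF order_refl] A_ident[OF that] ..
  qed
  have L0_p': "integrable (law j) (\<lambda>s. L0 j s powr p')" for j
  proof -
    have "integrable M (\<lambda>\<omega>. L0 j (\<xi> j \<omega>) powr p')"
    proof (rule Bochner_Integration.integrable_bound)
      show "integrable M (\<lambda>\<omega>. 1 + L0 j (\<xi> j \<omega>) powr p)" using L0_moment by simp
      show "(\<lambda>\<omega>. L0 j (\<xi> j \<omega>) powr p') \<in> borel_measurable M"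
        using measurable_compose[OF xi_rv[of j] L0_meas[of j]] by measurable
      have "s powr p' \<le> 1 + s powr p" if "0 \<le> s" for s
      proof (cases "s \<le> 1")
        case True
        then have "s powr p' \<le> 1" using that p_gt by (intro powr_le1) (auto simp: p'_def)
        then show ?thesis using powr_ge_zero[of s p] by linarith
      next
        case False
        then have "s powr p' \<le> s powr p" by (intro powr_mono) (auto simp: p'_def)
        then show ?thesis by linarith
      qed
      then show "AE \<omega> in M. norm (L0 j (\<xi> j \<omega>) powr p') \<le> norm (1 + L0 j (\<xi> j \<omega>) powr p)"
        using L0_nonneg by (intro AE_I2) (auto intro: order_trans[OF _ abs_ge_self])
    qed
    moreover have "(\<lambda>s. L0 j s powr p') \<in> borel_measurable borel" using L0_meas[of j] by measurable
    ultimately show ?thesis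
      unfolding law_def by (subst integrable_distr_eq[OF xi_rv]) auto
  qed
  \<comment> \<open>Convexity of the integrands enters here: for fixed \<open>s\<close>, together
    with the gradient bound, it gives continuity of the projected gradient at
    \<open>xs\<close>.\<close>
  have cont: "continuous (at xs within X) (\<lambda>v. null_proj B *v gr j v s)" for j s
    by (rule tangential_gradient_continuous[OF F_convex[of j s] F_grad _ X_def xs active inactive, of "L0 j s"])
       (use grad_bound in \<open>auto simp: gr_def\<close>)
  interpret dda: polyhedral_dual_averaging M X xs gr "\<lambda>n j. \<xi>s j (Suc n)" law "\<lambda>n. A (Suc n)" g z "\<lambda>n. Fk (Suc n)"
    L0 p' L "onorm ((*v) (K 1))" B b C c Hf c0 \<epsilon> \<mu>
  proof unfold_locales
    fix n j
    show "\<xi>s j (Suc n) \<in> borel_measurable (Fk (Suc (Suc n)))" "A (Suc n) \<in> borel_measurable (Fk (Suc (Suc n)))"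
      unfolding Fk_def
      by (auto intro!: history_measurable_sample history_measurable_weights z0_rv \<xi>s_M A_M)
    show "distr M borel (\<xi>s j (Suc n)) = law j" by (simp add: xi_law law_def)
    show "z 0 j \<in> borel_measurable (Fk (Suc 0))"
      unfolding Fk_def z_def by (auto intro!: history_measurable_initial z0_rv \<xi>s_M A_M)
    show "z (Suc n) j \<omega> = (\<Sum>i\<in>UNIV. (A (Suc n) \<omega> $ j $ i) *\<^sub>R z n i \<omega>)
        - g n *\<^sub>R gr j (closest_point X (z n j \<omega>)) (\<xi>s j (Suc n) \<omega>)" for \<omega>
      by (simp add: z_def mirror gr_def g_def)
    show "subalgebra M (Fk (Suc n))" unfolding Fk_def by (rule subalgebra_history[OF z0_rv \<xi>s_M A_M])
    show "sets (Fk (Suc n)) \<subseteq> sets (Fk (Suc (Suc n)))"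
      unfolding Fk_def by (rule history_mono[OF z0_rv \<xi>s_M A_M]) auto
    show "indep_set (rv_events M (\<xi>s j (Suc n))) (sets (Fk (Suc n)))" by (rule xi_fresh) simp
    show "indep_set (rv_events M (\<xi>s i (Suc n))) (sets (sigma (space M) (sets (Fk (Suc n)) \<union> rv_events M (\<xi>s j (Suc n)))))"
      if "i \<noteq> j" for i
      using xi_fresh[of "Suc n" i] xi_A_cond_indep[of "Suc n" i] xi_cond_indep[OF _ that, of "Suc n"]
      unfolding Fk_def Fk'_def by (intro sample_indep_of_other_sample[OF z0_rv \<xi>s_M A_M]) auto
    show "indep_set (rv_events M (A (Suc n))) (sets (Fk (Suc n)))" by (rule A_indep_past) simp
    show "AE \<omega> in M. doubly_stochastic (A (Suc n) \<omega>)" by (rule A_stoch) simp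
    show "onorm ((*v) (LINT \<omega>|M. transpose (A (Suc n) \<omega>)
        ** (Finite_Cartesian_Product.mat 1 - (1 / real CARD('m)) *\<^sub>R (\<chi> i j. 1)) ** A (Suc n) \<omega>)) \<le> onorm ((*v) (K 1))"
      using K_eq[of "Suc n"] by (simp add: K_def)
    show "0 \<le> onorm ((*v) (K 1))" by (intro onorm_pos_le matrix_vector_mul_bounded_linear)
    show "onorm ((*v) (K 1)) < 1" using A_contract[of 1] by (simp add: K_def)
    show "AE \<omega> in M. (\<lambda>n. closest_point X ((1 / real CARD('m)) *\<^sub>R (\<Sum>j\<in>UNIV. z n j \<omega>))) \<longlonglongrightarrow> xs"
      using xs_limit
    proof eventually_elim
      case (elim \<omega>)
      then have "(\<lambda>n. xbar (Suc n) \<omega>) \<longlonglongrightarrow> xs" by (rule LIMSEQ_Suc)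
      then show ?case by (simp add: xbar_def zbar_def mirror)
    qed
  next
    show "norm (gr j v s) \<le> L0 j s" if "v \<in> X" for j v s
      unfolding gr_def by (rule grad_bound[OF that])
    show "norm ((LINT s|law j. gr j v s) - (LINT s|law j. gr j w s)) \<le> L * norm (v - w)" if "v \<in> X" "w \<in> X" for j v w
      using f_smooth[OF that] by (simp add: mean that)
    show "2 < p'" "p' \<le> 3" using p_gt by (auto simp: p'_def)
    show "- (\<Sum>j\<in>UNIV. LINT s|law j. gr j xs s) \<in> rel_interior {transpose B *v l | l. \<forall>i. 0 \<le> l $ i}"
      using cq by (simp add: fsum_grad[OF xs])
    show "norm ((\<Sum>j\<in>UNIV. LINT s|law j. gr j v s) - (\<Sum>j\<in>UNIV. LINT s|law j. gr j xs s) - Hf *v (v - xs)) \<le> c0 * (norm (v - xs))\<^sup>2"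
      if "v \<in> X" "norm (v - xs) \<le> \<epsilon>" for v
      using expansion[OF that] by (simp add: fsum_grad[OF xs] fsum_grad[OF that(1)])
  qed (fact X xs gr_meas L0_meas L0_p' step_facts L_pos X_def active inactive c0_pos eps_pos mu_pos second_order cont)+
  have cov: "cov_matrix M (\<lambda>\<omega>. grad (\<lambda>v. F j v (\<xi> j \<omega>)) xs) = cov_matrix (law j) (gr j xs)" for j
  proof -
    have c: "(\<lambda>s. gr j xs s $ i) \<in> borel_measurable borel" for i
      by (rule measurable_compose[OF gr_borel[OF xs]]) (intro borel_measurable_continuous_onI continuous_intros)
    have m: "(LINT s|law j. gr j xs s $ i) = (LINT \<omega>|M. gr j xs (\<xi> j \<omega>) $ i)" for i
      unfolding law_def by (rule integral_distr[OF xi_rv c])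
    have "(LINT s|law j. (gr j xs s $ i - u) * (gr j xs s $ k - v)) = (LINT \<omega>|M. (gr j xs (\<xi> j \<omega>) $ i - u) * (gr j xs (\<xi> j \<omega>) $ k - v))" for i k u v
      unfolding law_def by (rule integral_distr[OF xi_rv]) (intro borel_measurable_times borel_measurable_diff c borel_measurable_const)
    then have "cov_matrix (law j) (gr j xs) = cov_matrix M (\<lambda>\<omega>. gr j xs (\<xi> j \<omega>))"
      by (simp only: cov_matrix_def m)
    then show ?thesis by (simp only: gr_def)
  qed
  have PHS: "dda.P = P" "dda.H = H" "dda.Sb = Sbar"
    unfolding dda.P_def dda.H_def dda.Sb_def P_def H_def Sbar_def cov by simp_all
  have r: "r \<le> CARD('d)" unfolding r_def using dim_subset_UNIV_cart .
  show ?thesis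
  proof
    fix j
    obtain N where N: "is_multivariate_normal N 0 (asymptotic_cov e r U P H Sbar)"
      "converges_in_distribution M (\<lambda>n \<omega>. (1 / sqrt (g n)) *\<^sub>R (dda.x n j \<omega> - xs)) N"
      using dda.asymptotic_normality[OF enum r U_Y[unfolded Y_def], of j] unfolding PHS by blast
    \<comment> \<open>Undoing the shift: iterate \<open>n\<close> of the locale is the point with
      index n + 1, and its scale is the step with index n + 1.\<close>
    have "(1 / sqrt (g n)) *\<^sub>R (dda.x n j \<omega> - xs) = (1 / sqrt (\<alpha>s (Suc n))) *\<^sub>R (x (Suc n) j \<omega> - xs)" for n \<omega>
      by (simp add: g_def dda.x_def x_def mirror)
    with N(2) have "(\<lambda>n. LINT \<omega>|M. h ((1 / sqrt (\<alpha>s (Suc n))) *\<^sub>R (x (Suc n) j \<omega> - xs))) \<longlonglongrightarrow> (LINT y|N. h y)"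
      if "continuous_on UNIV h" "bounded (range h)" for h :: "real^'d \<Rightarrow> real"
      using that by (simp add: converges_in_distribution_def)
    then have "converges_in_distribution M (\<lambda>k \<omega>. (1 / sqrt (\<alpha>s k)) *\<^sub>R (x k j \<omega> - xs)) N"
      unfolding converges_in_distribution_def
      using LIMSEQ_imp_Suc[of "\<lambda>k. LINT \<omega>|M. _ ((1 / sqrt (\<alpha>s k)) *\<^sub>R (x k j \<omega> - xs))"] by blast
    with N(1) show "\<exists>N. is_multivariate_normal N 0 (asymptotic_cov e r U P H Sbar) \<and>
           converges_in_distribution M (\<lambda>k \<omega>. (1 / sqrt (\<alpha>s k)) *\<^sub>R (x k j \<omega> - xs)) N" by blast
  qed
qed

end
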